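(* Fix an integer $d\ge2$, $0<\beta<1$, $\kappa_*>0$ and a probability density $\rho_0\in C_c^{1,\beta}(\mathbb R^d)$. Let $T_*>0$ be the common existence time described in the context and let $\rho^{\mathrm C}$ be the Coulomb solution ($\kappa=0$) on $[0,T_* )$ with initial datum $\rho_0$. Fix $0<T<T_*$. There exists $C_T=C(d,\beta,\kappa_*,\rho_0,T)<\infty$ such that, for every $N\ge2$, every choice $0<\kappa_N\le\kappa_*$ and every $1\le k\le N$, the law $\rho_N^{\kappa_N}(t)$ of the Yukawa particle system with screening parameter $\kappa_N$ started from $\rho_0^{\otimes N}$ satisfies $$\sup_{t\le T}\frac1N W_2^2\bigl(\rho_N^{\kappa_N}(t),(\rho^{\mathrm C}(t))^{\otimes N}\bigr)\le C_T\bigl(a_{N,d}+\alpha_d(\kappa_N)^2\bigr),$$ $$\sup_{t\le T}W_2^2\bigl(\rho_{N:k}^{\kappa_N}(t),(\rho^{\mathrm C}(t))^{\otimes k}\bigr)\le C_T\,k\,\bigl(a_{N,d}+\alpha_d(\kappa_N)^2\bigr).$$ Thus the error is $N^{-2/d}+\kappa_N^4$ for $d\ge3$ and $(1+\log N)/N+\kappa_N^2$ for $d=2$. If $\kappa_N\downarrow0$, both the normalized $N$-particle error and the error of every fixed marginal tend to zero as $N\to\infty$, without any condition on the relative rates.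
   Context: Kernels: for $\kappa>0$, $g_{\kappa,d}(x)=(2\pi)^{-d/2}(\kappa/|x|)^{\nu_d}K_{\nu_d}(\kappa|x|)$, $\nu_d=\frac d2-1$, with $K_\nu$ the modified Bessel function of the second kind; $(-\Delta+\kappa^2)g_{\kappa,d}=\delta_0$. For $\kappa=0$: $g_{0,2}(x)=-\frac1{2\pi}\log|x|+\frac{\log2-\gamma_E}{2\pi}$ and $g_{0,d}(x)=\frac{|x|^{2-d}}{(d-2)|\mathbb S^{d-1}|}$ for $d\ge3$. $a_{N,2}=\frac{1+\log N}{N}$, $a_{N,d}=N^{-2/d}$ for $d\ge3$; $\alpha_2(\kappa)=\kappa$, $\alpha_d(\kappa)=\kappa^2$ for $d\ge3$. Classical solutions: $T_*=T_*(d,\rho_0,\beta,\kappa_* )>0$ is a common time such that for every $0\le\kappa\le\kappa_*$ the problem $\partial_t\rho+\nabla\cdot(\rho u_\rho^\kappa)=0$, $u_\rho^\kappa=-\nabla g_{\kappa,d}*\rho$, $\rho(0)=\rho_0$, has a unique classical solution $\rho^\kappa\in L^\infty_{loc}([0,T_* );C^{1,\beta})\cap C([0,T_* );C^{1,\beta'})\cap C^1([0,T_* );C^{0,\beta'})$ for all $0<\beta'<\beta$, nonnegative with unit mass, with supports contained for $t\le T<T_*$ in a ball independent of $\kappa$, and with $\sup_{0\le\kappa\le\kappa_*}\sup_{t\le T}[\|\rho^\kappa\|_{L^\infty}+[\rho^\kappa]_{C^{0,\beta}}+\int|x|^2\rho^\kappa+\|u^\kappa_{\rho^\kappa}\|_{W^{1,\infty}}]<\infty$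 for every $T<T_*$. $\rho^{\mathrm C}$ is the solution for $\kappa=0$. Particle system: $\dot x_i=-\frac1N\sum_{j\ne i}\nabla g_{\kappa,d}(x_i-x_j)$, with global collision-free flow off the collision set $\Delta_N=\{X_N:\exists i\ne j,\ x_i=x_j\}$; $\rho_N^\kappa(t)$ is the push-forward of the initial law (which does not charge $\Delta_N$) and $\rho_{N:k}^\kappa(t)$ its $k$-particle marginal. $W_2$ on $(\mathbb R^d)^N$ uses the cost $\sum_i|x_i-y_i|^2$. *)

theory Defs
  imports "HOL-Probability.Probability"
begin

section \<open>Yukawa and Coulomb kernels\<close>

text \<open>
  The modified Bessel function of the second kind, by its integral representation
  $K_\nu(z) = \int_0^\infty e^{-z\cosh t}\cosh(\nu t)\,dt$, which is valid for all real $\nu$ and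
  all $z > 0$ (the only arguments used here).
\<close>

definition bessel_K :: "real \<Rightarrow> real \<Rightarrow> real" where
  "bessel_K \<nu> z = (LBINT t:{0..}. exp (- z * cosh t) * cosh (\<nu> * t))"

text \<open>
  The dimension $d$ is \<open>DIM('a)\<close>.  The area of the unit sphere $S^{d-1}$ is written as
  $d$ times the volume of the unit ball.  The value at \<open>x = 0\<close> is never used.
\<close>

definition kernel :: "real \<Rightarrow> 'a::euclidean_space \<Rightarrow> real" where
  "kernel \<kappa> x =
     (let d = real DIM('a); \<nu> = d / 2 - 1 in
      if \<kappa> > 0 then
        (2 * pi) powr (- d / 2) * (\<kappa> / norm x) powr \<nu> * bessel_K \<nu> (\<kappa> * norm x)
      else if DIM('a) = 2 then
        - ln (norm x) / (2 * pi) + (ln 2 - euler_mascheroni) / (2 * pi)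
      else
        norm x powr (2 - d) / ((d - 2) * (d * unit_ball_vol d)))"

definition gradient :: "('a::euclidean_space \<Rightarrow> real) \<Rightarrow> 'a \<Rightarrow> 'a" where
  "gradient f x = (\<Sum>b\<in>Basis. frechet_derivative f (at x) b *\<^sub>R b)"

definition divergence :: "('a::euclidean_space \<Rightarrow> 'a) \<Rightarrow> 'a \<Rightarrow> real" where
  "divergence F x = (\<Sum>b\<in>Basis. frechet_derivative F (at x) b \<bullet> b)"

text \<open>$u_\rho^\kappa = -\nabla g_{\kappa,d} * \rho$\<close>

definition velocity :: "real \<Rightarrow> ('a::euclidean_space \<Rightarrow> real) \<Rightarrow> 'a \<Rightarrow> 'a" where
  "velocity \<kappa> \<rho> x = - (LINT y|lborel. \<rho> y *\<^sub>R gradient (kernel \<kappa>) (x - y))"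


section \<open>Rates\<close>

definition a_rate :: "nat \<Rightarrow> nat \<Rightarrow> real" where
  "a_rate N d = (if d = 2 then (1 + ln (real N)) / real N else real N powr (- 2 / real d))"

definition alpha_rate :: "nat \<Rightarrow> real \<Rightarrow> real" where
  "alpha_rate d \<kappa> = (if d = 2 then \<kappa> else \<kappa>\<^sup>2)"


section \<open>Hoelder norms and curves in Hoelder spaces\<close>

text \<open>
  Norms take values in \<^typ>\<open>ennreal\<close>; a function belongs to the corresponding space exactly when
  its norm is finite.  In particular the norms below that involve derivatives are infinite on
  functions that are not everywhere differentiable.
\<close>

definition sup_norm :: "('a \<Rightarrow> 'b::real_normed_vector) \<Rightarrow> ennreal" where
  "sup_norm f = (SUP x. ennreal (norm (f x)))"

definition holder_seminorm ::
    "real \<Rightarrow> ('a::metric_space \<Rightarrow> 'b::real_normed_vector) \<Rightarrow> ennreal" where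
  "holder_seminorm \<beta> f =
     (SUP (x, y)\<in>{(x, y). x \<noteq> y}. ennreal (norm (f x - f y) / dist x y powr \<beta>))"

definition holder_norm ::
    "real \<Rightarrow> ('a::metric_space \<Rightarrow> 'b::real_normed_vector) \<Rightarrow> ennreal" where
  "holder_norm \<beta> f = sup_norm f + holder_seminorm \<beta> f"

definition C1_holder_norm :: "real \<Rightarrow> ('a::euclidean_space \<Rightarrow> real) \<Rightarrow> ennreal" where
  "C1_holder_norm \<beta> f =
     (if \<forall>x. f differentiable (at x)
      then sup_norm f + holder_norm \<beta> (gradient f) else \<infinity>)"

text \<open>
  The norm of $W^{1,\infty}$.  It is applied only to velocity fields of compactly supported $C^1$
  densities; these are $C^1$, so that essential suprema and weak derivatives are not needed.
\<close>

definition W1_infty_norm :: "('a::euclidean_space \<Rightarrow> 'a) \<Rightarrow> ennreal" where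
  "W1_infty_norm u =
     (if \<forall>x. u differentiable (at x)
      then sup_norm u + (SUP x. ennreal (onorm (frechet_derivative u (at x)))) else \<infinity>)"

definition C_curve ::
    "(('a \<Rightarrow> real) \<Rightarrow> ennreal) \<Rightarrow> real set \<Rightarrow> (real \<Rightarrow> 'a \<Rightarrow> real) \<Rightarrow> bool" where
  "C_curve nrm I f \<longleftrightarrow>
     (\<forall>t\<in>I. nrm (f t) < \<infinity> \<and> ((\<lambda>s. nrm (\<lambda>x. f s x - f t x)) \<longlongrightarrow> 0) (at t within I))"

definition C1_curve ::
    "(('a \<Rightarrow> real) \<Rightarrow> ennreal) \<Rightarrow> real set \<Rightarrow> (real \<Rightarrow> 'a \<Rightarrow> real) \<Rightarrow> bool" where
  "C1_curve nrm I f \<longleftrightarrow>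
     (\<exists>f'. C_curve nrm I f' \<and>
        (\<forall>t\<in>I. nrm (f t) < \<infinity> \<and>
           ((\<lambda>s. nrm (\<lambda>x. (f s x - f t x) / (s - t) - f' t x)) \<longlongrightarrow> 0) (at t within I)))"

definition Linfty_loc_curve ::
    "(('a \<Rightarrow> real) \<Rightarrow> ennreal) \<Rightarrow> real \<Rightarrow> (real \<Rightarrow> 'a \<Rightarrow> real) \<Rightarrow> bool" where
  "Linfty_loc_curve nrm Tstar f \<longleftrightarrow>
     (\<forall>T. 0 \<le> T \<and> T < Tstar \<longrightarrow>
        (\<exists>M::real. AE t in lborel. t \<in> {0..T} \<longrightarrow> nrm (f t) \<le> ennreal M))"


section \<open>Classical solutions and the common existence time\<close>

definition probability_density :: "('a::euclidean_space \<Rightarrow> real) \<Rightarrow> bool" where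
  "probability_density \<rho> \<longleftrightarrow>
     \<rho> \<in> borel_measurable borel \<and> (\<forall>x. 0 \<le> \<rho> x) \<and> (\<integral>\<^sup>+x. ennreal (\<rho> x) \<partial>lborel) = 1"

definition C1_holder_compact :: "real \<Rightarrow> ('a::euclidean_space \<Rightarrow> real) \<Rightarrow> bool" where
  "C1_holder_compact \<beta> f \<longleftrightarrow> C1_holder_norm \<beta> f < \<infinity> \<and> compact (closure {x. f x \<noteq> 0})"

text \<open>
  The equation $\partial_t\rho + \nabla\cdot(\rho u_\rho^\kappa) = 0$ is required pointwise, with a
  one-sided time derivative at \<open>t = 0\<close>.  Solutions are functions on $[0,T_*)$: their values at
  other times are irrelevant.
\<close>

definition classical_solution ::
    "real \<Rightarrow> real \<Rightarrow> real \<Rightarrow> ('a::euclidean_space \<Rightarrow> real) \<Rightarrow> (real \<Rightarrow> 'a \<Rightarrow> real) \<Rightarrow> bool" where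
  "classical_solution \<beta> \<kappa> Tstar \<rho>0 \<rho> \<longleftrightarrow>
     Linfty_loc_curve (C1_holder_norm \<beta>) Tstar \<rho> \<and>
     (\<forall>\<beta>'. 0 < \<beta>' \<and> \<beta>' < \<beta> \<longrightarrow>
        C_curve (C1_holder_norm \<beta>') {0..<Tstar} \<rho> \<and>
        C1_curve (holder_norm \<beta>') {0..<Tstar} \<rho>) \<and>
     (\<forall>t\<in>{0..<Tstar}. probability_density (\<rho> t)) \<and>
     (\<forall>T. 0 \<le> T \<and> T < Tstar \<longrightarrow>
        (\<exists>R. \<forall>t\<in>{0..T}. {x. \<rho> t x \<noteq> 0} \<subseteq> cball 0 R)) \<and>
     \<rho> 0 = \<rho>0 \<and>
     (\<forall>t\<in>{0..<Tstar}. \<forall>x.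
        (\<lambda>y. \<rho> t y *\<^sub>R velocity \<kappa> (\<rho> t) y) differentiable (at x) \<and>
        ((\<lambda>s. \<rho> s x) has_real_derivative
           - divergence (\<lambda>y. \<rho> t y *\<^sub>R velocity \<kappa> (\<rho> t) y) x) (at t within {0..<Tstar}))"

definition common_existence_time ::
    "real \<Rightarrow> real \<Rightarrow> ('a::euclidean_space \<Rightarrow> real) \<Rightarrow> real \<Rightarrow> bool" where
  "common_existence_time \<beta> \<kappa>star \<rho>0 Tstar \<longleftrightarrow>
     0 < Tstar \<and>
     (\<exists>\<rho> :: real \<Rightarrow> real \<Rightarrow> 'a \<Rightarrow> real.
        (\<forall>\<kappa>\<in>{0..\<kappa>star}.
           classical_solution \<beta> \<kappa> Tstar \<rho>0 (\<rho> \<kappa>) \<and>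
           (\<forall>\<sigma>. classical_solution \<beta> \<kappa> Tstar \<rho>0 \<sigma> \<longrightarrow> (\<forall>t\<in>{0..<Tstar}. \<sigma> t = \<rho> \<kappa> t))) \<and>
        (\<forall>T. 0 \<le> T \<and> T < Tstar \<longrightarrow>
           (\<exists>R. \<forall>\<kappa>\<in>{0..\<kappa>star}. \<forall>t\<in>{0..T}. {x. \<rho> \<kappa> t x \<noteq> 0} \<subseteq> cball 0 R) \<and>
           (SUP \<kappa>\<in>{0..\<kappa>star}. SUP t\<in>{0..T}.
              sup_norm (\<rho> \<kappa> t) + holder_seminorm \<beta> (\<rho> \<kappa> t)
              + (\<integral>\<^sup>+x. ennreal ((norm x)\<^sup>2 * \<rho> \<kappa> t x) \<partial>lborel)
              + W1_infty_norm (velocity \<kappa> (\<rho> \<kappa> t))) < \<infinity>))"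


section \<open>The particle system\<close>

text \<open>
  Configurations $X_N \in (\mathbb{R}^d)^N$ are the elements of
  \<open>{..<N} \<rightarrow>\<^sub>E UNIV\<close>, the underlying set of the product measurable space \<open>PiM {..<N} (\<lambda>_. borel)\<close>;
  particles are numbered from 0.
\<close>

definition collision_set :: "nat \<Rightarrow> (nat \<Rightarrow> 'a) set" where
  "collision_set N = {X. \<exists>i<N. \<exists>j<N. i \<noteq> j \<and> X i = X j}"

definition particle_trajectory ::
    "nat \<Rightarrow> real \<Rightarrow> (nat \<Rightarrow> 'a::euclidean_space) \<Rightarrow> (real \<Rightarrow> nat \<Rightarrow> 'a) \<Rightarrow> bool" where
  "particle_trajectory N \<kappa> X x \<longleftrightarrow>
     x 0 = X \<and>
     (\<forall>t\<ge>0. x t \<in> ({..<N} \<rightarrow>\<^sub>E UNIV) - collision_set N \<and>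
        (\<forall>i<N. ((\<lambda>s. x s i) has_vector_derivative
             - (1 / real N) *\<^sub>R (\<Sum>j\<in>{..<N} - {i}. gradient (kernel \<kappa>) (x t i - x t j)))
           (at t within {0..})))"

text \<open>
  For \<open>t \<ge> 0\<close> the choice below is unique, because the force is locally Lipschitz off the collision
  set.  On the collision set, which is not charged by the initial law, the flow is set to the
  identity.
\<close>

definition particle_flow ::
    "nat \<Rightarrow> real \<Rightarrow> real \<Rightarrow> (nat \<Rightarrow> 'a::euclidean_space) \<Rightarrow> (nat \<Rightarrow> 'a)" where
  "particle_flow N \<kappa> t X =
     (if X \<in> collision_set N then X else (SOME x. particle_trajectory N \<kappa> X x) t)"

text \<open>The law on $(\mathbb{R}^d)^n$ with density $\rho^{\otimes n}$\<close>

definition tensor_law :: "nat \<Rightarrow> ('a::euclidean_space \<Rightarrow> real) \<Rightarrow> (nat \<Rightarrow> 'a) measure" where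
  "tensor_law n \<rho> = PiM {..<n} (\<lambda>_. density lborel (\<lambda>x. ennreal (\<rho> x)))"

definition particle_law ::
    "nat \<Rightarrow> real \<Rightarrow> ('a::euclidean_space \<Rightarrow> real) \<Rightarrow> real \<Rightarrow> (nat \<Rightarrow> 'a) measure" where
  "particle_law N \<kappa> \<rho>0 t =
     distr (tensor_law N \<rho>0) (PiM {..<N} (\<lambda>_. borel)) (particle_flow N \<kappa> t)"

definition marginal :: "nat \<Rightarrow> (nat \<Rightarrow> 'a::euclidean_space) measure \<Rightarrow> (nat \<Rightarrow> 'a) measure" where
  "marginal k \<mu> = distr \<mu> (PiM {..<k} (\<lambda>_. borel)) (\<lambda>X. restrict X {..<k})"


section \<open>Quadratic Wasserstein distance\<close>

definition couplings :: "'a measure \<Rightarrow> 'b measure \<Rightarrow> ('a \<times> 'b) measure set" where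
  "couplings \<mu> \<nu> =
     {\<pi>. sets \<pi> = sets (\<mu> \<Otimes>\<^sub>M \<nu>) \<and> distr \<pi> \<mu> fst = \<mu> \<and> distr \<pi> \<nu> snd = \<nu>}"

text \<open>The squared distance $W_2^2$ on $(\mathbb{R}^d)^n$, with cost $\sum_i |x_i - y_i|^2$\<close>

definition W2_squared ::
    "nat \<Rightarrow> (nat \<Rightarrow> 'a::euclidean_space) measure \<Rightarrow> (nat \<Rightarrow> 'a) measure \<Rightarrow> ennreal" where
  "W2_squared n \<mu> \<nu> =
     (INF \<pi>\<in>couplings \<mu> \<nu>. \<integral>\<^sup>+p. (\<Sum>i<n. ennreal ((dist (fst p i) (snd p i))\<^sup>2)) \<partial>\<pi>)"

end

theory Submission
  imports Defs "HOL-Combinatorics.Permutations"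
begin

text \<open>Couple the Yukawa particles with independent particles that follow the Coulomb flow from the same initial points.
  The Yukawa and Coulomb kernels are mixtures of heat kernels (with weight \<open>exp (- ka\<^sup>2 s)\<close>), so their energies of
  the signed measure (particles minus background) are positive semidefinite, and removing the heat times below
  \<open>N powr (- 2 / d)\<close> makes them finite at the price of an error of the order of \<open>a_rate\<close>. The energy satisfies a
  Gronwall inequality: the mean-field part of its derivative is a commutator, controlled by the energy itself through
  the stress tensor of the potential, and screening contributes \<open>alpha_rate\<^sup>2\<close>. The energy dissipation in turn
  controls the squared force error that drives the two particle systems apart, so the coupling cost is bounded by the
  initial energy, whose expectation is of order \<open>a_rate\<close> for independent points. Exchangeability passes the bound to
  the marginals. The same commutator estimate, applied to the law transported by the Coulomb flow, shows that this law
  is the solution itself.\<close>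

text \<open>The cut is made in heat time because of the semigroup law: the kernel with times above
  \<open>2 * ta\<close> is the kernel with times above \<open>ta\<close>, smeared by the screened
  heat kernel of time \<open>ta\<close>, and this smearing function is exactly ka^2 minus the
  Laplacian applied to the latter kernel. Hence the cut energy is the Dirichlet energy of a smooth
  potential, and the divergence theorem applies although the particles are point masses. The price
  is the mismatch between the velocity at a particle and the velocity in its smeared cloud; it costs
  \<open>ta\<close> times a double sum of heat kernels, which the pair energy of short times
  controls. At the time N powr (- 2 / d) a heat kernel at the origin divided by N is of order one;
  there the self-energy per particle and the omitted short-time interaction with the background are
  both at most of order \<open>a_rate\<close>. The constants stay uniform as screening disappears,
  even in dimension 2 where the kernel itself then diverges, because the long times enter the
  estimates only through the gradient and through differences between the value at 0 and values at
  bounded distance.\<close>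

section \<open>Parameter integrals and integrals of derivatives\<close>

lemma has_derivative_lebesgue_integral:
 fixes f :: "'a::real_normed_vector \<Rightarrow> 'w \<Rightarrow> 'b::{banach, second_countable_topology}"
 assumes S: "convex S" "x0 \<in> S"
  and int: "\<And>x. x \<in> S \<Longrightarrow> integrable M (f x)"
  and der: "\<And>x w. x \<in> S \<Longrightarrow> w \<in> space M \<Longrightarrow> ((\<lambda>x. f x w) has_derivative D x w) (at x within S)"
  and bnd: "\<And>x w h. x \<in> S \<Longrightarrow> w \<in> space M \<Longrightarrow> norm (D x w h) \<le> B w * norm h"
  and B: "integrable M B"
  and meas: "\<And>h. (\<lambda>w. D x0 w h) \<in> borel_measurable M"
 shows "((\<lambda>x. \<integral>w. f x w \<partial>M) has_derivative (\<lambda>h. \<integral>w. D x0 w h \<partial>M)) (at x0 within S)"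
proof -
 have D_int: "integrable M (\<lambda>w. D x0 w h)" for h
 proof (rule Bochner_Integration.integrable_bound)
  show "integrable M (\<lambda>w. B w * norm h)" using B by simp
  show "AE w in M. norm (D x0 w h) \<le> norm (B w * norm h)"
   using bnd[OF S(2)] by (intro AE_I2) (auto intro: order_trans[OF _ abs_ge_self])
 qed (use meas in auto)
 have lin: "bounded_linear (D x0 w)" if "w \<in> space M" for w
  using der[OF S(2) that] by (rule has_derivative_bounded_linear)
 have bl: "bounded_linear (\<lambda>h. \<integral>w. D x0 w h \<partial>M)"
 proof (rule bounded_linear_intro)
  show "(\<integral>w. D x0 w (h + k) \<partial>M) = (\<integral>w. D x0 w h \<partial>M) + (\<integral>w. D x0 w k \<partial>M)" for h k
   by (subst Bochner_Integration.integral_add[symmetric, OF D_int D_int])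
    (intro Bochner_Integration.integral_cong refl linear_add bounded_linear.linear lin)
  show "(\<integral>w. D x0 w (r *\<^sub>R h) \<partial>M) = r *\<^sub>R (\<integral>w. D x0 w h \<partial>M)" for r h
   by (subst integral_scaleR_right[symmetric])
    (intro Bochner_Integration.integral_cong refl linear_scale bounded_linear.linear lin)
  show "norm (\<integral>w. D x0 w h \<partial>M) \<le> norm h * (\<integral>w. B w \<partial>M)" for h
  proof -
   have "norm (\<integral>w. D x0 w h \<partial>M) \<le> (\<integral>w. B w * norm h \<partial>M)"
    by (rule order_trans[OF integral_norm_bound integral_mono]) (use D_int B bnd S in auto)
   then show ?thesis by (simp add: mult.commute)
  qed
 qed
 \<comment> \<open>The mean value inequality on the convex set turns the derivative bound into a
   bound on increments. The remainder quotients below are therefore dominated by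
   \<open>2 * B w\<close>.\<close>
 have bound: "norm (f y w - f x0 w) \<le> B w * norm (y - x0)" if "y \<in> S" "w \<in> space M" for y w
 proof (cases "y = x0")
  case False
  then have "0 \<le> B w * norm (y - x0)" "norm (y - x0) > 0"
   using order_trans[OF norm_ge_zero bnd[OF that, of "y - x0"]] by auto
  then have "0 \<le> B w" by (simp add: zero_le_mult_iff)
  then show ?thesis
   by (intro differentiable_bound[OF S(1), of "\<lambda>x. f x w" "\<lambda>x. D x w"] onorm_bound)
    (use that S der bnd in auto)
 qed simp
 show ?thesis
  unfolding has_derivative_within
 proof (intro conjI bl, subst tendsto_at_iff_sequentially, intro allI impI)
  fix X assume X: "\<forall>i. X i \<in> S - {x0}" "X \<longlonglongrightarrow> x0"
  define s where "s i w = (1 / norm (X i - x0)) *\<^sub>R (f (X i) w - (f x0 w + D x0 w (X i - x0)))" for i w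
  have sint: "(\<integral>w. s i w \<partial>M) = (1 / norm (X i - x0)) *\<^sub>R
    ((\<integral>w. f (X i) w \<partial>M) - ((\<integral>w. f x0 w \<partial>M) + (\<integral>w. D x0 w (X i - x0) \<partial>M)))" for i
   unfolding s_def using X S int D_int by simp
  have "(\<lambda>i. \<integral>w. s i w \<partial>M) \<longlonglongrightarrow> (\<integral>w. 0 \<partial>M)"
  proof (rule integral_dominated_convergence[where w="\<lambda>w. 2 * B w"])
   show "s i \<in> borel_measurable M" for i
    unfolding s_def using int[of "X i"] int[of x0] X S meas
    by (auto intro!: borel_measurable_scaleR borel_measurable_diff borel_measurable_add
      dest: borel_measurable_integrable)
   show "integrable M (\<lambda>w. 2 * B w)" using B by simp
   show "AE w in M. (\<lambda>i. s i w) \<longlonglongrightarrow> 0"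
   proof (rule AE_I2)
    fix w assume "w \<in> space M"
    from der[OF S(2) this] have "((\<lambda>y. (1 / norm (y - x0)) *\<^sub>R (f y w - (f x0 w + D x0 w (y - x0)))) \<longlongrightarrow> 0) (at x0 within S)"
     unfolding has_derivative_within by auto
    then show "(\<lambda>i. s i w) \<longlonglongrightarrow> 0"
     using X unfolding tendsto_at_iff_sequentially s_def comp_def by auto
   qed
   show "AE w in M. norm (s i w) \<le> 2 * B w" for i
   proof (rule AE_I2)
    fix w assume w: "w \<in> space M"
    have n: "norm (X i - x0) > 0" using X by auto
    have "norm (f (X i) w - (f x0 w + D x0 w (X i - x0))) \<le> norm (f (X i) w - f x0 w) + norm (D x0 w (X i - x0))"
     by (metis diff_diff_eq norm_triangle_ineq4)
    also have "\<dots> \<le> 2 * B w * norm (X i - x0)"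
     using bound[of "X i" w] bnd[OF S(2) w, of "X i - x0"] X w by auto
    finally show "norm (s i w) \<le> 2 * B w" unfolding s_def norm_scaleR using n by (simp add: divide_le_eq)
   qed
  qed auto
  then show "((\<lambda>y. (1 / norm (y - x0)) *\<^sub>R ((\<integral>w. f y w \<partial>M) - ((\<integral>w. f x0 w \<partial>M) + (\<integral>w. D x0 w (y - x0) \<partial>M)))) \<circ> X) \<longlonglongrightarrow> 0"
   by (simp add: sint comp_def)
 qed
qed

lemma lborel_integral_shift:
 fixes f :: "'a::euclidean_space \<Rightarrow> 'b::{banach, second_countable_topology}"
 assumes [measurable]: "f \<in> borel_measurable borel"
 shows "(LBINT x. f (x + c)) = (LBINT x. f x)"
proof -
 have "(LBINT x. f x) = (\<integral>x. f x \<partial>distr lborel borel ((+) c))"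
  by (simp add: lborel_distr_plus)
 also have "\<dots> = (LBINT x. f (c + x))"
  by (rule integral_distr) auto
 finally show ?thesis by (simp add: add.commute)
qed

lemma nn_integral_lborel_shift:
 fixes f :: "'a::euclidean_space \<Rightarrow> ennreal"
 assumes [measurable]: "f \<in> borel_measurable borel"
 shows "(\<integral>\<^sup>+x. f (x + c) \<partial>lborel) = (\<integral>\<^sup>+x. f x \<partial>lborel)"
proof -
 have "(\<integral>\<^sup>+x. f x \<partial>lborel) = (\<integral>\<^sup>+x. f x \<partial>distr lborel borel ((+) c))"
  by (simp add: lborel_distr_plus)
 also have "\<dots> = (\<integral>\<^sup>+x. f (c + x) \<partial>lborel)"
  by (rule nn_integral_distr) auto
 finally show ?thesis by (simp add: add.commute)
qed

lemma integrable_lborel_shift: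
 fixes f :: "'a::euclidean_space \<Rightarrow> 'b::{banach, second_countable_topology}"
 assumes "integrable lborel f"
 shows "integrable lborel (\<lambda>x. f (x + c))"
proof -
 have "integrable (distr lborel borel ((+) c)) f" using assms by (simp add: lborel_distr_plus)
 then have "integrable lborel (\<lambda>x. f (c + x))"
  using assms by (subst (asm) integrable_distr_eq) auto
 then show ?thesis by (simp add: add.commute)
qed

text \<open>By the fundamental theorem of calculus the integral of \<open>D\<close> along the
  segment from x to x + b is f (x + b) - f x. Integration over x kills the right-hand side by
  translation invariance, and Fubini returns the integral of \<open>D\<close> on the left.\<close>

lemma integral_directional_derivative_eq_0:
 fixes f D :: "'a::euclidean_space \<Rightarrow> real"
 assumes f: "integrable lborel f" and D: "integrable lborel D"
  and der: "\<And>x. ((\<lambda>s. f (x + s *\<^sub>R b)) has_real_derivative D x) (at 0)"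
 shows "(LBINT x. D x) = 0"
proof -
 have [measurable]: "D \<in> borel_measurable borel" "f \<in> borel_measurable borel"
  using f D by (auto dest: borel_measurable_integrable)
 define F where "F = (\<lambda>(x, s). indicator {0..1::real} s *\<^sub>R D (x + s *\<^sub>R b))"
 have [measurable]: "F \<in> borel_measurable (lborel \<Otimes>\<^sub>M lborel)" unfolding F_def by measurable
 have Fi: "integrable (lborel \<Otimes>\<^sub>M lborel) F"
 proof (rule integrableI_bounded)
  have "(\<integral>\<^sup>+p. ennreal (norm (F p)) \<partial>(lborel \<Otimes>\<^sub>M lborel)) = (\<integral>\<^sup>+s. \<integral>\<^sup>+x. ennreal (norm (F (x, s))) \<partial>lborel \<partial>lborel)"
   by (rule lborel_pair.nn_integral_snd[symmetric, simplified]) simp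
  also have "\<dots> = (\<integral>\<^sup>+s. indicator {0..1::real} s * (\<integral>\<^sup>+x. ennreal (norm (D x)) \<partial>lborel) \<partial>lborel)"
  proof (rule nn_integral_cong)
   fix s :: real
   have "(\<integral>\<^sup>+x. ennreal (norm (F (x, s))) \<partial>lborel) = (\<integral>\<^sup>+x. indicator {0..1} s * ennreal (norm (D (x + s *\<^sub>R b))) \<partial>lborel)"
    unfolding F_def by (intro nn_integral_cong) (auto split: split_indicator)
   also have "\<dots> = indicator {0..1} s * (\<integral>\<^sup>+x. ennreal (norm (D (x + s *\<^sub>R b))) \<partial>lborel)"
    by (rule nn_integral_cmult) measurable
   finally show "(\<integral>\<^sup>+x. ennreal (norm (F (x, s))) \<partial>lborel) = indicator {0..1} s * (\<integral>\<^sup>+x. ennreal (norm (D x)) \<partial>lborel)"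
    using nn_integral_lborel_shift[of "\<lambda>x. ennreal (norm (D x))" "s *\<^sub>R b"] by simp
  qed
  also have "\<dots> = (\<integral>\<^sup>+x. ennreal (norm (D x)) \<partial>lborel)"
   by (subst nn_integral_multc) auto
  also have "\<dots> < \<infinity>" using D by (simp add: integrable_iff_bounded)
  finally show "(\<integral>\<^sup>+p. ennreal (norm (F p)) \<partial>(lborel \<Otimes>\<^sub>M lborel)) < \<infinity>" .
 qed simp
 have ftc: "((\<lambda>s. D (x + s *\<^sub>R b)) has_integral (f (x + b) - f x)) {0..1}" for x
 proof -
  have *: "((\<lambda>s. f (x + s *\<^sub>R b)) has_real_derivative D (x + t *\<^sub>R b)) (at t)" for t
  proof -
   have "((\<lambda>s. f ((x + t *\<^sub>R b) + s *\<^sub>R b)) has_real_derivative D (x + t *\<^sub>R b)) (at (t - t))"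
    using der[of "x + t *\<^sub>R b"] by simp
   then have "((\<lambda>s. f ((x + t *\<^sub>R b) + (s - t) *\<^sub>R b)) has_real_derivative D (x + t *\<^sub>R b) * 1) (at t)"
    by (rule DERIV_chain2[where g="\<lambda>s. s - t"]) (auto intro!: derivative_eq_intros)
   then show ?thesis by (simp add: algebra_simps)
  qed
  from fundamental_theorem_of_calculus[of 0 1 "\<lambda>s. f (x + s *\<^sub>R b)" "\<lambda>s. D (x + s *\<^sub>R b)"]
  show ?thesis using *
   by (auto simp: has_real_derivative_iff_has_vector_derivative intro: has_vector_derivative_at_within)
 qed
 have "AE x in lborel. integrable lborel (\<lambda>s. F (x, s))"
  using lborel_pair.AE_integrable_fst'[OF Fi] by simp
 then have "AE x in lborel. (LBINT s. F (x, s)) = f (x + b) - f x"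
 proof (rule AE_mp, intro AE_I2 impI)
  fix x assume "integrable lborel (\<lambda>s. F (x, s))"
  then have "set_integrable lborel {0..1} (\<lambda>s. D (x + s *\<^sub>R b))"
   unfolding set_integrable_def F_def by simp
  from set_borel_integral_eq_integral(2)[OF this] integral_unique[OF ftc[of x]]
  show "(LBINT s. F (x, s)) = f (x + b) - f x"
   unfolding F_def set_lebesgue_integral_def by simp
 qed
 then have "(LBINT x. (LBINT s. F (x, s))) = (LBINT x. f (x + b) - f x)"
  by (intro integral_cong_AE) auto
 also have "\<dots> = 0"
  using f integrable_lborel_shift[OF f, of b] by (simp add: lborel_integral_shift)
 finally have 1: "(LBINT x. (LBINT s. F (x, s))) = 0" .
 have "(LBINT x. (LBINT s. F (x, s))) = (LBINT s. (LBINT x. F (x, s)))"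
  using lborel_pair.Fubini_integral[of "\<lambda>x s. F (x, s)"] Fi by (simp add: case_prod_eta)
 also have "\<dots> = (LBINT s. indicator {0..1::real} s *\<^sub>R (LBINT x. D x))"
  unfolding F_def by (simp add: lborel_integral_shift)
 also have "\<dots> = (LBINT x. D x)" by simp
 finally show ?thesis using 1 by simp
qed

section \<open>Gronwall inequality and ordinary differential equations\<close>

text \<open>The integrating factor makes \<open>exp (- (C * s)) * (\<phi> s + K / C)\<close>
  nonincreasing. \<open>C\<close> may have either sign: \<open>flow_distance_bounds\<close> uses
  both rates, \<open>2 * L\<close> and \<open>- 2 * L\<close>, to get an upper and a lower
  bound.\<close>

lemma gronwall_differential:
 fixes \<phi> \<phi>' :: "real \<Rightarrow> real"
 assumes der: "\<And>t. t \<in> {0..T} \<Longrightarrow> (\<phi> has_real_derivative \<phi>' t) (at t within {0..T})"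
  and le: "\<And>t. t \<in> {0..T} \<Longrightarrow> \<phi>' t \<le> C * \<phi> t + K"
  and C: "C \<noteq> 0" and t: "t \<in> {0..T}"
 shows "\<phi> t \<le> exp (C * t) * (\<phi> 0 + K / C) - K / C"
proof -
 define \<psi> where "\<psi> s = exp (- (C * s)) * (\<phi> s + K / C)" for s
 have d: "(\<psi> has_real_derivative exp (- (C * s)) * (\<phi>' s - C * (\<phi> s + K / C))) (at s within {0..T})"
  if "s \<in> {0..T}" for s
  unfolding \<psi>_def by (auto intro!: derivative_eq_intros der that simp: algebra_simps)
 have "\<psi> t \<le> \<psi> 0"
 proof (rule DERIV_nonpos_imp_decreasing_open[where f=\<psi>])
  show "0 \<le> t" using t by simp
  show "\<exists>y. (\<psi> has_real_derivative y) (at x) \<and> y \<le> 0" if "0 < x" "x < t" for x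
  proof -
   have "at x within {0..T} = at x" using that t by (intro at_within_interior) auto
   moreover have "exp (- (C * x)) * (\<phi>' x - C * (\<phi> x + K / C)) \<le> 0"
    using le[of x] that t C by (intro mult_nonneg_nonpos) (auto simp: algebra_simps)
   ultimately show ?thesis using d[of x] that t by auto
  qed
  show "continuous_on {0..t} \<psi>"
   using d t by (intro DERIV_continuous_on[where D="\<lambda>s. exp (- (C * s)) * (\<phi>' s - C * (\<phi> s + K / C))"])
    (auto intro: DERIV_subset[where s="{0..T}"])
 qed
 then have "exp (C * t) * \<psi> t \<le> exp (C * t) * \<psi> 0" by simp
 then show ?thesis unfolding \<psi>_def by (simp add: mult.assoc[symmetric] exp_add[symmetric])
qed

text \<open>One fixed point serves all times at once: curves are measured in an exponentially
  weighted sup norm, in which the Picard operator is a contraction on the whole half-line.\<close>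

lemma picard_lindelof_global:
 fixes F :: "real \<Rightarrow> 'b::banach \<Rightarrow> 'b"
 assumes lip: "\<And>t x y. 0 \<le> t \<Longrightarrow> norm (F t x - F t y) \<le> L * norm (x - y)"
  and cont: "\<And>x. continuous_on {0..} (\<lambda>t. F t x)"
  and bnd: "\<And>t. 0 \<le> t \<Longrightarrow> norm (F t 0) \<le> B"
 obtains x where "x 0 = x0"
  "\<And>t. 0 \<le> t \<Longrightarrow> (x has_vector_derivative F t (x t)) (at t within {0..})"
proof -
 \<comment> \<open>A weight growing at least twice as fast as the Lipschitz constant makes the
   Picard operator contract by 1/2.\<close>
 define lam where "lam = 2 * (\<bar>L\<bar> + 1)"
 have lam: "lam > 0" "\<bar>L\<bar> / lam \<le> 1/2" unfolding lam_def by (auto simp: field_simps)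
 have lip': "norm (F t x - F t y) \<le> \<bar>L\<bar> * norm (x - y)" if "0 \<le> t" for t x y
  using lip[OF that, of x y] by (rule order_trans) (intro mult_right_mono, auto)
 have comp: "continuous_on {0..} (\<lambda>t. F t (y t))" if y: "continuous_on {0..} y" for y
  unfolding continuous_on_def
 proof
  fix t0 :: real assume t0: "t0 \<in> {0..}"
  have 1: "((\<lambda>t. F t (y t0)) \<longlongrightarrow> F t0 (y t0)) (at t0 within {0..})"
   using cont[of "y t0"] t0 by (auto simp: continuous_on_def)
  have "((\<lambda>t. \<bar>L\<bar> * norm (y t - y t0)) \<longlongrightarrow> \<bar>L\<bar> * norm (y t0 - y t0)) (at t0 within {0..})"
   using y t0 by (intro tendsto_intros) (auto simp: continuous_on_def)
  then have lim: "((\<lambda>t. \<bar>L\<bar> * norm (y t - y t0)) \<longlongrightarrow> 0) (at t0 within {0..})" by simp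
  have "((\<lambda>t. F t (y t) - F t (y t0)) \<longlongrightarrow> 0) (at t0 within {0..})"
  proof (rule Lim_null_comparison[OF _ lim])
   show "\<forall>\<^sub>F t in at t0 within {0..}. norm (F t (y t) - F t (y t0)) \<le> \<bar>L\<bar> * norm (y t - y t0)"
    unfolding eventually_at_filter by (rule always_eventually) (use lip' in simp)
  qed
  from tendsto_add[OF this 1] show "((\<lambda>t. F t (y t)) \<longlongrightarrow> F t0 (y t0)) (at t0 within {0..})" by simp
 qed
 \<comment> \<open>\<open>w y\<close> is the actual curve; the bounded function \<open>y\<close> is
   the curve divided by its exponential weight.\<close>
 define w where "w y s = exp (lam * s) *\<^sub>R apply_bcontfun y s" for y :: "(real, 'b) bcontfun" and s
 have wc: "continuous_on {0..} (w y)" for y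
  unfolding w_def by (intro continuous_intros) auto
 have Fi: "(\<lambda>s. F s (w y s)) integrable_on {0..t}" for y t
  by (intro integrable_continuous_real continuous_on_subset[OF comp[OF wc]]) auto
 have ei: "((\<lambda>s. exp (lam * s)) has_integral (exp (lam * t) - 1) / lam) {0..t}" if "0 \<le> t" for t
 proof -
  have "((\<lambda>s. exp (lam * s)) has_integral exp (lam * t) / lam - exp (lam * 0) / lam) {0..t}"
   using that lam by (intro fundamental_theorem_of_calculus)
    (auto simp: has_real_derivative_iff_has_vector_derivative[symmetric] intro!: derivative_eq_intros)
  then show ?thesis by (simp add: diff_divide_distrib)
 qed
 \<comment> \<open>Bounded continuous functions live on the whole line, so negative times are sent
   to 0; there \<open>P y\<close> is the constant \<open>x0\<close>.\<close>
 define P where "P y t = exp (- lam * max t 0) *\<^sub>R (x0 + integral {0..max t 0} (\<lambda>s. F s (w y s)))" for y t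
 have Pb: "P y \<in> bcontfun" for y
  unfolding bcontfun_def
 proof (intro CollectI conjI)
  have "continuous_on UNIV ((\<lambda>t. integral {0..t} (\<lambda>s. F s (w y s))) \<circ> (\<lambda>t. max t 0))"
  proof (rule continuous_on_compose)
   show "continuous_on (range (\<lambda>t::real. max t 0)) (\<lambda>t. integral {0..t} (\<lambda>s. F s (w y s)))"
   proof (rule continuous_on_subset[of "{0..}"])
    have "continuous (at t within {0..}) (\<lambda>t. integral {0..t} (\<lambda>s. F s (w y s)))" if "0 \<le> t" for t
    proof -
     have "continuous_on {0..t+1} (\<lambda>t. integral {0..t} (\<lambda>s. F s (w y s)))"
      using Fi by (rule indefinite_integral_continuous_1)
     then have "continuous (at t within {0..t+1}) (\<lambda>t. integral {0..t} (\<lambda>s. F s (w y s)))"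
      using that by (auto simp: continuous_on_eq_continuous_within)
     moreover have "at t within {0..t+1} = at t within {0..}"
      by (rule at_within_nhd[of _ "{t-1<..<t+1}"]) (use that in auto)
     ultimately show ?thesis by (simp add: continuous_within)
    qed
    then show "continuous_on {0..} (\<lambda>t. integral {0..t} (\<lambda>s. F s (w y s)))"
     by (auto simp: continuous_on_eq_continuous_within)
   qed auto
  qed (intro continuous_intros)
  then show "continuous_on UNIV (P y)" unfolding P_def comp_def by (intro continuous_intros) auto
  have "norm (P y t) \<le> norm x0 + (B + \<bar>L\<bar> * norm y) / lam" for t
  proof -
   define s where "s = max t 0"
   have s: "0 \<le> s" unfolding s_def by auto
   have b: "norm (F r (w y r)) \<le> (B + \<bar>L\<bar> * norm y) * exp (lam * r)" if "r \<in> {0..s}" for r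
   proof -
    have "norm (F r (w y r)) \<le> norm (F r 0) + norm (F r (w y r) - F r 0)"
     by (metis add.commute diff_add_cancel norm_triangle_ineq)
    also have "\<dots> \<le> B + \<bar>L\<bar> * norm (w y r)"
     using bnd[of r] lip'[of r "w y r" 0] that by auto
    also have "\<dots> \<le> B * exp (lam * r) + \<bar>L\<bar> * (exp (lam * r) * norm y)"
    proof (intro add_mono mult_left_mono)
     have "0 \<le> B" using order_trans[OF norm_ge_zero bnd[of 0]] by simp
     then show "B \<le> B * exp (lam * r)" using that lam by (simp add: mult_le_cancel_left1)
     show "norm (w y r) \<le> exp (lam * r) * norm y"
      unfolding w_def using norm_bounded[of y r] by simp
    qed auto
    finally show ?thesis by (simp add: algebra_simps)
   qed
   have "norm (integral {0..s} (\<lambda>r. F r (w y r))) \<le> (B + \<bar>L\<bar> * norm y) * ((exp (lam * s) - 1) / lam)"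
    using integral_norm_bound_integral[OF Fi has_integral_integrable[OF has_integral_mult_right[OF ei[OF s]]] b]
     integral_unique[OF has_integral_mult_right[OF ei[OF s]]] by auto
   also have "\<dots> \<le> (B + \<bar>L\<bar> * norm y) * (exp (lam * s) / lam)"
    using lam order_trans[OF norm_ge_zero bnd[of 0]]
    by (intro mult_left_mono divide_right_mono) auto
   finally have "norm (integral {0..s} (\<lambda>r. F r (w y r))) \<le> (B + \<bar>L\<bar> * norm y) / lam * exp (lam * s)"
    by simp
   then have "exp (- lam * s) * norm (integral {0..s} (\<lambda>r. F r (w y r))) \<le> exp (- lam * s) * ((B + \<bar>L\<bar> * norm y) / lam * exp (lam * s))"
    by (intro mult_left_mono) auto
   also have "\<dots> = (B + \<bar>L\<bar> * norm y) / lam * (exp (- lam * s) * exp (lam * s))"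
    by (simp only: mult_ac)
   also have "\<dots> = (B + \<bar>L\<bar> * norm y) / lam"
    by (simp flip: exp_add)
   finally have 1: "exp (- lam * s) * norm (integral {0..s} (\<lambda>r. F r (w y r))) \<le> (B + \<bar>L\<bar> * norm y) / lam" .
   have "exp (- lam * s) * norm x0 \<le> norm x0" using s lam by (intro mult_left_le_one_le) auto
   moreover have "norm (P y t) \<le> exp (- lam * s) * norm x0 + exp (- lam * s) * norm (integral {0..s} (\<lambda>r. F r (w y r)))"
    unfolding P_def s_def[symmetric] norm_scaleR
    by (simp flip: distrib_left add: norm_triangle_ineq)
   ultimately show ?thesis using 1 by linarith
  qed
  then show "bounded (range (P y))" unfolding bounded_iff by blast
 qed
 define \<Psi> where "\<Psi> y = Bcontfun (P y)" for y
 have \<Psi>: "apply_bcontfun (\<Psi> y) t = P y t" for y t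
  unfolding \<Psi>_def using Pb by (simp add: Bcontfun_inverse)
 have "dist (\<Psi> y) (\<Psi> z) \<le> 1/2 * dist y z" for y z
 proof (rule dist_bound)
  fix t :: real
  define s where "s = max t 0"
  have s: "0 \<le> s" unfolding s_def by auto
  have b: "norm (F r (w y r) - F r (w z r)) \<le> (\<bar>L\<bar> * dist y z) * exp (lam * r)" if "r \<in> {0..s}" for r
  proof -
   have "norm (F r (w y r) - F r (w z r)) \<le> \<bar>L\<bar> * norm (w y r - w z r)"
    using lip' that by auto
   also have "norm (w y r - w z r) = exp (lam * r) * dist (y r) (z r)"
    unfolding w_def by (simp add: dist_norm flip: scaleR_diff_right)
   finally show ?thesis using dist_bounded[of y r z]
    by (smt (verit, ccfv_SIG) exp_gt_zero mult.assoc mult.commute mult_left_mono abs_ge_zero)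
  qed
  have "dist (P y t) (P z t) = exp (- lam * s) * norm (integral {0..s} (\<lambda>r. F r (w y r) - F r (w z r)))"
   unfolding P_def s_def[symmetric] dist_norm
   by (subst integral_diff[OF Fi Fi]) (simp flip: scaleR_diff_right)
  also have "norm (integral {0..s} (\<lambda>r. F r (w y r) - F r (w z r))) \<le> (\<bar>L\<bar> * dist y z) * ((exp (lam * s) - 1) / lam)"
   using integral_norm_bound_integral[OF integrable_diff[OF Fi Fi] has_integral_integrable[OF has_integral_mult_right[OF ei[OF s]]] b]
    integral_unique[OF has_integral_mult_right[OF ei[OF s]]] by auto
  also have "\<dots> \<le> (\<bar>L\<bar> * dist y z) * (exp (lam * s) / lam)"
   using lam by (intro mult_left_mono divide_right_mono) auto
  also have "exp (- lam * s) * \<dots> = \<bar>L\<bar> / lam * dist y z"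
   by (simp add: exp_minus field_simps)
  also have "\<dots> \<le> 1/2 * dist y z" using lam by (intro mult_right_mono) auto
  finally show "dist (\<Psi> y t) (\<Psi> z t) \<le> 1/2 * dist y z" by (simp add: \<Psi>)
 qed
 then have "\<exists>!y. \<Psi> y = y" by (intro banach_fix_type[of "1/2"]) auto
 then obtain y where y: "\<Psi> y = y" by blast
 have yt: "w y t = x0 + integral {0..t} (\<lambda>s. F s (w y s))" if "0 \<le> t" for t
 proof -
  have "w y t = exp (lam * t) *\<^sub>R P y t" unfolding w_def using \<Psi>[of y t] y by simp
  then show ?thesis using that by (simp add: P_def max_absorb1 exp_add[symmetric])
 qed
 show thesis
 proof
  show "w y 0 = x0" using yt[of 0] by simp
  fix t :: real assume t: "0 \<le> t"
  have "((\<lambda>t. integral {0..t} (\<lambda>s. F s (w y s))) has_vector_derivative F t (w y t)) (at t within {0..t+1})"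
   by (rule integral_has_vector_derivative) (use t in \<open>auto intro: continuous_on_subset[OF comp[OF wc]]\<close>)
  then have "((\<lambda>t. x0 + integral {0..t} (\<lambda>s. F s (w y s))) has_vector_derivative F t (w y t)) (at t within {0..t+1})"
   by (auto intro!: derivative_eq_intros)
  then have "(w y has_vector_derivative F t (w y t)) (at t within {0..t+1})"
   by (rule has_vector_derivative_transform[rotated 2]) (use t yt in auto)
  moreover have "at t within {0..t+1} = at t within {0..}"
   by (rule at_within_nhd[of _ "{t-1<..<t+1}"]) (use t in auto)
  ultimately show "(w y has_vector_derivative F t (w y t)) (at t within {0..})"
   by (simp add: has_vector_derivative_def has_derivative_within)
 qed
qed

lemma sum_sq_dist_has_derivative:
 fixes x y :: "real \<Rightarrow> 'i \<Rightarrow> 'a::real_inner"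
 assumes "\<And>i. i \<in> I \<Longrightarrow> ((\<lambda>s. x s i) has_vector_derivative vx i) (at t within S)"
  and "\<And>i. i \<in> I \<Longrightarrow> ((\<lambda>s. y s i) has_vector_derivative vy i) (at t within S)"
 shows "((\<lambda>s. \<Sum>i\<in>I. (norm (x s i - y s i))\<^sup>2) has_real_derivative
  (\<Sum>i\<in>I. 2 * ((x t i - y t i) \<bullet> (vx i - vy i)))) (at t within S)"
proof -
 have "((\<lambda>s. (norm (x s i - y s i))\<^sup>2) has_real_derivative 2 * ((x t i - y t i) \<bullet> (vx i - vy i))) (at t within S)"
  if "i \<in> I" for i
 proof -
  have "((\<lambda>s. x s i - y s i) has_derivative (\<lambda>h. h *\<^sub>R (vx i - vy i))) (at t within S)"
   using has_vector_derivative_diff[OF assms(1)[OF that] assms(2)[OF that]]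
   by (simp add: has_vector_derivative_def)
  from has_derivative_inner[OF this this] show ?thesis
   unfolding has_field_derivative_def power2_norm_eq_inner
   by (rule has_derivative_eq_rhs) (auto simp: fun_eq_iff inner_commute)
 qed
 then show ?thesis by (intro DERIV_sum) auto
qed

text \<open>The bound on the inner products is two-sided, so squared distances neither grow nor
  shrink faster than exponentially. The lower bound is what keeps transported points from clustering
  in \<open>flow_heat_le\<close>.\<close>

lemma flow_distance_bounds:
 fixes x y :: "real \<Rightarrow> 'i \<Rightarrow> 'a::real_inner"
 assumes "\<And>i t. i \<in> I \<Longrightarrow> t \<in> {0..T} \<Longrightarrow> ((\<lambda>s. x s i) has_vector_derivative vx t i) (at t within {0..T})"
  and "\<And>i t. i \<in> I \<Longrightarrow> t \<in> {0..T} \<Longrightarrow> ((\<lambda>s. y s i) has_vector_derivative vy t i) (at t within {0..T})"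
  and lip: "\<And>t. t \<in> {0..T} \<Longrightarrow> \<bar>\<Sum>i\<in>I. (x t i - y t i) \<bullet> (vx t i - vy t i)\<bar> \<le> L * (\<Sum>i\<in>I. (norm (x t i - y t i))\<^sup>2)"
  and L: "L \<noteq> 0" and t: "t \<in> {0..T}"
 shows "(\<Sum>i\<in>I. (norm (x t i - y t i))\<^sup>2) \<le> exp (2 * L * t) * (\<Sum>i\<in>I. (norm (x 0 i - y 0 i))\<^sup>2)"
  and "exp (- 2 * L * t) * (\<Sum>i\<in>I. (norm (x 0 i - y 0 i))\<^sup>2) \<le> (\<Sum>i\<in>I. (norm (x t i - y t i))\<^sup>2)"
proof -
 let ?D = "\<lambda>t. \<Sum>i\<in>I. (norm (x t i - y t i))\<^sup>2"
 let ?D' = "\<lambda>t. \<Sum>i\<in>I. 2 * ((x t i - y t i) \<bullet> (vx t i - vy t i))"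
 have d: "(?D has_real_derivative ?D' t) (at t within {0..T})" if "t \<in> {0..T}" for t
  using that assms(1,2) by (intro sum_sq_dist_has_derivative)
 have b: "\<bar>?D' t\<bar> \<le> 2 * L * ?D t" if "t \<in> {0..T}" for t
  using lip[OF that] by (simp flip: sum_distrib_left)
 show "?D t \<le> exp (2 * L * t) * ?D 0"
  using gronwall_differential[of T ?D ?D' "2 * L" 0 t, OF d _ _ t] b L by fastforce
 have "(\<lambda>s. - ?D s) t \<le> exp (- 2 * L * t) * (- ?D 0)"
  using gronwall_differential[of T "\<lambda>s. - ?D s" "\<lambda>s. - ?D' s" "- 2 * L" 0 t, OF DERIV_minus[OF d] _ _ t] b L
  by fastforce
 then show "exp (- 2 * L * t) * ?D 0 \<le> ?D t" by simp
qed

section \<open>Heat kernels\<close>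

definition heat :: "real \<Rightarrow> 'a::euclidean_space \<Rightarrow> real" where
 "heat s x = (4 * pi * s) powr (- (real DIM('a) / 2)) * exp (- (norm x)\<^sup>2 / (4 * s))"

lemma heat_nonneg [simp]: "0 \<le> heat s x"
 by (simp add: heat_def)

lemma heat_minus [simp]: "heat s (- x) = heat s x"
 by (simp add: heat_def)

lemma heat_minus_commute: "heat s (x - y) = heat s (y - x)"
 by (simp add: heat_def norm_minus_commute)

lemma borel_measurable_heat [measurable (raw)]:
 fixes g :: "'w \<Rightarrow> 'a::euclidean_space"
 assumes [measurable]: "f \<in> borel_measurable M" "g \<in> borel_measurable M"
 shows "(\<lambda>w. heat (f w) (g w)) \<in> borel_measurable M"
 unfolding heat_def by measurable

lemma heat_le:
 assumes "0 < s"
 shows "heat s (x::'a::euclidean_space) \<le> (4 * pi * s) powr (- (real DIM('a) / 2))"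
 unfolding heat_def using assms by (intro mult_left_le) auto

text \<open>The heat kernel at time s is a product of centred normal densities of variance 2 s, one
  for each coordinate.\<close>

lemma nn_integral_heat:
 assumes s: "0 < s"
 shows "(\<integral>\<^sup>+(x::'a::euclidean_space). ennreal (heat s x) \<partial>lborel) = 1"
proof -
 define \<sigma> where "\<sigma> = sqrt (2 * s)"
 have \<sigma>: "\<sigma> > 0" "\<sigma>\<^sup>2 = 2 * s" unfolding \<sigma>_def using s by auto
 have h: "heat s x = (\<Prod>b\<in>Basis. normal_density 0 \<sigma> (x \<bullet> b))" for x :: 'a
 proof -
  have "(\<Prod>b\<in>Basis. normal_density 0 \<sigma> (x \<bullet> b)) =
   (\<Prod>b\<in>(Basis::'a set). 1 / sqrt (4 * pi * s)) * (\<Prod>b\<in>Basis. exp (- (x \<bullet> b)\<^sup>2 / (4 * s)))"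
   unfolding normal_density_def \<sigma>(2) prod.distrib[symmetric] by (simp add: mult.commute mult.left_commute)
  also have "(\<Prod>b\<in>(Basis::'a set). 1 / sqrt (4 * pi * s)) = (4 * pi * s) powr (- (real DIM('a) / 2))"
  proof -
   have *: "1 / sqrt (4 * pi * s) = (4 * pi * s) powr (- (1 / 2))"
    using s by (simp add: powr_minus_divide powr_half_sqrt)
   show ?thesis using s unfolding * by (simp add: powr_power)
  qed
  also have "(\<Prod>b\<in>Basis. exp (- (x \<bullet> b)\<^sup>2 / (4 * s))) = exp (- (norm x)\<^sup>2 / (4 * s))"
  proof -
   have "(norm x)\<^sup>2 = (\<Sum>b\<in>Basis. (x \<bullet> b)\<^sup>2)"
    unfolding power2_norm_eq_inner by (subst euclidean_inner) (simp add: power2_eq_square)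
   then show ?thesis
    by (simp add: exp_sum[symmetric] sum_negf sum_divide_distrib[symmetric] flip: minus_divide_left)
  qed
  finally show ?thesis by (simp add: heat_def)
 qed
 have "(\<integral>\<^sup>+(x::'a). ennreal (heat s x) \<partial>lborel) = (\<integral>\<^sup>+(x::'a). (\<Prod>b\<in>Basis. ennreal (normal_density 0 \<sigma> (x \<bullet> b))) \<partial>lborel)"
  by (simp add: h prod_ennreal)
 also have "\<dots> = (\<Prod>b\<in>(Basis::'a set). \<integral>\<^sup>+y. ennreal (normal_density 0 \<sigma> y) \<partial>lborel)"
  by (rule nn_integral_lborel_prod) auto
 also have "(\<integral>\<^sup>+y. ennreal (normal_density 0 \<sigma> y) \<partial>lborel) = 1"
  using \<sigma> by (subst nn_integral_eq_integral) auto
 finally show ?thesis by simp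
qed

lemma nn_integral_heat_diff:
 assumes s: "0 < s"
 shows "(\<integral>\<^sup>+x. ennreal (heat s (x - y)) \<partial>lborel) = 1"
  and "(\<integral>\<^sup>+x. ennreal (heat s (y - x)) \<partial>lborel) = 1"
proof -
 show "(\<integral>\<^sup>+x. ennreal (heat s (x - y)) \<partial>lborel) = 1"
  using nn_integral_lborel_shift[of "\<lambda>x. ennreal (heat s x)" "- y"] by (simp add: nn_integral_heat[OF s])
 then show "(\<integral>\<^sup>+x. ennreal (heat s (y - x)) \<partial>lborel) = 1"
  by (simp add: heat_minus_commute)
qed

lemma integrable_heat:
 assumes "0 < s"
 shows "integrable lborel (heat s)" "integrable lborel (\<lambda>x. heat s (x - y))" "integrable lborel (\<lambda>x. heat s (y - x))"
 by (auto intro!: integrableI_bounded simp: nn_integral_heat[OF assms] nn_integral_heat_diff[OF assms])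

lemma integral_heat:
 assumes "0 < s"
 shows "(LBINT x. heat s x) = 1" "(LBINT x. heat s (x - y)) = 1" "(LBINT x. heat s (y - x)) = 1"
 by (auto simp: integral_eq_nn_integral nn_integral_heat[OF assms] nn_integral_heat_diff[OF assms])

text \<open>Completing the square in z: two Gaussians multiply to a Gaussian in x - y times a
  normalized Gaussian in z around a weighted mean of x and y. Integration over z then gives the
  semigroup law.\<close>

lemma heat_mult_heat:
 fixes x y z :: "'a::euclidean_space"
 assumes s: "0 < s" and t: "0 < t"
 shows "heat s (x - z) * heat t (z - y) =
  heat (s + t) (x - y) * heat (s * t / (s + t)) (z - ((t / (s + t)) *\<^sub>R x + (s / (s + t)) *\<^sub>R y))"
proof -
 let ?A = "(t / (s + t)) *\<^sub>R x + (s / (s + t)) *\<^sub>R y"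
 define p q where "p = x - z" and "q = z - y"
 define r where "r = z - ?A"
 have xy: "x - y = p + q" by (simp add: p_def q_def)
 have st: "s + t > 0" using s t by simp
 have "(s + t) *\<^sub>R r = s *\<^sub>R q - t *\<^sub>R p"
 proof -
  have "(s + t) *\<^sub>R ?A = t *\<^sub>R x + s *\<^sub>R y"
   using st by (simp add: scaleR_add_right)
  then show ?thesis unfolding r_def p_def q_def scaleR_diff_right by (simp add: scaleR_add_left)
 qed
 then have r: "r = (1 / (s + t)) *\<^sub>R (s *\<^sub>R q - t *\<^sub>R p)"
  using st by (metis divide_inverse less_irrefl mult_1 pth_1 real_vector.scale_scale right_inverse mult.commute inverse_eq_divide)
 have nr: "(norm r)\<^sup>2 = (norm (s *\<^sub>R q - t *\<^sub>R p))\<^sup>2 / (s + t)\<^sup>2"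
  unfolding r using st by (simp add: power_divide power_mult_distrib)
 have "(norm p)\<^sup>2 / (4 * s) + (norm q)\<^sup>2 / (4 * t) =
  (norm (p + q))\<^sup>2 / (4 * (s + t)) + (norm r)\<^sup>2 / (4 * (s * t / (s + t)))"
  unfolding nr using s t st
  unfolding power2_norm_eq_inner
  apply (simp add: divide_simps inner_add inner_diff inner_commute power2_eq_square)
  apply (simp add: algebra_simps inner_commute)
  done
 then have e: "exp (- (norm p)\<^sup>2 / (4 * s)) * exp (- (norm q)\<^sup>2 / (4 * t)) =
  exp (- (norm (p + q))\<^sup>2 / (4 * (s + t))) * exp (- (norm r)\<^sup>2 / (4 * (s * t / (s + t))))"
  by (simp add: exp_add[symmetric])
 have c: "(4 * pi * s) powr a * (4 * pi * t) powr a = (4 * pi * (s + t)) powr a * (4 * pi * (s * t / (s + t))) powr a" for a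
 proof -
  have "(4 * pi * s) * (4 * pi * t) = (4 * pi * (s + t)) * (4 * pi * (s * t / (s + t)))" using st by simp
  then show ?thesis by (metis powr_mult)
 qed
 show ?thesis
  unfolding heat_def p_def[symmetric] q_def[symmetric] r_def[symmetric] xy
  using e c[of "- (real DIM('a) / 2)"] by (simp add: mult.commute mult.left_commute)
qed

lemma integral_heat_mult_heat:
 fixes x y :: "'a::euclidean_space"
 assumes s: "0 < s" and t: "0 < t"
 shows "(LBINT z. heat s (x - z) * heat t (z - y)) = heat (s + t) (x - y)"
  and "integrable lborel (\<lambda>z. heat s (x - z) * heat t (z - y))"
  and "(\<integral>\<^sup>+z. ennreal (heat s (x - z) * heat t (z - y)) \<partial>lborel) = ennreal (heat (s + t) (x - y))"
proof -
 have st: "0 < s * t / (s + t)" using s t by simp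
 show "(LBINT z. heat s (x - z) * heat t (z - y)) = heat (s + t) (x - y)"
  unfolding heat_mult_heat[OF s t] by (simp add: integral_heat[OF st])
 show "integrable lborel (\<lambda>z. heat s (x - z) * heat t (z - y))"
  unfolding heat_mult_heat[OF s t] by (simp add: integrable_heat[OF st])
 show "(\<integral>\<^sup>+z. ennreal (heat s (x - z) * heat t (z - y)) \<partial>lborel) = ennreal (heat (s + t) (x - y))"
  unfolding heat_mult_heat[OF s t] by (simp add: ennreal_mult' nn_integral_cmult nn_integral_heat_diff[OF st])
qed

lemma mult_exp_minus_le_one: "y * exp (- y) \<le> (1::real)"
proof -
 have "y * exp (- y) \<le> exp y * exp (- y)"
  using exp_ge_add_one_self[of y] by (intro mult_right_mono) (linarith, simp)
 then show ?thesis by (simp flip: exp_add)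
qed

text \<open>Half of the exponent is set aside. In the bounds that follow it absorbs powers of norm
  x, at the price of doubling the time.\<close>

lemma heat_double:
 fixes x :: "'a::euclidean_space"
 assumes s: "0 < s"
 shows "heat s x = 2 powr (real DIM('a) / 2) * heat (2 * s) x * exp (- (norm x)\<^sup>2 / (8 * s))"
proof -
 have "(4 * pi * (2 * s)) powr (- (real DIM('a) / 2)) = 2 powr (- (real DIM('a) / 2)) * (4 * pi * s) powr (- (real DIM('a) / 2))"
  using s by (simp add: powr_mult[symmetric] mult.commute mult.left_commute)
 moreover have "exp (- (norm x)\<^sup>2 / (4 * s)) = exp (- (norm x)\<^sup>2 / (4 * (2 * s))) * exp (- (norm x)\<^sup>2 / (8 * s))"
  using s by (simp add: exp_add[symmetric] field_simps)
 ultimately show ?thesis unfolding heat_def by (simp add: powr_minus field_simps)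
qed

lemma norm_sq_heat_le:
 fixes x :: "'a::euclidean_space"
 assumes s: "0 < s"
 shows "(norm x)\<^sup>2 * heat s x \<le> 2 powr (real DIM('a) / 2) * (8 * s) * heat (2 * s) x"
proof -
 have "(norm x)\<^sup>2 / (8 * s) * exp (- ((norm x)\<^sup>2 / (8 * s))) \<le> 1" by (rule mult_exp_minus_le_one)
 then have *: "(norm x)\<^sup>2 * exp (- (norm x)\<^sup>2 / (8 * s)) \<le> 8 * s" using s by (simp add: field_simps)
 have "(norm x)\<^sup>2 * heat s x = 2 powr (real DIM('a) / 2) * heat (2 * s) x * ((norm x)\<^sup>2 * exp (- (norm x)\<^sup>2 / (8 * s)))"
  by (subst heat_double[OF s]) simp
 also have "\<dots> \<le> 2 powr (real DIM('a) / 2) * heat (2 * s) x * (8 * s)"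
  by (intro mult_left_mono *) auto
 finally show ?thesis by (simp add: mult_ac)
qed

lemma norm_heat_le:
 fixes x :: "'a::euclidean_space"
 assumes s: "0 < s"
 shows "norm x * heat s x \<le> 2 powr (real DIM('a) / 2) * sqrt (8 * s) * heat (2 * s) x"
proof -
 define y where "y = norm x / sqrt (8 * s)"
 have y: "y \<ge> 0" "y\<^sup>2 = (norm x)\<^sup>2 / (8 * s)" unfolding y_def using s by (simp_all add: power_divide)
 have "y * exp (- y\<^sup>2) \<le> 1"
 proof (cases "y \<le> 1")
  case True
  then show ?thesis using y(1) by (intro mult_le_one) auto
 next
  case False
  then have "y * exp (- y\<^sup>2) \<le> y\<^sup>2 * exp (- y\<^sup>2)" by (intro mult_right_mono) (auto simp: power2_eq_square)
  also have "\<dots> \<le> 1" by (rule mult_exp_minus_le_one)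
  finally show ?thesis .
 qed
 then have *: "norm x * exp (- (norm x)\<^sup>2 / (8 * s)) \<le> sqrt (8 * s)"
  unfolding y(2) y_def using s by (simp add: field_simps)
 have "norm x * heat s x = 2 powr (real DIM('a) / 2) * heat (2 * s) x * (norm x * exp (- (norm x)\<^sup>2 / (8 * s)))"
  by (subst heat_double[OF s]) simp
 also have "\<dots> \<le> 2 powr (real DIM('a) / 2) * heat (2 * s) x * sqrt (8 * s)"
  by (intro mult_left_mono *) auto
 finally show ?thesis by (simp add: mult_ac)
qed

lemma heat_le_heat_double:
 fixes x :: "'a::euclidean_space"
 assumes s: "0 < s"
 shows "heat s x \<le> 2 powr (real DIM('a) / 2) * heat (2 * s) x"
 by (subst heat_double[OF s], rule mult_left_le) (use s in auto)

lemma heat_has_derivative: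
 "((\<lambda>x. heat s x) has_derivative (\<lambda>h. - (x \<bullet> h) / (2 * s) * heat s x)) (at x within S)"
proof (cases "s = 0")
 case False
 then show ?thesis unfolding heat_def power2_norm_eq_inner
  by (auto intro!: derivative_eq_intros simp: inner_commute fun_eq_iff field_simps)
qed (simp add: heat_def)

lemma heat_has_time_derivative:
 assumes s: "0 < s"
 shows "((\<lambda>s. heat s (x::'a::euclidean_space)) has_real_derivative
  ((norm x)\<^sup>2 / (4 * s\<^sup>2) - real DIM('a) / (2 * s)) * heat s x) (at s)"
proof -
 define a where "a = - (real DIM('a) / 2)"
 have 1: "((\<lambda>s. (4 * pi * s) powr a) has_real_derivative (a / s) * (4 * pi * s) powr a) (at s)"
  using s by (auto intro!: derivative_eq_intros simp: powr_diff field_simps)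
 have 2: "((\<lambda>s. exp (- (norm x)\<^sup>2 / (4 * s))) has_real_derivative
   ((norm x)\<^sup>2 / (4 * s\<^sup>2)) * exp (- (norm x)\<^sup>2 / (4 * s))) (at s)"
  using s by (auto intro!: derivative_eq_intros simp: power2_eq_square)
 from DERIV_mult[OF 1 2] show ?thesis
  unfolding heat_def a_def[symmetric] by (rule DERIV_cong) (simp add: a_def algebra_simps)
qed

section \<open>Mixtures of heat kernels\<close>

lemma set_integral_substitution_real:
 fixes f g g' :: "real \<Rightarrow> real"
 assumes S: "S \<in> sets borel" "g ` S \<in> sets borel"
  and der: "\<And>x. x \<in> S \<Longrightarrow> (g has_real_derivative g' x) (at x)"
  and inj: "inj_on g S"
  and meas: "set_borel_measurable borel S (\<lambda>x. \<bar>g' x\<bar> * f (g x))" "set_borel_measurable borel (g ` S) f"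
 shows "set_integrable lborel S (\<lambda>x. \<bar>g' x\<bar> * f (g x)) \<longleftrightarrow> set_integrable lborel (g ` S) f" (is ?A)
  and "set_integrable lborel (g ` S) f \<Longrightarrow> (LBINT x:S. \<bar>g' x\<bar> * f (g x)) = (LBINT y:g ` S. f y)"
proof -
 have ab: "h absolutely_integrable_on A \<longleftrightarrow> set_integrable lborel A h"
  if "set_borel_measurable borel A h" for A and h :: "real \<Rightarrow> real"
  using that unfolding set_integrable_def set_borel_measurable_def by (subst integrable_completion) auto
 note cv = has_absolute_integral_change_of_variables_1'[of S g g' f, OF _ DERIV_subset[OF der subset_UNIV] inj]
 have S': "S \<in> sets lebesgue" using S by (simp add: sets_completionI_sets)
 show ?A using cv[OF S'] meas by (auto simp: ab)
 assume i: "set_integrable lborel (g ` S) f"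
 with \<open>?A\<close> have i': "set_integrable lborel S (\<lambda>x. \<bar>g' x\<bar> * f (g x))" by simp
 show "(LBINT x:S. \<bar>g' x\<bar> * f (g x)) = (LBINT y:g ` S. f y)"
  unfolding set_borel_integral_eq_integral(2)[OF i] set_borel_integral_eq_integral(2)[OF i']
  using cv[OF S', of "integral (g ` S) f"] i meas by (simp add: ab)
qed

text \<open>The substitution t = b / s in the Gamma integral.\<close>

lemma Gamma_integral_inverse:
 fixes a b :: real
 assumes a: "0 < a" and b: "0 < b"
 shows "set_integrable lborel {0<..} (\<lambda>s. s powr (- a - 1) * exp (- b / s))"
  and "(LBINT s:{0<..}. s powr (- a - 1) * exp (- b / s)) = Gamma a / b powr a"
proof -
 let ?f = "\<lambda>t::real. t powr (a - 1) / exp t"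
 let ?g = "\<lambda>s::real. b / s"
 have img: "?g ` {0<..} = {0<..}"
 proof
  show "{0<..} \<subseteq> ?g ` {0<..}"
  proof
   fix y :: real assume "y \<in> {0<..}"
   then show "y \<in> ?g ` {0<..}" using b by (intro image_eqI[of _ _ "b / y"]) auto
  qed
 qed (use b in auto)
 have hi: "(?f has_integral Gamma a) {0<..}"
  using Gamma_integral_real[OF a]
  by (subst has_integral_spike_set_eq[of _ "{0..}"]) (auto intro: negligible_subset[of "{0}"])
 then have "?f absolutely_integrable_on {0<..}"
  by (intro nonnegative_absolutely_integrable_1) (auto simp: has_integral_iff)
 then have fi: "set_integrable lborel {0<..} ?f"
  unfolding set_integrable_def by (subst (asm) integrable_completion) auto
 have eq: "\<bar>- b / s\<^sup>2\<bar> * ?f (?g s) = b powr a * (s powr (- a - 1) * exp (- b / s))" if "s \<in> {0<..}" for s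
  using that b by (simp add: powr_diff powr_minus powr_divide exp_minus field_simps power2_eq_square)
 have m1: "set_borel_measurable borel {0<..} (\<lambda>s. \<bar>- b / s\<^sup>2\<bar> * ?f (?g s))"
  unfolding set_borel_measurable_def by measurable
 have m2: "set_borel_measurable borel (?g ` {0<..}) ?f"
  unfolding set_borel_measurable_def img by measurable
 have d: "((/) b has_real_derivative - b / x\<^sup>2) (at x)" if "x \<in> {0<..}" for x
  using that by (auto intro!: derivative_eq_intros simp: power2_eq_square)
 note sub = set_integral_substitution_real[of "{0<..}" ?g "\<lambda>s. - b / s\<^sup>2" ?f, OF _ _ d _ m1 m2, unfolded img]
 have inj: "inj_on ?g {0<..}" using b by (auto simp: inj_on_def)
 have "set_integrable lborel {0<..} (\<lambda>s. \<bar>- b / s\<^sup>2\<bar> * ?f (?g s))"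
  using sub(1) fi inj by simp
 then have i2: "set_integrable lborel {0<..} (\<lambda>s. b powr a * (s powr (- a - 1) * exp (- b / s)))"
  by (rule set_integrable_cong[THEN iffD1, rotated 3]) (use eq in auto)
 then show i3: "set_integrable lborel {0<..} (\<lambda>s. s powr (- a - 1) * exp (- b / s))"
  using b by simp
 have "(LBINT s:{0<..}. b powr a * (s powr (- a - 1) * exp (- b / s))) = (LBINT s:{0<..}. \<bar>- b / s\<^sup>2\<bar> * ?f (?g s))"
  by (rule set_lebesgue_integral_cong) (use eq in auto)
 also have "\<dots> = (LBINT s:{0<..}. ?f s)" using sub(2) fi inj by simp
 also have "\<dots> = Gamma a"
  using set_borel_integral_eq_integral(2)[OF fi] hi by (simp add: integral_unique)
 finally show "(LBINT s:{0<..}. s powr (- a - 1) * exp (- b / s)) = Gamma a / b powr a"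
  using b by (simp add: field_simps)
qed

text \<open>The maximum over s sits at s = b / a. The inequality ln y <= y - 1 for y = b / (a s)
  yields it; the gain of a factor exp (- a) is given away.\<close>

lemma powr_minus_mult_exp_le:
 assumes a: "0 < a" and b: "0 < b" and s: "0 < (s::real)"
 shows "s powr (- a) * exp (- b / s) \<le> (a / b) powr a"
proof -
 let ?A = "s powr (- a) * exp (- b / s)"
 have "ln (b / (a * s)) \<le> b / (a * s) - 1" using a b s by (intro ln_le_minus_one) auto
 then have "a * ln (b / (a * s)) \<le> a * (b / (a * s) - 1)" using a by (intro mult_left_mono) auto
 also have "\<dots> \<le> b / s" using a by (simp add: algebra_simps)
 finally have "exp (a * ln (b / (a * s))) \<le> exp (b / s)" by simp
 then have le: "(b / (a * s)) powr a \<le> exp (b / s)" using a b s by (simp add: powr_def)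
 have "b / (a * s) = (b / a) * (1 / s)" by simp
 then have "(b / (a * s)) powr a = (b / a) powr a * (1 / s) powr a" by (simp only: powr_mult)
 also have "(1 / s) powr a = s powr (- a)" using s by (simp add: powr_minus_divide powr_divide)
 finally have "(b / a) powr a * ?A = (b / (a * s)) powr a * exp (- b / s)"
  by (simp only: mult.assoc)
 also have "\<dots> \<le> exp (b / s) * exp (- b / s)" using le by (intro mult_right_mono) auto
 also have "\<dots> = 1" by (simp flip: exp_add)
 finally have *: "(b / a) powr a * ?A \<le> 1" .
 have "(a / b) powr a * ((b / a) powr a * ?A) \<le> (a / b) powr a * 1"
  by (intro mult_left_mono *) auto
 moreover have "(a / b) powr a * (b / a) powr a = 1" using a b by (simp flip: powr_mult)
 ultimately show ?thesis by (metis mult.assoc mult_1 mult_1_right)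
qed

lemma heat_div_power_eq:
 assumes "0 < s"
 shows "heat s (x::'a::euclidean_space) / s ^ k =
  (4 * pi) powr (- (real DIM('a) / 2)) * (s powr (- (real DIM('a) / 2 + real k)) * exp (- ((norm x)\<^sup>2 / 4) / s))"
proof -
 define e where "e = real DIM('a) / 2"
 have 1: "(4 * pi * s) powr (- e) = (4 * pi) powr (- e) * s powr (- e)" by (simp only: powr_mult)
 have "- (e + real k) = - e - real k" by simp
 then have 2: "s powr (- (e + real k)) = s powr (- e) / s ^ k"
  using assms by (simp only: powr_diff powr_realpow)
 have 3: "- (norm x)\<^sup>2 / (4 * s) = - ((norm x)\<^sup>2 / 4) / s" by simp
 show ?thesis unfolding heat_def e_def[symmetric] 1 2 3 by simp
qed

text \<open>Away from the origin the Gaussian factor beats every negative power of s, so the bound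
  is uniform in s. \<open>heat_div_power_le_cut\<close> is the complementary bound, uniform in x for
  times bounded below.\<close>

lemma heat_div_power_le:
 fixes x :: "'a::euclidean_space"
 assumes s: "0 < s" and r: "0 < r" "r \<le> norm x"
 shows "heat s x / s ^ k \<le> (4 * pi) powr (- (real DIM('a) / 2)) * ((real DIM('a) / 2 + real k) / (r\<^sup>2 / 4)) powr (real DIM('a) / 2 + real k)"
proof -
 have "exp (- ((norm x)\<^sup>2 / 4) / s) \<le> exp (- (r\<^sup>2 / 4) / s)"
  using s r by (auto intro!: divide_right_mono power_mono)
 then have "s powr (- (real DIM('a) / 2 + real k)) * exp (- ((norm x)\<^sup>2 / 4) / s) \<le>
  s powr (- (real DIM('a) / 2 + real k)) * exp (- (r\<^sup>2 / 4) / s)"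
  by (intro mult_left_mono) auto
 also have "\<dots> \<le> ((real DIM('a) / 2 + real k) / (r\<^sup>2 / 4)) powr (real DIM('a) / 2 + real k)"
  using r s by (intro powr_minus_mult_exp_le) (auto intro: add_pos_nonneg)
 finally show ?thesis unfolding heat_div_power_eq[OF s] by (intro mult_left_mono) auto
qed

lemma heat_div_power_le_cut:
 fixes x :: "'a::euclidean_space"
 assumes "0 < ta" "ta \<le> s"
 shows "heat s x / s ^ k \<le> (4 * pi * ta) powr (- (real DIM('a) / 2)) / ta ^ k"
proof (rule frac_le)
 have "(4 * pi * s) powr (- (real DIM('a) / 2)) \<le> (4 * pi * ta) powr (- (real DIM('a) / 2))"
  using assms by (intro powr_mono2') auto
 then show "heat s x \<le> (4 * pi * ta) powr (- (real DIM('a) / 2))"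
  using heat_le[of s x] assms by linarith
qed (use assms in \<open>auto intro!: power_mono\<close>)

lemma integrable_exp_decay:
 assumes "0 < (ka::real)"
 shows "integrable lborel (\<lambda>s. indicator {0<..} s * exp (- ka\<^sup>2 * s))"
proof -
 let ?A = "\<lambda>s. exp (- ka\<^sup>2 * s)"
 have "?A integrable_on {0..}"
  using has_integral_exp_minus_to_infinity[of "ka\<^sup>2" 0] assms by (auto simp: has_integral_iff)
 then have "?A absolutely_integrable_on {0..}"
  by (intro nonnegative_absolutely_integrable_1) auto
 then have "set_integrable lborel {0..} ?A"
  unfolding set_integrable_def by (subst (asm) integrable_completion) auto
 then have "set_integrable lborel {0<..} ?A"
  by (rule set_integrable_subset) auto
 then show ?thesis unfolding set_integrable_def by simp
qed

text \<open>All kernels of the proof have the form below: the Yukawa kernel is \<open>hmix {0<..} ka 0\<close>, restricting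
 the set of times cuts it off at a length scale, and the index \<open>k\<close> counts differentiations.\<close>

definition hmix :: "real set \<Rightarrow> real \<Rightarrow> nat \<Rightarrow> 'a::euclidean_space \<Rightarrow> real" where
 "hmix A ka k x = (LINT s|lborel. indicator A s * exp (- ka\<^sup>2 * s) * (heat s x / s ^ k))"

text \<open>The gradient of \<open>hmix A ka 0\<close>, since \<open>heat s\<close> has gradient - x
  / (2 s) times itself. It is given by a formula so that it also makes sense at ka = 0, where in
  dimension 2 the mixture of index 0 over all times diverges.\<close>

definition gmix :: "real set \<Rightarrow> real \<Rightarrow> 'a::euclidean_space \<Rightarrow> 'a" where
 "gmix A ka x = - (hmix A ka 1 x / 2) *\<^sub>R x"

text \<open>The two situations in which, for ka > 0, a mixture converges and is smooth near x: x is
  away from the singularity, or the short times that create the singularity are cut off.\<close>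

definition hmix_at :: "real set \<Rightarrow> 'a::euclidean_space \<Rightarrow> bool" where
 "hmix_at A x \<longleftrightarrow> A \<in> sets borel \<and> A \<subseteq> {0<..} \<and> (x \<noteq> 0 \<or> (\<exists>ta>0. A \<subseteq> {ta<..}))"

lemma hmix_atI [intro]: "A \<in> sets borel \<Longrightarrow> A \<subseteq> {0<..} \<Longrightarrow> x \<noteq> 0 \<Longrightarrow> hmix_at A x"
 and hmix_atI_cut: "A \<in> sets borel \<Longrightarrow> A \<subseteq> {ta<..} \<Longrightarrow> 0 < ta \<Longrightarrow> hmix_at A x"
 unfolding hmix_at_def by (auto intro: less_trans)

lemma hmix_minus [simp]: "hmix A ka k (- x) = hmix A ka k x"
 by (simp add: hmix_def)

lemma gmix_minus [simp]: "gmix A ka (- x) = - gmix A ka x"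
 by (simp add: gmix_def)

lemma gmix_0 [simp]: "gmix A ka 0 = 0"
 by (simp add: gmix_def)

lemma hmix_nonneg [simp]: "A \<subseteq> {0<..} \<Longrightarrow> 0 \<le> hmix A ka k x"
 unfolding hmix_def
 by (intro Bochner_Integration.integral_nonneg) (auto split: split_indicator)

lemma borel_measurable_hmix [measurable (raw)]:
 fixes f :: "'w \<Rightarrow> 'a::euclidean_space"
 assumes [measurable]: "A \<in> sets borel" "f \<in> borel_measurable M"
 shows "(\<lambda>w. hmix A ka k (f w)) \<in> borel_measurable M"
 unfolding hmix_def by measurable

lemma borel_measurable_gmix [measurable (raw)]:
 fixes f :: "'w \<Rightarrow> 'a::euclidean_space"
 assumes [measurable]: "A \<in> sets borel" "f \<in> borel_measurable M"
 shows "(\<lambda>w. gmix A ka (f w)) \<in> borel_measurable M"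
 unfolding gmix_def by measurable

lemma heat_div_power_bounded_near:
 fixes x :: "'a::euclidean_space"
 assumes "hmix_at A x"
 obtains C e where "0 < e" "0 \<le> C" "\<And>y s. y \<in> ball x e \<Longrightarrow> s \<in> A \<Longrightarrow> heat s y / s ^ k \<le> C"
 using assms unfolding hmix_at_def
proof (elim conjE disjE exE)
 assume A: "A \<in> sets borel" "A \<subseteq> {0<..}" and x: "x \<noteq> 0"
 define r where "r = norm x / 2"
 have r: "r > 0" using x by (simp add: r_def)
 have "r \<le> norm y" if "y \<in> ball x r" for y
 proof -
  have "norm x - norm y \<le> norm (x - y)" by (rule norm_triangle_ineq2)
  then show ?thesis using that unfolding r_def by (auto simp: dist_norm)
 qed
 then show thesis
  using that[of r "(4 * pi) powr (- (real DIM('a) / 2)) * ((real DIM('a) / 2 + real k) / (r\<^sup>2 / 4)) powr (real DIM('a) / 2 + real k)"]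
   heat_div_power_le[OF _ r, of _ "_ :: 'a" k] A r by (auto simp: subset_iff)
next
 fix ta :: real assume A: "A \<in> sets borel" "A \<subseteq> {0<..}" "0 < ta" "A \<subseteq> {ta<..}"
 then show thesis
  using that[of 1 "(4 * pi * ta) powr (- (real DIM('a) / 2)) / ta ^ k"] heat_div_power_le_cut[of ta _ "_ :: 'a" k]
  by (auto simp: subset_iff less_imp_le)
qed

lemma hmix_integrable:
 fixes x :: "'a::euclidean_space"
 assumes A: "hmix_at A x" and ka: "0 < ka"
 shows "integrable lborel (\<lambda>s. indicator A s * exp (- ka\<^sup>2 * s) * (heat s x / s ^ k))"
proof -
 obtain C e where C: "0 < e" "0 \<le> C" "\<And>y s. y \<in> ball x e \<Longrightarrow> s \<in> A \<Longrightarrow> heat s y / s ^ k \<le> C"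
  using heat_div_power_bounded_near[OF A] by metis
 have [measurable]: "A \<in> sets borel" and A0: "A \<subseteq> {0<..}" using A by (auto simp: hmix_at_def)
 show ?thesis
 proof (rule Bochner_Integration.integrable_bound)
  show "integrable lborel (\<lambda>s. C * (indicator {0<..} s * exp (- ka\<^sup>2 * s)))"
   using integrable_exp_decay[OF ka] by simp
  show "AE s in lborel. norm (indicator A s * exp (- ka\<^sup>2 * s) * (heat s x / s ^ k)) \<le> norm (C * (indicator {0<..} s * exp (- ka\<^sup>2 * s)))"
  proof (intro AE_I2)
   fix s :: real
   show "norm (indicator A s * exp (- ka\<^sup>2 * s) * (heat s x / s ^ k)) \<le> norm (C * (indicator {0<..} s * exp (- ka\<^sup>2 * s)))"
   proof (cases "s \<in> A")
    case True
    then have "s > 0" "heat s x / s ^ k \<le> C" using A0 C(1) C(3)[of x s] by auto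
    then have "exp (- ka\<^sup>2 * s) * (heat s x / s ^ k) \<le> exp (- ka\<^sup>2 * s) * C"
     by (intro mult_left_mono) auto
    then show ?thesis using True \<open>s > 0\<close> C(2) by (simp add: mult.commute)
   qed auto
  qed
 qed measurable
qed

lemma hmix_le:
 assumes A: "hmix_at A x" and ka: "0 < ka" and B: "hmix_at B x" "B \<subseteq> A"
 shows "hmix B ka k x \<le> hmix A ka k x"
 unfolding hmix_def
 by (rule integral_mono[OF hmix_integrable[OF B(1) ka] hmix_integrable[OF A ka]])
  (use A B in \<open>auto simp: hmix_at_def subset_iff split: split_indicator\<close>)

lemma hmix_disjoint_Un:
 assumes A: "hmix_at A x" and B: "hmix_at B x" and ka: "0 < ka" and d: "A \<inter> B = {}"
 shows "hmix (A \<union> B) ka k x = hmix A ka k x + hmix B ka k x"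
 unfolding hmix_def
 by (subst Bochner_Integration.integral_add[symmetric, OF hmix_integrable[OF A ka] hmix_integrable[OF B ka]])
  (use d in \<open>auto simp: indicator_add[symmetric] algebra_simps intro!: Bochner_Integration.integral_cong split: split_indicator\<close>)

text \<open>Differentiating a heat kernel brings out - x / (2 s), which is why the index grows by
  one.\<close>

lemma hmix_has_derivative:
 fixes x :: "'a::euclidean_space"
 assumes A: "hmix_at A x" and ka: "0 < ka"
 shows "(hmix A ka k has_derivative (\<lambda>h. - (hmix A ka (Suc k) x / 2) * (x \<bullet> h))) (at x)"
proof -
 obtain C e where C: "0 < e" "0 \<le> C" "\<And>y s. y \<in> ball x e \<Longrightarrow> s \<in> A \<Longrightarrow> heat s y / s ^ Suc k \<le> C"
  using heat_div_power_bounded_near[OF A] by metis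
 have [measurable]: "A \<in> sets borel" and A0: "A \<subseteq> {0<..}" using A by (auto simp: hmix_at_def)
 \<comment> \<open>The ball has to stay where the mixture converges: for x \<noteq> 0 it must avoid
   the origin.\<close>
 obtain e' where e': "e' > 0" "e' \<le> e" "\<And>y. y \<in> ball x e' \<Longrightarrow> hmix_at A y"
 proof (cases "x = 0")
  case True
  then show ?thesis using A C that[of e] by (auto simp: hmix_at_def)
 next
  case False
  have "y \<noteq> 0" if "y \<in> ball x (min e (norm x))" for y using that by (auto simp: dist_norm)
  then show ?thesis using False A C that[of "min e (norm x)"] by (auto simp: hmix_at_def)
 qed
 let ?w = "\<lambda>s. indicator A s * exp (- ka\<^sup>2 * s)"
 let ?D = "\<lambda>y s h. ?w s * (- (y \<bullet> h) / (2 * s) * heat s y / s ^ k)"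
 have "((\<lambda>y. \<integral>s. ?w s * (heat s y / s ^ k) \<partial>lborel) has_derivative (\<lambda>h. \<integral>s. ?D x s h \<partial>lborel)) (at x within ball x e')"
 proof (rule has_derivative_lebesgue_integral[where B = "\<lambda>s. (norm x + e') / 2 * C * (indicator {0<..} s * exp (- ka\<^sup>2 * s))"])
  show "integrable lborel (\<lambda>s. ?w s * (heat s y / s ^ k))" if "y \<in> ball x e'" for y
   using e'(3)[OF that] ka by (rule hmix_integrable)
  show "((\<lambda>y. ?w s * (heat s y / s ^ k)) has_derivative ?D y s) (at y within ball x e')" for y s
  proof (cases "s \<in> A")
   case True
   then have "s > 0" using A0 by auto
   then show ?thesis by (auto intro!: derivative_eq_intros heat_has_derivative)
  qed simp
  show "norm (?D y s h) \<le> (norm x + e') / 2 * C * (indicator {0<..} s * exp (- ka\<^sup>2 * s)) * norm h"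
   if y: "y \<in> ball x e'" for y s h
  proof (cases "s \<in> A")
   case True
   then have s: "s > 0" using A0 by auto
   have ny: "norm y \<le> norm x + e'"
    using norm_triangle_ineq2[of y x] y by (auto simp: dist_norm norm_minus_commute)
   have "norm (?D y s h) = exp (- ka\<^sup>2 * s) * (\<bar>y \<bullet> h\<bar> * ((heat s y / s ^ Suc k) / 2))"
    using True s by (simp add: abs_mult)
   also have "\<dots> \<le> exp (- ka\<^sup>2 * s) * (((norm x + e') * norm h) * (C / 2))"
   proof (intro mult_left_mono mult_mono divide_right_mono)
    show "\<bar>y \<bullet> h\<bar> \<le> (norm x + e') * norm h"
     by (rule order_trans[OF Cauchy_Schwarz_ineq2]) (use ny in \<open>auto intro: mult_right_mono\<close>)
    show "heat s y / s ^ Suc k \<le> C" using C(3)[of y s] y e' True by auto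
   qed (use e' s in \<open>auto intro!: mult_nonneg_nonneg add_nonneg_nonneg\<close>)
   finally show ?thesis using s by (simp add: mult_ac)
  qed (use e' C in \<open>auto split: split_indicator intro!: mult_nonneg_nonneg add_nonneg_nonneg\<close>)
  show "integrable lborel (\<lambda>s. (norm x + e') / 2 * C * (indicator {0<..} s * exp (- ka\<^sup>2 * s)))"
   using integrable_exp_decay[OF ka] by simp
 qed (use e' in auto)
 moreover have "(LBINT s. ?D x s h) = - (hmix A ka (Suc k) x / 2) * (x \<bullet> h)" for h
 proof -
  have "(LBINT s. ?D x s h) = (LBINT s. - (x \<bullet> h) / 2 * (?w s * (heat s x / s ^ Suc k)))"
   by (intro Bochner_Integration.integral_cong refl) (simp add: mult_ac)
  also have "\<dots> = - (x \<bullet> h) / 2 * hmix A ka (Suc k) x"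
   unfolding hmix_def by (simp only: integral_mult_right_zero)
  finally show ?thesis by simp
 qed
 ultimately have "((\<lambda>y. hmix A ka k y) has_derivative (\<lambda>h. - (hmix A ka (Suc k) x / 2) * (x \<bullet> h))) (at x within ball x e')"
  unfolding hmix_def[of A ka k] by (simp only:)
 then show ?thesis using e' by (simp add: at_within_open[of x "ball x e'"])
qed

lemma hmix_has_derivative_gmix:
 assumes "hmix_at A x" "0 < ka"
 shows "(hmix A ka 0 has_derivative (\<lambda>h. gmix A ka x \<bullet> h)) (at x)"
 by (rule has_derivative_eq_rhs[OF hmix_has_derivative[OF assms]]) (simp add: gmix_def)

lemma gmix_has_derivative:
 assumes "hmix_at A x" "0 < ka"
 shows "(gmix A ka has_derivative (\<lambda>h. (hmix A ka 2 x / 4 * (x \<bullet> h)) *\<^sub>R x - (hmix A ka 1 x / 2) *\<^sub>R h)) (at x)"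
 unfolding gmix_def One_nat_def numeral_2_eq_2
 by (auto intro!: derivative_eq_intros hmix_has_derivative[OF assms] simp: fun_eq_iff)

section \<open>Identification of the mixtures with the Yukawa and Coulomb kernels\<close>

text \<open>The even part of exp (- \<nu> t) is cosh (\<nu> t) and the other factor is even, so the
  integral over the line is twice the integral over the half-line.\<close>

lemma bessel_K_eq_integral_UNIV:
 fixes \<nu> z :: real
 assumes int: "integrable lborel (\<lambda>t. exp (- z * cosh t) * exp (- \<nu> * t))"
 shows "bessel_K \<nu> z = (LBINT t. exp (- z * cosh t) * exp (- \<nu> * t)) / 2"
proof -
 let ?h = "\<lambda>t::real. exp (- z * cosh t) * exp (- \<nu> * t)"
 let ?k = "\<lambda>t::real. exp (- z * cosh t) * cosh (\<nu> * t)"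
 have int': "integrable lborel (\<lambda>t. ?h (- t))"
  using lborel_integrable_real_affine[OF int, of "-1" 0] by simp
 have refl: "(LBINT t. f (- t)) = (LBINT t. f t)" for f :: "real \<Rightarrow> real"
  using lborel_integral_real_affine[of "-1" f 0] by simp
 have k: "?k t = (?h t + ?h (- t)) / 2" for t
  by (simp add: cosh_field_def[of "\<nu> * t"] algebra_simps add_divide_distrib)
 have ki: "integrable lborel ?k" unfolding k using int int' by simp
 have "(LBINT t. ?h t) = (LBINT t. ?k t)"
  unfolding k using int int' refl[of ?h] by simp
 also have "\<dots> = (LBINT t. indicator {0..} t * ?k t + indicator {..<0} t * ?k t)"
  by (intro Bochner_Integration.integral_cong) (auto split: split_indicator)
 also have "\<dots> = (LBINT t. indicator {0..} t * ?k t) + (LBINT t. indicator {..<0} t * ?k t)"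
  using ki by (intro Bochner_Integration.integral_add integrable_mult_indicator[where 'b=real, simplified]) auto
 also have "(LBINT t. indicator {..<0} t * ?k t) = (LBINT t. indicator {..<0} (- t) * ?k (- t))"
  by (rule refl[symmetric])
 also have "\<dots> = (LBINT t. indicator {0..} t * ?k t)"
 proof (rule integral_cong_AE)
  have [measurable]: "(cosh :: real \<Rightarrow> real) \<in> borel_measurable borel"
   by (intro borel_measurable_continuous_onI continuous_intros)
  show "(\<lambda>t. indicator {..<0} (- t) * ?k (- t)) \<in> borel_measurable lborel"
   and "(\<lambda>t. indicator {0..} t * ?k t) \<in> borel_measurable lborel" by measurable
  have "AE t::real in lborel. t \<noteq> 0" by (rule AE_lborel_singleton)
  then show "AE t in lborel. indicator {..<0} (- t) * ?k (- t) = indicator {0..} t * ?k t"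
   by eventually_elim (auto split: split_indicator)
 qed
 finally show ?thesis unfolding bessel_K_def set_lebesgue_integral_def by simp
qed

text \<open>Substitute s = c exp t with c = norm x / (2 ka). Then \<open>ka\<^sup>2 * s + (norm
  x)\<^sup>2 / (4 * s) = ka * norm x * cosh t\<close>, and the mixture turns into the integral
  representation of the Bessel function.\<close>

lemma kernel_eq_hmix:
 fixes x :: "'a::euclidean_space"
 assumes ka: "0 < ka" and x: "x \<noteq> 0"
 shows "kernel ka x = hmix {0<..} ka 0 x"
proof -
 define r c e \<nu> where "r = norm x" and "c = r / (2 * ka)" and "e = real DIM('a) / 2" and "\<nu> = e - 1"
 have r: "r > 0" and c: "c > 0" using x ka by (auto simp: r_def c_def)
 let ?f = "\<lambda>s. exp (- ka\<^sup>2 * s) * heat s x"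
 let ?g = "\<lambda>t. c * exp t"
 let ?h = "\<lambda>t::real. exp (- (ka * r) * cosh t) * exp (- \<nu> * t)"
 have img: "range ?g = {0<..}"
 proof
  show "{0<..} \<subseteq> range ?g"
  proof
   fix y :: real assume "y \<in> {0<..}"
   then show "y \<in> range ?g" using c by (intro image_eqI[of _ _ "ln (y / c)"]) auto
  qed
 qed (use c in auto)
 have fi: "set_integrable lborel {0<..} ?f"
  using hmix_integrable[of "{0<..}" x ka 0] x ka unfolding set_integrable_def
  by (simp add: hmix_atI mult.assoc)
 have eq: "\<bar>?g t\<bar> * ?f (?g t) = ((4 * pi) powr (- e) * c powr (- \<nu>)) * ?h t" for t
 proof -
  have 1: "ka\<^sup>2 * (c * exp t) + r\<^sup>2 / (4 * (c * exp t)) = ka * r * cosh t"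
   unfolding c_def cosh_field_def using r ka
   by (simp add: field_simps power2_eq_square exp_minus)
  have 2: "(4 * pi * (c * exp t)) powr (- e) = (4 * pi) powr (- e) * (c powr (- e) * exp (- e * t))"
   by (simp only: powr_mult) (simp add: powr_def)
  have 3: "c * c powr (- e) = c powr (- \<nu>)"
   unfolding \<nu>_def using c by (simp add: powr_diff powr_minus divide_inverse)
  have 4: "exp t * exp (- e * t) = exp (- \<nu> * t)" unfolding \<nu>_def by (simp add: exp_add[symmetric] algebra_simps)
  have 5: "exp (- ka\<^sup>2 * ?g t) * exp (- r\<^sup>2 / (4 * ?g t)) = exp (- (ka * r) * cosh t)"
   unfolding exp_add[symmetric] using 1 by simp
  have "\<bar>?g t\<bar> * ?f (?g t) = (c * exp t) * (exp (- ka\<^sup>2 * ?g t) * exp (- r\<^sup>2 / (4 * ?g t))) * (4 * pi * (c * exp t)) powr (- e)"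
   unfolding heat_def r_def[symmetric] e_def[symmetric] using c by (simp add: mult_ac)
  also have "\<dots> = ((4 * pi) powr (- e) * (c * c powr (- e))) * (exp (- (ka * r) * cosh t) * (exp t * exp (- e * t)))"
   unfolding 5 2 by (simp only: mult_ac)
  finally show ?thesis unfolding 3 4 .
 qed
 have m1: "set_borel_measurable borel UNIV (\<lambda>t. \<bar>?g t\<bar> * ?f (?g t))"
  unfolding set_borel_measurable_def by measurable
 have m2: "set_borel_measurable borel (range ?g) ?f"
  unfolding set_borel_measurable_def img by measurable
 have d: "(?g has_real_derivative ?g t) (at t)" for t by (auto intro!: derivative_eq_intros)
 have inj: "inj ?g" using c by (auto simp: inj_on_def)
 note sub = set_integral_substitution_real[of UNIV ?g ?g ?f, OF _ _ d inj m1 m2, unfolded img]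
 have C: "(4 * pi) powr (- e) * c powr (- \<nu>) \<noteq> 0" using c by simp
 have "set_integrable lborel UNIV (\<lambda>t. \<bar>?g t\<bar> * ?f (?g t))" using sub(1) fi by simp
 then have hi: "integrable lborel ?h" unfolding eq set_integrable_def using C by simp
 have "hmix {0<..} ka 0 x = (LBINT s:{0<..}. ?f s)"
  unfolding hmix_def set_lebesgue_integral_def by (simp add: mult.assoc)
 also have "\<dots> = (LBINT t:UNIV. \<bar>?g t\<bar> * ?f (?g t))" using sub(2) fi by simp
 also have "\<dots> = ((4 * pi) powr (- e) * c powr (- \<nu>)) * (LBINT t. ?h t)"
  unfolding eq set_lebesgue_integral_def by simp
 also have "(LBINT t. ?h t) = 2 * bessel_K \<nu> (ka * r)"
  using bessel_K_eq_integral_UNIV[OF hi] by simp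
 also have "(4 * pi) powr (- e) * c powr (- \<nu>) * (2 * bessel_K \<nu> (ka * r)) =
   (2 * pi) powr (- e) * (ka / r) powr \<nu> * bessel_K \<nu> (ka * r)"
 proof -
  have "4 * pi = 2 * (2 * pi)" by simp
  then have 1: "(4 * pi) powr (- e) = 2 powr (- e) * (2 * pi) powr (- e)" by (simp only: powr_mult)
  have "1 / c = 2 * (ka / r)" unfolding c_def by simp
  moreover have "c powr (- \<nu>) = (1 / c) powr \<nu>" using c by (simp add: powr_minus_divide powr_divide)
  ultimately have 2: "c powr (- \<nu>) = 2 powr \<nu> * (ka / r) powr \<nu>" by (simp only: powr_mult)
  have 3: "2 powr (- e) * 2 powr \<nu> * 2 = (1::real)"
   unfolding \<nu>_def by (simp add: powr_diff powr_minus)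
  have "(4 * pi) powr (- e) * c powr (- \<nu>) * (2 * bessel_K \<nu> (ka * r)) =
   (2 powr (- e) * 2 powr \<nu> * 2) * ((2 * pi) powr (- e) * (ka / r) powr \<nu> * bessel_K \<nu> (ka * r))"
   unfolding 1 2 by (simp only: mult_ac)
  then show ?thesis unfolding 3 by simp
 qed
 also have "\<dots> = kernel ka x"
  unfolding kernel_def Let_def using ka by (simp add: e_def \<nu>_def r_def)
 finally show ?thesis by simp
qed

lemma gradient_eqI:
 assumes "(f has_derivative (\<lambda>h. v \<bullet> h)) (at x)"
 shows "gradient f x = v"
 unfolding gradient_def frechet_derivative_at[OF assms, symmetric] by (rule euclidean_representation)

lemma gradient_kernel_pos:
 fixes x :: "'a::euclidean_space"
 assumes ka: "0 < ka" and x: "x \<noteq> 0"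
 shows "gradient (kernel ka) x = gmix {0<..} ka x"
  and "(kernel ka has_derivative (\<lambda>h. gmix {0<..} ka x \<bullet> h)) (at x)"
proof -
 let ?A = "\<lambda>h. gmix {0<..} ka x \<bullet> h"
 show "(kernel ka has_derivative ?A) (at x)"
 proof (rule has_derivative_transform_within_open)
  show "(hmix {0<..} ka 0 has_derivative ?A) (at x)"
   using x ka by (intro hmix_has_derivative_gmix hmix_atI) auto
  show "open (- {0 :: 'a})" by (intro open_Compl closed_singleton)
 qed (use x ka in \<open>auto simp: kernel_eq_hmix\<close>)
 then show "gradient (kernel ka) x = gmix {0<..} ka x" by (rule gradient_eqI)
qed

lemma norm_powr_has_derivative:
 fixes x :: "'a::euclidean_space"
 assumes "x \<noteq> 0"
 shows "((\<lambda>x. norm x powr a) has_derivative (\<lambda>h. (a * norm x powr (a - 2) * (x \<bullet> h)))) (at x)"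
  and "((\<lambda>x. ln (norm x)) has_derivative (\<lambda>h. norm x powr (- 2) * (x \<bullet> h))) (at x)"
proof -
 have p: "x \<bullet> x > 0" using assms by simp
 have d: "((\<lambda>x. x \<bullet> x) has_derivative (\<lambda>h. 2 * (x \<bullet> h))) (at x)"
  by (rule has_derivative_eq_rhs[OF has_derivative_inner[OF has_derivative_ident has_derivative_ident]])
   (simp add: inner_commute)
 have n2: "x \<bullet> x = norm x powr 2" using assms by (simp add: power2_norm_eq_inner)
 have e: "norm x powr b = (x \<bullet> x) powr (b / 2)" for b and x :: 'a
  by (cases "x = 0") (auto simp: norm_eq_sqrt_inner powr_half_sqrt[symmetric] powr_powr)
 have "((\<lambda>x. (x \<bullet> x) powr (a / 2)) has_derivative (\<lambda>h. (a / 2) * (x \<bullet> x) powr (a / 2 - 1) * (2 * (x \<bullet> h)))) (at x)"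
  by (rule has_derivative_eq_rhs[OF DERIV_compose_FDERIV[OF has_real_derivative_powr[OF p, of "a / 2"] d]]) (simp add: mult_ac)
 then show "((\<lambda>x. norm x powr a) has_derivative (\<lambda>h. (a * norm x powr (a - 2) * (x \<bullet> h)))) (at x)"
  unfolding e by (simp add: diff_divide_distrib mult_ac)
 have l: "ln (norm x) = ln (x \<bullet> x) / 2" for x :: 'a
  by (cases "x = 0") (auto simp: norm_eq_sqrt_inner ln_sqrt)
 have "((\<lambda>x. ln (x \<bullet> x)) has_derivative (\<lambda>h. inverse (x \<bullet> x) * (2 * (x \<bullet> h)))) (at x)"
  by (rule has_derivative_eq_rhs[OF DERIV_compose_FDERIV[OF DERIV_ln[OF p] d]]) (simp add: fun_eq_iff)
 from has_derivative_mult_right[OF this, of "1 / 2"]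
 show "((\<lambda>x. ln (norm x)) has_derivative (\<lambda>h. norm x powr (- 2) * (x \<bullet> h))) (at x)"
  unfolding l powr_minus n2 by simp
qed

text \<open>At ka = 0 only index 1 is evaluated. In dimension 2 the mixture of index 0 diverges at
  large times, but the gradient needs index 1, where one more power of 1 / s is available.\<close>

lemma hmix_coulomb:
 fixes x :: "'a::euclidean_space"
 assumes x: "x \<noteq> 0"
 shows "integrable lborel (\<lambda>s. indicator {0<..} s * exp (- 0\<^sup>2 * s) * (heat s x / s ^ 1))"
  and "hmix {0<..} 0 1 x / 2 = norm x powr (- real DIM('a)) / (real DIM('a) * unit_ball_vol (real DIM('a)))"
proof -
 define e where "e = real DIM('a) / 2"
 have e: "e > 0" by (simp add: e_def)
 have b: "0 < (norm x)\<^sup>2 / 4" using x by simp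
 note G = Gamma_integral_inverse[OF e b]
 have eq: "indicator {0<..} s * exp (- 0\<^sup>2 * s) * (heat s x / s ^ 1) =
  (4 * pi) powr (- e) * (indicator {0<..} s *\<^sub>R (s powr (- e - 1) * exp (- ((norm x)\<^sup>2 / 4) / s)))" for s
  using heat_div_power_eq[of s x 1] by (auto simp: e_def split: split_indicator)
 show "integrable lborel (\<lambda>s. indicator {0<..} s * exp (- 0\<^sup>2 * s) * (heat s x / s ^ 1))"
  unfolding eq using G(1) unfolding set_integrable_def by simp
 have "hmix {0<..} 0 1 x = (4 * pi) powr (- e) * (Gamma e / ((norm x)\<^sup>2 / 4) powr e)"
  unfolding hmix_def eq using G(2) unfolding set_lebesgue_integral_def by simp
 also have "\<dots> = pi powr (- e) * Gamma e * norm x powr (- real DIM('a))"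
 proof -
  have "(norm x)\<^sup>2 = norm x powr 2" using x by simp
  then have "((norm x)\<^sup>2) powr e = norm x powr (2 * e)" by (simp only: powr_powr)
  then have "((norm x)\<^sup>2) powr e = norm x powr (real DIM('a))" by (simp add: e_def)
  then have 1: "((norm x)\<^sup>2 / 4) powr e = norm x powr (real DIM('a)) / 4 powr e"
   by (simp only: powr_divide)
  have 2: "(4 * pi) powr (- e) = pi powr (- e) / 4 powr e"
   by (simp only: powr_mult) (simp add: powr_minus_divide)
  have 3: "norm x powr (- real DIM('a)) = 1 / norm x powr (real DIM('a))"
   by (rule powr_minus_divide)
  show ?thesis unfolding 1 2 3 by simp
 qed
 finally have h: "hmix {0<..} 0 1 x = pi powr (- e) * Gamma e * norm x powr (- real DIM('a))" .
 have "Gamma (e + 1) = e * Gamma e" using e by (intro Gamma_plus1) (auto simp: nonpos_Ints_def)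
 then have "unit_ball_vol (real DIM('a)) = pi powr e / (e * Gamma e)"
  unfolding unit_ball_vol_def e_def[symmetric] by (simp only:)
 then have "real DIM('a) * unit_ball_vol (real DIM('a)) = 2 * e * (pi powr e / (e * Gamma e))"
  by (simp add: e_def)
 also have "\<dots> = 2 * (pi powr e / Gamma e)" using e by simp
 also have "\<dots> = 2 / (pi powr (- e) * Gamma e)"
  by (simp add: powr_minus_divide)
 finally have "real DIM('a) * unit_ball_vol (real DIM('a)) = 2 / (pi powr (- e) * Gamma e)" .
 then show "hmix {0<..} 0 1 x / 2 = norm x powr (- real DIM('a)) / (real DIM('a) * unit_ball_vol (real DIM('a)))"
  unfolding h by (simp add: field_simps)
qed

text \<open>The logarithmic kernel of dimension 2 is no convergent heat mixture, so the identity is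
  proved for gradients, from the closed form in \<open>hmix_coulomb\<close>.\<close>

lemma gradient_kernel_0:
 fixes x :: "'a::euclidean_space"
 assumes d: "2 \<le> DIM('a)" and x: "x \<noteq> 0"
 shows "gradient (kernel 0) x = gmix {0<..} 0 x"
proof (rule gradient_eqI)
 let ?V = "real DIM('a) * unit_ball_vol (real DIM('a))"
 have g: "gmix {0<..} 0 x \<bullet> h = - (norm x powr (- real DIM('a)) / ?V) * (x \<bullet> h)" for h
  unfolding gmix_def hmix_coulomb(2)[OF x, simplified] by (simp add: hmix_coulomb(2)[OF x, simplified])
 have V: "?V > 0" by simp
 show "(kernel 0 has_derivative (\<lambda>h. gmix {0<..} 0 x \<bullet> h)) (at x)"
 proof (cases "DIM('a) = 2")
  case True
  have "?V = 2 * pi" using True by (simp add: unit_ball_vol_def Gamma_numeral)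
  have k: "kernel 0 = (\<lambda>x::'a. - (1 / (2 * pi)) * ln (norm x) + (ln 2 - euler_mascheroni) / (2 * pi))"
   using True by (simp add: fun_eq_iff kernel_def)
  show ?thesis unfolding k g \<open>?V = 2 * pi\<close>
   by (rule has_derivative_eq_rhs[OF has_derivative_add[OF has_derivative_mult_right[OF norm_powr_has_derivative(2)[OF x]] has_derivative_const]])
    (simp add: True)
 next
  case False
  then have "real DIM('a) \<noteq> 2" using of_nat_eq_iff by fastforce
  have k: "kernel 0 = (\<lambda>x::'a. 1 / ((real DIM('a) - 2) * ?V) * norm x powr (2 - real DIM('a)))"
   using False by (simp add: fun_eq_iff kernel_def Let_def)
  show ?thesis unfolding k g
   by (rule has_derivative_eq_rhs[OF has_derivative_mult_right[OF norm_powr_has_derivative(1)[OF x]]])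
    (use \<open>real DIM('a) \<noteq> 2\<close> V in \<open>simp add: fun_eq_iff divide_simps\<close>, simp add: algebra_simps)
 qed
qed

section \<open>Screened Poisson equation and semigroup law for the cut kernels\<close>

text \<open>The left-hand side is ka^2 minus the Laplacian applied to the cut kernel, written out by
  means of \<open>gmix_has_derivative\<close>. By the heat equation its integrand is the
  s-derivative of \<open>- (exp (- ka\<^sup>2 * s) * heat s x)\<close>, so only the boundary value
  at \<open>ta\<close> survives.\<close>

lemma hmix_screened_poisson:
 fixes x :: "'a::euclidean_space"
 assumes ka: "0 < ka" and ta: "0 < ta"
 shows "ka\<^sup>2 * hmix {ta<..} ka 0 x + real DIM('a) / 2 * hmix {ta<..} ka 1 x - (norm x)\<^sup>2 / 4 * hmix {ta<..} ka 2 x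
  = exp (- ka\<^sup>2 * ta) * heat ta x"
proof -
 let ?w = "\<lambda>s. indicator {ta<..} s * exp (- ka\<^sup>2 * s)"
 let ?F = "\<lambda>s. - (exp (- ka\<^sup>2 * s) * heat s x)"
 let ?f = "\<lambda>s. exp (- ka\<^sup>2 * s) * (ka\<^sup>2 * heat s x - ((norm x)\<^sup>2 / (4 * s\<^sup>2) - real DIM('a) / (2 * s)) * heat s x)"
 have at: "hmix_at {ta<..} x" using ta by (intro hmix_atI_cut[of _ ta]) auto
 note int = hmix_integrable[OF at ka]
 have eq: "indicator {ta<..} s *\<^sub>R ?f s = ka\<^sup>2 * (?w s * (heat s x / s ^ 0)) + real DIM('a) / 2 * (?w s * (heat s x / s ^ 1))
   - (norm x)\<^sup>2 / 4 * (?w s * (heat s x / s ^ 2))" for s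
  using ta by (auto split: split_indicator simp: field_simps)
 have i: "set_integrable lborel {ta<..} ?f"
  unfolding set_integrable_def eq
  by (intro Bochner_Integration.integrable_add Bochner_Integration.integrable_diff integrable_mult_right int)
 have D: "(?F has_real_derivative ?f s) (at s)" if "ta < s" for s
  using that ta by (auto intro!: derivative_eq_intros heat_has_time_derivative simp: algebra_simps)
 have hc: "isCont (\<lambda>s. heat s x) s" if "0 < s" for s
  using heat_has_time_derivative[OF that] by (rule DERIV_isCont)
 have "(LBINT s=ereal ta..\<infinity>. ?f s) = 0 - ?F ta"
 proof (rule interval_integral_FTC_integrable)
  show "(?F has_vector_derivative ?f s) (at s)" if "ereal ta < ereal s" for s
   using D[of s] that by (simp add: has_real_derivative_iff_has_vector_derivative)
  show "isCont ?f s" if "ereal ta < ereal s" for s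
   using that ta hc[of s] by (intro continuous_intros) auto
  show "set_integrable lborel (einterval (ereal ta) \<infinity>) ?f"
   using i by (simp add: einterval_eq)
  have "(?F \<longlongrightarrow> ?F ta) (at_right ta)"
   using hc[OF ta] ta by (intro tendsto_intros) (auto simp: isCont_def intro: filterlim_mono at_le)
  then show "((?F \<circ> real_of_ereal) \<longlongrightarrow> ?F ta) (at_right (ereal ta))"
   by (simp add: ereal_tendsto_simps)
  have "(?F \<longlongrightarrow> 0) at_top"
  proof (rule Lim_null_comparison)
   show "\<forall>\<^sub>F s in at_top. norm (?F s) \<le> exp (- ka\<^sup>2 * s) * (4 * pi * ta) powr (- (real DIM('a) / 2))"
    using eventually_ge_at_top[of ta]
   proof eventually_elim
    case (elim s)
    then have "heat s x \<le> (4 * pi * ta) powr (- (real DIM('a) / 2))"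
     using heat_div_power_le_cut[OF ta, of s x 0] by simp
    then show ?case by (simp add: abs_mult)
   qed
   have "((\<lambda>s. exp (- ka\<^sup>2 * s)) \<longlongrightarrow> 0) at_top"
    using ka by (intro filterlim_compose[OF exp_at_bot] filterlim_tendsto_neg_mult_at_bot[OF tendsto_const])
     (auto intro: filterlim_ident)
   then show "((\<lambda>s. exp (- ka\<^sup>2 * s) * (4 * pi * ta) powr (- (real DIM('a) / 2))) \<longlongrightarrow> 0) at_top"
    by (rule tendsto_mult_left_zero)
  qed
  then show "((?F \<circ> real_of_ereal) \<longlongrightarrow> 0) (at_left \<infinity>)"
   by (simp add: ereal_tendsto_simps)
 qed auto
 then have "(LBINT s:{ta<..}. ?f s) = exp (- ka\<^sup>2 * ta) * heat ta x"
  by (simp add: interval_integral_to_infinity_eq)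
 moreover have "(LBINT s:{ta<..}. ?f s) = ka\<^sup>2 * hmix {ta<..} ka 0 x + real DIM('a) / 2 * hmix {ta<..} ka 1 x - (norm x)\<^sup>2 / 4 * hmix {ta<..} ka 2 x"
 proof -
  have i0: "integrable lborel (\<lambda>s. ka\<^sup>2 * (?w s * (heat s x / s ^ 0)))"
   and i1: "integrable lborel (\<lambda>s. real DIM('a) / 2 * (?w s * (heat s x / s ^ 1)))"
   and i2: "integrable lborel (\<lambda>s. (norm x)\<^sup>2 / 4 * (?w s * (heat s x / s ^ 2)))"
   by (intro integrable_mult_right int)+
  show ?thesis
   unfolding set_lebesgue_integral_def eq hmix_def
   by (simp only: Bochner_Integration.integral_diff[OF Bochner_Integration.integrable_add[OF i0 i1] i2]
     Bochner_Integration.integral_add[OF i0 i1] integral_mult_right_zero)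
 qed
 ultimately show ?thesis by simp
qed

text \<open>The semigroup law shifts every heat time of the mixture by \<open>ta\<close>, and the
  factor \<open>exp (- ka\<^sup>2 * ta)\<close> supplies the screening weight of the shifted
  time.\<close>

lemma hmix_convolution:
 fixes x y :: "'a::euclidean_space"
 assumes ka: "0 < ka" and ta: "0 < ta" and \<sigma>: "0 < \<sigma>"
 shows "(LBINT z. (exp (- ka\<^sup>2 * ta) * heat ta (x - z)) * hmix {\<sigma><..} ka 0 (z - y)) = hmix {\<sigma> + ta<..} ka 0 (x - y)"
proof -
 let ?w = "\<lambda>s. indicator {\<sigma><..} s * exp (- ka\<^sup>2 * (s + ta))"
 define F where "F = (\<lambda>(z::'a, s). ?w s * (heat ta (x - z) * heat s (z - y)))"
 have [measurable]: "F \<in> borel_measurable (lborel \<Otimes>\<^sub>M lborel)" unfolding F_def by measurable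
 have at: "hmix_at {\<sigma> + ta<..} (x - y)" using ta \<sigma> by (intro hmix_atI_cut[of _ "\<sigma> + ta"]) auto
 have sh: "?w s * heat (s + ta) (x - y) = (\<lambda>s. indicator {\<sigma> + ta<..} s * exp (- ka\<^sup>2 * s) * (heat s (x - y) / s ^ 0)) (s + ta)" for s
  by (auto split: split_indicator)
 have int: "integrable lborel (\<lambda>s. ?w s * heat (s + ta) (x - y))"
  unfolding sh by (rule integrable_lborel_shift[OF hmix_integrable[OF at ka]])
 have inner: "(LBINT z. F (z, s)) = ?w s * heat (s + ta) (x - y)"
  "(\<integral>\<^sup>+z. ennreal (norm (F (z, s))) \<partial>lborel) = ennreal (?w s * heat (s + ta) (x - y))" for s
 proof -
  have "(LBINT z. F (z, s)) = ?w s * heat (s + ta) (x - y) \<and> (\<integral>\<^sup>+z. ennreal (norm (F (z, s))) \<partial>lborel) = ennreal (?w s * heat (s + ta) (x - y))"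
  proof (cases "\<sigma> < s")
   case True
   then have "0 < s" using \<sigma> by simp
   from integral_heat_mult_heat(1,3)[OF ta this, of x y] True show ?thesis
    unfolding F_def by (simp add: abs_mult ennreal_mult' nn_integral_cmult add.commute)
  qed (simp add: F_def)
  then show "(LBINT z. F (z, s)) = ?w s * heat (s + ta) (x - y)"
   "(\<integral>\<^sup>+z. ennreal (norm (F (z, s))) \<partial>lborel) = ennreal (?w s * heat (s + ta) (x - y))" by auto
 qed
 have Fi: "integrable (lborel \<Otimes>\<^sub>M lborel) F"
 proof (rule integrableI_bounded)
  have "(\<integral>\<^sup>+p. ennreal (norm (F p)) \<partial>(lborel \<Otimes>\<^sub>M lborel)) = (\<integral>\<^sup>+s. \<integral>\<^sup>+z. ennreal (norm (F (z, s))) \<partial>lborel \<partial>lborel)"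
   by (rule lborel_pair.nn_integral_snd[symmetric, simplified]) simp
  also have "\<dots> < \<infinity>"
   unfolding inner using int by (auto simp: integrable_iff_bounded abs_mult)
  finally show "(\<integral>\<^sup>+p. ennreal (norm (F p)) \<partial>(lborel \<Otimes>\<^sub>M lborel)) < \<infinity>" .
 qed simp
 have "(LBINT z. (exp (- ka\<^sup>2 * ta) * heat ta (x - z)) * hmix {\<sigma><..} ka 0 (z - y)) = (LBINT z. (LBINT s. F (z, s)))"
 proof (rule Bochner_Integration.integral_cong[OF refl])
  fix z
  have "F (z, s) = (exp (- ka\<^sup>2 * ta) * heat ta (x - z)) * (indicator {\<sigma><..} s * exp (- ka\<^sup>2 * s) * (heat s (z - y) / s ^ 0))" for s
  proof -
   have "exp (- ka\<^sup>2 * (s + ta)) = exp (- ka\<^sup>2 * ta) * exp (- ka\<^sup>2 * s)"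
    by (simp add: algebra_simps flip: exp_add)
   then show ?thesis unfolding F_def by simp
  qed
  then show "(exp (- ka\<^sup>2 * ta) * heat ta (x - z)) * hmix {\<sigma><..} ka 0 (z - y) = (LBINT s. F (z, s))"
   unfolding hmix_def by (simp only: integral_mult_right_zero)
 qed
 also have "\<dots> = (LBINT s. (LBINT z. F (z, s)))"
  using lborel_pair.Fubini_integral[of "\<lambda>x s. F (x, s)"] Fi by (simp add: case_prod_eta)
 also have "\<dots> = hmix {\<sigma> + ta<..} ka 0 (x - y)"
  unfolding inner sh hmix_def by (rule lborel_integral_shift) simp
 finally show ?thesis .
qed

lemma nn_integral_hmix_le:
 fixes A :: "real set"
 assumes A: "A \<in> sets borel" "A \<subseteq> {0<..}"
 shows "(\<integral>\<^sup>+x. ennreal (hmix A ka k (x - (y::'a::euclidean_space))) \<partial>lborel) \<le> (\<integral>\<^sup>+s. ennreal (indicator A s * exp (- ka\<^sup>2 * s) / s ^ k) \<partial>lborel)"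
proof -
 have [measurable]: "A \<in> sets borel" by fact
 let ?F = "\<lambda>(x::'a) s. ennreal (indicator A s * exp (- ka\<^sup>2 * s) * (heat s (x - y) / s ^ k))"
 have "ennreal (hmix A ka k (x - y)) \<le> (\<integral>\<^sup>+s. ?F x s \<partial>lborel)" for x
 proof (cases "integrable lborel (\<lambda>s. indicator A s * exp (- ka\<^sup>2 * s) * (heat s (x - y) / s ^ k))")
  case True
  have "0 \<le> indicator A s * exp (- ka\<^sup>2 * s) * (heat s (x - y) / s ^ k)" for s
   using A(2) by (auto split: split_indicator)
  from nn_integral_eq_integral[OF True AE_I2[OF this]] show ?thesis unfolding hmix_def by simp
 qed (simp add: hmix_def not_integrable_integral_eq)
 then have "(\<integral>\<^sup>+x. ennreal (hmix A ka k (x - y)) \<partial>lborel) \<le> (\<integral>\<^sup>+x. \<integral>\<^sup>+s. ?F x s \<partial>lborel \<partial>lborel)"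
  by (intro nn_integral_mono)
 also have "\<dots> = (\<integral>\<^sup>+s. \<integral>\<^sup>+x. ?F x s \<partial>lborel \<partial>lborel)"
  by (rule lborel_pair.Fubini'[symmetric]) measurable
 also have "\<dots> = (\<integral>\<^sup>+s. ennreal (indicator A s * exp (- ka\<^sup>2 * s) / s ^ k) \<partial>lborel)"
 proof (rule nn_integral_cong)
  fix s
  show "(\<integral>\<^sup>+x. ?F x s \<partial>lborel) = ennreal (indicator A s * exp (- ka\<^sup>2 * s) / s ^ k)"
  proof (cases "s \<in> A")
   case True
   then have s: "0 < s" using A(2) by auto
   have "(\<integral>\<^sup>+x. ?F x s \<partial>lborel) = (\<integral>\<^sup>+x. ennreal (exp (- ka\<^sup>2 * s) / s ^ k) * ennreal (heat s (x - y)) \<partial>lborel)"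
    using True s by (intro nn_integral_cong) (simp add: ennreal_mult[symmetric])
   then show ?thesis using True by (simp add: nn_integral_cmult nn_integral_heat_diff[OF s])
  qed simp
 qed
 finally show ?thesis .
qed

lemma integrable_hmix:
 assumes A: "A \<in> sets borel" "A \<subseteq> {0<..}" and ka: "0 < ka"
 shows "integrable lborel (\<lambda>x. hmix A ka 0 (x - (y::'a::euclidean_space)))"
proof (rule integrableI_bounded)
 have [measurable]: "A \<in> sets borel" by fact
 show "(\<lambda>x. hmix A ka 0 (x - y)) \<in> borel_measurable lborel" by measurable
 have "(\<integral>\<^sup>+x. ennreal (norm (hmix A ka 0 (x - y))) \<partial>lborel) \<le> (\<integral>\<^sup>+s. ennreal (indicator A s * exp (- ka\<^sup>2 * s) / s ^ 0) \<partial>lborel)"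
  using nn_integral_hmix_le[OF A, where k=0] A by simp
 also have "\<dots> \<le> (\<integral>\<^sup>+s. ennreal (norm (indicator {0<..} s * exp (- ka\<^sup>2 * s))) \<partial>lborel)"
  by (intro nn_integral_mono) (use A in \<open>auto split: split_indicator\<close>)
 also have "\<dots> < \<infinity>" using integrable_exp_decay[OF ka] by (simp add: integrable_iff_bounded)
 finally show "(\<integral>\<^sup>+x. ennreal (norm (hmix A ka 0 (x - y))) \<partial>lborel) < \<infinity>" .
qed

section \<open>Stress tensor and commutator estimate\<close>

lemma borel_measurable_differentiable:
 fixes u :: "'a::euclidean_space \<Rightarrow> 'b::euclidean_space"
 assumes "\<And>z. (u has_derivative u' z) (at z)"
 shows "u \<in> borel_measurable borel"
proof (rule borel_measurable_continuous_onI)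
 show "continuous_on UNIV u"
  by (rule continuous_at_imp_continuous_on) (use has_derivative_continuous[OF assms] in blast)
qed

text \<open>The derivative need not be continuous, but it is the pointwise limit of measurable
  difference quotients.\<close>

lemma borel_measurable_has_derivative:
 fixes u :: "'a::euclidean_space \<Rightarrow> 'b::euclidean_space"
 assumes "\<And>z. (u has_derivative u' z) (at z)"
 shows "(\<lambda>z. u' z b) \<in> borel_measurable borel"
proof (rule borel_measurable_LIMSEQ_metric)
 have [measurable]: "u \<in> borel_measurable borel" using assms by (rule borel_measurable_differentiable)
 show "(\<lambda>z. real (Suc n) *\<^sub>R (u (z + (1 / real (Suc n)) *\<^sub>R b) - u z)) \<in> borel_measurable borel" for n
  by measurable
 show "(\<lambda>n. real (Suc n) *\<^sub>R (u (z + (1 / real (Suc n)) *\<^sub>R b) - u z)) \<longlonglongrightarrow> u' z b" for z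
 proof -
  have "((\<lambda>s. z + s *\<^sub>R b) has_derivative (\<lambda>s. s *\<^sub>R b)) (at 0)"
   by (auto intro!: derivative_eq_intros)
  then have "((\<lambda>s. u (z + s *\<^sub>R b)) has_derivative (\<lambda>s. u' z (s *\<^sub>R b))) (at 0)"
   by (rule has_derivative_compose) (use assms[of z] in simp)
  then have "((\<lambda>s. norm (u (z + s *\<^sub>R b) - u z - s *\<^sub>R u' z b) / norm s) \<longlongrightarrow> 0) (at 0)"
   using linear_scale[OF has_derivative_linear[OF assms]] by (simp add: has_derivative_iff_norm)
  moreover have "filterlim (\<lambda>n. 1 / real (Suc n)) (at 0) sequentially"
   unfolding filterlim_at using LIMSEQ_inverse_real_of_nat by (auto simp: inverse_eq_divide)
  ultimately have "(\<lambda>n. norm (u (z + (1 / real (Suc n)) *\<^sub>R b) - u z - (1 / real (Suc n)) *\<^sub>R u' z b) / norm (1 / real (Suc n))) \<longlonglongrightarrow> 0"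
   by (rule filterlim_compose)
  moreover have "norm (u (z + (1 / real (Suc n)) *\<^sub>R b) - u z - (1 / real (Suc n)) *\<^sub>R u' z b) / norm (1 / real (Suc n)) =
    norm (real (Suc n) *\<^sub>R (u (z + (1 / real (Suc n)) *\<^sub>R b) - u z) - u' z b)" for n
  proof -
   have "real (Suc n) *\<^sub>R (u (z + (1 / real (Suc n)) *\<^sub>R b) - u z) - u' z b =
     real (Suc n) *\<^sub>R (u (z + (1 / real (Suc n)) *\<^sub>R b) - u z - (1 / real (Suc n)) *\<^sub>R u' z b)"
    by (simp only: scaleR_diff_right scaleR_scaleR) simp
   then show ?thesis by (simp only: norm_scaleR) simp
  qed
  ultimately have "(\<lambda>n. norm (real (Suc n) *\<^sub>R (u (z + (1 / real (Suc n)) *\<^sub>R b) - u z) - u' z b)) \<longlonglongrightarrow> 0"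
   by (simp only:)
  then show ?thesis by (simp only: LIM_zero_iff tendsto_norm_zero_iff)
 qed
qed

lemma integral_divergence_eq_0:
 fixes V :: "'a::euclidean_space \<Rightarrow> 'a"
 assumes der: "\<And>z. (V has_derivative V' z) (at z)"
  and V: "\<And>b. b \<in> Basis \<Longrightarrow> integrable lborel (\<lambda>z. V z \<bullet> b)"
  and V': "\<And>b. b \<in> Basis \<Longrightarrow> integrable lborel (\<lambda>z. V' z b \<bullet> b)"
 shows "(LBINT z. (\<Sum>b\<in>Basis. V' z b \<bullet> b)) = 0"
proof -
 have "(LBINT z. V' z b \<bullet> b) = 0" if b: "b \<in> Basis" for b
 proof (rule integral_directional_derivative_eq_0[OF V[OF b] V'[OF b]])
  fix z
  have "((\<lambda>s. z + s *\<^sub>R b) has_derivative (\<lambda>s. s *\<^sub>R b)) (at 0)"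
   by (auto intro!: derivative_eq_intros)
  then have "((\<lambda>s. V (z + s *\<^sub>R b)) has_derivative (\<lambda>s. V' z (s *\<^sub>R b))) (at 0)"
   by (rule has_derivative_compose) (use der[of z] in simp)
  from has_derivative_inner_left[OF this, of b]
  show "((\<lambda>s. V (z + s *\<^sub>R b) \<bullet> b) has_real_derivative V' z b \<bullet> b) (at 0)"
   unfolding has_field_derivative_def
   by (rule has_derivative_eq_rhs)
    (simp add: fun_eq_iff linear_scale[OF bounded_linear.linear[OF has_derivative_bounded_linear[OF der]]])
 qed
 then show ?thesis using V' by simp
qed

text \<open>H is a potential, P its gradient and Q = ka^2 H - Laplacian H its source. The divergence
  theorem for H P gives the energy identity. For (u \<bullet> P) P - (E / 2) u, the stress tensor
  contracted with u, it relates Q (u \<bullet> P) to terms in which u enters only through its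
  derivative. These are at most (1 + d / 2) L E, the part d / 2 coming from the divergence of
  u.\<close>

lemma stress_tensor_identities:
 fixes H :: "'a::euclidean_space \<Rightarrow> real" and P u :: "'a \<Rightarrow> 'a" and P' u' :: "'a \<Rightarrow> 'a \<Rightarrow> 'a"
 assumes H: "\<And>z. (H has_derivative (\<lambda>h. P z \<bullet> h)) (at z)"
  and P: "\<And>z. (P has_derivative P' z) (at z)"
  and sym: "\<And>z h k. P' z h \<bullet> k = P' z k \<bullet> h"
  and K: "integrable lborel K" "\<And>z. K z \<le> M"
  and HK: "\<And>z. \<bar>H z\<bar> \<le> K z" and PK: "\<And>z. norm (P z) \<le> K z" and P'K: "\<And>z h. norm (P' z h) \<le> K z * norm h"
  and Q: "\<And>z. Q z = ka\<^sup>2 * H z - (\<Sum>b\<in>Basis. P' z b \<bullet> b)"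
  and u: "\<And>z. (u has_derivative u' z) (at z)" and uB: "\<And>z. norm (u z) \<le> B" and uL: "\<And>z h. norm (u' z h) \<le> L * norm h"
 defines "E \<equiv> \<lambda>z. (norm (P z))\<^sup>2 + ka\<^sup>2 * (H z)\<^sup>2"
 shows "integrable lborel E"
  and "(LBINT z. Q z * H z) = (LBINT z. E z)"
  and "\<bar>\<integral>z. Q z * (u z \<bullet> P z) \<partial>lborel\<bar> \<le> (1 + real DIM('a) / 2) * L * (LBINT z. E z)"
proof -
 have K0: "0 \<le> K z" for z using HK[of z] by linarith
 have M0: "0 \<le> M" using K0 K(2) order_trans by blast
 have L0: "0 \<le> L"
 proof -
  obtain b :: 'a where b: "b \<in> Basis" using nonempty_Basis by blast
  show ?thesis using order_trans[OF norm_ge_zero uL[of 0 b]] b by simp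
 qed
 have B0: "0 \<le> B" using order_trans[OF norm_ge_zero uB[of 0]] .
 have [measurable]: "u \<in> borel_measurable borel" "H \<in> borel_measurable borel" "P \<in> borel_measurable borel"
  by (rule borel_measurable_differentiable[OF u] borel_measurable_differentiable[OF H] borel_measurable_differentiable[OF P])+
 have [measurable]: "(\<lambda>z. u' z b) \<in> borel_measurable borel" "(\<lambda>z. P' z b) \<in> borel_measurable borel" for b
  using borel_measurable_has_derivative[OF u] borel_measurable_has_derivative[OF P] by auto
 have KM: "K z * K z \<le> M * K z" for z using K(2) K0 by (intro mult_right_mono) auto
 \<comment> \<open>Every integrand below is at most quadratic in \<open>K\<close>, and
   \<open>K z * K z \<le> M * K z\<close> makes such integrands integrable.\<close>
 have dom: "integrable lborel f" if "f \<in> borel_measurable borel" "\<And>z. \<bar>f z\<bar> \<le> c * (K z * K z)" "0 \<le> c" for f :: "'a \<Rightarrow> real" and c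
 proof (rule Bochner_Integration.integrable_bound)
  show "integrable lborel (\<lambda>z. c * (M * K z))" using K by simp
  show "AE z in lborel. norm (f z) \<le> norm (c * (M * K z))"
  proof (rule AE_I2)
   fix z
   have "\<bar>f z\<bar> \<le> c * (M * K z)" using that(2)[of z] mult_left_mono[OF KM[of z] that(3)] by linarith
   then show "norm (f z) \<le> norm (c * (M * K z))" by auto
  qed
 qed (use that in simp)
 have PP: "(norm (P z))\<^sup>2 \<le> K z * K z" for z
  using mult_mono[OF PK[of z] PK[of z]] K0 by (simp add: power2_eq_square)
 have HH: "(H z)\<^sup>2 \<le> K z * K z" for z
  using mult_mono[OF HK[of z] HK[of z]] K0 by (simp add: power2_eq_square abs_mult[symmetric])
 have P'b: "\<bar>P' z b \<bullet> b\<bar> \<le> K z" if "b \<in> Basis" for z b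
  using Cauchy_Schwarz_ineq2[of "P' z b" b] P'K[of z b] that by simp
 have lap: "\<bar>\<Sum>b\<in>Basis. P' z b \<bullet> b\<bar> \<le> real DIM('a) * K z" for z
  using order_trans[OF sum_abs[of "\<lambda>b. P' z b \<bullet> b" Basis] sum_mono[of Basis "\<lambda>b. \<bar>P' z b \<bullet> b\<bar>" "\<lambda>_. K z", OF P'b]]
  by simp
 have [measurable]: "Q \<in> borel_measurable borel" unfolding Q[abs_def] by measurable
 have QK: "\<bar>Q z\<bar> \<le> (ka\<^sup>2 + real DIM('a)) * K z" for z
 proof -
  have "\<bar>Q z\<bar> \<le> ka\<^sup>2 * \<bar>H z\<bar> + \<bar>\<Sum>b\<in>Basis. P' z b \<bullet> b\<bar>"
   unfolding Q using abs_triangle_ineq4[of "ka\<^sup>2 * H z"] by (simp add: abs_mult)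
  also have "\<dots> \<le> ka\<^sup>2 * K z + real DIM('a) * K z"
   using lap[of z] HK[of z] by (intro add_mono mult_left_mono) auto
  finally show ?thesis by (simp add: algebra_simps)
 qed
 have i1: "integrable lborel (\<lambda>z. (norm (P z))\<^sup>2)"
  by (rule dom[of _ 1]) (use PP in auto)
 have i2: "integrable lborel (\<lambda>z. (H z)\<^sup>2)"
  by (rule dom[of _ 1]) (use HH in auto)
 show Ei: "integrable lborel E" unfolding E_def using i1 i2 by simp
 have QHi: "integrable lborel (\<lambda>z. Q z * H z)"
 proof (rule dom[of _ "ka\<^sup>2 + real DIM('a)"])
  show "\<bar>Q z * H z\<bar> \<le> (ka\<^sup>2 + real DIM('a)) * (K z * K z)" for z
   using mult_mono[OF QK[of z] HK[of z]] K0 by (simp add: abs_mult mult.assoc)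
 qed auto
 have QuPi: "integrable lborel (\<lambda>z. Q z * (u z \<bullet> P z))"
 proof (rule dom[of _ "(ka\<^sup>2 + real DIM('a)) * B"])
  show "\<bar>Q z * (u z \<bullet> P z)\<bar> \<le> (ka\<^sup>2 + real DIM('a)) * B * (K z * K z)" for z
  proof -
   have "\<bar>u z \<bullet> P z\<bar> \<le> B * K z"
    by (rule order_trans[OF Cauchy_Schwarz_ineq2]) (use uB[of z] PK[of z] B0 in \<open>auto intro: mult_mono\<close>)
   from mult_mono[OF QK[of z] this] show ?thesis using K0[of z] by (simp add: abs_mult mult_ac)
  qed
 qed (use B0 in auto)
 have exp: "(\<Sum>b\<in>Basis. (v \<bullet> b) * (w \<bullet> b)) = v \<bullet> w" for v w :: 'a
  by (rule euclidean_inner[symmetric])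
 have lin: "linear (P' z)" "linear (u' z)" for z
  using has_derivative_linear[OF P] has_derivative_linear[OF u] by auto
 have ex: "(\<Sum>b\<in>Basis. (v \<bullet> b) * (f b \<bullet> w)) = f v \<bullet> w" if "linear f" for v w :: 'a and f :: "'a \<Rightarrow> 'a"
 proof -
  have "f v = f (\<Sum>b\<in>Basis. (v \<bullet> b) *\<^sub>R b)" by (simp add: euclidean_representation)
  also have "\<dots> = (\<Sum>b\<in>Basis. (v \<bullet> b) *\<^sub>R f b)" using that by (simp add: linear_sum linear_scale)
  finally show ?thesis by (simp add: inner_sum_left)
 qed
 have "(LBINT z. (\<Sum>b\<in>Basis. ((P z \<bullet> b) *\<^sub>R P z + H z *\<^sub>R P' z b) \<bullet> b)) = 0"
 proof (rule integral_divergence_eq_0[where V = "\<lambda>z. H z *\<^sub>R P z"])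
  show "((\<lambda>z. H z *\<^sub>R P z) has_derivative (\<lambda>h. (P z \<bullet> h) *\<^sub>R P z + H z *\<^sub>R P' z h)) (at z)" for z
   by (rule has_derivative_eq_rhs[OF has_derivative_scaleR[OF H P]]) (simp add: fun_eq_iff)
  fix b :: 'a assume b: "b \<in> Basis"
  have Pb: "\<bar>P z \<bullet> b\<bar> \<le> K z" for z
   using Cauchy_Schwarz_ineq2[of "P z" b] PK[of z] b by simp
  show "integrable lborel (\<lambda>z. H z *\<^sub>R P z \<bullet> b)"
   by (rule dom[of _ 1]) (use mult_mono[OF HK Pb] K0 in \<open>auto simp: abs_mult\<close>)
  show "integrable lborel (\<lambda>z. ((P z \<bullet> b) *\<^sub>R P z + H z *\<^sub>R P' z b) \<bullet> b)"
  proof (rule dom[of _ 2])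
   show "\<bar>((P z \<bullet> b) *\<^sub>R P z + H z *\<^sub>R P' z b) \<bullet> b\<bar> \<le> 2 * (K z * K z)" for z
    using mult_mono[OF Pb[of z] Pb[of z]] mult_mono[OF HK[of z] P'b[OF b, of z]] K0[of z]
     abs_triangle_ineq[of "(P z \<bullet> b) * (P z \<bullet> b)" "H z * (P' z b \<bullet> b)"]
    by (simp add: inner_add_left abs_mult)
  qed auto
 qed
 moreover have "(\<Sum>b\<in>Basis. ((P z \<bullet> b) *\<^sub>R P z + H z *\<^sub>R P' z b) \<bullet> b) = E z - Q z * H z" for z
  unfolding E_def Q
  by (simp add: inner_add_left sum.distrib exp dot_square_norm sum_distrib_left[symmetric] algebra_simps power2_eq_square)
 ultimately show "(LBINT z. Q z * H z) = (LBINT z. E z)"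
  using Ei QHi by simp
 let ?V = "\<lambda>z. (u z \<bullet> P z) *\<^sub>R P z - (E z / 2) *\<^sub>R u z"
 let ?V' = "\<lambda>z h. (u' z h \<bullet> P z + u z \<bullet> P' z h) *\<^sub>R P z + (u z \<bullet> P z) *\<^sub>R P' z h
   - ((P z \<bullet> P' z h + ka\<^sup>2 * H z * (P z \<bullet> h)) *\<^sub>R u z + (E z / 2) *\<^sub>R u' z h)"
 have Ed: "((\<lambda>z. E z / 2) has_derivative (\<lambda>h. P z \<bullet> P' z h + ka\<^sup>2 * H z * (P z \<bullet> h))) (at z)" for z
  unfolding E_def power2_norm_eq_inner
  by (auto intro!: derivative_eq_intros P H simp: fun_eq_iff inner_commute field_simps)
 have uP: "((\<lambda>z. u z \<bullet> P z) has_derivative (\<lambda>h. u' z h \<bullet> P z + u z \<bullet> P' z h)) (at z)" for z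
  by (rule has_derivative_eq_rhs[OF has_derivative_inner[OF u P]]) (simp add: fun_eq_iff add.commute)
 have Vd: "(?V has_derivative ?V' z) (at z)" for z
  by (rule has_derivative_eq_rhs[OF has_derivative_diff[OF has_derivative_scaleR[OF uP P] has_derivative_scaleR[OF Ed u]]])
   (simp add: fun_eq_iff add.commute)
 have EK: "0 \<le> E z" "E z \<le> (1 + ka\<^sup>2) * (K z * K z)" for z
  unfolding E_def using PP[of z] mult_left_mono[OF HH[of z], of "ka\<^sup>2"] by (auto simp: algebra_simps)
 have uPb: "\<bar>u z \<bullet> P z\<bar> \<le> B * K z" for z
  by (rule order_trans[OF Cauchy_Schwarz_ineq2]) (use uB[of z] PK[of z] B0 in \<open>auto intro: mult_mono\<close>)
 have "(LBINT z. (\<Sum>b\<in>Basis. ?V' z b \<bullet> b)) = 0"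
 proof (rule integral_divergence_eq_0[OF Vd])
  fix b :: 'a assume b: "b \<in> Basis"
  have Pb: "\<bar>P z \<bullet> b\<bar> \<le> K z" for z
   using Cauchy_Schwarz_ineq2[of "P z" b] PK[of z] b by simp
  have ub: "\<bar>u z \<bullet> b\<bar> \<le> B" for z
   using Cauchy_Schwarz_ineq2[of "u z" b] uB[of z] b by simp
  have [measurable]: "E \<in> borel_measurable borel" unfolding E_def by measurable
  show "integrable lborel (\<lambda>z. ?V z \<bullet> b)"
  proof (rule dom[of _ "B + (1 + ka\<^sup>2) * B"])
   show "\<bar>?V z \<bullet> b\<bar> \<le> (B + (1 + ka\<^sup>2) * B) * (K z * K z)" for z
   proof -
    have "\<bar>?V z \<bullet> b\<bar> \<le> \<bar>u z \<bullet> P z\<bar> * \<bar>P z \<bullet> b\<bar> + (E z / 2) * \<bar>u z \<bullet> b\<bar>"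
     using abs_triangle_ineq4[of "(u z \<bullet> P z) * (P z \<bullet> b)" "E z / 2 * (u z \<bullet> b)"] EK[of z]
     by (simp add: inner_diff_left abs_mult)
    also have "\<dots> \<le> (B * K z) * K z + ((1 + ka\<^sup>2) * (K z * K z)) * B"
     using uPb[of z] Pb[of z] ub[of z] EK[of z] K0[of z] B0 by (intro add_mono mult_mono) auto
    finally show ?thesis by (simp add: algebra_simps)
   qed
  qed (use B0 in auto)
  define c where "c = (L + B) + B + (B + ka\<^sup>2 * B) + (1 + ka\<^sup>2) * L"
  show "integrable lborel (\<lambda>z. ?V' z b \<bullet> b)"
  proof (rule dom[of _ c])
   fix z
   have u'b: "norm (u' z b) \<le> L" using uL[of z b] b by simp
   have P'n: "norm (P' z b) \<le> K z" using P'K[of z b] b by simp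
   have t1: "\<bar>u' z b \<bullet> P z + u z \<bullet> P' z b\<bar> \<le> (L + B) * K z"
   proof -
    have "\<bar>u' z b \<bullet> P z\<bar> \<le> L * K z" "\<bar>u z \<bullet> P' z b\<bar> \<le> B * K z"
     by (rule order_trans[OF Cauchy_Schwarz_ineq2]; use u'b PK[of z] L0 B0 P'n uB[of z] in \<open>auto intro!: mult_mono\<close>)+
    then show ?thesis by (simp add: algebra_simps)
   qed
   have t2: "\<bar>P z \<bullet> P' z b + ka\<^sup>2 * H z * (P z \<bullet> b)\<bar> \<le> (1 + ka\<^sup>2) * (K z * K z)"
   proof -
    have "\<bar>P z \<bullet> P' z b\<bar> \<le> K z * K z"
     by (rule order_trans[OF Cauchy_Schwarz_ineq2]) (use PK[of z] P'n K0[of z] in \<open>auto intro!: mult_mono\<close>)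
    moreover have "\<bar>ka\<^sup>2 * H z * (P z \<bullet> b)\<bar> \<le> ka\<^sup>2 * (K z * K z)"
     unfolding abs_mult using HK[of z] Pb[of z] K0[of z] by (auto simp: mult.assoc intro!: mult_left_mono mult_mono)
    ultimately show ?thesis by (simp add: algebra_simps)
   qed
   have "\<bar>?V' z b \<bullet> b\<bar> \<le> \<bar>u' z b \<bullet> P z + u z \<bullet> P' z b\<bar> * \<bar>P z \<bullet> b\<bar> + \<bar>u z \<bullet> P z\<bar> * \<bar>P' z b \<bullet> b\<bar>
    + (\<bar>P z \<bullet> P' z b + ka\<^sup>2 * H z * (P z \<bullet> b)\<bar> * \<bar>u z \<bullet> b\<bar> + E z / 2 * \<bar>u' z b \<bullet> b\<bar>)"
    unfolding inner_diff_left inner_add_left[of _ _ b] inner_scaleR_left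
    by (rule order_trans[OF abs_triangle_ineq4 add_mono[OF abs_triangle_ineq abs_triangle_ineq, THEN order_trans]])
     (use EK[of z] in \<open>simp add: abs_mult\<close>)
   also have "\<dots> \<le> ((L + B) * K z) * K z + (B * K z) * K z + (((1 + ka\<^sup>2) * (K z * K z)) * B + ((1 + ka\<^sup>2) * (K z * K z)) * L)"
   proof (intro add_mono mult_mono t1 t2 Pb uPb P'b[OF b] ub abs_ge_zero)
    show "\<bar>u' z b \<bullet> b\<bar> \<le> L" using Cauchy_Schwarz_ineq2[of "u' z b" b] u'b b by simp
    have nn: "0 \<le> (1 + ka\<^sup>2) * (K z * K z)" using K0[of z] by (intro mult_nonneg_nonneg) auto
    then show "E z / 2 \<le> (1 + ka\<^sup>2) * (K z * K z)" using EK[of z] by linarith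
    show "0 \<le> (1 + ka\<^sup>2) * (K z * K z)" "0 \<le> (1 + ka\<^sup>2) * (K z * K z)" by fact+
    show "0 \<le> (L + B) * K z" "0 \<le> B * K z" using L0 B0 K0[of z] by auto
   qed
   finally show "\<bar>?V' z b \<bullet> b\<bar> \<le> c * (K z * K z)" unfolding c_def by (simp add: algebra_simps)
  qed (use B0 L0 in \<open>auto simp: c_def\<close>)
 qed
 \<comment> \<open>The terms \<open>P' z (P z) \<bullet> u z\<close> and
   \<open>P' z (u z) \<bullet> P z\<close> cancel by symmetry of the Hessian, so no second
   derivative other than the Laplacian inside Q remains.\<close>
 moreover have "(\<Sum>b\<in>Basis. ?V' z b \<bullet> b) =
   u' z (P z) \<bullet> P z - E z / 2 * (\<Sum>b\<in>Basis. u' z b \<bullet> b) - Q z * (u z \<bullet> P z)" for z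
 proof -
  have a1: "(\<Sum>b\<in>Basis. (u' z b \<bullet> P z) * (P z \<bullet> b)) = u' z (P z) \<bullet> P z"
   using ex[OF lin(2), of "P z" z "P z"] by (simp add: mult.commute)
  have a2: "(\<Sum>b\<in>Basis. (u z \<bullet> P' z b) * (P z \<bullet> b)) = P' z (P z) \<bullet> u z"
   using ex[OF lin(1), of "P z" z "u z"] by (simp add: mult.commute inner_commute)
  have a3: "(\<Sum>b\<in>Basis. (P z \<bullet> P' z b) * (u z \<bullet> b)) = P' z (u z) \<bullet> P z"
   using ex[OF lin(1), of "u z" z "P z"] by (simp add: mult.commute inner_commute)
  have a4: "(\<Sum>b\<in>Basis. ka\<^sup>2 * H z * (P z \<bullet> b) * (u z \<bullet> b)) = ka\<^sup>2 * H z * (u z \<bullet> P z)"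
   unfolding mult.assoc sum_distrib_left[symmetric] exp by (simp add: inner_commute)
  have "(\<Sum>b\<in>Basis. ?V' z b \<bullet> b) = (\<Sum>b\<in>Basis. (u' z b \<bullet> P z) * (P z \<bullet> b)) + (\<Sum>b\<in>Basis. (u z \<bullet> P' z b) * (P z \<bullet> b))
   + (u z \<bullet> P z) * (\<Sum>b\<in>Basis. P' z b \<bullet> b) - ((\<Sum>b\<in>Basis. (P z \<bullet> P' z b) * (u z \<bullet> b)) + (\<Sum>b\<in>Basis. ka\<^sup>2 * H z * (P z \<bullet> b) * (u z \<bullet> b))
   + E z / 2 * (\<Sum>b\<in>Basis. u' z b \<bullet> b))"
   by (simp add: inner_diff_left inner_add_left sum.distrib sum_subtractf sum_distrib_left distrib_right)
  also have "\<dots> = u' z (P z) \<bullet> P z + (u z \<bullet> P z) * (\<Sum>b\<in>Basis. P' z b \<bullet> b) - ka\<^sup>2 * H z * (u z \<bullet> P z) - E z / 2 * (\<Sum>b\<in>Basis. u' z b \<bullet> b)"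
   unfolding a1 a2 a3 a4 sym[of z "P z" "u z"] by simp
  finally show ?thesis unfolding Q by (simp add: algebra_simps)
 qed
 ultimately have 0: "(LBINT z. (u' z (P z) \<bullet> P z - E z / 2 * (\<Sum>b\<in>Basis. u' z b \<bullet> b)) - Q z * (u z \<bullet> P z)) = 0" by simp
 let ?R = "\<lambda>z. u' z (P z) \<bullet> P z - E z / 2 * (\<Sum>b\<in>Basis. u' z b \<bullet> b)"
 have Rb: "\<bar>?R z\<bar> \<le> (1 + real DIM('a) / 2) * L * E z" for z
 proof -
  have "\<bar>u' z (P z) \<bullet> P z\<bar> \<le> L * norm (P z) * norm (P z)"
   by (rule order_trans[OF Cauchy_Schwarz_ineq2]) (use uL in \<open>auto intro: mult_right_mono\<close>)
  also have "\<dots> \<le> L * E z"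
   unfolding E_def mult.assoc using L0 by (intro mult_left_mono) (auto simp: power2_eq_square)
  finally have 1: "\<bar>u' z (P z) \<bullet> P z\<bar> \<le> L * E z" .
  have "\<bar>\<Sum>b\<in>Basis. u' z b \<bullet> b\<bar> \<le> (\<Sum>b\<in>(Basis::'a set). L)"
  proof (rule order_trans[OF sum_abs sum_mono])
   show "\<bar>u' z b \<bullet> b\<bar> \<le> L" if "b \<in> Basis" for b
    using Cauchy_Schwarz_ineq2[of "u' z b" b] uL[of z b] that by simp
  qed
  then have "E z / 2 * \<bar>\<Sum>b\<in>Basis. u' z b \<bullet> b\<bar> \<le> E z / 2 * (real DIM('a) * L)"
   using EK by (intro mult_left_mono) auto
  then show ?thesis using 1 abs_triangle_ineq4[of "u' z (P z) \<bullet> P z" "E z / 2 * (\<Sum>b\<in>Basis. u' z b \<bullet> b)"] EK(1)[of z]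
   by (simp add: abs_mult algebra_simps)
 qed
 have m: "(\<lambda>z. u' z (P z) \<bullet> P z) \<in> borel_measurable borel"
 proof -
  have "u' z (P z) \<bullet> P z = (\<Sum>b\<in>Basis. (P z \<bullet> b) * (u' z b \<bullet> P z))" for z
   using ex[OF lin(2), of "P z" z "P z"] by simp
  then show ?thesis by simp
 qed
 have Ri: "integrable lborel ?R"
 proof (rule Bochner_Integration.integrable_bound[of lborel "\<lambda>z. (1 + real DIM('a) / 2) * L * E z"])
  show "AE z in lborel. norm (?R z) \<le> norm ((1 + real DIM('a) / 2) * L * E z)"
   using Rb by (intro AE_I2) (auto intro: order_trans[OF _ abs_ge_self])
  have [measurable]: "E \<in> borel_measurable borel" unfolding E_def by measurable
  show "?R \<in> borel_measurable lborel" using m by measurable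
 qed (use Ei in simp)
 have "(LBINT z. Q z * (u z \<bullet> P z)) = (LBINT z. ?R z)"
  using 0 Bochner_Integration.integral_diff[OF Ri QuPi] by simp
 also have "\<bar>\<dots>\<bar> \<le> (LBINT z. (1 + real DIM('a) / 2) * L * E z)"
  by (rule integral_abs_bound_integral) (use Ri Ei Rb in auto)
 finally show "\<bar>\<integral>z. Q z * (u z \<bullet> P z) \<partial>lborel\<bar> \<le> (1 + real DIM('a) / 2) * L * (LBINT z. E z)" by simp
qed

section \<open>Integrable domination of the cut kernel and its derivatives\<close>

lemma heat_le_at_0: "heat s (x::'a::euclidean_space) \<le> heat s (0::'a)" if "0 < s"
 using heat_le[OF that, of x] by (simp add: heat_def)

text \<open>The integral on the right is the dominating function of
  \<open>hmix_cut_dominated\<close>. Being a mixture itself, it inherits measurability,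
  integrability and the bound by its value at 0.\<close>

lemma hmix_double:
 "hmix {2 * ta<..} (ka / sqrt 2) 0 (x::'a::euclidean_space) = 2 * (LBINT s. indicator {ta<..} s * exp (- ka\<^sup>2 * s) * heat (2 * s) x)"
 unfolding hmix_def
 by (subst lborel_integral_real_affine[of 2 _ 0])
  (auto simp: power_divide intro!: Bochner_Integration.integral_cong split: split_indicator)

lemma integrable_double:
 assumes ka: "0 < ka" and ta: "0 < ta"
 shows "integrable lborel (\<lambda>s. indicator {ta<..} s * exp (- ka\<^sup>2 * s) * heat (2 * s) (x::'a::euclidean_space))"
proof -
 have "integrable lborel (\<lambda>s. indicator {2 * ta<..} s * exp (- (ka / sqrt 2)\<^sup>2 * s) * (heat s x / s ^ 0))"
  using ta ka by (intro hmix_integrable hmix_atI_cut[of _ "2 * ta"]) auto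
 from lborel_integrable_real_affine[OF this, of 2 0]
 have "integrable lborel (\<lambda>s. indicator {2 * ta<..} (2 * s) * exp (- (ka / sqrt 2)\<^sup>2 * (2 * s)) * heat (2 * s) x)" by simp
 moreover have "indicator {2 * ta<..} (2 * s) * exp (- (ka / sqrt 2)\<^sup>2 * (2 * s)) = indicator {ta<..} s * exp (- ka\<^sup>2 * s)" for s
  by (auto simp: power_divide split: split_indicator)
 ultimately show ?thesis by simp
qed

lemma hmix_le_at_0:
 assumes A: "hmix_at A (0::'a::euclidean_space)" and ka: "0 < ka"
 shows "hmix A ka k (x::'a) \<le> hmix A ka k (0::'a)"
 unfolding hmix_def
proof (rule integral_mono)
 have A': "hmix_at A x" using A by (auto simp: hmix_at_def)
 show "integrable lborel (\<lambda>s. indicator A s * exp (- ka\<^sup>2 * s) * (heat s x / s ^ k))"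
  "integrable lborel (\<lambda>s. indicator A s * exp (- ka\<^sup>2 * s) * (heat s (0::'a) / s ^ k))"
  by (intro hmix_integrable A A' ka)+
 show "indicator A s * exp (- ka\<^sup>2 * s) * (heat s x / s ^ k) \<le> indicator A s * exp (- ka\<^sup>2 * s) * (heat s (0::'a) / s ^ k)" for s
  using A heat_le_at_0[of s x] by (auto simp: hmix_at_def subset_iff split: split_indicator intro!: divide_right_mono mult_left_mono)
qed

text \<open>The Hessian of \<open>hmix A ka 0\<close> at x applied to h, that is, the derivative of
  \<open>gmix A ka\<close>.\<close>

definition hessmix :: "real set \<Rightarrow> real \<Rightarrow> 'a::euclidean_space \<Rightarrow> 'a \<Rightarrow> 'a" where
 "hessmix A ka x h = (hmix A ka 2 x / 4 * (x \<bullet> h)) *\<^sub>R x - (hmix A ka 1 x / 2) *\<^sub>R h"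

text \<open>One even function controls kernel, gradient and Hessian: polynomial weights are absorbed
  by doubling the heat time, and negative powers of s are bounded because s stays above
  \<open>ta\<close>. Boundedness and integrability of K together make products and convolutions of
  potentials integrable.\<close>

lemma hmix_cut_dominated:
 assumes ka: "0 < ka" and ta: "0 < ta"
 obtains K :: "'a::euclidean_space \<Rightarrow> real" and C where
  "integrable lborel K" "K \<in> borel_measurable borel" "\<And>x. K x \<le> C" "\<And>x. 0 \<le> K x" "\<And>x. K (- x) = K x"
  "\<And>x. hmix {ta<..} ka 0 x \<le> K x" "\<And>x. norm (gmix {ta<..} ka x) \<le> K x"
  "\<And>x h. norm (hessmix {ta<..} ka x h) \<le> K x * norm h"
proof -
 define p where "p = 2 powr (real DIM('a) / 2)"
 have p: "p \<ge> 0" by (simp add: p_def)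
 let ?K = "\<lambda>x::'a. \<integral>s. indicator {ta<..} s * exp (- ka\<^sup>2 * s) * heat (2 * s) x \<partial>lborel"
 have K0: "0 \<le> ?K x" for x by (intro Bochner_Integration.integral_nonneg) simp
 have at: "hmix_at {ta<..} x" for x :: 'a using ta by (intro hmix_atI_cut[of _ ta]) auto
 have le: "c * hmix {ta<..} ka k x \<le> D * ?K x"
  if "\<And>s. ta < s \<Longrightarrow> c * (heat s x / s ^ k) \<le> D * heat (2 * s) x" for c D k and x :: 'a
 proof -
  have "c * hmix {ta<..} ka k x = (LBINT s. c * (indicator {ta<..} s * exp (- ka\<^sup>2 * s) * (heat s x / s ^ k)))"
   unfolding hmix_def by (simp only: integral_mult_right_zero)
  also have "\<dots> \<le> (LBINT s. D * (indicator {ta<..} s * exp (- ka\<^sup>2 * s) * heat (2 * s) x))"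
  proof (rule integral_mono)
   show "c * (indicator {ta<..} s * exp (- ka\<^sup>2 * s) * (heat s x / s ^ k)) \<le> D * (indicator {ta<..} s * exp (- ka\<^sup>2 * s) * heat (2 * s) x)" for s
    using mult_left_mono[OF that[of s], of "exp (- ka\<^sup>2 * s)"] by (auto split: split_indicator simp: mult_ac)
  qed (intro integrable_mult_right hmix_integrable[OF at ka] integrable_double[OF ka ta])+
  finally show ?thesis by simp
 qed
 have d0: "heat s x \<le> p * heat (2 * s) x" if "ta < s" for s and x :: 'a
  unfolding p_def using heat_le_heat_double[of s x] that ta by simp
 have h0: "hmix {ta<..} ka 0 x \<le> p * ?K x" for x using le[of 1 x 0 p] d0 by simp
 have d1: "heat s x / s ^ 1 \<le> (p / ta) * heat (2 * s) x" if "ta < s" for s and x :: 'a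
 proof -
  have "heat s x / s \<le> (p * heat (2 * s) x) / ta" using d0[OF that, of x] that ta p by (intro frac_le) auto
  then show ?thesis by simp
 qed
 have h1: "hmix {ta<..} ka 1 x \<le> p / ta * ?K x" for x using le[of 1 x 1 "p / ta"] d1 by simp
 have d2: "(norm x)\<^sup>2 * (heat s x / s ^ 2) \<le> (p * 8 / ta) * heat (2 * s) x" if "ta < s" for s and x :: 'a
 proof -
  have s: "0 < s" using that ta by simp
  have "(norm x)\<^sup>2 * heat s x / s\<^sup>2 \<le> p * (8 * s) * heat (2 * s) x / s\<^sup>2"
   using norm_sq_heat_le[OF s, of x] unfolding p_def by (intro divide_right_mono) auto
  also have "\<dots> = (p * 8 * heat (2 * s) x) / s" using s by (simp add: power2_eq_square)
  also have "\<dots> \<le> (p * 8 * heat (2 * s) x) / ta" using that ta p by (intro divide_left_mono) auto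
  finally show ?thesis by simp
 qed
 have h2: "(norm x)\<^sup>2 * hmix {ta<..} ka 2 x \<le> p * 8 / ta * ?K x" for x
  using le[of "(norm x)\<^sup>2" x 2 "p * 8 / ta"] d2 by simp
 have dg: "norm x * (heat s x / s ^ 1) \<le> (p * sqrt 8 / sqrt ta) * heat (2 * s) x" if "ta < s" for s and x :: 'a
 proof -
  have s: "0 < s" using that ta by simp
  have "norm x * heat s x / s \<le> p * sqrt (8 * s) * heat (2 * s) x / s"
   using norm_heat_le[OF s, of x] s unfolding p_def by (intro divide_right_mono) auto
  also have "\<dots> = (p * sqrt 8 * heat (2 * s) x) / sqrt s"
   using s by (simp add: real_sqrt_mult field_simps)
  also have "\<dots> \<le> (p * sqrt 8 * heat (2 * s) x) / sqrt ta" using that ta p s by (intro divide_left_mono) auto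
  finally show ?thesis by simp
 qed
 have hg: "norm x * hmix {ta<..} ka 1 x \<le> p * sqrt 8 / sqrt ta * ?K x" for x
  using le[of "norm x" x 1 "p * sqrt 8 / sqrt ta"] dg by simp
 define c where "c = p + p * sqrt 8 / sqrt ta + p * 8 / ta + p / ta"
 have nn: "0 \<le> p * sqrt 8 / sqrt ta" "0 \<le> p * 8 / ta" "0 \<le> p / ta" using p ta by auto
 have sub: "{ta<..} \<subseteq> {0<..}" using ta by auto
 note hn = hmix_nonneg[OF sub]
 define K where "K x = c * ?K x" for x
 have K_eq: "K x = c / 2 * hmix {2 * ta<..} (ka / sqrt 2) 0 x" for x
  unfolding K_def hmix_double by simp
 have c0: "0 \<le> c" unfolding c_def using nn p by linarith
 have at2: "hmix_at {2 * ta<..} (0::'a)" using ta by (intro hmix_atI_cut[of _ "2 * ta"]) auto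
 show thesis
 proof
  show "integrable lborel K" unfolding K_eq[abs_def]
   using integrable_hmix[of "{2 * ta<..}" "ka / sqrt 2" "0::'a"] ta ka
   by (intro integrable_mult_right) (simp add: subset_iff)
  show "K \<in> borel_measurable borel" unfolding K_eq[abs_def] by measurable
  show "K x \<le> c / 2 * hmix {2 * ta<..} (ka / sqrt 2) 0 (0::'a)" for x
   unfolding K_eq using hmix_le_at_0[OF at2] ka c0 by (intro mult_left_mono) auto
  show "0 \<le> K x" for x unfolding K_def using K0 c0 by simp
  show "K (- x) = K x" for x unfolding K_eq by simp
  have Kge: "b * ?K x \<le> K x" if "b \<le> c" for b x unfolding K_def using that K0 by (intro mult_right_mono) auto
  have cc: "p \<le> c" "p * sqrt 8 / sqrt ta \<le> c" "p * 8 / ta + p / ta \<le> c" unfolding c_def using nn p by linarith+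
  show "hmix {ta<..} ka 0 x \<le> K x" for x using h0[of x] Kge[OF cc(1), of x] by linarith
  show "norm (gmix {ta<..} ka x) \<le> K x" for x
  proof -
   have "norm (gmix {ta<..} ka x) = norm x * hmix {ta<..} ka 1 x / 2"
    unfolding gmix_def using hn[of ka 1 x] by simp
   also have "\<dots> \<le> norm x * hmix {ta<..} ka 1 x" using hn[of ka 1 x] by simp
   finally show ?thesis using hg[of x] Kge[OF cc(2), of x] by linarith
  qed
  show "norm (hessmix {ta<..} ka x h) \<le> K x * norm h" for x h
  proof -
   have "norm (hessmix {ta<..} ka x h) \<le> hmix {ta<..} ka 2 x / 4 * \<bar>x \<bullet> h\<bar> * norm x + hmix {ta<..} ka 1 x / 2 * norm h"
    unfolding hessmix_def using hn[of ka 1 x] hn[of ka 2 x]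
    by (intro order_trans[OF norm_triangle_ineq4]) (simp add: abs_mult)
   also have "\<dots> \<le> hmix {ta<..} ka 2 x / 4 * (norm x * norm h) * norm x + hmix {ta<..} ka 1 x / 2 * norm h"
    using hn[of ka 2 x] by (intro add_right_mono mult_right_mono mult_left_mono Cauchy_Schwarz_ineq2) auto
   also have "\<dots> = ((norm x)\<^sup>2 * hmix {ta<..} ka 2 x / 4 + hmix {ta<..} ka 1 x / 2) * norm h"
    by (simp add: power2_eq_square algebra_simps)
   also have "\<dots> \<le> ((p * 8 / ta + p / ta) * ?K x) * norm h"
   proof (intro mult_right_mono)
    have "(norm x)\<^sup>2 * hmix {ta<..} ka 2 x / 4 + hmix {ta<..} ka 1 x / 2 \<le> (norm x)\<^sup>2 * hmix {ta<..} ka 2 x + hmix {ta<..} ka 1 x"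
     using hn[of ka 1 x] mult_nonneg_nonneg[OF zero_le_power2 hn[of ka 2 x], of "norm x"] by linarith
    also have "\<dots> \<le> (p * 8 / ta + p / ta) * ?K x" using h2[of x] h1[of x] by (simp only: distrib_right)
    finally show "(norm x)\<^sup>2 * hmix {ta<..} ka 2 x / 4 + hmix {ta<..} ka 1 x / 2 \<le> (p * 8 / ta + p / ta) * ?K x" .
   qed simp
   also have "\<dots> \<le> K x * norm h" by (intro mult_right_mono Kge cc) simp
   finally show ?thesis .
  qed
 qed
qed

lemma fubini_dominated:
 fixes f :: "'a::euclidean_space \<Rightarrow> 'a \<Rightarrow> real"
 assumes "prob_space \<mu>" and sets [measurable_cong]: "sets \<mu> = sets borel"
  and [measurable]: "(\<lambda>(y, z). f y z) \<in> borel_measurable (borel \<Otimes>\<^sub>M borel)"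
  and le: "\<And>y z. \<bar>f y z\<bar> \<le> k (z - y)" and k: "integrable lborel k"
 shows "integrable lborel (\<lambda>z. \<integral>y. f y z \<partial>\<mu>)" "integrable \<mu> (\<lambda>y. \<integral>z. f y z \<partial>lborel)"
  and "(LBINT z. (\<integral>y. f y z \<partial>\<mu>)) = (\<integral>y. (LBINT z. f y z) \<partial>\<mu>)"
proof -
 let ?A = "\<mu> \<Otimes>\<^sub>M lborel"
 interpret P: prob_space \<mu> by fact
 interpret pair_sigma_finite \<mu> lborel ..
 have [measurable]: "k \<in> borel_measurable borel" using k by auto
 have i: "integrable ?A (\<lambda>(y, z). f y z)"
 proof (rule integrableI_bounded)
  show "(\<lambda>(y, z). f y z) \<in> borel_measurable ?A" by measurable
  have "(\<integral>\<^sup>+p. ennreal (norm (case p of (y, z) \<Rightarrow> f y z)) \<partial>?A) =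
    (\<integral>\<^sup>+y. \<integral>\<^sup>+z. ennreal (norm (f y z)) \<partial>lborel \<partial>\<mu>)"
   by (subst lborel.nn_integral_fst[symmetric]) auto
  also have "\<dots> \<le> (\<integral>\<^sup>+y. \<integral>\<^sup>+z. ennreal (norm (k (z + (- y)))) \<partial>lborel \<partial>\<mu>)"
  proof (intro nn_integral_mono ennreal_leI)
   fix y z show "norm (f y z) \<le> norm (k (z + (- y)))" using le[of y z] by simp
  qed
  also have "\<dots> = (\<integral>\<^sup>+y. (\<integral>\<^sup>+z. ennreal (norm (k z)) \<partial>lborel) \<partial>\<mu>)"
   by (subst nn_integral_lborel_shift) auto
  also have "\<dots> < \<infinity>" using k by (simp add: P.emeasure_space_1 integrable_iff_bounded)
  finally show "(\<integral>\<^sup>+p. ennreal (norm (case p of (y, z) \<Rightarrow> f y z)) \<partial>?A) < \<infinity>" .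
 qed
 show "integrable lborel (\<lambda>z. \<integral>y. f y z \<partial>\<mu>)" "integrable \<mu> (\<lambda>y. \<integral>z. f y z \<partial>lborel)"
  and "(LBINT z. (\<integral>y. f y z \<partial>\<mu>)) = (\<integral>y. (LBINT z. f y z) \<partial>\<mu>)"
  using integrable_snd[OF i] integrable_fst[OF i] Fubini_integral[OF i] by auto
qed

section \<open>Integrals against the difference of two laws\<close>

text \<open>\<open>sdiff\<close> integrates against the signed measure \<mu> - \<nu>, and
  \<open>ssum\<close> against \<mu> + \<nu>, which dominates its total variation. The energy of the
  signed measure is a nested \<open>sdiff\<close>.\<close>

locale law_pair =
 fixes \<mu> \<nu> :: "'a::euclidean_space measure"
 assumes prob: "prob_space \<mu>" "prob_space \<nu>"
  and sets_eq [measurable_cong]: "sets \<mu> = sets borel" "sets \<nu> = sets borel"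
begin

definition sdiff :: "('a \<Rightarrow> 'b::{banach, second_countable_topology}) \<Rightarrow> 'b" where
 "sdiff f = (\<integral>x. f x \<partial>\<mu>) - (\<integral>x. f x \<partial>\<nu>)"

definition ssum :: "('a \<Rightarrow> real) \<Rightarrow> real" where
 "ssum f = (\<integral>x. f x \<partial>\<mu>) + (\<integral>x. f x \<partial>\<nu>)"

sublocale M: prob_space \<mu> by (rule prob)
sublocale N: prob_space \<nu> by (rule prob)

lemma space_eq [simp]: "space \<mu> = UNIV" "space \<nu> = UNIV"
 using sets_eq[THEN sets_eq_imp_space_eq] by auto

lemma integrable_bounded:
 fixes f :: "'a \<Rightarrow> 'b::{banach, second_countable_topology}"
 assumes [measurable]: "f \<in> borel_measurable borel" and "\<And>x. norm (f x) \<le> C"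
 shows "integrable \<mu> f" "integrable \<nu> f"
 using assms(2) by (auto intro!: M.integrable_const_bound[of _ C] N.integrable_const_bound[of _ C])

lemma borel_measurable_sdiff [measurable (raw)]:
 fixes f :: "'w \<Rightarrow> 'a \<Rightarrow> 'b::{banach, second_countable_topology}"
 assumes [measurable]: "(\<lambda>(w, x). f w x) \<in> borel_measurable (M \<Otimes>\<^sub>M borel)"
 shows "(\<lambda>w. sdiff (f w)) \<in> borel_measurable M"
 unfolding sdiff_def by measurable

lemma borel_measurable_ssum [measurable (raw)]:
 assumes [measurable]: "(\<lambda>(w, x). f w x) \<in> borel_measurable (M \<Otimes>\<^sub>M borel)"
 shows "(\<lambda>w. ssum (f w)) \<in> borel_measurable M"
 unfolding ssum_def by measurable

lemma sdiff_add:
 assumes "f \<in> borel_measurable borel" "\<And>x. norm (f x) \<le> C" "g \<in> borel_measurable borel" "\<And>x. norm (g x) \<le> D"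
 shows "sdiff (\<lambda>x. f x + g x) = sdiff f + sdiff g" "sdiff (\<lambda>x. f x - g x) = sdiff f - sdiff g"
 unfolding sdiff_def using integrable_bounded[OF assms(1,2)] integrable_bounded[OF assms(3,4)] by simp_all

lemma sdiff_linear:
 assumes "bounded_linear T" "f \<in> borel_measurable borel" "\<And>x. norm (f x) \<le> C"
 shows "sdiff (\<lambda>x. T (f x)) = T (sdiff f)"
 unfolding sdiff_def using integrable_bounded[OF assms(2,3)] assms(1)
 by (simp add: integral_bounded_linear linear_diff bounded_linear.linear)

lemma ssum_nonneg: "(\<And>x. 0 \<le> f x) \<Longrightarrow> 0 \<le> ssum f"
 unfolding ssum_def by (intro add_nonneg_nonneg Bochner_Integration.integral_nonneg) auto

lemma ssum_le: 
 assumes "f \<in> borel_measurable borel" "\<And>x. 0 \<le> f x" "\<And>x. f x \<le> C"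
 shows "ssum f \<le> 2 * C"
proof -
 have "\<And>x. norm (f x) \<le> C" using assms by auto
 from integrable_bounded[OF assms(1) this] show ?thesis
  unfolding ssum_def using M.integral_le_const[of f C] N.integral_le_const[of f C] assms(3) by auto
qed

lemma ssum_mult: "ssum (\<lambda>x. c * f x) = c * ssum f"
 unfolding ssum_def by (simp add: algebra_simps)

lemma norm_sdiff_le:
 fixes f :: "'a \<Rightarrow> 'b::{banach, second_countable_topology}"
 assumes "f \<in> borel_measurable borel" "g \<in> borel_measurable borel" "\<And>x. norm (f x) \<le> g x" "\<And>x. g x \<le> C"
 shows "norm (sdiff f) \<le> ssum g"
proof -
 have f: "integrable \<mu> f" "integrable \<nu> f"
  using integrable_bounded[OF assms(1), of C] assms(3,4) order_trans by blast+
 have g: "integrable \<mu> g" "integrable \<nu> g"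
 proof -
  have "norm (g x) \<le> C" for x using order_trans[OF norm_ge_zero assms(3)[of x]] assms(4)[of x] by simp
  then show "integrable \<mu> g" "integrable \<nu> g" using integrable_bounded[OF assms(2)] by blast+
 qed
 have "norm (\<integral>x. f x \<partial>\<mu>) \<le> (\<integral>x. g x \<partial>\<mu>)" "norm (\<integral>x. f x \<partial>\<nu>) \<le> (\<integral>x. g x \<partial>\<nu>)"
  using f g assms(3) by (auto intro!: Bochner_Integration.integral_norm_bound_integral)
 then show ?thesis unfolding sdiff_def ssum_def using norm_triangle_ineq4 by (smt (verit, best))
qed

lemma sdiff_fubini:
 fixes f :: "'a \<Rightarrow> 'a \<Rightarrow> real"
 assumes "(\<lambda>(y, z). f y z) \<in> borel_measurable (borel \<Otimes>\<^sub>M borel)"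
  and "\<And>y z. \<bar>f y z\<bar> \<le> k (z - y)" and "integrable lborel k"
 shows "integrable lborel (\<lambda>z. sdiff (\<lambda>y. f y z))"
  and "(LBINT z. sdiff (\<lambda>y. f y z)) = sdiff (\<lambda>y. \<integral>z. f y z \<partial>lborel)"
  and "integrable lborel (\<lambda>z. ssum (\<lambda>y. f y z))"
  and "(LBINT z. ssum (\<lambda>y. f y z)) = ssum (\<lambda>y. \<integral>z. f y z \<partial>lborel)"
 unfolding sdiff_def ssum_def
 using fubini_dominated[OF prob(1) sets_eq(1) assms] fubini_dominated[OF prob(2) sets_eq(2) assms]
 by auto

lemma sdiff_has_derivative:
 fixes f :: "'a \<Rightarrow> 'b::euclidean_space"
 assumes der: "\<And>w. (f has_derivative f' w) (at w)"
  and bnd: "\<And>w h. norm (f' w h) \<le> C * norm h" and f: "\<And>w. norm (f w) \<le> D"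
 shows "((\<lambda>z. sdiff (\<lambda>y. f (z - y))) has_derivative (\<lambda>h. sdiff (\<lambda>y. f' (z - y) h))) (at z)"
proof -
 have [measurable]: "f \<in> borel_measurable borel" using der by (rule borel_measurable_differentiable)
 have [measurable]: "(\<lambda>w. f' w h) \<in> borel_measurable borel" for h using der by (rule borel_measurable_has_derivative)
 have d: "((\<lambda>z. f (z - y)) has_derivative f' (z - y)) (at z)" for z y
 proof -
  have "((\<lambda>z. z - y) has_derivative (\<lambda>h. h)) (at z)" by (auto intro!: derivative_eq_intros)
  from has_derivative_compose[OF this der] show ?thesis .
 qed
 have "((\<lambda>z. \<integral>y. f (z - y) \<partial>L) has_derivative (\<lambda>h. \<integral>y. f' (z - y) h \<partial>L)) (at z within UNIV)"
  if L: "prob_space L" and [measurable_cong]: "sets L = sets borel" for L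
 proof (rule has_derivative_lebesgue_integral[where B = "\<lambda>_. C"])
  interpret prob_space L by fact
  show "integrable L (\<lambda>y. f (z - y))" for z using f by (intro integrable_const_bound[of _ D]) auto
  show "integrable L (\<lambda>_. C)" by simp
 qed (use bnd d in auto)
 from has_derivative_diff[OF this[OF prob(1) sets_eq(1)] this[OF prob(2) sets_eq(2)]]
 show ?thesis unfolding sdiff_def .
qed

end

text \<open>Obtained from \<open>hmix_convolution\<close> by differentiation in y under the integral
  sign and uniqueness of the derivative.\<close>

lemma gmix_convolution:
 fixes x y v :: "'a::euclidean_space"
 assumes ka: "0 < ka" and ta: "0 < ta"
 shows "(LBINT z. (exp (- ka\<^sup>2 * ta) * heat ta (x - z)) * (v \<bullet> gmix {ta<..} ka (z - y))) = v \<bullet> gmix {2 * ta<..} ka (x - y)"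
proof -
 let ?A = "\<lambda>h. - (h \<bullet> gmix {2 * ta<..} ka (x - y))"
 obtain K :: "'a \<Rightarrow> real" and C where K: "\<And>x. K x \<le> C" "\<And>x. 0 \<le> K x" "\<And>x. hmix {ta<..} ka 0 x \<le> K x" "\<And>x. norm (gmix {ta<..} ka x) \<le> K x"
  using hmix_cut_dominated[OF ka ta] by metis
 have at: "hmix_at {ta<..} w" "hmix_at {2 * ta<..} w" for w :: 'a
  using ta hmix_atI_cut[of "{ta<..}" ta w] hmix_atI_cut[of "{2 * ta<..}" "2 * ta" w] by auto
 have sh: "((\<lambda>y. hmix A ka 0 (c - y)) has_derivative (\<lambda>h. - (h \<bullet> gmix A ka (c - y)))) (at y)"
  if "\<And>w::'a. hmix_at A w" for A and c y :: 'a
 proof -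
  have "((\<lambda>y. c - y) has_derivative (\<lambda>h. - h)) (at y)" by (auto intro!: derivative_eq_intros)
  from has_derivative_compose[OF this hmix_has_derivative_gmix[OF that ka]] show ?thesis by (simp add: inner_commute)
 qed
 let ?q = "\<lambda>z. exp (- ka\<^sup>2 * ta) * heat ta (x - z)"
 have "((\<lambda>y. \<integral>z. ?q z * hmix {ta<..} ka 0 (z - y) \<partial>lborel) has_derivative
   (\<lambda>h. \<integral>z. ?q z * (- (h \<bullet> gmix {ta<..} ka (z - y))) \<partial>lborel)) (at y within UNIV)"
 proof (rule has_derivative_lebesgue_integral[where B = "\<lambda>z. ?q z * C"])
  show "integrable lborel (\<lambda>z. ?q z * C)" by (simp add: integrable_heat(3)[OF ta])
  show "integrable lborel (\<lambda>z. ?q z * hmix {ta<..} ka 0 (z - y))" for y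
  proof (rule Bochner_Integration.integrable_bound)
   show "integrable lborel (\<lambda>z. ?q z * C)" by (simp add: integrable_heat(3)[OF ta])
   show "AE z in lborel. norm (?q z * hmix {ta<..} ka 0 (z - y)) \<le> norm (?q z * C)"
   proof (rule AE_I2)
    fix z
    have "\<bar>hmix {ta<..} ka 0 (z - y)\<bar> \<le> \<bar>C\<bar>"
     using K(1,3)[of "z - y"] ta by (subst abs_of_nonneg) (auto simp: subset_iff)
    then show "norm (?q z * hmix {ta<..} ka 0 (z - y)) \<le> norm (?q z * C)"
     unfolding real_norm_def abs_mult by (intro mult_left_mono) auto
   qed
  qed measurable
  show "((\<lambda>y. ?q z * hmix {ta<..} ka 0 (z - y)) has_derivative (\<lambda>h. ?q z * (- (h \<bullet> gmix {ta<..} ka (z - y))))) (at y)" for y z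
   by (intro has_derivative_mult_right sh at)
  show "norm (?q z * (- (h \<bullet> gmix {ta<..} ka (z - y)))) \<le> ?q z * C * norm h" for y z h
  proof -
   have "\<bar>h \<bullet> gmix {ta<..} ka (z - y)\<bar> \<le> norm h * C"
    by (rule order_trans[OF Cauchy_Schwarz_ineq2]) (use K(1,4)[of "z - y"] in \<open>auto intro!: mult_left_mono\<close>)
   then show ?thesis by (simp add: abs_mult mult.assoc mult.commute[of C] mult_left_mono)
  qed
 qed auto
 moreover have "((\<lambda>y. \<integral>z. ?q z * hmix {ta<..} ka 0 (z - y) \<partial>lborel) has_derivative ?A) (at y)"
  unfolding hmix_convolution[OF ka ta ta] mult_2[symmetric] by (intro sh at)
 ultimately have "(\<lambda>h. \<integral>z. ?q z * (- (h \<bullet> gmix {ta<..} ka (z - y))) \<partial>lborel) = ?A"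
  by (auto intro: has_derivative_unique)
 from fun_cong[OF this, of v] show ?thesis by simp
qed

lemma has_derivative_bound_imp_lipschitz:
 fixes u :: "'a::real_normed_vector \<Rightarrow> 'b::real_normed_vector"
 assumes "\<And>z. (u has_derivative u' z) (at z)" "\<And>z h. norm (u' z h) \<le> L * norm h" "0 \<le> L"
 shows "norm (u x - u y) \<le> L * norm (x - y)"
 by (rule differentiable_bound[of UNIV u u'])
  (use assms in \<open>auto intro!: onorm_bound has_derivative_at_withinI\<close>)

context law_pair begin

text \<open>Let H be the potential of the signed measure for times above \<open>ta\<close>, P its
  gradient, and Q the signed measure smeared by the screened heat kernel of time \<open>ta\<close>.
  Then Q is the source of H, and by \<open>hmix_convolution\<close> \<open>E0\<close> is the
  integral of Q H, hence a Dirichlet energy. In the commutator u is taken at x; freezing it at the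
  smearing point z gives the stress tensor term. The remainder contains u x - u z, at most L norm (x
  - z), and against the heat kernel this is of size L sqrt ta.\<close>

lemma commutator_estimate:
 fixes u :: "'a \<Rightarrow> 'a"
 assumes ka: "0 < ka" and ta: "0 < ta"
  and u: "\<And>z. (u has_derivative u' z) (at z)" and uB: "\<And>z. norm (u z) \<le> B"
  and uL: "\<And>z h. norm (u' z h) \<le> L * norm h" and L: "0 \<le> L"
 defines "E0 \<equiv> sdiff (\<lambda>x. sdiff (\<lambda>y. hmix {2 * ta<..} ka 0 (x - y)))"
 shows "0 \<le> E0"
  and "\<bar>sdiff (\<lambda>x. sdiff (\<lambda>y. u x \<bullet> gmix {2 * ta<..} ka (x - y)))\<bar>
   \<le> (2 + real DIM('a)) * L * E0 + 2 powr real DIM('a) * 4 * L * ta * ssum (\<lambda>x. ssum (\<lambda>y. heat (4 * ta) (x - y)))"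
  and "integrable lborel (\<lambda>z. (sdiff (\<lambda>y. hmix {ta<..} ka 0 (z - y)))\<^sup>2)"
   "ka\<^sup>2 * (LBINT z. (sdiff (\<lambda>y. hmix {ta<..} ka 0 (z - y)))\<^sup>2) \<le> E0"
  and "(\<And>z. sdiff (\<lambda>y. hmix {ta<..} ka 0 (z - y)) = 0) \<Longrightarrow> sdiff (\<lambda>x. heat ta (x - z)) = 0"
proof -
 obtain K0 :: "'a \<Rightarrow> real" and C where K0: "integrable lborel K0" and K0m [measurable]: "K0 \<in> borel_measurable borel"
  and K0C: "\<And>x. K0 x \<le> C" and K0n: "\<And>x. 0 \<le> K0 x" and K0e: "\<And>x. K0 (- x) = K0 x"
  and mK: "\<And>x. hmix {ta<..} ka 0 x \<le> K0 x" and gK: "\<And>x. norm (gmix {ta<..} ka x) \<le> K0 x"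
  and hK: "\<And>x h. norm (hessmix {ta<..} ka x h) \<le> K0 x * norm h"
  using hmix_cut_dominated[OF ka ta] by metis
 have C0: "0 \<le> C" using K0n[of 0] K0C[of 0] by linarith
 have sub: "{ta<..} \<subseteq> {0<..}" using ta by auto
 have mK': "\<bar>hmix {ta<..} ka 0 x\<bar> \<le> K0 x" for x
  using mK[of x] hmix_nonneg[OF sub, of ka 0 x] by simp
 have at: "hmix_at {ta<..} w" for w :: 'a using ta hmix_atI_cut[of "{ta<..}" ta w] by auto
 let ?m = "hmix {ta<..} ka 0 :: 'a \<Rightarrow> real" and ?g = "gmix {ta<..} ka :: 'a \<Rightarrow> 'a"
 let ?q = "\<lambda>w. exp (- ka\<^sup>2 * ta) * heat ta w :: real"
 have md: "(?m has_derivative (\<lambda>h. ?g w \<bullet> h)) (at w)" for w by (rule hmix_has_derivative_gmix[OF at ka])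
 have gd: "(?g has_derivative hessmix {ta<..} ka w) (at w)" for w
  using gmix_has_derivative[OF at ka] by (simp add: hessmix_def[abs_def])
 have hm [measurable]: "(\<lambda>w. hessmix {ta<..} ka w h) \<in> borel_measurable borel" for h :: 'a
  unfolding hessmix_def by measurable
 have um [measurable]: "u \<in> borel_measurable borel" by (rule borel_measurable_differentiable[OF u])
 define H where "H z = sdiff (\<lambda>y. ?m (z - y))" for z
 define P where "P z = sdiff (\<lambda>y. ?g (z - y))" for z
 define P' where "P' z h = sdiff (\<lambda>y. hessmix {ta<..} ka (z - y) h)" for z h
 define K where "K z = ssum (\<lambda>y. K0 (z - y))" for z
 define Q where "Q z = sdiff (\<lambda>x. ?q (x - z))" for z
 have gC: "norm (?g w) \<le> C" for w using gK[of w] K0C[of w] by linarith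
 have mC: "norm (?m w) \<le> C" for w using mK'[of w] K0C[of w] by simp
 have hC: "norm (hessmix {ta<..} ka w h) \<le> C * norm h" for w h :: 'a
  using hK[of w h] mult_right_mono[OF K0C[of w] norm_ge_zero[of h]] by linarith
 have Hd: "(H has_derivative (\<lambda>h. P z \<bullet> h)) (at z)" for z
 proof -
  have "(H has_derivative (\<lambda>h. sdiff (\<lambda>y. ?g (z - y) \<bullet> h))) (at z)"
   unfolding H_def[abs_def]
  proof (rule sdiff_has_derivative[OF md, of C C])
   show "norm (?g w \<bullet> h) \<le> C * norm h" for w h
    using Cauchy_Schwarz_ineq2[of "?g w" h] mult_right_mono[OF gC[of w] norm_ge_zero[of h]] by simp
  qed (use mC in auto)
  moreover have "sdiff (\<lambda>y. ?g (z - y) \<bullet> h) = P z \<bullet> h" for h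
   unfolding P_def using gC by (intro sdiff_linear[OF bounded_linear_inner_left, of _ C]) auto
  ultimately show ?thesis by simp
 qed
 have Pd: "(P has_derivative P' z) (at z)" for z
  unfolding P_def[abs_def] P'_def[abs_def]
  by (rule sdiff_has_derivative[OF gd, of C C]) (use hC gC in auto)
 have P'inner: "P' z h \<bullet> k = sdiff (\<lambda>y. hessmix {ta<..} ka (z - y) h \<bullet> k)" for z h k
  unfolding P'_def using hC by (intro sdiff_linear[OF bounded_linear_inner_left, of _ "C * norm h", symmetric]) auto
 have sym: "P' z h \<bullet> k = P' z k \<bullet> h" for z h k
 proof -
  have "hessmix {ta<..} ka w h \<bullet> k = hessmix {ta<..} ka w k \<bullet> h" for w
   unfolding hessmix_def by (simp add: inner_diff_left inner_commute[of h k])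
  then show ?thesis unfolding P'inner by simp
 qed
 have Ki: "integrable lborel K"
  unfolding K_def[abs_def]
 proof (rule sdiff_fubini(3)[OF _ _ K0])
  show "\<bar>K0 (z - y)\<bar> \<le> K0 (z - y)" for z y using K0n[of "z - y"] by simp
 qed measurable
 have KM: "K z \<le> 2 * C" for z
  unfolding K_def by (rule ssum_le) (use K0n K0C in auto)
 have HK: "\<bar>H z\<bar> \<le> K z" for z
  using norm_sdiff_le[of "\<lambda>y. ?m (z - y)" "\<lambda>y. K0 (z - y)" C] mK' K0C unfolding H_def K_def by simp
 have PK: "norm (P z) \<le> K z" for z
  using norm_sdiff_le[of "\<lambda>y. ?g (z - y)" "\<lambda>y. K0 (z - y)" C] gK K0C unfolding P_def K_def by simp
 have P'K: "norm (P' z h) \<le> K z * norm h" for z h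
 proof -
  have "norm (P' z h) \<le> ssum (\<lambda>y. norm h * K0 (z - y))"
   unfolding P'_def
  proof (rule norm_sdiff_le)
   show "norm (hessmix {ta<..} ka (z - y) h) \<le> norm h * K0 (z - y)" for y
    using hK[of "z - y" h] by (simp add: mult.commute)
   show "norm h * K0 (z - y) \<le> norm h * C" for y by (intro mult_left_mono K0C) auto
  qed measurable
  then show ?thesis unfolding K_def ssum_mult by (simp add: mult.commute)
 qed
 \<comment> \<open>The screened Poisson equation integrated against the signed measure; the trace of
   the Hessian is the Laplacian.\<close>
 have Qeq: "Q z = ka\<^sup>2 * H z - (\<Sum>b\<in>Basis. P' z b \<bullet> b)" for z
 proof -
  have exp2: "(\<Sum>b\<in>Basis. (w \<bullet> b) * (w \<bullet> b)) = (norm w)\<^sup>2" for w :: 'a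
   by (simp add: euclidean_inner[symmetric] power2_norm_eq_inner)
  have tr: "(\<Sum>b\<in>Basis. hessmix {ta<..} ka w b \<bullet> b) = (norm w)\<^sup>2 / 4 * hmix {ta<..} ka 2 w - real DIM('a) / 2 * hmix {ta<..} ka 1 w" for w :: 'a
  proof -
   have "(\<Sum>b\<in>Basis. hessmix {ta<..} ka w b \<bullet> b) =
     (\<Sum>b\<in>(Basis :: 'a set). (hmix {ta<..} ka 2 w / 4) * ((w \<bullet> b) * (w \<bullet> b)) - hmix {ta<..} ka 1 w / 2)"
    by (rule sum.cong) (simp_all add: hessmix_def inner_diff_left)
   then show ?thesis by (simp only: sum_subtractf sum_distrib_left[symmetric] exp2) simp
  qed
  have q: "?q (x - z) = ka\<^sup>2 * ?m (z - x) - (\<Sum>b\<in>Basis. hessmix {ta<..} ka (z - x) b \<bullet> b)" for x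
   using hmix_screened_poisson[OF ka ta, of "z - x"] unfolding tr by (simp add: heat_minus_commute[of _ x z])
  have trC: "norm (\<Sum>b\<in>Basis. hessmix {ta<..} ka w b \<bullet> b) \<le> real DIM('a) * C" for w :: 'a
  proof (rule order_trans[OF norm_sum])
   have "norm (hessmix {ta<..} ka w b \<bullet> b) \<le> C" if "b \<in> Basis" for b
    using Cauchy_Schwarz_ineq2[of "hessmix {ta<..} ka w b" b] hC[of w b] that by simp
   then show "(\<Sum>b\<in>Basis. norm (hessmix {ta<..} ka w b \<bullet> b)) \<le> real DIM('a) * C"
    using sum_mono[of Basis "\<lambda>b. norm (hessmix {ta<..} ka w b \<bullet> b)" "\<lambda>_. C"] by simp
  qed
  have "Q z = sdiff (\<lambda>x. ka\<^sup>2 * ?m (z - x)) - sdiff (\<lambda>x. \<Sum>b\<in>Basis. hessmix {ta<..} ka (z - x) b \<bullet> b)"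
   unfolding Q_def q
  proof (rule sdiff_add(2))
   show "norm (ka\<^sup>2 * ?m (z - x)) \<le> ka\<^sup>2 * C" for x using mC[of "z - x"] by (simp add: abs_mult mult_left_mono)
  qed (use trC in auto)
  also have "sdiff (\<lambda>x. ka\<^sup>2 * ?m (z - x)) = ka\<^sup>2 * H z"
   unfolding H_def using mC by (intro sdiff_linear[OF bounded_linear_mult_right, of _ C]) auto
  also have "sdiff (\<lambda>x. \<Sum>b\<in>Basis. hessmix {ta<..} ka (z - x) b \<bullet> b) = (\<Sum>b\<in>Basis. sdiff (\<lambda>x. hessmix {ta<..} ka (z - x) b \<bullet> b))"
  proof -
   have "integrable \<mu> (\<lambda>x. hessmix {ta<..} ka (z - x) b \<bullet> b)" "integrable \<nu> (\<lambda>x. hessmix {ta<..} ka (z - x) b \<bullet> b)" if "b \<in> Basis" for b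
   proof -
    have "norm (hessmix {ta<..} ka (z - x) b \<bullet> b) \<le> C" for x
     using Cauchy_Schwarz_ineq2[of "hessmix {ta<..} ka (z - x) b" b] hC[of "z - x" b] that by simp
    then show "integrable \<mu> (\<lambda>x. hessmix {ta<..} ka (z - x) b \<bullet> b)" "integrable \<nu> (\<lambda>x. hessmix {ta<..} ka (z - x) b \<bullet> b)"
     by (intro integrable_bounded[where C = C]; measurable)+
   qed
   then show ?thesis unfolding sdiff_def by (simp add: sum_subtractf)
  qed
  finally show ?thesis by (simp add: P'inner)
 qed
 note st = stress_tensor_identities[OF Hd Pd sym Ki KM HK PK P'K Qeq u uB uL]
 let ?E = "\<lambda>z. (norm (P z))\<^sup>2 + ka\<^sup>2 * (H z)\<^sup>2"
 have Hm [measurable]: "H \<in> borel_measurable borel" by (rule borel_measurable_differentiable[OF Hd])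
 have Pm [measurable]: "P \<in> borel_measurable borel" by (rule borel_measurable_differentiable[OF Pd])
 have q0: "0 \<le> ?q w" for w :: 'a by simp
 define q1 where "q1 = heat ta (0::'a)"
 have q1: "?q w \<le> q1" "0 \<le> q1" for w :: 'a
 proof -
  have "?q w \<le> 1 * heat ta w" using ta by (intro mult_right_mono) auto
  then show "?q w \<le> q1" using heat_le_at_0[OF ta, of w] by (simp add: q1_def)
 qed (simp add: q1_def)
 have qi: "integrable lborel (\<lambda>w. c * ?q w)" for c
  by (intro integrable_mult_right integrable_heat(1)[OF ta])
 have HC: "\<bar>H z\<bar> \<le> 2 * C" for z using HK[of z] KM[of z] by linarith
 have PC: "norm (P z) \<le> 2 * C" for z using PK[of z] KM[of z] by linarith
 have inner1: "(LBINT z. ?q (x - z) * H z) = sdiff (\<lambda>y. hmix {2 * ta<..} ka 0 (x - y))" for x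
 proof -
  have "?q (x - z) * H z = sdiff (\<lambda>y. ?q (x - z) * ?m (z - y))" for z
   unfolding H_def using mC by (intro sdiff_linear[OF bounded_linear_mult_right, symmetric, of _ C]) auto
  then have "(LBINT z. ?q (x - z) * H z) = sdiff (\<lambda>y. \<integral>z. ?q (x - z) * ?m (z - y) \<partial>lborel)"
  proof (simp only:, intro sdiff_fubini(2))
   show "\<bar>?q (x - z) * ?m (z - y)\<bar> \<le> q1 * K0 (z - y)" for y z
    unfolding abs_mult by (intro mult_mono) (use q1 mK' in auto)
   show "integrable lborel (\<lambda>w. q1 * K0 w)" using K0 by simp
  qed measurable
  then show ?thesis by (simp only: hmix_convolution[OF ka ta ta] mult_2)
 qed
 have E0_eq: "E0 = (LBINT z. ?E z)"
 proof -
  have "E0 = sdiff (\<lambda>x. \<integral>z. ?q (x - z) * H z \<partial>lborel)" unfolding E0_def inner1 ..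
  also have "\<dots> = (LBINT z. sdiff (\<lambda>x. ?q (x - z) * H z))"
  proof (rule sdiff_fubini(2)[symmetric])
   show "\<bar>?q (x - z) * H z\<bar> \<le> 2 * C * ?q (z - x)" for x z
    using mult_left_mono[OF HC[of z] q0[of "x - z"]] by (simp add: abs_mult heat_minus_commute[of _ z x] mult.commute)
  qed (measurable, rule qi)
  also have "\<dots> = (LBINT z. Q z * H z)"
   unfolding Q_def using q1 q0
   by (intro Bochner_Integration.integral_cong refl sdiff_linear[OF bounded_linear_mult_left, of _ q1]) auto
  finally show ?thesis using st(2) by simp
 qed
 show E0n: "0 \<le> E0" unfolding E0_eq by (intro Bochner_Integration.integral_nonneg) simp
 have H2: "integrable lborel (\<lambda>z. ka\<^sup>2 * (H z)\<^sup>2)"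
  by (rule Bochner_Integration.integrable_bound[OF st(1)]) auto
 then show "integrable lborel (\<lambda>z. (sdiff (\<lambda>y. hmix {ta<..} ka 0 (z - y)))\<^sup>2)"
  using ka unfolding H_def by (simp add: mult.commute[of "ka\<^sup>2"])
 show "ka\<^sup>2 * (LBINT z. (sdiff (\<lambda>y. hmix {ta<..} ka 0 (z - y)))\<^sup>2) \<le> E0"
  unfolding E0_eq integral_mult_right_zero[symmetric] H_def[symmetric] by (rule integral_mono[OF H2 st(1)]) simp
 \<comment> \<open>A potential that vanishes identically has vanishing derivatives, hence a
   vanishing source.\<close>
 show "sdiff (\<lambda>x. heat ta (x - z)) = 0" if "\<And>z. sdiff (\<lambda>y. hmix {ta<..} ka 0 (z - y)) = 0"
 proof -
  have H0: "H = (\<lambda>z. 0)" using that by (simp add: H_def[abs_def])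
  have P0: "P = (\<lambda>z. 0)"
  proof
   fix z
   have "((\<lambda>z. 0) has_derivative (\<lambda>h. P z \<bullet> h)) (at z)" using Hd[of z] unfolding H0 .
   from has_derivative_unique[OF this has_derivative_const] show "P z = 0" by (metis inner_eq_zero_iff)
  qed
  have "P' z = (\<lambda>h. 0)" using has_derivative_unique[OF Pd[of z, unfolded P0] has_derivative_const] .
  then have "Q z = 0" unfolding Qeq H0 by simp
  moreover have "Q z = exp (- ka\<^sup>2 * ta) * sdiff (\<lambda>x. heat ta (x - z))"
   unfolding Q_def using heat_le_at_0[OF ta] by (intro sdiff_linear[OF bounded_linear_mult_right, of _ q1]) (auto simp: q1_def)
  ultimately show ?thesis by simp
 qed
 define A where "A = sdiff (\<lambda>x. sdiff (\<lambda>y. u x \<bullet> gmix {2 * ta<..} ka (x - y)))"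
 \<comment> \<open>The error made by evaluating u at the smearing point z instead of at x.\<close>
 define R where "R z = sdiff (\<lambda>x. ?q (x - z) * ((u x - u z) \<bullet> P z))" for z
 have inner2: "(LBINT z. ?q (x - z) * (u x \<bullet> P z)) = sdiff (\<lambda>y. u x \<bullet> gmix {2 * ta<..} ka (x - y))" for x
 proof -
  have "?q (x - z) * (u x \<bullet> P z) = sdiff (\<lambda>y. ?q (x - z) * (u x \<bullet> ?g (z - y)))" for z
   unfolding P_def using gC
   by (intro sdiff_linear[OF bounded_linear_compose[OF bounded_linear_mult_right bounded_linear_inner_right], symmetric, of _ C]) auto
  then have "(LBINT z. ?q (x - z) * (u x \<bullet> P z)) = sdiff (\<lambda>y. \<integral>z. ?q (x - z) * (u x \<bullet> ?g (z - y)) \<partial>lborel)"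
  proof (simp only:, intro sdiff_fubini(2))
   show "\<bar>?q (x - z) * (u x \<bullet> ?g (z - y))\<bar> \<le> q1 * B * K0 (z - y)" for y z
   proof -
    have "\<bar>u x \<bullet> ?g (z - y)\<bar> \<le> B * K0 (z - y)"
     by (rule order_trans[OF Cauchy_Schwarz_ineq2 mult_mono])
      (use uB gK order_trans[OF norm_ge_zero uB] in auto)
    then have "\<bar>?q (x - z)\<bar> * \<bar>u x \<bullet> ?g (z - y)\<bar> \<le> q1 * (B * K0 (z - y))"
     by (intro mult_mono) (use q1 in auto)
    then show ?thesis by (simp only: abs_mult mult.assoc)
   qed
   show "integrable lborel (\<lambda>w. q1 * B * K0 w)" using K0 by simp
  qed measurable
  then show ?thesis by (simp only: gmix_convolution[OF ka ta])
 qed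
 have B0: "0 \<le> B" using order_trans[OF norm_ge_zero uB] .
 have uPb: "\<bar>u x \<bullet> P z\<bar> \<le> B * (2 * C)" for x z
  by (rule order_trans[OF Cauchy_Schwarz_ineq2 mult_mono]) (use uB PC B0 in auto)
 have i1: "integrable lborel (\<lambda>z. sdiff (\<lambda>x. ?q (x - z) * (u x \<bullet> P z)))"
  and A_eq: "A = (LBINT z. sdiff (\<lambda>x. ?q (x - z) * (u x \<bullet> P z)))"
 proof -
  have b: "\<bar>?q (x - z) * (u x \<bullet> P z)\<bar> \<le> B * (2 * C) * ?q (z - x)" for x z
   using mult_left_mono[OF uPb[of x z] q0[of "x - z"]] by (simp add: abs_mult heat_minus_commute[of _ z x] mult.commute)
  have m: "(\<lambda>(x, z). ?q (x - z) * (u x \<bullet> P z)) \<in> borel_measurable (borel \<Otimes>\<^sub>M borel)" by measurable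
  show "integrable lborel (\<lambda>z. sdiff (\<lambda>x. ?q (x - z) * (u x \<bullet> P z)))"
   by (rule sdiff_fubini(1)[OF m b qi])
  show "A = (LBINT z. sdiff (\<lambda>x. ?q (x - z) * (u x \<bullet> P z)))"
   unfolding A_def inner2[symmetric] by (rule sdiff_fubini(2)[OF m b qi, symmetric])
 qed
 have split: "sdiff (\<lambda>x. ?q (x - z) * (u x \<bullet> P z)) = Q z * (u z \<bullet> P z) + R z" for z
 proof -
  have 1: "norm (?q (x - z) * (u y \<bullet> P z)) \<le> q1 * (B * (2 * C))" for x y
   unfolding real_norm_def abs_mult[of "?q (x - z)"] by (intro mult_mono) (use q1 uPb B0 C0 in auto)
  have "sdiff (\<lambda>x. ?q (x - z) * (u x \<bullet> P z)) = sdiff (\<lambda>x. ?q (x - z) * (u z \<bullet> P z) + ?q (x - z) * ((u x - u z) \<bullet> P z))"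
   by (simp add: algebra_simps)
  also have "\<dots> = sdiff (\<lambda>x. ?q (x - z) * (u z \<bullet> P z)) + R z"
   unfolding R_def
  proof (rule sdiff_add(1))
   show "norm (?q (x - z) * ((u x - u z) \<bullet> P z)) \<le> q1 * (B * (2 * C)) + q1 * (B * (2 * C))" for x
    unfolding inner_diff_left right_diff_distrib
    by (rule order_trans[OF norm_triangle_ineq4 add_mono[OF 1 1]])
  qed (use 1 in auto)
  also have "sdiff (\<lambda>x. ?q (x - z) * (u z \<bullet> P z)) = Q z * (u z \<bullet> P z)"
   unfolding Q_def using q1 q0 by (intro sdiff_linear[OF bounded_linear_mult_left, of _ q1]) auto
  finally show ?thesis .
 qed
 \<comment> \<open>The constant of \<open>norm_heat_le\<close>: norm (x - z) times a heat kernel of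
   time ta costs a multiple of sqrt ta and a doubling of the time.\<close>
 define c where "c = 2 powr (real DIM('a) / 2) * sqrt (8 * ta)"
 have c0: "0 \<le> c" unfolding c_def using ta by simp
 define W where "W z = ssum (\<lambda>x. heat (2 * ta) (x - z))" for z
 define w1 where "w1 = heat (2 * ta) (0::'a)"
 have w1: "heat (2 * ta) w \<le> w1" "0 \<le> w1" for w :: 'a
  unfolding w1_def using heat_le_at_0[of "2 * ta" w] ta by auto
 have W0: "0 \<le> W z" and W1: "W z \<le> 2 * w1" for z
  unfolding W_def using w1 by (auto intro!: ssum_nonneg ssum_le)
 have Wm [measurable]: "W \<in> borel_measurable borel" unfolding W_def by measurable
 have Rb: "\<bar>R z\<bar> \<le> L / 2 * (?E z + c\<^sup>2 * (W z)\<^sup>2)" for z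
 proof -
  have "norm (R z) \<le> ssum (\<lambda>x. (c * L * norm (P z)) * heat (2 * ta) (x - z))"
   unfolding R_def
  proof (rule norm_sdiff_le)
   show "norm (?q (x - z) * ((u x - u z) \<bullet> P z)) \<le> (c * L * norm (P z)) * heat (2 * ta) (x - z)" for x
   proof -
    have "\<bar>(u x - u z) \<bullet> P z\<bar> \<le> L * norm (x - z) * norm (P z)"
     by (rule order_trans[OF Cauchy_Schwarz_ineq2])
      (use has_derivative_bound_imp_lipschitz[OF u uL L] in \<open>auto intro!: mult_right_mono\<close>)
    then have "?q (x - z) * \<bar>(u x - u z) \<bullet> P z\<bar> \<le> heat ta (x - z) * (L * norm (x - z) * norm (P z))"
     using ta by (intro mult_mono) (auto intro: mult_left_le_one_le)
    also have "\<dots> = (norm (x - z) * heat ta (x - z)) * (L * norm (P z))" by simp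
    also have "\<dots> \<le> (c * heat (2 * ta) (x - z)) * (L * norm (P z))"
     using norm_heat_le[OF ta, of "x - z"] L unfolding c_def by (intro mult_right_mono) auto
    finally show ?thesis using q0[of "x - z"] by (simp add: abs_mult mult_ac)
   qed
   show "(c * L * norm (P z)) * heat (2 * ta) (x - z) \<le> (c * L * norm (P z)) * w1" for x
    using c0 L w1 by (intro mult_left_mono) auto
  qed measurable
  then have "\<bar>R z\<bar> \<le> L * (norm (P z) * (c * W z))" unfolding ssum_mult W_def by (simp add: mult_ac)
  also have "\<dots> \<le> L * (((norm (P z))\<^sup>2 + (c * W z)\<^sup>2) / 2)"
   using L sum_squares_bound[of "norm (P z)" "c * W z"] by (intro mult_left_mono) auto
  also have "\<dots> \<le> L * ((?E z + c\<^sup>2 * (W z)\<^sup>2) / 2)"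
   using L by (intro mult_left_mono) (auto simp: power_mult_distrib)
  finally show ?thesis by simp
 qed
 \<comment> \<open>Squaring doubles the time once more: two heat kernels of time 2 ta convolve to
   one of time 4 ta.\<close>
 have W2: "integrable lborel (\<lambda>z. (W z)\<^sup>2)" "(LBINT z. (W z)\<^sup>2) = ssum (\<lambda>x. ssum (\<lambda>y. heat (4 * ta) (x - y)))"
 proof -
  have t2: "0 < 2 * ta" using ta by simp
  have sq: "(W z)\<^sup>2 = ssum (\<lambda>x. W z * heat (2 * ta) (x - z))" for z
   unfolding ssum_mult by (simp add: W_def power2_eq_square)
  have m1: "(\<lambda>(x, z). W z * heat (2 * ta) (x - z)) \<in> borel_measurable (borel \<Otimes>\<^sub>M borel)" by measurable
  have b1: "\<bar>W z * heat (2 * ta) (x - z)\<bar> \<le> 2 * w1 * heat (2 * ta) (z - x)" for x z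
   using mult_right_mono[OF W1[of z] heat_nonneg[of "2 * ta" "x - z"]] W0[of z] by (simp add: abs_mult heat_minus_commute[of _ z x])
  have k1: "integrable lborel (\<lambda>w::'a. c * heat (2 * ta) w)" for c
   by (intro integrable_mult_right integrable_heat(1)[OF t2])
  show "integrable lborel (\<lambda>z. (W z)\<^sup>2)"
   unfolding sq by (rule sdiff_fubini(3)[OF m1 b1 k1])
  have o: "(LBINT z. (W z)\<^sup>2) = ssum (\<lambda>x. \<integral>z. W z * heat (2 * ta) (x - z) \<partial>lborel)"
   unfolding sq by (rule sdiff_fubini(4)[OF m1 b1 k1])
  have i: "(LBINT z. W z * heat (2 * ta) (x - z)) = ssum (\<lambda>y. heat (4 * ta) (x - y))" for x
  proof -
   have e: "W z * heat (2 * ta) (x - z) = ssum (\<lambda>y. heat (2 * ta) (x - z) * heat (2 * ta) (z - y))" for z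
    unfolding ssum_mult W_def by (simp add: heat_minus_commute[of _ z] mult.commute)
   have m2: "(\<lambda>(y, z). heat (2 * ta) (x - z) * heat (2 * ta) (z - y)) \<in> borel_measurable (borel \<Otimes>\<^sub>M borel)" by measurable
   have b2: "\<bar>heat (2 * ta) (x - z) * heat (2 * ta) (z - y)\<bar> \<le> w1 * heat (2 * ta) (z - y)" for y z
    using mult_right_mono[OF w1(1)[of "x - z"] heat_nonneg[of "2 * ta" "z - y"]] by simp
   have "(LBINT z. W z * heat (2 * ta) (x - z)) = ssum (\<lambda>y. \<integral>z. heat (2 * ta) (x - z) * heat (2 * ta) (z - y) \<partial>lborel)"
    unfolding e by (rule sdiff_fubini(4)[OF m2 b2 k1])
   then show ?thesis by (simp add: integral_heat_mult_heat(1)[OF t2 t2])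
  qed
  show "(LBINT z. (W z)\<^sup>2) = ssum (\<lambda>x. ssum (\<lambda>y. heat (4 * ta) (x - y)))"
   unfolding o i ..
 qed
 have [measurable]: "R \<in> borel_measurable borel" unfolding R_def by measurable
 have domi: "integrable lborel (\<lambda>z. L / 2 * (?E z + c\<^sup>2 * (W z)\<^sup>2))"
  by (intro integrable_mult_right Bochner_Integration.integrable_add st(1) W2(1))
 have Ri: "integrable lborel R"
  using domi
  by (rule Bochner_Integration.integrable_bound) (use Rb in \<open>auto intro!: AE_I2 intro: order_trans[OF _ abs_ge_self]\<close>)
 have "(\<lambda>z. Q z * (u z \<bullet> P z)) = (\<lambda>z. sdiff (\<lambda>x. ?q (x - z) * (u x \<bullet> P z)) - R z)"
  using split by (simp add: fun_eq_iff)
 then have QuPi: "integrable lborel (\<lambda>z. Q z * (u z \<bullet> P z))"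
  using Bochner_Integration.integrable_diff[OF i1 Ri] by simp
 have "A = (LBINT z. Q z * (u z \<bullet> P z)) + (LBINT z. R z)"
  unfolding A_eq split by (rule Bochner_Integration.integral_add[OF QuPi Ri])
 moreover have "\<bar>\<integral>z. R z \<partial>lborel\<bar> \<le> L / 2 * (E0 + c\<^sup>2 * ssum (\<lambda>x. ssum (\<lambda>y. heat (4 * ta) (x - y))))"
 proof -
  have "\<bar>\<integral>z. R z \<partial>lborel\<bar> \<le> (LBINT z. L / 2 * (?E z + c\<^sup>2 * (W z)\<^sup>2))"
   by (rule integral_abs_bound_integral[OF Ri domi]) (use Rb in auto)
  also have "\<dots> = L / 2 * (E0 + c\<^sup>2 * ssum (\<lambda>x. ssum (\<lambda>y. heat (4 * ta) (x - y))))"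
   unfolding E0_eq W2(2)[symmetric] integral_mult_right_zero
   by (subst Bochner_Integration.integral_add[OF st(1)]) (use W2(1) in auto)
  finally show ?thesis .
 qed
 moreover have "\<bar>\<integral>z. Q z * (u z \<bullet> P z) \<partial>lborel\<bar> \<le> (1 + real DIM('a) / 2) * L * E0"
  using st(3) unfolding E0_eq .
 moreover have "c\<^sup>2 = 2 powr real DIM('a) * (8 * ta)"
  unfolding c_def using ta by (simp add: power_mult_distrib powr_power)
 ultimately have "\<bar>A\<bar> \<le> (1 + real DIM('a) / 2) * L * E0 + L / 2 * (E0 + 2 powr real DIM('a) * (8 * ta) * ssum (\<lambda>x. ssum (\<lambda>y. heat (4 * ta) (x - y))))"
  by (smt (verit))
 \<comment> \<open>The stress tensor contributes 1 + d / 2, and Young's inequality for the remainder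
   adds 1 / 2.\<close>
 also have "\<dots> = (3 / 2 + real DIM('a) / 2) * (L * E0) + 2 powr real DIM('a) * 4 * L * ta * ssum (\<lambda>x. ssum (\<lambda>y. heat (4 * ta) (x - y)))"
  by (simp add: field_simps)
 also have "(3 / 2 + real DIM('a) / 2) * (L * E0) \<le> (2 + real DIM('a)) * (L * E0)"
  using L E0n by (intro mult_right_mono) auto
 finally show "\<bar>sdiff (\<lambda>x. sdiff (\<lambda>y. u x \<bullet> gmix {2 * ta<..} ka (x - y)))\<bar>
   \<le> (2 + real DIM('a)) * L * E0 + 2 powr real DIM('a) * 4 * L * ta * ssum (\<lambda>x. ssum (\<lambda>y. heat (4 * ta) (x - y)))"
  unfolding A_def by (simp add: mult.assoc)
qed

end

section \<open>Particle dynamics\<close>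

lemma hmix_norm_cong: "norm x = norm y \<Longrightarrow> hmix A ka k (x::'a::euclidean_space) = hmix A ka k (y::'a)"
 by (simp add: hmix_def heat_def)

lemma hmix_antimono:
 fixes x y :: "'a::euclidean_space"
 assumes A: "hmix_at A x" and ka: "0 < ka" and le: "norm x \<le> norm y"
 shows "hmix A ka k y \<le> hmix A ka k x"
 unfolding hmix_def
proof (rule integral_mono)
 have A': "hmix_at A y" using A le by (auto simp: hmix_at_def)
 show "integrable lborel (\<lambda>s. indicator A s * exp (- ka\<^sup>2 * s) * (heat s x / s ^ k))"
  "integrable lborel (\<lambda>s. indicator A s * exp (- ka\<^sup>2 * s) * (heat s y / s ^ k))"
  by (intro hmix_integrable A A' ka)+
 show "indicator A s * exp (- ka\<^sup>2 * s) * (heat s y / s ^ k) \<le> indicator A s * exp (- ka\<^sup>2 * s) * (heat s x / s ^ k)" for s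
 proof (cases "s \<in> A")
  case True
  then have s: "0 < s" using A by (auto simp: hmix_at_def)
  have "heat s y \<le> heat s x"
   unfolding heat_def using s le by (auto intro!: mult_left_mono divide_right_mono power_mono)
  then show ?thesis using True s by (auto intro!: mult_left_mono divide_right_mono)
 qed simp
qed

section \<open>Truncation of the force, and blow-up of the kernel at collisions\<close>

text \<open>Controls the radial part of the Hessian away from the origin, and through it the
  Lipschitz constant of the truncated force.\<close>

lemma norm_sq_hmix_bounded:
 assumes ka: "0 < ka" and \<delta>: "0 < \<delta>"
 obtains C where "0 \<le> C" "\<And>x::'a::euclidean_space. \<delta> \<le> norm x \<Longrightarrow> (norm x)\<^sup>2 * hmix {0<..} ka 2 x \<le> C"
proof -
 define e where "e = real DIM('a) / 2"
 define C1 where "C1 = (4 * pi) powr (- e) * ((e + real 1) / (\<delta>\<^sup>2 / 4)) powr (e + real 1)"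
 define C2 where "C2 = 2 powr e * 8 * (C1 * 2)"
 have C1: "0 \<le> C1" unfolding C1_def by simp
 show thesis
 proof (rule that[of "C2 * (LBINT s. indicator {0<..} s * exp (- ka\<^sup>2 * s))"])
  show "0 \<le> C2 * (LBINT s. indicator {0<..} s * exp (- ka\<^sup>2 * s))"
   unfolding C2_def using C1 by (intro mult_nonneg_nonneg Bochner_Integration.integral_nonneg) auto
  fix x :: 'a assume x: "\<delta> \<le> norm x"
  then have x0: "x \<noteq> 0" using \<delta> by auto
  have b: "(norm x)\<^sup>2 * (heat s x / s ^ 2) \<le> C2" if s: "0 < s" for s
  proof -
   have "(norm x)\<^sup>2 * heat s x / s\<^sup>2 \<le> 2 powr e * (8 * s) * heat (2 * s) x / s\<^sup>2"
    using norm_sq_heat_le[OF s, of x] unfolding e_def by (intro divide_right_mono) auto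
   also have "\<dots> = 2 powr e * 8 * (heat (2 * s) x / (2 * s) ^ 1 * 2)" using s by (simp add: power2_eq_square)
   also have "\<dots> \<le> C2" unfolding C2_def C1_def e_def
    using heat_div_power_le[of "2 * s" \<delta> x 1] s \<delta> x by (intro mult_left_mono mult_right_mono) auto
   finally show ?thesis by simp
  qed
  have "(norm x)\<^sup>2 * hmix {0<..} ka 2 x = (LBINT s. (norm x)\<^sup>2 * (indicator {0<..} s * exp (- ka\<^sup>2 * s) * (heat s x / s ^ 2)))"
   unfolding hmix_def by (simp only: integral_mult_right_zero)
  also have "\<dots> \<le> (LBINT s. C2 * (indicator {0<..} s * exp (- ka\<^sup>2 * s)))"
  proof (rule integral_mono)
   show "integrable lborel (\<lambda>s. (norm x)\<^sup>2 * (indicator {0<..} s * exp (- ka\<^sup>2 * s) * (heat s x / s ^ 2)))"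
    using x0 ka by (intro integrable_mult_right hmix_integrable hmix_atI) auto
   show "(norm x)\<^sup>2 * (indicator {0<..} s * exp (- ka\<^sup>2 * s) * (heat s x / s ^ 2)) \<le> C2 * (indicator {0<..} s * exp (- ka\<^sup>2 * s))" for s
    using mult_left_mono[OF b[of s], of "exp (- ka\<^sup>2 * s)"] by (auto split: split_indicator simp: mult_ac)
  qed (use integrable_exp_decay[OF ka] in simp)
  finally show "(norm x)\<^sup>2 * hmix {0<..} ka 2 x \<le> C2 * (LBINT s. indicator {0<..} s * exp (- ka\<^sup>2 * s))" by simp
 qed
qed

text \<open>The force with the singularity removed; it agrees with the true force at distance at least \<open>\<delta>\<close>.\<close>

definition trunc_force :: "real \<Rightarrow> real \<Rightarrow> 'a::euclidean_space \<Rightarrow> 'a" where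
 "trunc_force ka \<delta> z = (hmix {0<..} ka 1 (max (norm z) \<delta> *\<^sub>R (SOME b. b \<in> (Basis :: 'a set))) / 2) *\<^sub>R z"

lemma trunc_force_eq:
 fixes z :: "'a::euclidean_space"
 assumes "\<delta> \<le> norm z"
 shows "trunc_force ka \<delta> z = - gmix {0<..} ka z"
proof -
 have "(SOME b. b \<in> (Basis :: 'a set)) \<in> Basis" by (rule someI_ex) (use nonempty_Basis in blast)
 then have "hmix {0<..} ka 1 (max (norm z) \<delta> *\<^sub>R (SOME b. b \<in> (Basis :: 'a set))) = hmix {0<..} ka 1 z"
  using assms by (intro hmix_norm_cong) (simp add: max_absorb1)
 then show ?thesis by (simp add: trunc_force_def gmix_def)
qed

text \<open>The truncated force is a (norm z) z with a nonincreasing profile a that is constant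
  below \<delta>. For norm z <= norm w split the difference into (a (norm z) - a (norm w)) z and a
  (norm w) (z - w). The mean value theorem bounds the first part, because the squared radius times
  the mixture of index 2 is bounded beyond \<delta>.\<close>

lemma trunc_force_lipschitz:
 assumes ka: "0 < ka" and \<delta>: "0 < \<delta>"
 obtains L where "0 < L" "\<And>z w::'a::euclidean_space. norm (trunc_force ka \<delta> z - trunc_force ka \<delta> w) \<le> L * norm (z - w)"
proof -
 define e where "e = (SOME b. b \<in> (Basis :: 'a set))"
 have "e \<in> Basis" unfolding e_def by (rule someI_ex) (use nonempty_Basis in blast)
 then have e [simp]: "norm e = 1" "e \<bullet> e = 1" "e \<noteq> 0" by auto
 define a where "a r = hmix {0<..} ka 1 (max r \<delta> *\<^sub>R e) / 2" for r
 obtain C where C: "0 \<le> C" "\<And>x::'a. \<delta> \<le> norm x \<Longrightarrow> (norm x)\<^sup>2 * hmix {0<..} ka 2 x \<le> C"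
  using norm_sq_hmix_bounded[OF ka \<delta>] by metis
 have a0: "0 \<le> a r" for r unfolding a_def by simp
 have anti: "a r' \<le> a r" if "r \<le> r'" for r r'
  unfolding a_def using \<delta> ka that by (intro divide_right_mono hmix_antimono hmix_atI) auto
 define L0 where "L0 = a \<delta> + C"
 have L00: "0 \<le> L0" unfolding L0_def using a0[of \<delta>] C(1) by simp
 have aC: "(a r - a r') * r \<le> L0 * (r' - r)" if r: "0 \<le> r" "r \<le> r'" for r r'
 proof (cases "max r \<delta> < r'")
  case True
  let ?h = "\<lambda>r. hmix {0<..} ka 1 (r *\<^sub>R e)" and ?h' = "\<lambda>r. - (hmix {0<..} ka 2 (r *\<^sub>R e) / 2) * r"
  have "(?h has_real_derivative ?h' x) (at x)" if x: "max r \<delta> \<le> x" for x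
  proof -
   have "((\<lambda>r. r *\<^sub>R e) has_derivative (\<lambda>h. h *\<^sub>R e)) (at x)" by (auto intro!: derivative_eq_intros)
   moreover have "hmix_at {0<..} (x *\<^sub>R e)" using x \<delta> by (intro hmix_atI) auto
   ultimately show ?thesis unfolding has_field_derivative_def
    by - (drule (1) has_derivative_compose[OF _ hmix_has_derivative[OF _ ka, of _ _ 1]], erule has_derivative_eq_rhs, simp add: fun_eq_iff numeral_2_eq_2)
  qed
  then obtain x where x: "max r \<delta> < x" "x < r'" "?h r' - ?h (max r \<delta>) = (r' - max r \<delta>) * ?h' x"
   using MVT2[OF True, of ?h ?h'] by blast
  have h2: "0 \<le> hmix {0<..} ka 2 (x *\<^sub>R e)" by simp
  have "a r - a r' = - (?h r' - ?h (max r \<delta>)) / 2" using True by (simp add: a_def max_absorb1 diff_divide_distrib)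
  then have "(a r - a r') * r = (r' - max r \<delta>) * (hmix {0<..} ka 2 (x *\<^sub>R e) / 4 * x * r)"
   unfolding x(3) by simp
  also have "\<dots> \<le> (r' - r) * (x * x * hmix {0<..} ka 2 (x *\<^sub>R e))"
  proof (rule mult_mono)
   have "hmix {0<..} ka 2 (x *\<^sub>R e) * (x * r) \<le> hmix {0<..} ka 2 (x *\<^sub>R e) * (x * x)"
    using x r \<delta> h2 by (intro mult_left_mono) auto
   moreover have "0 \<le> hmix {0<..} ka 2 (x *\<^sub>R e) * (x * r)" using x r h2 by (intro mult_nonneg_nonneg) auto
   ultimately show "hmix {0<..} ka 2 (x *\<^sub>R e) / 4 * x * r \<le> x * x * hmix {0<..} ka 2 (x *\<^sub>R e)" by (simp add: mult_ac)
   show "0 \<le> hmix {0<..} ka 2 (x *\<^sub>R e) / 4 * x * r" using x r h2 by (intro mult_nonneg_nonneg) auto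
  qed (use r in auto)
  also have "\<dots> \<le> (r' - r) * C" using C(2)[of "x *\<^sub>R e"] x r \<delta> by (intro mult_left_mono) (auto simp: power2_eq_square)
  also have "\<dots> \<le> L0 * (r' - r)" unfolding L0_def mult.commute[of _ "r' - r"] using r a0[of \<delta>] by (intro mult_left_mono) auto
  finally show ?thesis .
 next
  case False
  then have "max r \<delta> = max r' \<delta>" using r by auto
  then have "a r = a r'" by (simp add: a_def)
  then show ?thesis using r L00 by simp
 qed
 have main: "norm (a (norm z) *\<^sub>R z - a (norm w) *\<^sub>R w) \<le> 2 * L0 * norm (z - w)" if "norm z \<le> norm w" for z w :: 'a
 proof -
  have aL: "a r \<le> L0" for r
   unfolding L0_def using anti[of \<delta> "max r \<delta>"] C(1) by (simp add: a_def)
  have d: "norm w - norm z \<le> norm (z - w)" by (metis norm_minus_commute norm_triangle_ineq2)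
  have "a (norm z) *\<^sub>R z - a (norm w) *\<^sub>R w = (a (norm z) - a (norm w)) *\<^sub>R z + a (norm w) *\<^sub>R (z - w)"
   by (simp add: algebra_simps)
  then have "norm (a (norm z) *\<^sub>R z - a (norm w) *\<^sub>R w) \<le> (a (norm z) - a (norm w)) * norm z + a (norm w) * norm (z - w)"
   using norm_triangle_ineq[of "(a (norm z) - a (norm w)) *\<^sub>R z" "a (norm w) *\<^sub>R (z - w)"] anti[OF that] a0 by simp
  also have "\<dots> \<le> L0 * norm (z - w) + L0 * norm (z - w)"
   using order_trans[OF aC[OF norm_ge_zero that] mult_left_mono[OF d L00]] by (intro add_mono mult_right_mono aL) auto
  finally show ?thesis by (simp add: algebra_simps)
 qed
 have tf: "trunc_force ka \<delta> z = a (norm z) *\<^sub>R z" for z :: 'a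
  unfolding trunc_force_def a_def e_def ..
 show thesis
 proof (rule that[of "2 * L0 + 1"])
  show "0 < 2 * L0 + 1" using L00 by simp
  fix z w :: 'a
  have "norm (a (norm z) *\<^sub>R z - a (norm w) *\<^sub>R w) \<le> 2 * L0 * norm (z - w)"
   using main[of z w] main[of w z] by (cases "norm z \<le> norm w") (auto simp: norm_minus_commute)
  then show "norm (trunc_force ka \<delta> z - trunc_force ka \<delta> w) \<le> (2 * L0 + 1) * norm (z - w)"
   unfolding tf using norm_ge_zero[of "z - w"] unfolding distrib_right by linarith
 qed
qed

text \<open>For heat times between the squared norm of z and 1 the Gaussian factor is bounded below
  and s powr (- d / 2) is at least 1 / s. The kernel is therefore at least a multiple of - ln (norm
  z), in every dimension from 2 on.\<close>

lemma hmix_blowup: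
 assumes d: "2 \<le> DIM('a)" and ka: "0 < ka"
 obtains \<delta> where "0 < \<delta>" "\<And>z::'a::euclidean_space. z \<noteq> 0 \<Longrightarrow> norm z \<le> \<delta> \<Longrightarrow> M < hmix {0<..} ka 0 z"
proof -
 define e where "e = real DIM('a) / 2"
 have e: "1 \<le> e" using d by (simp add: e_def)
 define c where "c = exp (- ka\<^sup>2) * ((4 * pi) powr (- e) * exp (- 1 / 4))"
 have c: "c > 0" by (simp add: c_def)
 \<comment> \<open>Chosen so that - 2 c ln \<delta> is the absolute value of M plus 1.\<close>
 define \<delta> where "\<delta> = exp (- (\<bar>M\<bar> + 1) / (2 * c))"
 have \<delta>: "0 < \<delta>" "\<delta> \<le> 1" unfolding \<delta>_def using c by (auto simp: divide_nonpos_pos)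
 show thesis
 proof (rule that[OF \<delta>(1)])
  fix z :: 'a assume z: "z \<noteq> 0" "norm z \<le> \<delta>"
  define r where "r = (norm z)\<^sup>2"
  have r: "0 < r" "r \<le> 1" using z \<delta> by (auto simp: r_def power_le_one)
  have "((\<lambda>s. 1 / s) has_integral (ln 1 - ln r)) {r..1}"
   using r by (intro fundamental_theorem_of_calculus)
    (auto simp: has_real_derivative_iff_has_vector_derivative[symmetric] intro!: derivative_eq_intros)
  then have hi: "((\<lambda>s. 1 / s) has_integral (- ln r)) {r..1}" by simp
  have "(\<lambda>s. 1 / s) absolutely_integrable_on {r..1}"
   using hi r by (intro nonnegative_absolutely_integrable_1) (auto simp: has_integral_iff)
  then have si: "set_integrable lborel {r..1} (\<lambda>s. 1 / s)"
   unfolding set_integrable_def by (subst (asm) integrable_completion) auto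
  have int: "(LBINT s. indicator {r..1} s * (1 / s)) = - ln r"
   using set_borel_integral_eq_integral(2)[OF si] hi by (simp add: set_lebesgue_integral_def integral_unique)
  have "c * (- ln r) = (LBINT s. c * (indicator {r..1} s * (1 / s)))" unfolding int[symmetric] by (simp only: integral_mult_right_zero)
  also have "\<dots> \<le> hmix {0<..} ka 0 z"
   unfolding hmix_def
  proof (rule integral_mono)
   show "integrable lborel (\<lambda>s. c * (indicator {r..1} s * (1 / s)))"
    using si unfolding set_integrable_def by (intro integrable_mult_right) simp
   show "integrable lborel (\<lambda>s. indicator {0<..} s * exp (- ka\<^sup>2 * s) * (heat s z / s ^ 0))"
    using z ka by (intro hmix_integrable hmix_atI) auto
   show "c * (indicator {r..1} s * (1 / s)) \<le> indicator {0<..} s * exp (- ka\<^sup>2 * s) * (heat s z / s ^ 0)" for s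
   proof (cases "s \<in> {r..1}")
    case True
    then have s: "0 < s" "s \<le> 1" "r \<le> s" using r by auto
    have "- (1 / 4) \<le> - (norm z)\<^sup>2 / (4 * s)" using s by (simp add: r_def[symmetric] field_simps)
    then have 1: "exp (- 1 / 4) \<le> exp (- (norm z)\<^sup>2 / (4 * s))" by simp
    have "1 / s = s powr (- 1)" using s by (simp add: powr_minus_divide)
    also have "\<dots> \<le> s powr (- e)" using s e by (intro powr_mono') auto
    finally have "(4 * pi) powr (- e) * (1 / s) \<le> (4 * pi) powr (- e) * s powr (- e)" by (intro mult_left_mono) auto
    also have "\<dots> = (4 * pi * s) powr (- e)" by (simp only: powr_mult)
    finally have 2: "(4 * pi) powr (- e) * (1 / s) \<le> (4 * pi * s) powr (- e)" .
    have 3: "exp (- ka\<^sup>2) \<le> exp (- ka\<^sup>2 * s)" using s by (simp add: mult_left_le)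
    have "exp (- ka\<^sup>2) * (((4 * pi) powr (- e) * (1 / s)) * exp (- 1 / 4)) \<le> exp (- ka\<^sup>2 * s) * ((4 * pi * s) powr (- e) * exp (- (norm z)\<^sup>2 / (4 * s)))"
     using s by (intro mult_mono 1 2 3) auto
    then show ?thesis using True s unfolding c_def heat_def e_def[symmetric] by (simp add: mult_ac)
   qed auto
  qed
  finally have le: "c * (- ln r) \<le> hmix {0<..} ka 0 z" .
  have "ln r = 2 * ln (norm z)" unfolding r_def using z by (simp add: ln_realpow)
  also have "ln (norm z) \<le> - (\<bar>M\<bar> + 1) / (2 * c)"
   using z unfolding \<delta>_def by (metis ln_exp ln_le_cancel_iff exp_gt_zero zero_less_norm_iff)
  finally have "c * ln r \<le> c * (2 * (- (\<bar>M\<bar> + 1) / (2 * c)))" using c by (intro mult_left_mono) auto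
  also have "\<dots> = - (\<bar>M\<bar> + 1)" using c by simp
  finally show "M < hmix {0<..} ka 0 z" using le by simp
 qed
qed

instance bcontfun :: (metric_space, banach) banach ..

section \<open>Particle systems with a Lipschitz force\<close>

definition pforce :: "('a::euclidean_space \<Rightarrow> 'a) \<Rightarrow> nat \<Rightarrow> (nat \<Rightarrow> 'a) \<Rightarrow> nat \<Rightarrow> 'a" where
 "pforce \<phi> N x i = (1 / real N) *\<^sub>R (\<Sum>j\<in>{..<N} - {i}. \<phi> (x i - x j))"

definition psolution :: "('a::euclidean_space \<Rightarrow> 'a) \<Rightarrow> nat \<Rightarrow> real set \<Rightarrow> (real \<Rightarrow> nat \<Rightarrow> 'a) \<Rightarrow> bool" where
 "psolution \<phi> N I x \<longleftrightarrow> (\<forall>t\<in>I. \<forall>i<N. ((\<lambda>s. x s i) has_vector_derivative pforce \<phi> N (x t) i) (at t within I))"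

lemma psolution_subset: "psolution \<phi> N I x \<Longrightarrow> J \<subseteq> I \<Longrightarrow> psolution \<phi> N J x"
 unfolding psolution_def by (blast intro: has_vector_derivative_within_subset)

lemma psolution_cong:
 assumes "psolution \<phi> N I x" "\<And>t i j. t \<in> I \<Longrightarrow> i < N \<Longrightarrow> j < N \<Longrightarrow> i \<noteq> j \<Longrightarrow> \<phi> (x t i - x t j) = \<psi> (x t i - x t j)"
 shows "psolution \<psi> N I x"
proof -
 have "pforce \<phi> N (x t) i = pforce \<psi> N (x t) i" if "t \<in> I" "i < N" for t i
  unfolding pforce_def using assms(2) that by (intro arg_cong2[where f = "(*\<^sub>R)"] sum.cong refl) auto
 then show ?thesis using assms(1) by (auto simp: psolution_def)
qed

lemma bounded_linear_apply_bcontfun: "bounded_linear (\<lambda>X::'i::topological_space \<Rightarrow>\<^sub>C 'a::real_normed_vector. apply_bcontfun X i)"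
 by (rule bounded_linear_intro[of _ 1]) (auto simp: plus_bcontfun.rep_eq scaleR_bcontfun.rep_eq norm_bounded)

text \<open>Picard iteration needs a Banach space whose points encode configurations of a number of particles that is
 not fixed by the type: interpolate a configuration piecewise linearly to a function on the real line.\<close>

lemma psolution_exists:
 fixes \<phi> :: "'a::euclidean_space \<Rightarrow> 'a"
 assumes L: "0 \<le> L" "\<And>z w. norm (\<phi> z - \<phi> w) \<le> L * norm (z - w)"
 shows "\<exists>y. (\<forall>i<N. y 0 i = X i) \<and> psolution \<phi> N {0..} y"
proof -
 define hat where "hat r = max 0 (1 - \<bar>r\<bar>)" for r :: real
 have hat: "0 \<le> hat r" "hat r \<le> 1" for r unfolding hat_def by auto
 define f where "f h r = (\<Sum>k<N. hat (r - real k) *\<^sub>R h k)" for h :: "nat \<Rightarrow> 'a" and r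
 have f_at: "f h (real i) = h i" if "i < N" for h i
 proof -
  have "f h (real i) = (\<Sum>k<N. if i = k then h k else 0)"
   unfolding f_def hat_def by (rule sum.cong) (auto simp: max_def)
  then show ?thesis using that by simp
 qed
 have f_le: "norm (f h r) \<le> (\<Sum>k<N. norm (h k))" for h r
  unfolding f_def
  by (rule order_trans[OF norm_sum sum_mono]) (use hat in \<open>auto simp: mult_left_le_one_le\<close>)
 have bc: "f h \<in> bcontfun" for h
  unfolding bcontfun_def
 proof (intro CollectI conjI)
  show "continuous_on UNIV (f h)" unfolding f_def hat_def by (intro continuous_intros)
  show "bounded (range (f h))" using f_le unfolding bounded_iff by blast
 qed
 define pt where "pt Y k = apply_bcontfun Y (real k)" for Y :: "real \<Rightarrow>\<^sub>C 'a" and k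
 define F where "F Y = Bcontfun (f (pforce \<phi> N (pt Y)))" for Y
 have F: "apply_bcontfun (F Y) r = f (pforce \<phi> N (pt Y)) r" for Y r
  unfolding F_def using bc by (simp add: Bcontfun_inverse)
 have lip: "norm (F Y - F Z) \<le> (real N * (2 * L)) * norm (Y - Z)" for Y Z
 proof (rule norm_bound)
  fix r
  have c: "norm (pt Y k - pt Z k) \<le> norm (Y - Z)" for k
   using norm_bounded[of "Y - Z" "real k"] by (simp add: minus_bcontfun.rep_eq pt_def)
  have i: "norm (pforce \<phi> N (pt Y) i - pforce \<phi> N (pt Z) i) \<le> 2 * L * norm (Y - Z)" if "i < N" for i
  proof -
   have "norm (pforce \<phi> N (pt Y) i - pforce \<phi> N (pt Z) i) = norm ((1 / real N) *\<^sub>R (\<Sum>j\<in>{..<N} - {i}. \<phi> (pt Y i - pt Y j) - \<phi> (pt Z i - pt Z j)))"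
    by (simp add: pforce_def sum_subtractf scaleR_diff_right)
   also have "\<dots> \<le> (1 / real N) * (\<Sum>j\<in>{..<N} - {i}. 2 * L * norm (Y - Z))"
    unfolding norm_scaleR
   proof (intro mult_mono order_trans[OF norm_sum sum_mono])
    fix j
    have "norm (\<phi> (pt Y i - pt Y j) - \<phi> (pt Z i - pt Z j)) \<le> L * norm ((pt Y i - pt Z i) - (pt Y j - pt Z j))"
     using L(2)[of "pt Y i - pt Y j" "pt Z i - pt Z j"] by (simp add: algebra_simps)
    also have "\<dots> \<le> L * (norm (Y - Z) + norm (Y - Z))"
     by (intro mult_left_mono order_trans[OF norm_triangle_ineq4] add_mono c L)
    finally show "norm (\<phi> (pt Y i - pt Y j) - \<phi> (pt Z i - pt Z j)) \<le> 2 * L * norm (Y - Z)" by simp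
   qed (auto intro!: sum_nonneg norm_ge_zero)
   also have "(\<Sum>j\<in>{..<N} - {i}. 2 * L * norm (Y - Z)) \<le> real N * (2 * L * norm (Y - Z))"
    using L that by (auto simp: card_Diff_singleton intro!: mult_right_mono)
   finally show ?thesis using that by (simp add: divide_simps)
  qed
  have "apply_bcontfun (F Y - F Z) r = f (\<lambda>i. pforce \<phi> N (pt Y) i - pforce \<phi> N (pt Z) i) r"
   by (simp add: minus_bcontfun.rep_eq F f_def sum_subtractf scaleR_diff_right)
  then have "norm (apply_bcontfun (F Y - F Z) r) \<le> (\<Sum>i<N. norm (pforce \<phi> N (pt Y) i - pforce \<phi> N (pt Z) i))"
   using f_le by simp
  also have "\<dots> \<le> (\<Sum>i<N. 2 * L * norm (Y - Z))" using i by (intro sum_mono) auto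
  finally show "norm (apply_bcontfun (F Y - F Z) r) \<le> (real N * (2 * L)) * norm (Y - Z)" by simp
 qed
 define x0 where "x0 = Bcontfun (f X)"
 have x0: "pt x0 i = X i" if "i < N" for i
  unfolding x0_def pt_def using bc[of X] f_at[OF that] by (simp add: Bcontfun_inverse)
 obtain x where x: "x 0 = x0" "\<And>t. 0 \<le> t \<Longrightarrow> (x has_vector_derivative F (x t)) (at t within {0..})"
  using picard_lindelof_global[of "\<lambda>_. F" "real N * (2 * L)" "norm (F 0)" x0] lip by auto
 have ptF: "pt (F Y) i = pforce \<phi> N (pt Y) i" if "i < N" for Y i
  unfolding pt_def[of "F Y"] F by (rule f_at[OF that])
 have "((\<lambda>s. pt (x s) i) has_vector_derivative pforce \<phi> N (pt (x t)) i) (at t within {0..})"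
  if "0 \<le> t" "i < N" for t i
  using bounded_linear.has_vector_derivative[OF bounded_linear_apply_bcontfun x(2)[OF that(1)], of "real i"] that(2)
  unfolding pt_def[symmetric] by (simp add: ptF)
 then show ?thesis
  using x(1) x0 by (intro exI[of _ "\<lambda>t. pt (x t)"]) (auto simp: psolution_def)
qed

text \<open>With d_i the distance of the i-th particles, a pair contributes at most L d_i (d_i +
  d_j). Young's inequality splits the mixed term, and the prefactor 1 / N cancels the number of
  partners, so the constant 3/2 + 1/2 is free of N.\<close>

lemma pforce_one_sided_lipschitz:
 fixes \<phi> :: "'a::euclidean_space \<Rightarrow> 'a"
 assumes L: "0 \<le> L" "\<And>z w. norm (\<phi> z - \<phi> w) \<le> L * norm (z - w)"
 shows "\<bar>\<Sum>i<N. (x i - y i) \<bullet> (pforce \<phi> N x i - pforce \<phi> N y i)\<bar> \<le> 2 * L * (\<Sum>i<N. (norm (x i - y i))\<^sup>2)"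
proof -
 let ?d = "\<lambda>i. norm (x i - y i)"
 have "\<bar>(x i - y i) \<bullet> (pforce \<phi> N x i - pforce \<phi> N y i)\<bar> \<le> (1 / real N) * (\<Sum>j<N. L * ((3 / 2) * (?d i)\<^sup>2 + (1 / 2) * (?d j)\<^sup>2))" if "i < N" for i
 proof -
  have "norm (pforce \<phi> N x i - pforce \<phi> N y i) = (1 / real N) * norm (\<Sum>j\<in>{..<N} - {i}. \<phi> (x i - x j) - \<phi> (y i - y j))"
   unfolding pforce_def by (simp add: sum_subtractf flip: scaleR_diff_right)
  also have "\<dots> \<le> (1 / real N) * (\<Sum>j\<in>{..<N} - {i}. L * (?d i + ?d j))"
  proof (intro mult_left_mono order_trans[OF norm_sum sum_mono])
   fix j
   have "norm (\<phi> (x i - x j) - \<phi> (y i - y j)) \<le> L * norm ((x i - y i) - (x j - y j))"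
    using L(2)[of "x i - x j" "y i - y j"] by (simp add: algebra_simps)
   also have "\<dots> \<le> L * (?d i + ?d j)" by (intro mult_left_mono norm_triangle_ineq4 L)
   finally show "norm (\<phi> (x i - x j) - \<phi> (y i - y j)) \<le> L * (?d i + ?d j)" .
  qed auto
  also have "\<dots> \<le> (1 / real N) * (\<Sum>j<N. L * (?d i + ?d j))"
   using L by (intro mult_left_mono sum_mono2) auto
  finally have n: "norm (pforce \<phi> N x i - pforce \<phi> N y i) \<le> (1 / real N) * (\<Sum>j<N. L * (?d i + ?d j))" .
  have "\<bar>(x i - y i) \<bullet> (pforce \<phi> N x i - pforce \<phi> N y i)\<bar> \<le> ?d i * ((1 / real N) * (\<Sum>j<N. L * (?d i + ?d j)))"
   by (rule order_trans[OF Cauchy_Schwarz_ineq2 mult_left_mono[OF n]]) simp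
  also have "\<dots> = (1 / real N) * (\<Sum>j<N. L * (?d i * ?d i + ?d i * ?d j))"
   by (simp add: sum_distrib_left algebra_simps)
  also have "\<dots> \<le> (1 / real N) * (\<Sum>j<N. L * ((3 / 2) * (?d i)\<^sup>2 + (1 / 2) * (?d j)\<^sup>2))"
  proof (intro mult_left_mono sum_mono L)
   show "?d i * ?d i + ?d i * ?d j \<le> (3 / 2) * (?d i)\<^sup>2 + (1 / 2) * (?d j)\<^sup>2" for j
    using sum_squares_bound[of "?d i" "?d j"] by (simp add: power2_eq_square)
  qed auto
  finally show ?thesis .
 qed
 then have "\<bar>\<Sum>i<N. (x i - y i) \<bullet> (pforce \<phi> N x i - pforce \<phi> N y i)\<bar> \<le> (\<Sum>i<N. (1 / real N) * (\<Sum>j<N. L * ((3 / 2) * (?d i)\<^sup>2 + (1 / 2) * (?d j)\<^sup>2)))"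
  by (intro order_trans[OF sum_abs sum_mono]) auto
 also have "\<dots> = (1 / real N) * (L * (3 / 2 * (real N * (\<Sum>i<N. (?d i)\<^sup>2)) + 1 / 2 * (real N * (\<Sum>j<N. (?d j)\<^sup>2))))"
  by (simp only: sum_distrib_left[symmetric] sum.distrib sum_constant card_lessThan)
 also have "\<dots> \<le> 2 * L * (\<Sum>i<N. (?d i)\<^sup>2)"
  by (cases "N = 0") (auto simp: field_simps)
 finally show ?thesis .
qed

lemma psolution_distance:
 fixes \<phi> :: "'a::euclidean_space \<Rightarrow> 'a"
 assumes L: "0 < L" "\<And>z w. norm (\<phi> z - \<phi> w) \<le> L * norm (z - w)"
  and x: "psolution \<phi> N {0..T} x" and y: "psolution \<phi> N {0..T} y" and t: "t \<in> {0..T}"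
 shows "(\<Sum>i<N. (norm (x t i - y t i))\<^sup>2) \<le> exp (4 * L * t) * (\<Sum>i<N. (norm (x 0 i - y 0 i))\<^sup>2)"
proof -
 have "(\<Sum>i<N. (norm (x t i - y t i))\<^sup>2) \<le> exp (2 * (2 * L) * t) * (\<Sum>i<N. (norm (x 0 i - y 0 i))\<^sup>2)"
  by (rule flow_distance_bounds(1)[where vx = "\<lambda>t. pforce \<phi> N (x t)" and vy = "\<lambda>t. pforce \<phi> N (y t)"])
   (use x y t L pforce_one_sided_lipschitz[of L \<phi>] in \<open>auto simp: psolution_def\<close>)
 then show ?thesis by simp
qed

lemma psolution_unique:
 fixes \<phi> :: "'a::euclidean_space \<Rightarrow> 'a"
 assumes L: "0 < L" "\<And>z w. norm (\<phi> z - \<phi> w) \<le> L * norm (z - w)"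
  and x: "psolution \<phi> N {0..T} x" and y: "psolution \<phi> N {0..T} y" and t: "t \<in> {0..T}"
  and init: "\<And>i. i < N \<Longrightarrow> x 0 i = y 0 i" and i: "i < N"
 shows "x t i = y t i"
proof -
 have "(\<Sum>i<N. (norm (x t i - y t i))\<^sup>2) \<le> 0"
  using psolution_distance[OF L x y t] init by simp
 then have "(\<Sum>i<N. (norm (x t i - y t i))\<^sup>2) = 0" by (intro antisym sum_nonneg) auto
 then show ?thesis using i by (simp add: sum_nonneg_eq_0_iff)
qed

lemma sum_off_diagonal_swap:
 "(\<Sum>i<N. \<Sum>j\<in>{..<N} - {i}. f i j) = (\<Sum>i<(N::nat). \<Sum>j\<in>{..<N} - {i}. f j i)"
proof -
 have e: "{..<N} - {i} = {j \<in> {..<N}. i \<noteq> j}" "{..<N} - {i} = {j \<in> {..<N}. j \<noteq> i}" for i by auto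
 have "(\<Sum>i<N. \<Sum>j\<in>{..<N} - {i}. f i j) = (\<Sum>i<N. \<Sum>j\<in>{j \<in> {..<N}. i \<noteq> j}. f i j)" by (simp only: e(1))
 also have "\<dots> = (\<Sum>j<N. \<Sum>i\<in>{i \<in> {..<N}. i \<noteq> j}. f i j)" by (rule sum.swap_restrict) auto
 also have "\<dots> = (\<Sum>i<N. \<Sum>j\<in>{..<N} - {i}. f j i)" by (simp only: e(2))
 finally show ?thesis .
qed

text \<open>The gradient is odd, so both particles of a pair contribute the same amount; hence the
  factor 2.\<close>

lemma pair_energy_has_derivative:
 fixes x :: "real \<Rightarrow> nat \<Rightarrow> 'a::euclidean_space"
 assumes ka: "0 < ka" and x: "\<And>i. i < N \<Longrightarrow> ((\<lambda>s. x s i) has_vector_derivative v i) (at t within I)"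
  and at: "\<And>i j. i < N \<Longrightarrow> j < N \<Longrightarrow> i \<noteq> j \<Longrightarrow> hmix_at A (x t i - x t j)"
 shows "((\<lambda>s. \<Sum>i<N. \<Sum>j\<in>{..<N} - {i}. hmix A ka 0 (x s i - x s j)) has_real_derivative
  2 * (\<Sum>i<N. (\<Sum>j\<in>{..<N} - {i}. gmix A ka (x t i - x t j)) \<bullet> v i)) (at t within I)"
proof -
 have "((\<lambda>s. hmix A ka 0 (x s i - x s j)) has_real_derivative gmix A ka (x t i - x t j) \<bullet> (v i - v j)) (at t within I)"
  if "i < N" "j \<in> {..<N} - {i}" for i j
 proof -
  have "((\<lambda>s. x s i - x s j) has_derivative (\<lambda>h. h *\<^sub>R (v i - v j))) (at t within I)"
   using has_vector_derivative_diff[OF x x, of i j] that by (simp add: has_vector_derivative_def)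
  then have "((\<lambda>s. hmix A ka 0 (x s i - x s j)) has_derivative (\<lambda>h. gmix A ka (x t i - x t j) \<bullet> h *\<^sub>R (v i - v j))) (at t within I)"
   by (rule has_derivative_compose) (use that in \<open>auto intro: hmix_has_derivative_gmix at ka\<close>)
  then show ?thesis
   unfolding has_field_derivative_def by (rule has_derivative_eq_rhs) (simp add: fun_eq_iff)
 qed
 then have "((\<lambda>s. \<Sum>i<N. \<Sum>j\<in>{..<N} - {i}. hmix A ka 0 (x s i - x s j)) has_real_derivative
   (\<Sum>i<N. \<Sum>j\<in>{..<N} - {i}. gmix A ka (x t i - x t j) \<bullet> (v i - v j))) (at t within I)"
  by (intro DERIV_sum) auto
 moreover have "(\<Sum>i<N. \<Sum>j\<in>{..<N} - {i}. gmix A ka (x t i - x t j) \<bullet> (v i - v j)) =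
  2 * (\<Sum>i<N. (\<Sum>j\<in>{..<N} - {i}. gmix A ka (x t i - x t j)) \<bullet> v i)"
 proof -
  have "(\<Sum>i<N. \<Sum>j\<in>{..<N} - {i}. gmix A ka (x t i - x t j) \<bullet> v j) = (\<Sum>i<N. \<Sum>j\<in>{..<N} - {i}. gmix A ka (x t j - x t i) \<bullet> v i)"
   by (rule sum_off_diagonal_swap)
  also have "\<dots> = (\<Sum>i<N. \<Sum>j\<in>{..<N} - {i}. - (gmix A ka (x t i - x t j) \<bullet> v i))"
   by (intro sum.cong refl) (metis gmix_minus inner_minus_left minus_diff_eq)
  finally show ?thesis
   by (simp add: inner_diff_right sum_subtractf sum_negf inner_sum_left)
 qed
 ultimately show ?thesis by simp
qed

definition pflow :: "('a::euclidean_space \<Rightarrow> 'a) \<Rightarrow> nat \<Rightarrow> (nat \<Rightarrow> 'a) \<Rightarrow> real \<Rightarrow> nat \<Rightarrow> 'a" where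
 "pflow \<phi> N X = (SOME y. (\<forall>i<N. y 0 i = X i) \<and> psolution \<phi> N {0..} y)"

lemma pflow:
 fixes \<phi> :: "'a::euclidean_space \<Rightarrow> 'a"
 assumes "0 \<le> L" "\<And>z w. norm (\<phi> z - \<phi> w) \<le> L * norm (z - w)"
 shows "i < N \<Longrightarrow> pflow \<phi> N X 0 i = X i" "psolution \<phi> N {0..} (pflow \<phi> N X)"
 using someI_ex[OF psolution_exists[OF assms, where X = X and N = N]] unfolding pflow_def by auto

text \<open>Such a function depends on the first N coordinates only. Padding a configuration by 0
  moves the question to functions on all of nat, where the product and Borel sigma-algebras agree
  and continuity suffices.\<close>

lemma borel_measurable_PiM_lipschitz:
 fixes f :: "(nat \<Rightarrow> 'a::euclidean_space) \<Rightarrow> 'b::euclidean_space"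
 assumes f: "\<And>X Y. (norm (f X - f Y))\<^sup>2 \<le> C * (\<Sum>i<N. (norm (X i - Y i))\<^sup>2)"
 shows "f \<in> borel_measurable (PiM {..<N} (\<lambda>_. borel))"
proof -
 let ?A = "PiM {..<N} (\<lambda>_. borel)"
 define r where "r X i = (if i < N then X i else (0::'a))" for X :: "nat \<Rightarrow> 'a" and i
 have r: "r \<in> measurable ?A (borel :: (nat \<Rightarrow> 'a) measure)"
 proof -
  have "r \<in> measurable ?A (PiM UNIV (\<lambda>_. borel :: 'a measure))"
  proof (rule measurable_PiM_single')
   show "(\<lambda>X. r X i) \<in> borel_measurable (PiM {..<N} (\<lambda>_. borel :: 'a measure))" for i
    unfolding r_def by (cases "i < N") auto
  qed auto
  then show ?thesis by (subst measurable_cong_sets[OF refl sets_PiM_equal_borel[symmetric]])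
 qed
 have "continuous_on UNIV f"
  unfolding continuous_on_def
 proof
  fix X :: "nat \<Rightarrow> 'a"
  have c: "((\<lambda>Y. Y i) \<longlongrightarrow> X i) (at X)" for i
   using continuous_on_product_coordinates[of i] by (auto simp: continuous_on_def)
  have "((\<lambda>Y. C * (\<Sum>i<N. (norm (Y i - X i))\<^sup>2)) \<longlongrightarrow> C * (\<Sum>i<N. (norm (X i - X i))\<^sup>2)) (at X)"
   by (intro tendsto_intros c)
  then have "((\<lambda>Y. C * (\<Sum>i<N. (norm (Y i - X i))\<^sup>2)) \<longlongrightarrow> 0) (at X)" by simp
  then have "((\<lambda>Y. (norm (f Y - f X))\<^sup>2) \<longlongrightarrow> 0) (at X)"
   by (rule Lim_null_comparison[rotated]) (use f in auto)
  then have "((\<lambda>Y. sqrt ((norm (f Y - f X))\<^sup>2)) \<longlongrightarrow> sqrt 0) (at X)" by (rule tendsto_real_sqrt)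
  then have "((\<lambda>Y. f Y - f X) \<longlongrightarrow> 0) (at X)" by (simp add: tendsto_norm_zero_iff)
  then show "(f \<longlongrightarrow> f X) (at X within UNIV)" by (simp add: LIM_zero_iff)
 qed
 then have "f \<in> borel_measurable borel" by (rule borel_measurable_continuous_onI)
 then have m: "(\<lambda>X. f (r X)) \<in> borel_measurable ?A" by (rule measurable_compose[OF r])
 have "f (r X) = f X" for X
 proof -
  have "(norm (f (r X) - f X))\<^sup>2 \<le> 0" using f[of "r X" X] by (simp add: r_def)
  then show ?thesis by simp
 qed
 then show ?thesis using m by simp
qed

lemma borel_measurable_pflow:
 fixes \<phi> :: "'a::euclidean_space \<Rightarrow> 'a"
 assumes L: "0 < L" "\<And>z w. norm (\<phi> z - \<phi> w) \<le> L * norm (z - w)" and t: "0 \<le> t" and i: "i < N"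
 shows "(\<lambda>X. pflow \<phi> N X t i) \<in> borel_measurable (PiM {..<N} (\<lambda>_. borel))"
proof (rule borel_measurable_PiM_lipschitz)
 fix X Y :: "nat \<Rightarrow> 'a"
 have L0: "0 \<le> L" using L by simp
 have "(norm (pflow \<phi> N X t i - pflow \<phi> N Y t i))\<^sup>2 \<le> (\<Sum>i<N. (norm (pflow \<phi> N X t i - pflow \<phi> N Y t i))\<^sup>2)"
  using i by (intro member_le_sum) auto
 also have "\<dots> \<le> exp (4 * L * t) * (\<Sum>i<N. (norm (pflow \<phi> N X 0 i - pflow \<phi> N Y 0 i))\<^sup>2)"
  using t by (intro psolution_distance[where \<phi> = \<phi> and T = t] L psolution_subset[OF pflow(2)[OF L0 L(2)]]) auto
 also have "(\<Sum>i<N. (norm (pflow \<phi> N X 0 i - pflow \<phi> N Y 0 i))\<^sup>2) = (\<Sum>i<N. (norm (X i - Y i))\<^sup>2)"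
  by (intro sum.cong refl) (simp add: pflow(1)[OF L0 L(2)])
 finally show "(norm (pflow \<phi> N X t i - pflow \<phi> N Y t i))\<^sup>2 \<le> exp (4 * L * t) * (\<Sum>i<N. (norm (X i - Y i))\<^sup>2)" .
qed

section \<open>Collision-free trajectories of the Yukawa system\<close>

lemma no_collision_min_distance:
 fixes x :: "real \<Rightarrow> nat \<Rightarrow> 'a::euclidean_space"
 assumes c: "\<And>i. i < N \<Longrightarrow> continuous_on {0..T} (\<lambda>t. x t i)"
  and n: "\<And>t i j. t \<in> {0..T} \<Longrightarrow> i < N \<Longrightarrow> j < N \<Longrightarrow> i \<noteq> j \<Longrightarrow> x t i \<noteq> x t j"
 obtains \<delta> where "0 < \<delta>" "\<And>t i j. t \<in> {0..T} \<Longrightarrow> i < N \<Longrightarrow> j < N \<Longrightarrow> i \<noteq> j \<Longrightarrow> \<delta> \<le> norm (x t i - x t j)"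
proof -
 have "\<exists>d>0. \<forall>t\<in>{0..T}. d \<le> norm (x t i - x t j)" if "i < N" "j < N" "i \<noteq> j" for i j
 proof (cases "0 \<le> T")
  case True
  have "continuous_on {0..T} (\<lambda>t. norm (x t i - x t j))" using that by (intro continuous_intros c)
  then have "\<exists>s\<in>{0..T}. \<forall>t\<in>{0..T}. norm (x s i - x s j) \<le> norm (x t i - x t j)"
   using True by (intro continuous_attains_inf) auto
  then obtain s where s: "s \<in> {0..T}" "\<And>t. t \<in> {0..T} \<Longrightarrow> norm (x s i - x s j) \<le> norm (x t i - x t j)"
   by blast
  then show ?thesis using n[of s i j] that by (intro exI[of _ "norm (x s i - x s j)"]) auto
 qed (auto intro: exI[of _ 1])
 then obtain d where d: "\<And>i j. i < N \<Longrightarrow> j < N \<Longrightarrow> i \<noteq> j \<Longrightarrow> 0 < d i j \<and> (\<forall>t\<in>{0..T}. d i j \<le> norm (x t i - x t j))"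
  by metis
 let ?D = "insert 1 ((\<lambda>(i, j). d i j) ` {(i, j). i < N \<and> j < N \<and> i \<noteq> j})"
 have fin: "finite ?D"
  by (intro finite.insertI finite_imageI finite_subset[of "{(i, j). i < N \<and> j < N \<and> i \<noteq> j}" "{..<N} \<times> {..<N}"]) auto
 show thesis
 proof (rule that[of "Min ?D"])
  show "0 < Min ?D" using fin d by (subst Min_gr_iff) auto
  fix t i j assume *: "t \<in> {0..T}" "i < N" "j < N" "i \<noteq> j"
  then have "Min ?D \<le> d i j" using fin by (intro Min_le) auto
  then show "Min ?D \<le> norm (x t i - x t j)" using d[of i j] * by force
 qed
qed

lemma psolution_continuous:
 assumes "psolution \<phi> N I x" "i < N"
 shows "continuous_on I (\<lambda>t. x t i)"
 by (rule continuous_on_vector_derivative) (use assms in \<open>auto simp: psolution_def\<close>)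

lemma gradient_kernel_diff:
 "0 < ka \<Longrightarrow> x \<noteq> y \<Longrightarrow> gradient (kernel ka) (x - y) = gmix {0<..} ka (x - y)"
 by (simp add: gradient_kernel_pos)

lemma particle_trajectory_iff:
 fixes x :: "real \<Rightarrow> nat \<Rightarrow> 'a::euclidean_space"
 assumes ka: "0 < ka"
 shows "particle_trajectory N ka X x \<longleftrightarrow> x 0 = X \<and> (\<forall>t\<ge>0. x t \<in> ({..<N} \<rightarrow>\<^sub>E UNIV) - collision_set N)
  \<and> psolution (\<lambda>z. - gmix {0<..} ka z) N {0..} x"
proof -
 let ?A = "\<lambda>z. - gmix {0<..} ka z"
 have "- (1 / real N) *\<^sub>R (\<Sum>j\<in>{..<N} - {i}. gradient (kernel ka) (x t i - x t j)) = pforce ?A N (x t) i"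
  if "x t \<in> ({..<N} \<rightarrow>\<^sub>E UNIV) - collision_set N" "i < N" for t i
 proof -
  have "(\<Sum>j\<in>{..<N} - {i}. gradient (kernel ka) (x t i - x t j)) = (\<Sum>j\<in>{..<N} - {i}. gmix {0<..} ka (x t i - x t j))"
   using that ka by (intro sum.cong refl gradient_kernel_diff) (auto simp: collision_set_def)
  then show ?thesis by (simp add: pforce_def sum_negf)
 qed
 then have eq: "x t \<in> ({..<N} \<rightarrow>\<^sub>E UNIV) - collision_set N \<Longrightarrow>
   (\<forall>i<N. ((\<lambda>s. x s i) has_vector_derivative - (1 / real N) *\<^sub>R (\<Sum>j\<in>{..<N} - {i}. gradient (kernel ka) (x t i - x t j))) (at t within {0..})) \<longleftrightarrow>
   (\<forall>i<N. ((\<lambda>s. x s i) has_vector_derivative pforce ?A N (x t) i) (at t within {0..}))" for t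
  by simp
 have "(\<forall>t\<ge>0. A t \<and> B t) \<longleftrightarrow> (\<forall>t\<ge>0. A t) \<and> (\<forall>t\<in>{0..}. C t)"
  if "\<And>t. A t \<Longrightarrow> B t = C t" for A B C :: "real \<Rightarrow> bool"
  using that by auto
 from this[OF eq] show ?thesis unfolding particle_trajectory_def psolution_def by (simp only:)
qed

text \<open>A trajectory whose particles stay \<delta> apart cannot distinguish the true force from
  the truncated one, so uniqueness for the Lipschitz system applies.\<close>

lemma trajectory_eq_pflow:
 fixes x :: "real \<Rightarrow> nat \<Rightarrow> 'a::euclidean_space"
 assumes ka: "0 < ka" and \<delta>: "0 < \<delta>" and x: "psolution (\<lambda>z. - gmix {0<..} ka z) N {0..T} x"
  and d: "\<And>t i j. t \<in> {0..T} \<Longrightarrow> i < N \<Longrightarrow> j < N \<Longrightarrow> i \<noteq> j \<Longrightarrow> \<delta> \<le> norm (x t i - x t j)"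
  and t: "t \<in> {0..T}" and i: "i < N"
 shows "x t i = pflow (trunc_force ka \<delta>) N (x 0) t i"
proof -
 let ?A = "trunc_force ka \<delta>"
 obtain L where L: "0 < L" "\<And>z w::'a. norm (trunc_force ka \<delta> z - trunc_force ka \<delta> w) \<le> L * norm (z - w)"
  using trunc_force_lipschitz[OF ka \<delta>] by metis
 have L0: "0 \<le> L" using L by simp
 have 1: "psolution ?A N {0..T} x"
  by (rule psolution_cong[OF x]) (simp add: trunc_force_eq[OF d])
 have 2: "psolution ?A N {0..T} (pflow ?A N (x 0))"
  by (rule psolution_subset[OF pflow(2)[OF L0 L(2)]]) auto
 show ?thesis
  by (rule psolution_unique[OF L 1 2 t _ i]) (rule pflow(1)[OF L0 L(2), symmetric])
qed

text \<open>Solve the truncated system and show that the truncation is never reached. Up to the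
  first time at which some pair is at distance \<delta> the motion is a gradient flow, so the pair
  energy does not increase; but at that time one pair alone would carry more than the initial
  energy.\<close>

lemma particle_trajectory_exists:
 fixes X :: "nat \<Rightarrow> 'a::euclidean_space"
 assumes d: "2 \<le> DIM('a)" and ka: "0 < ka" and X: "X \<in> {..<N} \<rightarrow>\<^sub>E UNIV" "X \<notin> collision_set N"
 shows "\<exists>x. particle_trajectory N ka X x"
proof -
 let ?A = "\<lambda>z. - gmix {0<..} ka z"
 let ?E = "\<lambda>Y::nat \<Rightarrow> 'a. \<Sum>i<N. \<Sum>j\<in>{..<N} - {i}. hmix {0<..} ka 0 (Y i - Y j)"
 obtain \<delta>1 where \<delta>1: "0 < \<delta>1" "\<And>z::'a. z \<noteq> 0 \<Longrightarrow> norm z \<le> \<delta>1 \<Longrightarrow> ?E X < hmix {0<..} ka 0 z"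
  using hmix_blowup[OF d ka, where M = "?E X"] by blast
 obtain \<delta>2 where \<delta>2: "0 < \<delta>2" "\<And>i j. i < N \<Longrightarrow> j < N \<Longrightarrow> i \<noteq> j \<Longrightarrow> \<delta>2 \<le> norm (X i - X j)"
 proof (rule no_collision_min_distance[of N 0 "\<lambda>_. X"])
  fix \<delta> assume "0 < \<delta>" "\<And>t i j. t \<in> {0..0::real} \<Longrightarrow> i < N \<Longrightarrow> j < N \<Longrightarrow> i \<noteq> j \<Longrightarrow> \<delta> \<le> norm (X i - X j)"
  then show thesis by (intro that[of \<delta>]) (auto intro: atLeastAtMost_iff[of 0, THEN iffD2])
 qed (use X in \<open>auto simp: collision_set_def\<close>)
 \<comment> \<open>Within \<open>\<delta>1\<close> a single pair interaction exceeds the whole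
   initial energy; halving \<open>\<delta>2\<close> makes the initial distances strictly larger than
   \<delta>.\<close>
 define \<delta> where "\<delta> = min \<delta>1 (\<delta>2 / 2)"
 have \<delta>: "0 < \<delta>" "\<delta> \<le> \<delta>1" "\<delta> < \<delta>2" using \<delta>1 \<delta>2 by (auto simp: \<delta>_def)
 obtain L where L: "0 \<le> L" "\<And>z w::'a. norm (trunc_force ka \<delta> z - trunc_force ka \<delta> w) \<le> L * norm (z - w)"
  using trunc_force_lipschitz[OF ka \<delta>(1)] less_imp_le by metis
 define y where "y = pflow (trunc_force ka \<delta>) N X"
 have y0: "y 0 i = X i" if "i < N" for i unfolding y_def using pflow(1)[OF L that] .
 have ys: "psolution (trunc_force ka \<delta>) N {0..} y" unfolding y_def by (rule pflow(2)[OF L])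
 have yc: "continuous_on {0..} (\<lambda>t. norm (y t i - y t j))" if "i < N" "j < N" for i j
  using psolution_continuous[OF ys that(1)] psolution_continuous[OF ys that(2)] by (intro continuous_intros)
 have good: "\<delta> < norm (y t i - y t j)" if "0 \<le> t" "i < N" "j < N" "i \<noteq> j" for t i j
 proof (rule ccontr)
  assume neg: "\<not> \<delta> < norm (y t i - y t j)"
  define P where "P = {(i, j). i < N \<and> j < N \<and> i \<noteq> j}"
  have "finite P" unfolding P_def by (rule finite_subset[of _ "{..<N} \<times> {..<N}"]) auto
  define bad where "bad = (\<Union>(i, j)\<in>P. {0..} \<inter> (\<lambda>t. norm (y t i - y t j)) -` {..\<delta>})"
  have "closed bad" unfolding bad_def
  proof (rule closed_UN[OF \<open>finite P\<close>], safe)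
   fix a b assume "(a, b) \<in> P"
   then show "closed ({0..} \<inter> (\<lambda>t. norm (y t a - y t b)) -` {..\<delta>})"
    by (intro continuous_closed_preimage yc) (auto simp: P_def)
  qed
  moreover have "bad \<noteq> {}" using neg that unfolding bad_def P_def by fastforce
  moreover have bb: "bdd_below bad" by (rule bdd_belowI[of _ 0]) (auto simp: bad_def)
  ultimately have tb: "Inf bad \<in> bad" by (intro closed_contains_Inf)
  \<comment> \<open>The first time at which some pair is at distance at most \<delta>.\<close>
  define s where "s = Inf bad"
  obtain i j where ij: "i < N" "j < N" "i \<noteq> j" "norm (y s i - y s j) \<le> \<delta>" "0 \<le> s"
   using tb unfolding bad_def P_def s_def by auto
  have before: "\<delta> < norm (y r a - y r b)" if "0 \<le> r" "r < s" "a < N" "b < N" "a \<noteq> b" for r a b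
  proof (rule ccontr)
   assume "\<not> ?thesis"
   then have "r \<in> bad" using that unfolding bad_def P_def by fastforce
   then have "s \<le> r" unfolding s_def by (intro cInf_lower bb)
   then show False using that by simp
  qed
  have s0: "0 < s"
  proof (rule ccontr)
   assume "\<not> 0 < s"
   then have "s = 0" using ij by simp
   then show False using ij y0 \<delta>2(2)[of i j] \<delta> by auto
  qed
  have ge: "\<delta> \<le> norm (y r a - y r b)" if "r \<in> {0..s}" "a < N" "b < N" "a \<noteq> b" for r a b
  proof (rule continuous_ge_on_closure[where S = "{0..<s}" and f = "\<lambda>r. norm (y r a - y r b)" and x = r])
   show "continuous_on (closure {0..<s}) (\<lambda>r. norm (y r a - y r b))"
    using s0 that by (intro continuous_on_subset[OF yc]) auto
   show "r \<in> closure {0..<s}" using that s0 by simp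
  qed (use before that in \<open>auto intro: less_imp_le\<close>)
  \<comment> \<open>Up to time s the truncation is not felt, so the true energy identity is
    available.\<close>
  have ytrue: "psolution ?A N {0..s} y"
   by (rule psolution_cong[OF psolution_subset[OF ys]]) (auto simp: trunc_force_eq[OF ge])
  have ne: "y r a \<noteq> y r b" if "r \<in> {0..s}" "a < N" "b < N" "a \<noteq> b" for r a b
   using ge[OF that] \<delta> by auto
  have der: "((\<lambda>r. ?E (y r)) has_real_derivative - 2 * real N * (\<Sum>i<N. (norm (pforce ?A N (y r) i))\<^sup>2)) (at r within {0..s})"
   if r: "r \<in> {0..s}" for r
  proof -
   have "((\<lambda>r. ?E (y r)) has_real_derivative 2 * (\<Sum>i<N. (\<Sum>j\<in>{..<N} - {i}. gmix {0<..} ka (y r i - y r j)) \<bullet> pforce ?A N (y r) i)) (at r within {0..s})"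
   proof (rule pair_energy_has_derivative[OF ka])
    show "((\<lambda>s. y s i) has_vector_derivative pforce ?A N (y r) i) (at r within {0..s})" if "i < N" for i
     using ytrue that r by (auto simp: psolution_def)
   qed (use ne r in \<open>auto intro!: hmix_atI\<close>)
   moreover have "(\<Sum>j\<in>{..<N} - {i}. gmix {0<..} ka (y r i - y r j)) = - real N *\<^sub>R pforce ?A N (y r) i" for i
    using ij by (simp add: pforce_def sum_negf)
   ultimately show ?thesis by (simp add: sum_distrib_left power2_norm_eq_inner mult.assoc)
  qed
  have "?E (y s) \<le> ?E (y 0)"
  proof (rule DERIV_nonpos_imp_decreasing_open[where f = "\<lambda>r. ?E (y r)"])
   show "0 \<le> s" using s0 by simp
   show "continuous_on {0..s} (\<lambda>r. ?E (y r))" using der by (rule DERIV_continuous_on)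
   fix r assume r: "0 < r" "r < s"
   then have "at r within {0..s} = at r" by (intro at_within_interior) auto
   then show "\<exists>l. ((\<lambda>r. ?E (y r)) has_real_derivative l) (at r) \<and> l \<le> 0"
    using der[of r] r by (intro exI conjI) (auto intro!: mult_nonneg_nonneg sum_nonneg)
  qed
  also have "?E (y 0) = ?E X" using y0 by (intro sum.cong refl) auto
  \<comment> \<open>The pair at distance at most \<delta> gives the contradiction, since all other
    pair energies are nonnegative.\<close>
  also have "?E X < hmix {0<..} ka 0 (y s i - y s j)"
   using ij ne[of s i j] \<delta> s0 by (intro \<delta>1(2)) auto
  also have "\<dots> \<le> (\<Sum>j\<in>{..<N} - {i}. hmix {0<..} ka 0 (y s i - y s j))"
   using ij by (intro member_le_sum[of j]) auto
  also have "\<dots> \<le> ?E (y s)"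
   using ij by (intro member_le_sum[of i "{..<N}" "\<lambda>i. \<Sum>j\<in>{..<N} - {i}. hmix {0<..} ka 0 (y s i - y s j)"] sum_nonneg) (auto intro!: sum_nonneg)
  finally show False by simp
 qed
 \<comment> \<open>Configurations are extensional, hence \<open>undefined\<close> from index N
   on.\<close>
 define x where "x t i = (if i < N then y t i else undefined)" for t i
 have "particle_trajectory N ka X x"
  unfolding particle_trajectory_iff[OF ka]
 proof (intro conjI allI impI)
  show "x 0 = X" unfolding x_def using y0 X by (auto simp: fun_eq_iff PiE_def extensional_def)
  show "x t \<in> ({..<N} \<rightarrow>\<^sub>E UNIV) - collision_set N" if "0 \<le> t" for t
  proof -
   have "y t i \<noteq> y t j" if "i < N" "j < N" "i \<noteq> j" for i j
    using good[OF \<open>0 \<le> t\<close> that] \<delta>(1) by auto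
   then show ?thesis unfolding x_def collision_set_def by (auto split: if_splits)
  qed
  have "psolution ?A N {0..} y"
   by (rule psolution_cong[OF ys]) (auto intro!: trunc_force_eq less_imp_le good)
  moreover have "pforce \<phi> N (x t) i = pforce \<phi> N (y t) i" if "i < N" for \<phi> t i
   using that by (auto simp: pforce_def x_def intro!: sum.cong arg_cong2[where f = "(*\<^sub>R)"])
  ultimately show "psolution ?A N {0..} x"
   by (auto simp: psolution_def x_def)
 qed
 then show ?thesis by blast
qed

lemma particle_trajectory_min_distance:
 fixes x :: "real \<Rightarrow> nat \<Rightarrow> 'a::euclidean_space"
 assumes ka: "0 < ka" and x: "particle_trajectory N ka X x"
 obtains \<delta> where "0 < \<delta>" "\<And>t i j. t \<in> {0..T} \<Longrightarrow> i < N \<Longrightarrow> j < N \<Longrightarrow> i \<noteq> j \<Longrightarrow> \<delta> \<le> norm (x t i - x t j)"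
proof (rule no_collision_min_distance[of N T x])
 note x' = x[unfolded particle_trajectory_iff[OF ka]]
 have xs: "psolution (\<lambda>z. - gmix {0<..} ka z) N {0..T} x"
  using x' by (auto intro: psolution_subset)
 show "continuous_on {0..T} (\<lambda>t. x t i)" if "i < N" for i by (rule psolution_continuous[OF xs that])
 show "x t i \<noteq> x t j" if "t \<in> {0..T}" "i < N" "j < N" "i \<noteq> j" for t i j
 proof -
  have "x t \<notin> collision_set N" using x' that by auto
  then show ?thesis using that by (auto simp: collision_set_def)
 qed
qed (rule that)

lemma particle_trajectory_eq_pflow:
 fixes x :: "real \<Rightarrow> nat \<Rightarrow> 'a::euclidean_space"
 assumes ka: "0 < ka" and x: "particle_trajectory N ka X x" and \<delta>: "0 < \<delta>"
  and d: "\<And>t i j. t \<in> {0..T} \<Longrightarrow> i < N \<Longrightarrow> j < N \<Longrightarrow> i \<noteq> j \<Longrightarrow> \<delta> \<le> norm (x t i - x t j)"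
  and t: "t \<in> {0..T}" and i: "i < N"
 shows "x t i = pflow (trunc_force ka \<delta>) N X t i"
proof -
 let ?A = "\<lambda>z. - gmix {0<..} ka z"
 have x0: "x 0 = X" and xs: "psolution ?A N {0..} x"
  using x unfolding particle_trajectory_iff[OF ka] by auto
 have "psolution ?A N {0..T} x" by (rule psolution_subset[OF xs]) auto
 from trajectory_eq_pflow[OF ka \<delta> this d t i] show ?thesis using x0 by simp
qed

lemma particle_trajectory_unique:
 fixes x :: "real \<Rightarrow> nat \<Rightarrow> 'a::euclidean_space"
 assumes ka: "0 < ka" and x: "particle_trajectory N ka X x" and y: "particle_trajectory N ka X y" and t: "0 \<le> t"
 shows "x t = y t"
proof -
 obtain d1 where d1: "0 < d1" "\<And>s i j. s \<in> {0..t} \<Longrightarrow> i < N \<Longrightarrow> j < N \<Longrightarrow> i \<noteq> j \<Longrightarrow> d1 \<le> norm (x s i - x s j)"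
  using particle_trajectory_min_distance[OF ka x, where T = t] by blast
 obtain d2 where d2: "0 < d2" "\<And>s i j. s \<in> {0..t} \<Longrightarrow> i < N \<Longrightarrow> j < N \<Longrightarrow> i \<noteq> j \<Longrightarrow> d2 \<le> norm (y s i - y s j)"
  using particle_trajectory_min_distance[OF ka y, where T = t] by blast
 have m: "0 < min d1 d2" using d1 d2 by simp
 have d1': "min d1 d2 \<le> norm (x s i - x s j)" if "s \<in> {0..t}" "i < N" "j < N" "i \<noteq> j" for s i j
  using d1(2)[OF that] by simp
 have d2': "min d1 d2 \<le> norm (y s i - y s j)" if "s \<in> {0..t}" "i < N" "j < N" "i \<noteq> j" for s i j
  using d2(2)[OF that] by simp
 have "t \<in> {0..t}" using t by simp
 then have "x t i = y t i" if "i < N" for i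
  using particle_trajectory_eq_pflow[OF ka x m, where T = t, OF d1' _ that]
   particle_trajectory_eq_pflow[OF ka y m, where T = t, OF d2' _ that] by simp
 moreover have "x t \<in> {..<N} \<rightarrow>\<^sub>E UNIV" "y t \<in> {..<N} \<rightarrow>\<^sub>E UNIV"
  using x y t unfolding particle_trajectory_def by auto
 ultimately show ?thesis by (intro PiE_ext) auto
qed

lemma particle_flow_trajectory:
 fixes X :: "nat \<Rightarrow> 'a::euclidean_space"
 assumes "2 \<le> DIM('a)" "0 < ka" "X \<in> {..<N} \<rightarrow>\<^sub>E UNIV" "X \<notin> collision_set N"
 shows "particle_trajectory N ka X (\<lambda>t. particle_flow N ka t X)"
 using someI_ex[OF particle_trajectory_exists[OF assms]] assms(4) by (simp add: particle_flow_def)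

lemma particle_flow_PiE:
 fixes X :: "nat \<Rightarrow> 'a::euclidean_space"
 assumes "2 \<le> DIM('a)" "0 < ka" "X \<in> {..<N} \<rightarrow>\<^sub>E UNIV" "0 \<le> t"
 shows "particle_flow N ka t X \<in> {..<N} \<rightarrow>\<^sub>E UNIV"
proof (cases "X \<in> collision_set N")
 case False
 then show ?thesis using particle_flow_trajectory[OF assms(1-3)] assms(4) by (auto simp: particle_trajectory_def)
qed (use assms in \<open>simp add: particle_flow_def\<close>)

lemma pred_collision_set [measurable]:
 "Measurable.pred (PiM {..<N} (\<lambda>_. borel :: 'a::euclidean_space measure)) (\<lambda>X. X \<in> collision_set N)"
proof -
 have e: "X \<in> collision_set N \<longleftrightarrow> (\<exists>i\<in>{..<N}. \<exists>j\<in>{..<N}. i \<noteq> j \<and> norm (X i - X j) = 0)" for X :: "nat \<Rightarrow> 'a"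
  by (auto simp: collision_set_def)
 show ?thesis unfolding e
 proof (intro pred_intros_finite pred_intros_logic)
  fix i j assume "i \<in> {..<N}" "j \<in> {..<N}"
  then have [measurable]: "(\<lambda>X. X i) \<in> borel_measurable (PiM {..<N} (\<lambda>_. borel :: 'a measure))"
   "(\<lambda>X. X j) \<in> borel_measurable (PiM {..<N} (\<lambda>_. borel :: 'a measure))" by auto
  show "Measurable.pred (PiM {..<N} (\<lambda>_. borel :: 'a measure)) (\<lambda>X. norm (X i - X j) = 0)"
   by measurable
 qed auto
qed

text \<open>Each trajectory keeps a positive distance up to time t, so the flow is the pointwise
  limit, indeed eventually equal to, the flows truncated at 1 / (n + 1). Those depend continuously
  on the initial configuration.\<close>

lemma measurable_particle_flow:
 assumes d: "2 \<le> DIM('a::euclidean_space)" and ka: "0 < ka" and t: "0 \<le> t"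
 shows "particle_flow N ka t \<in> measurable (PiM {..<N} (\<lambda>_. borel :: 'a measure)) (PiM {..<N} (\<lambda>_. borel))"
proof (rule measurable_PiM_single')
 let ?P = "PiM {..<N} (\<lambda>_. borel :: 'a measure)"
 show "particle_flow N ka t \<in> space ?P \<rightarrow> {..<N} \<rightarrow>\<^sub>E space borel"
  using particle_flow_PiE[OF d ka _ t] by (auto simp: space_PiM)
 fix i assume i: "i \<in> {..<N}"
 let ?f = "\<lambda>n X. if X \<in> collision_set N then X i else pflow (trunc_force ka (1 / real (Suc n))) N X t i"
 show "(\<lambda>X. particle_flow N ka t X i) \<in> borel_measurable ?P"
 proof (rule borel_measurable_LIMSEQ_metric)
  fix n
  have "0 < 1 / real (Suc n)" by simp
  then obtain L where L: "0 < L" "\<And>z w::'a. norm (trunc_force ka (1 / real (Suc n)) z - trunc_force ka (1 / real (Suc n)) w) \<le> L * norm (z - w)"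
   using trunc_force_lipschitz[OF ka] by blast
  have [measurable]: "(\<lambda>X. pflow (trunc_force ka (1 / real (Suc n))) N X t i) \<in> borel_measurable ?P"
   using borel_measurable_pflow[OF L t] i by simp
  have [measurable]: "(\<lambda>X. X i) \<in> borel_measurable ?P" using i by simp
  show "?f n \<in> borel_measurable ?P" by measurable
 next
  fix X assume X: "X \<in> space ?P"
  show "(\<lambda>n. ?f n X) \<longlonglongrightarrow> particle_flow N ka t X i"
  proof (cases "X \<in> collision_set N")
   case False
   let ?x = "\<lambda>t. particle_flow N ka t X"
   have tr: "particle_trajectory N ka X ?x"
    using X False by (intro particle_flow_trajectory d ka) (auto simp: space_PiM)
   obtain \<delta> where \<delta>: "0 < \<delta>" "\<And>s i j. s \<in> {0..t} \<Longrightarrow> i < N \<Longrightarrow> j < N \<Longrightarrow> i \<noteq> j \<Longrightarrow> \<delta> \<le> norm (?x s i - ?x s j)"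
    using particle_trajectory_min_distance[OF ka tr, where T = t] by blast
   obtain n0 where n0: "1 / real (Suc n0) < \<delta>" using nat_approx_posE[OF \<delta>(1)] by blast
   have "?f n X = particle_flow N ka t X i" if "n0 \<le> n" for n
   proof -
    have "1 / real (Suc n) \<le> 1 / real (Suc n0)" using that by (intro divide_left_mono) auto
    then have le: "1 / real (Suc n) \<le> norm (?x s i - ?x s j)" if "s \<in> {0..t}" "i < N" "j < N" "i \<noteq> j" for s i j
     using n0 \<delta>(2)[OF that] by linarith
    have "0 < 1 / real (Suc n)" by simp
    from particle_trajectory_eq_pflow[OF ka tr this, where T = t, OF le, where t = t and i = i] show ?thesis using False t i by simp
   qed
   then have "\<forall>\<^sub>F n in sequentially. ?f n X = particle_flow N ka t X i"
    unfolding eventually_sequentially by blast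
   then show ?thesis by (rule tendsto_eventually)
  qed (simp add: particle_flow_def)
 qed
qed

text \<open>A relabelled trajectory is again a trajectory, and trajectories are unique.\<close>

lemma particle_flow_permute:
 fixes X :: "nat \<Rightarrow> 'a::euclidean_space"
 assumes d: "2 \<le> DIM('a)" and ka: "0 < ka" and X: "X \<in> {..<N} \<rightarrow>\<^sub>E UNIV" "X \<notin> collision_set N"
  and p: "p permutes {..<N}" and t: "0 \<le> t"
 shows "particle_flow N ka t (X \<circ> p) = particle_flow N ka t X \<circ> p"
proof -
 have pN: "p i < N \<longleftrightarrow> i < N" for i using permutes_in_image[OF p, of i] by simp
 have inj: "p i = p j \<longleftrightarrow> i = j" for i j using permutes_inj[OF p] by (auto simp: inj_def)
 have PiE: "Y \<circ> p \<in> {..<N} \<rightarrow>\<^sub>E UNIV" if "Y \<in> {..<N} \<rightarrow>\<^sub>E UNIV" for Y :: "nat \<Rightarrow> 'a"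
  using that pN by (auto simp: PiE_def extensional_def)
 have coll: "Y \<circ> p \<notin> collision_set N" if "Y \<notin> collision_set N" for Y :: "nat \<Rightarrow> 'a"
  using that pN inj unfolding collision_set_def by (simp add: comp_def) blast
 let ?x = "\<lambda>t. particle_flow N ka t X"
 have tr: "particle_trajectory N ka X ?x" by (rule particle_flow_trajectory[OF d ka X])
 have "particle_trajectory N ka (X \<circ> p) (\<lambda>t. ?x t \<circ> p)"
  unfolding particle_trajectory_iff[OF ka]
 proof (intro conjI allI impI)
  show "?x 0 \<circ> p = X \<circ> p" using tr by (simp add: particle_trajectory_iff[OF ka])
  show "?x t \<circ> p \<in> ({..<N} \<rightarrow>\<^sub>E UNIV) - collision_set N" if "0 \<le> t" for t
   using tr that PiE coll by (simp add: particle_trajectory_iff[OF ka])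
  have f: "pforce \<phi> N (Y \<circ> p) i = pforce \<phi> N Y (p i)" if "i < N" for Y :: "nat \<Rightarrow> 'a" and \<phi> i
  proof -
   have "bij_betw p ({..<N} - {i}) ({..<N} - {p i})"
    using permutes_imp_bij[OF p] inj that
    by (intro bij_betw_byWitness[where f' = "inv p"]) (auto simp: pN permutes_inverses[OF p] permutes_in_image[OF permutes_inv[OF p], simplified])
   from sum.reindex_bij_betw[OF this, of "\<lambda>j. \<phi> (Y (p i) - Y j)"] show ?thesis by (simp add: pforce_def)
  qed
  show "psolution (\<lambda>z. - gmix {0<..} ka z) N {0..} (\<lambda>t. ?x t \<circ> p)"
   using tr by (simp add: particle_trajectory_iff[OF ka] psolution_def f pN)
 qed
 from particle_trajectory_unique[OF ka particle_flow_trajectory[OF d ka PiE[OF X(1)] coll[OF X(2)]] this t]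
 show ?thesis .
qed

section \<open>Solution curves and their flow\<close>

lemma norm_gmix: "A \<subseteq> {0<..} \<Longrightarrow> norm (gmix A ka z) = norm z / 2 * hmix A ka 1 z"
 by (simp add: gmix_def)

text \<open>Domination by the unscreened integrand of \<open>hmix_coulomb\<close>, so that ka = 0 is
  covered.\<close>

lemma hmix_1_integrable:
 fixes z :: "'a::euclidean_space"
 assumes A: "A \<in> sets borel" "A \<subseteq> {0<..}" and z: "z \<noteq> 0"
 shows "integrable lborel (\<lambda>s. indicator A s * exp (- ka\<^sup>2 * s) * (heat s z / s ^ 1))"
proof (rule Bochner_Integration.integrable_bound[OF hmix_coulomb(1)[OF z]])
 have [measurable]: "A \<in> sets borel" by fact
 show "(\<lambda>s. indicator A s * exp (- ka\<^sup>2 * s) * (heat s z / s ^ 1)) \<in> borel_measurable lborel" by measurable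
 show "AE s in lborel. norm (indicator A s * exp (- ka\<^sup>2 * s) * (heat s z / s ^ 1)) \<le> norm (indicator {0<..} s * exp (- 0\<^sup>2 * s) * (heat s z / s ^ 1))"
 proof (rule AE_I2)
  fix s
  show "norm (indicator A s * exp (- ka\<^sup>2 * s) * (heat s z / s ^ 1)) \<le> norm (indicator {0<..} s * exp (- 0\<^sup>2 * s) * (heat s z / s ^ 1))"
   using A by (auto split: split_indicator simp: abs_mult subset_iff intro!: mult_left_le_one_le divide_right_mono)
 qed
qed

lemma gmix_Un:
 fixes z :: "'a::euclidean_space"
 assumes A: "A \<in> sets borel" "A \<subseteq> {0<..}" and B: "B \<in> sets borel" "B \<subseteq> {0<..}" and d: "A \<inter> B = {}"
 shows "gmix (A \<union> B) ka z = gmix A ka z + gmix B ka z"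
proof (cases "z = 0")
 case False
 have "hmix (A \<union> B) ka 1 z = hmix A ka 1 z + hmix B ka 1 z"
  unfolding hmix_def
  by (subst Bochner_Integration.integral_add[symmetric, OF hmix_1_integrable[OF A False] hmix_1_integrable[OF B False]])
   (use d in \<open>auto simp: indicator_add[symmetric] algebra_simps intro!: Bochner_Integration.integral_cong split: split_indicator\<close>)
 then show ?thesis by (simp add: gmix_def algebra_simps add_divide_distrib)
qed simp

lemma nn_integral_powr_minus_half:
 assumes "0 \<le> S"
 shows "(\<integral>\<^sup>+s. ennreal (indicator {0<..S} s * s powr (- (1 / 2))) \<partial>lborel) = ennreal (2 * sqrt S)"
proof -
 let ?A = "\<lambda>s. s powr (- (1 / 2))"
 have "(?A has_integral (S powr (- (1 / 2) + 1) / (- (1 / 2) + 1))) {0..S}"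
  using assms by (intro has_integral_powr_from_0) auto
 then have "(?A has_integral (2 * sqrt S)) {0..S}"
  using assms by (simp add: powr_half_sqrt mult.commute)
 then have "(?A has_integral (2 * sqrt S)) {0<..S}"
  by (subst has_integral_spike_set_eq[of _ "{0..S}"]) (auto intro: negligible_subset[of "{0}"])
 from nn_integral_has_integral_lebesgue[OF _ this] show ?thesis by simp
qed

text \<open>The constant of \<open>norm_heat_le\<close> at s = 1.\<close>

definition gmix_const :: "'a::euclidean_space itself \<Rightarrow> real" where
 "gmix_const _ = 2 powr (real DIM('a) / 2) * sqrt 8"

lemma gmix_const_pos: "0 < gmix_const TYPE('a::euclidean_space)"
 by (simp add: gmix_const_def)

text \<open>The gradient of a heat kernel of time s has an L1 norm of order s powr (- 1 / 2), which
  is integrable at 0. The force of heat times up to S thus has mass of order sqrt S, whatever the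
  screening.\<close>

lemma gmix_near:
 fixes x :: "'a::euclidean_space"
 assumes S: "0 \<le> S"
 shows "integrable lborel (\<lambda>y. norm (gmix {0<..S} ka (x - y)))"
  and "(LBINT y. norm (gmix {0<..S} ka (x - y))) \<le> gmix_const TYPE('a) * sqrt S"
proof -
 define p where "p = 2 powr (real DIM('a) / 2)"
 have p: "0 \<le> p" by (simp add: p_def)
 let ?F = "\<lambda>(y::'a) s. ennreal (indicator {0<..S} s * (norm (x - y) * heat s (x - y) / (2 * s)))"
 have sub: "{0<..S} \<subseteq> {0<..}" by auto
 have "ennreal (norm (gmix {0<..S} ka (x - y))) \<le> (\<integral>\<^sup>+s. ?F y s \<partial>lborel)" for y
 proof (cases "x = y")
  case False
  then have i: "integrable lborel (\<lambda>s. indicator {0<..S} s * exp (- ka\<^sup>2 * s) * (heat s (x - y) / s ^ 1))"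
   by (intro hmix_1_integrable sub) auto
  have "ennreal (norm (gmix {0<..S} ka (x - y))) = ennreal (LBINT s. norm (x - y) / 2 * (indicator {0<..S} s * exp (- ka\<^sup>2 * s) * (heat s (x - y) / s ^ 1)))"
   unfolding norm_gmix[OF sub] hmix_def by (simp only: integral_mult_right_zero)
  also have "\<dots> = (\<integral>\<^sup>+s. ennreal (norm (x - y) / 2 * (indicator {0<..S} s * exp (- ka\<^sup>2 * s) * (heat s (x - y) / s ^ 1))) \<partial>lborel)"
   using i by (intro nn_integral_eq_integral[symmetric] integrable_mult_right) (auto split: split_indicator)
  also have "\<dots> \<le> (\<integral>\<^sup>+s. ?F y s \<partial>lborel)"
  proof (intro nn_integral_mono ennreal_leI)
   fix s :: real
   show "norm (x - y) / 2 * (indicator {0<..S} s * exp (- ka\<^sup>2 * s) * (heat s (x - y) / s ^ 1)) \<le> indicator {0<..S} s * (norm (x - y) * heat s (x - y) / (2 * s))"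
   proof (cases "s \<in> {0<..S}")
    case True
    have "exp (- ka\<^sup>2 * s) * (norm (x - y) * heat s (x - y) / (2 * s)) \<le> norm (x - y) * heat s (x - y) / (2 * s)"
     using True by (intro mult_left_le_one_le) auto
    then show ?thesis using True by (simp add: mult_ac)
   qed simp
  qed
  finally show ?thesis .
 qed simp
 then have "(\<integral>\<^sup>+y. ennreal (norm (gmix {0<..S} ka (x - y))) \<partial>lborel) \<le> (\<integral>\<^sup>+y. \<integral>\<^sup>+s. ?F y s \<partial>lborel \<partial>lborel)"
  by (intro nn_integral_mono)
 also have "\<dots> = (\<integral>\<^sup>+s. \<integral>\<^sup>+y. ?F y s \<partial>lborel \<partial>lborel)"
  by (rule lborel_pair.Fubini'[symmetric]) measurable
 also have "\<dots> \<le> (\<integral>\<^sup>+s. ennreal (p * sqrt 8 / 2) * ennreal (indicator {0<..S} s * s powr (- (1 / 2))) \<partial>lborel)"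
 proof (rule nn_integral_mono)
  fix s :: real
  show "(\<integral>\<^sup>+y. ?F y s \<partial>lborel) \<le> ennreal (p * sqrt 8 / 2) * ennreal (indicator {0<..S} s * s powr (- (1 / 2)))"
  proof (cases "s \<in> {0<..S}")
   case True
   then have s: "0 < s" by simp
   have "(\<integral>\<^sup>+y. ?F y s \<partial>lborel) \<le> (\<integral>\<^sup>+y. ennreal (p * sqrt 8 / 2 * s powr (- (1 / 2))) * ennreal (heat (2 * s) (x - y)) \<partial>lborel)"
   proof (rule nn_integral_mono)
    fix y
    have "norm (x - y) * heat s (x - y) / (2 * s) \<le> p * sqrt (8 * s) * heat (2 * s) (x - y) / (2 * s)"
     unfolding p_def using norm_heat_le[OF s, of "x - y"] s by (intro divide_right_mono) auto
    also have "\<dots> = (p * sqrt 8 / 2) * (sqrt s / s) * heat (2 * s) (x - y)" by (simp add: real_sqrt_mult)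
    also have "sqrt s / s = s powr (- (1 / 2))"
     using s by (simp add: powr_minus_divide powr_half_sqrt real_div_sqrt divide_simps)
    finally show "?F y s \<le> ennreal (p * sqrt 8 / 2 * s powr (- (1 / 2))) * ennreal (heat (2 * s) (x - y))"
     using True p by (subst ennreal_mult[symmetric]) (auto intro!: ennreal_leI)
   qed
   also have "\<dots> = ennreal (p * sqrt 8 / 2 * s powr (- (1 / 2)))"
    using s by (subst nn_integral_cmult) (auto simp: nn_integral_heat_diff)
   finally show ?thesis using True p by (simp add: ennreal_mult[symmetric])
  qed simp
 qed
 also have "\<dots> = ennreal (p * sqrt 8 / 2) * ennreal (2 * sqrt S)"
  by (subst nn_integral_cmult) (auto simp only: nn_integral_powr_minus_half[OF S], measurable)
 also have "\<dots> = ennreal (p * sqrt 8 * sqrt S)" using p S by (simp add: ennreal_mult[symmetric])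
 finally have nn: "(\<integral>\<^sup>+y. ennreal (norm (gmix {0<..S} ka (x - y))) \<partial>lborel) \<le> ennreal (p * sqrt 8 * sqrt S)" .
 show i: "integrable lborel (\<lambda>y. norm (gmix {0<..S} ka (x - y)))"
 proof (rule integrableI_bounded)
  show "(\<integral>\<^sup>+y. ennreal (norm (norm (gmix {0<..S} ka (x - y)))) \<partial>lborel) < \<infinity>"
   using nn by (simp add: le_less_trans)
 qed measurable
 have "ennreal (LBINT y. norm (gmix {0<..S} ka (x - y))) \<le> ennreal (p * sqrt 8 * sqrt S)"
  using nn by (subst (asm) nn_integral_eq_integral[OF i]) auto
 then show "(LBINT y. norm (gmix {0<..S} ka (x - y))) \<le> gmix_const TYPE('a) * sqrt S"
  using p S by (simp add: gmix_const_def p_def)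
qed

lemma integral_powr_minus_three_half:
 "integrable lborel (\<lambda>s::real. indicator {1<..} s * s powr (- (3 / 2)))"
 "(LBINT (s::real). indicator {1<..} s * s powr (- (3 / 2))) = 2"
proof -
 have "((\<lambda>s::real. s powr (- (3 / 2))) has_integral (- (1 powr (- (3 / 2) + 1)) / (- (3 / 2) + 1))) {1..}"
  by (intro has_integral_powr_to_inf) auto
 then have "((\<lambda>s::real. s powr (- (3 / 2))) has_integral 2) {1..}" by simp
 then have hi: "((\<lambda>s::real. s powr (- (3 / 2))) has_integral 2) {1<..}"
  by (subst has_integral_spike_set_eq[of _ "{1..}"]) (auto intro: negligible_subset[of "{1}"])
 then have "(\<lambda>s::real. s powr (- (3 / 2))) absolutely_integrable_on {1<..}"
  by (intro nonnegative_absolutely_integrable_1) (auto simp: has_integral_iff)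
 then have si: "set_integrable lborel {1<..} (\<lambda>s::real. s powr (- (3 / 2)))"
  unfolding set_integrable_def by (subst (asm) integrable_completion) auto
 then show "integrable lborel (\<lambda>s::real. indicator {1<..} s * s powr (- (3 / 2)))" by (simp add: set_integrable_def)
 show "(LBINT (s::real). indicator {1<..} s * s powr (- (3 / 2))) = 2"
  using set_borel_integral_eq_integral(2)[OF si] hi by (simp add: set_lebesgue_integral_def integral_unique)
qed

text \<open>The majorant is a Gamma integral with exponent 1 / 2. Its value sqrt pi / (r / 2)
  cancels the prefactor r / 2, and sqrt pi is below 2.\<close>

lemma integral_far_le:
 fixes f :: "real \<Rightarrow> real"
 assumes f: "integrable lborel (\<lambda>s. indicator {1<..} s * f s)" and r: "0 < r" and c: "0 \<le> c"
  and le: "\<And>s. 1 < s \<Longrightarrow> f s \<le> c * (s powr (- (3 / 2)) * exp (- (r\<^sup>2 / 4) / s))"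
 shows "r / 2 * (LBINT s. indicator {1<..} s * f s) \<le> 2 * c"
proof -
 let ?k = "\<lambda>s. indicator {0<..} s *\<^sub>R (s powr (- (1 / 2) - 1) * exp (- (r\<^sup>2 / 4) / s))"
 have b: "0 < r\<^sup>2 / 4" using r by simp
 note G = Gamma_integral_inverse[of "1 / 2", OF _ b, unfolded set_integrable_def set_lebesgue_integral_def]
 have "(LBINT s. indicator {1<..} s * f s) \<le> (LBINT s. c * ?k s)"
  using G(1) le c by (intro integral_mono f integrable_mult_right) (auto split: split_indicator)
 also have "\<dots> = c * (Gamma (1 / 2) / (r\<^sup>2 / 4) powr (1 / 2))" using G(2) by (simp only: integral_mult_right_zero)
 also have "(r\<^sup>2 / 4) powr (1 / 2) = r / 2" using r by (simp add: powr_half_sqrt real_sqrt_divide)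
 finally have "r / 2 * (LBINT s. indicator {1<..} s * f s) \<le> r / 2 * (c * (sqrt pi / (r / 2)))"
  using r unfolding Gamma_one_half_real by (intro mult_left_mono) auto
 also have "\<dots> = c * sqrt pi" using r by simp
 also have "\<dots> \<le> c * sqrt (2\<^sup>2)" using c pi_less_4 by (intro mult_left_mono real_sqrt_le_mono) auto
 finally show ?thesis by simp
qed

text \<open>The second part says how much growth in s the gradient tolerates while the decay s powr
  (- 3 / 2) remains: a factor sqrt s in dimension 2, a factor s from dimension 3 on. This is the
  origin of the two cases of \<open>alpha_rate\<close>.\<close>

lemma heat_div_le:
 fixes z :: "'a::euclidean_space"
 assumes d: "2 \<le> DIM('a)" and s: "1 < s"
 shows "heat s z / s ^ 1 \<le> s powr (- (3 / 2)) * exp (- ((norm z)\<^sup>2 / 4) / s)"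
  and "(if DIM('a) = 2 then sqrt s else s) * (heat s z / s ^ 1) \<le> s powr (- (3 / 2)) * exp (- ((norm z)\<^sup>2 / 4) / s)"
proof -
 let ?A = "if DIM('a) = 2 then sqrt s else s" and ?B = "- ((norm z)\<^sup>2 / 4) / s"
 define e where "e = real DIM('a) / 2"
 have "(4 * pi) powr (- e) \<le> 1" using d pi_gt3 powr_mono[of "- e" 0 "4 * pi"] by (simp add: e_def)
 then have h: "heat s z / s ^ 1 \<le> s powr (- (e + 1)) * exp ?B"
  using s unfolding heat_div_power_eq[of s z 1, OF less_trans[OF zero_less_one s]] e_def of_nat_1 by (intro mult_left_le_one_le) auto
 have "s powr (- (e + 1)) \<le> s powr (- (3 / 2))" using s d by (intro powr_mono) (auto simp: e_def)
 with h show "heat s z / s ^ 1 \<le> s powr (- (3 / 2)) * exp ?B"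
  by (elim order_trans) (intro mult_right_mono, auto)
 have "?A * s powr (- (e + 1)) \<le> s powr (- (3 / 2))"
 proof (cases "DIM('a) = 2")
  case True
  then show ?thesis using s powr_add[of s "1 / 2" "- 2"] by (simp add: e_def powr_half_sqrt)
 next
  case False
  then have "s powr (- e) \<le> s powr (- (3 / 2))" using s d by (intro powr_mono) (auto simp: e_def)
  moreover have "s * s powr (- (e + 1)) = s powr (- e)" using s powr_add[of s 1 "- (e + 1)"] by simp
  ultimately show ?thesis unfolding if_not_P[OF False] by (simp only:)
 qed
 note w = mult_right_mono[OF this exp_ge_zero[of "- ((norm z)\<^sup>2 / 4) / s"]]
 have "0 \<le> ?A" using s by simp
 from order_trans[OF mult_left_mono[OF h this, unfolded mult.assoc[symmetric]] w]
 show "?A * (heat s z / s ^ 1) \<le> s powr (- (3 / 2)) * exp ?B"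
  by (simp only: times_divide_eq_right)
qed

lemma gmix_far:
 fixes z :: "'a::euclidean_space"
 assumes d: "2 \<le> DIM('a)"
 shows "norm (gmix {1<..} 0 z) \<le> gmix_const TYPE('a)"
proof (cases "z = 0")
 case False
 have "norm (gmix {1<..} 0 z) = norm z / 2 * (LBINT s. indicator {1<..} s * (exp (- 0\<^sup>2 * s) * (heat s z / s ^ 1)))"
  by (subst norm_gmix) (auto simp: hmix_def mult.assoc)
 also have "\<dots> \<le> 2 * 1"
  using hmix_1_integrable[of "{1<..}" z 0] False heat_div_le(1)[OF d, of _ z]
  by (intro integral_far_le) (auto simp: subset_iff mult.assoc)
 also have "\<dots> \<le> gmix_const TYPE('a)"
 proof -
  have "2 * 1 \<le> 1 * sqrt 8" by (simp add: real_le_rsqrt)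
  also have "\<dots> \<le> gmix_const TYPE('a)" unfolding gmix_const_def by (intro mult_right_mono) (auto simp: ge_one_powr_ge_zero)
  finally show ?thesis .
 qed
 finally show ?thesis .
qed (simp add: less_imp_le[OF gmix_const_pos])

text \<open>With y = ka^2 s, 1 - exp (- y) is at most y and at most 1, hence at most sqrt y. The
  square root is the growth that dimension 2 can afford.\<close>

lemma screening_weight_le:
 assumes "0 \<le> ka" "0 \<le> s" "2 \<le> d"
 shows "1 - exp (- ka\<^sup>2 * s) \<le> alpha_rate d ka * (if d = 2 then sqrt s else s)"
proof (cases "d = 2")
 case True
 have "1 - exp (- y\<^sup>2) \<le> y" if "0 \<le> y" for y :: real
 proof (cases "y \<le> 1")
  case True
  then have "y\<^sup>2 \<le> y" using that by (simp add: power2_eq_square mult_left_le)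
  then show ?thesis using exp_ge_add_one_self[of "- y\<^sup>2"] by linarith
 next
  case False
  then show ?thesis using exp_gt_zero[of "- y\<^sup>2"] by linarith
 qed
 from this[of "ka * sqrt s"] show ?thesis using assms True by (simp add: alpha_rate_def power_mult_distrib)
next
 case False
 then show ?thesis using exp_ge_add_one_self[of "- ka\<^sup>2 * s"] by (simp add: alpha_rate_def)
qed

text \<open>The growth in s that \<open>screening_weight_le\<close> gives to the removed weight is
  exactly the growth that \<open>heat_div_le\<close> tolerates.\<close>

lemma screening_tail:
 fixes z :: "'a::euclidean_space"
 assumes d: "2 \<le> DIM('a)" and ka: "0 \<le> ka"
 shows "norm (gmix {1<..} 0 z - gmix {1<..} ka z) \<le> 5 * alpha_rate DIM('a) ka"
proof (cases "z = 0")
 let ?A = "hmix {1<..} 0 1 z - hmix {1<..} ka 1 z"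
 case False
 let ?\<alpha> = "alpha_rate DIM('a) ka" and ?f = "\<lambda>ka s. exp (- ka\<^sup>2 * s) * (heat s z / s ^ 1)"
 have \<alpha>: "0 \<le> ?\<alpha>" using ka by (simp add: alpha_rate_def)
 have i: "integrable lborel (\<lambda>s. indicator {1<..} s * ?f ka s)" for ka
  using hmix_1_integrable[of "{1<..}" z ka] False by (simp add: mult.assoc subset_iff)
 have h: "hmix {1<..} ka 1 z = (LBINT s. indicator {1<..} s * ?f ka s)" for ka by (simp add: hmix_def mult.assoc)
 have le: "0 \<le> ?f 0 s - ?f ka s" "?f 0 s - ?f ka s \<le> ?\<alpha> * (s powr (- (3 / 2)) * exp (- ((norm z)\<^sup>2 / 4) / s))" if s: "1 < s" for s
 proof -
  have eq: "?f 0 s - ?f ka s = (1 - exp (- ka\<^sup>2 * s)) * (heat s z / s ^ 1)" by (simp add: left_diff_distrib diff_divide_distrib)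
  show "0 \<le> ?f 0 s - ?f ka s" unfolding eq using s by (intro mult_nonneg_nonneg) auto
  have "?f 0 s - ?f ka s \<le> (?\<alpha> * (if DIM('a) = 2 then sqrt s else s)) * (heat s z / s ^ 1)"
   unfolding eq using s d ka by (intro mult_right_mono screening_weight_le) auto
  also have "\<dots> \<le> ?\<alpha> * (s powr (- (3 / 2)) * exp (- ((norm z)\<^sup>2 / 4) / s))"
   unfolding mult.assoc by (intro mult_left_mono heat_div_le(2)[OF d s] \<alpha>)
  finally show "?f 0 s - ?f ka s \<le> ?\<alpha> * (s powr (- (3 / 2)) * exp (- ((norm z)\<^sup>2 / 4) / s))" .
 qed
 have d: "hmix {1<..} 0 1 z - hmix {1<..} ka 1 z = (LBINT s. indicator {1<..} s * (?f 0 s - ?f ka s))"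
  unfolding h Bochner_Integration.integral_diff[OF i i, symmetric] by (simp only: right_diff_distrib)
 have "0 \<le> hmix {1<..} 0 1 z - hmix {1<..} ka 1 z"
  unfolding d using le(1) by (intro Bochner_Integration.integral_nonneg) (simp split: split_indicator)
 moreover have "gmix {1<..} 0 z - gmix {1<..} ka z = - (?A / 2) *\<^sub>R z"
  by (simp add: gmix_def algebra_simps diff_divide_distrib)
 ultimately have "norm (gmix {1<..} 0 z - gmix {1<..} ka z) = norm z / 2 * ?A" by simp
 also have "\<dots> \<le> 2 * ?\<alpha>"
  unfolding d using False \<alpha> le(2) Bochner_Integration.integrable_diff[OF i i, of 0 ka]
  by (intro integral_far_le) (auto simp: right_diff_distrib)
 finally show ?thesis using \<alpha> by simp
qed (use ka in \<open>simp add: alpha_rate_def\<close>)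

section \<open>The Coulomb solution, its velocity field and its flow\<close>

text \<open>Collects the properties of the Coulomb solution on the closed interval that the
  estimates use. A single constant \<open>B\<close> bounds the density, its time derivative, the
  velocity and the derivative of the velocity; \<open>1 \<le> B\<close> lets it serve as a positive
  Gronwall rate.\<close>

locale density_curve =
 fixes \<rho> \<rho>' :: "real \<Rightarrow> 'a::euclidean_space \<Rightarrow> real" and T R B :: real
 assumes dim: "2 \<le> DIM('a)" and T: "0 < T" and R: "0 \<le> R" and B: "1 \<le> B"
  and dens: "t \<in> {0..T} \<Longrightarrow> probability_density (\<rho> t)"
  and supp: "t \<in> {0..T} \<Longrightarrow> x \<notin> cball 0 R \<Longrightarrow> \<rho> t x = 0"
  and bound: "t \<in> {0..T} \<Longrightarrow> \<rho> t x \<le> B"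
  and diff: "t \<in> {0..T} \<Longrightarrow> \<exists>C D. \<forall>x. (\<rho> t has_derivative D x) (at x) \<and> (\<forall>h. \<bar>D x h\<bar> \<le> C * norm h)"
  and u_diff: "t \<in> {0..T} \<Longrightarrow> velocity 0 (\<rho> t) differentiable (at x)"
  and u_bound: "t \<in> {0..T} \<Longrightarrow> norm (velocity 0 (\<rho> t) x) \<le> B"
  and u_deriv: "t \<in> {0..T} \<Longrightarrow> norm (frechet_derivative (velocity 0 (\<rho> t)) (at x) h) \<le> B * norm h"
  and time_deriv: "t \<in> {0..T} \<Longrightarrow> ((\<lambda>s. \<rho> s x) has_real_derivative \<rho>' t x) (at t within {0..T})"
  and time_bound: "t \<in> {0..T} \<Longrightarrow> \<bar>\<rho>' t x\<bar> \<le> B"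
  and continuity_eq: "t \<in> {0..T} \<Longrightarrow> \<rho>' t x = - divergence (\<lambda>y. \<rho> t y *\<^sub>R velocity 0 (\<rho> t) y) x"
begin

abbreviation u :: "real \<Rightarrow> 'a \<Rightarrow> 'a" where "u t \<equiv> velocity 0 (\<rho> t)"
abbreviation u' :: "real \<Rightarrow> 'a \<Rightarrow> 'a \<Rightarrow> 'a" where "u' t x \<equiv> frechet_derivative (velocity 0 (\<rho> t)) (at x)"
abbreviation law :: "real \<Rightarrow> 'a measure" where "law t \<equiv> density lborel (\<lambda>x. ennreal (\<rho> t x))"

lemma rho_nonneg: "t \<in> {0..T} \<Longrightarrow> 0 \<le> \<rho> t x"
 using dens by (auto simp: probability_density_def)

lemma rho_measurable: "t \<in> {0..T} \<Longrightarrow> \<rho> t \<in> borel_measurable borel"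
 using dens by (auto simp: probability_density_def)

lemma prob_law: "t \<in> {0..T} \<Longrightarrow> prob_space (law t)"
proof
 assume "t \<in> {0..T}"
 then show "emeasure (law t) (space (law t)) = 1"
  using dens[of t] by (simp add: emeasure_density probability_density_def)
qed

lemma u_has_derivative: "t \<in> {0..T} \<Longrightarrow> (u t has_derivative u' t x) (at x)"
 using u_diff frechet_derivative_works by blast

lemma u_lipschitz: "t \<in> {0..T} \<Longrightarrow> norm (u t x - u t y) \<le> B * norm (x - y)"
 by (rule has_derivative_bound_imp_lipschitz[OF u_has_derivative u_deriv]) (use B in auto)

lemma u_measurable: "t \<in> {0..T} \<Longrightarrow> u t \<in> borel_measurable borel"
 by (rule borel_measurable_differentiable[OF u_has_derivative])

lemma integral_law:
 fixes f :: "'a \<Rightarrow> 'b::{banach, second_countable_topology}"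
 assumes t: "t \<in> {0..T}" and [measurable]: "f \<in> borel_measurable borel"
 shows "(\<integral>x. f x \<partial>law t) = (LBINT x. \<rho> t x *\<^sub>R f x)"
 by (rule integral_density) (use rho_measurable[OF t] rho_nonneg[OF t] in auto)

lemma rho_integral: "t \<in> {0..T} \<Longrightarrow> integrable lborel (\<rho> t)" "t \<in> {0..T} \<Longrightarrow> (LBINT x. \<rho> t x) = 1"
proof -
 assume t: "t \<in> {0..T}"
 have nn: "(\<integral>\<^sup>+x. ennreal (\<rho> t x) \<partial>lborel) = 1" using dens[OF t] by (simp add: probability_density_def)
 show i: "integrable lborel (\<rho> t)"
  by (rule integrableI_nonneg) (use nn rho_measurable[OF t] rho_nonneg[OF t] in auto)
 show "(LBINT x. \<rho> t x) = 1"
  using nn rho_nonneg[OF t] rho_measurable[OF t] by (subst integral_eq_nn_integral) auto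
qed

lemma velocity_eq:
 assumes t: "t \<in> {0..T}"
 shows "u t x = - (LBINT y. \<rho> t y *\<^sub>R gmix {0<..} 0 (x - y))"
proof -
 let ?A = "\<lambda>y. \<rho> t y *\<^sub>R gradient (kernel 0) (x - y)"
 have [measurable]: "\<rho> t \<in> borel_measurable borel" by (rule rho_measurable[OF t])
 have "(\<lambda>y. \<rho> t y *\<^sub>R gmix {0<..} 0 (x - y)) \<in> borel_measurable borel" by measurable
 have "AE y in lborel. y \<noteq> x" by (rule AE_lborel_singleton)
 then have ae: "AE y in lborel. \<rho> t y *\<^sub>R gradient (kernel 0) (x - y) = \<rho> t y *\<^sub>R gmix {0<..} 0 (x - y)"
  by eventually_elim (simp add: gradient_kernel_0[OF dim])
 have "(LBINT y. \<rho> t y *\<^sub>R gradient (kernel 0) (x - y)) = (LBINT y. \<rho> t y *\<^sub>R gmix {0<..} 0 (x - y))"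
 proof (rule integral_cong_AE)
  \<comment> \<open>At y = x the gradient has no formula. Splitting off this point shows
    measurability, and the point is a null set.\<close>
  have "?A =
    (\<lambda>y. if y = x then \<rho> t x *\<^sub>R gradient (kernel 0) 0 else \<rho> t y *\<^sub>R gmix {0<..} 0 (x - y))"
   by (auto simp: fun_eq_iff gradient_kernel_0[OF dim])
  then show "?A \<in> borel_measurable lborel" by simp
 qed (use ae in auto)
 then show ?thesis by (simp add: velocity_def)
qed

definition vol where "vol = measure lborel (cball (0::'a) R)"

lemma bounded_compact_support:
 fixes f :: "'a \<Rightarrow> 'b::{banach, second_countable_topology}"
 assumes "f \<in> borel_measurable borel" "\<And>x. norm (f x) \<le> M" "\<And>x. x \<notin> cball 0 R \<Longrightarrow> f x = 0"
 shows "integrable lborel f" "(LBINT x. norm (f x)) \<le> M * vol"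
proof -
 have i: "integrable lborel (\<lambda>x. M * indicator (cball (0::'a) R) x)"
  using emeasure_lborel_cball_finite[of "0::'a" R] by (intro integrable_mult_right integrable_real_indicator) auto
 have le: "norm (f x) \<le> M * indicator (cball (0::'a) R) x" for x
  using assms(2)[of x] assms(3)[of x] by (auto split: split_indicator)
 show fi: "integrable lborel f"
  by (rule Bochner_Integration.integrable_bound[OF i]) (use assms(1) le in \<open>auto intro!: AE_I2 intro: order_trans[OF _ abs_ge_self]\<close>)
 have "(LBINT x. norm (f x)) \<le> (LBINT x. M * indicator (cball (0::'a) R) x)"
  by (rule integral_mono) (use fi i le in auto)
 then show "(LBINT x. norm (f x)) \<le> M * vol" by (simp add: vol_def)
qed

lemma gmix_integral_near:
 fixes f :: "'a \<Rightarrow> real"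
 assumes [measurable]: "f \<in> borel_measurable borel" and f: "\<And>x. \<bar>f x\<bar> \<le> M" and S: "0 \<le> S"
 shows "integrable lborel (\<lambda>y. f y *\<^sub>R gmix {0<..S} ka (x - y))"
  and "(LBINT y. \<bar>f y\<bar> * norm (gmix {0<..S} ka (x - y))) \<le> M * (gmix_const TYPE('a) * sqrt S)"
proof -
 have M: "0 \<le> M" using f[of 0] by linarith
 have i: "integrable lborel (\<lambda>y. M * norm (gmix {0<..S} ka (x - y)))"
  by (intro integrable_mult_right gmix_near(1) S)
 have le: "\<bar>f y\<bar> * norm (gmix {0<..S} ka (x - y)) \<le> M * norm (gmix {0<..S} ka (x - y))" for y
  by (intro mult_right_mono f) auto
 show j: "integrable lborel (\<lambda>y. f y *\<^sub>R gmix {0<..S} ka (x - y))"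
  by (rule Bochner_Integration.integrable_bound[OF i]) (use le M in \<open>auto intro!: AE_I2 simp: abs_mult\<close>)
 have "(LBINT y. \<bar>f y\<bar> * norm (gmix {0<..S} ka (x - y))) \<le> (LBINT y. M * norm (gmix {0<..S} ka (x - y)))"
  by (rule integral_mono) (use integrable_norm[OF j] i le in auto)
 also have "\<dots> \<le> M * (gmix_const TYPE('a) * sqrt S)"
  using gmix_near(2)[OF S, of ka x] M by (simp add: mult_left_mono)
 finally show "(LBINT y. \<bar>f y\<bar> * norm (gmix {0<..S} ka (x - y))) \<le> M * (gmix_const TYPE('a) * sqrt S)" .
qed

text \<open>Split the heat times at 1: the near part is integrable and is paired with the sup norm
  of f, the far part is bounded and is paired with the L1 norm of f, at most
  \<open>M * vol\<close>.\<close>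

lemma coulomb_field_bound:
 fixes f :: "'a \<Rightarrow> real"
 assumes [measurable]: "f \<in> borel_measurable borel" and f: "\<And>x. \<bar>f x\<bar> \<le> M" "\<And>x. x \<notin> cball 0 R \<Longrightarrow> f x = 0"
 shows "integrable lborel (\<lambda>y. f y *\<^sub>R gmix {0<..} 0 (x - y))"
  and "norm (LBINT y. f y *\<^sub>R gmix {0<..} 0 (x - y)) \<le> gmix_const TYPE('a) * (1 + vol) * M"
proof -
 let ?A = "LBINT y. f y *\<^sub>R gmix {0<..1} 0 (x - y)" and ?B = "LBINT y. f y *\<^sub>R gmix {0<..} 0 (x - y)" and ?C = "LBINT y. f y *\<^sub>R gmix {1<..} 0 (x - y)"
 let ?g = "gmix_const TYPE('a)"
 have fi: "integrable lborel f" "(LBINT y. \<bar>f y\<bar>) \<le> M * vol"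
  using bounded_compact_support[of f M] f by auto
 have un: "{0<..} = {0<..1} \<union> {1::real<..}" by auto
 have e: "f y *\<^sub>R gmix {0<..} 0 (x - y) = f y *\<^sub>R gmix {0<..1} 0 (x - y) + f y *\<^sub>R gmix {1<..} 0 (x - y)" for y
  unfolding un by (subst gmix_Un) (auto simp: scaleR_add_right)
 note n = gmix_integral_near[of f M 1 0 x, OF assms(1) f(1)]
 have i: "integrable lborel (\<lambda>y. ?g * \<bar>f y\<bar>)" using fi(1) by simp
 have le: "norm (f y *\<^sub>R gmix {1<..} 0 (x - y)) \<le> ?g * \<bar>f y\<bar>" for y
  using mult_left_mono[OF gmix_far[OF dim, of "x - y"], of "\<bar>f y\<bar>"] by (simp add: mult.commute)
 have j: "integrable lborel (\<lambda>y. f y *\<^sub>R gmix {1<..} 0 (x - y))"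
  by (rule Bochner_Integration.integrable_bound[OF i]) (use le in \<open>auto intro!: AE_I2 intro: order_trans[OF _ abs_ge_self]\<close>)
 show "integrable lborel (\<lambda>y. f y *\<^sub>R gmix {0<..} 0 (x - y))"
  unfolding e using n j by (intro Bochner_Integration.integrable_add) auto
 have "norm ?B \<le>
  norm ?A + norm ?C"
  unfolding e using n j by (subst Bochner_Integration.integral_add) (auto intro: norm_triangle_ineq)
 also have "norm ?A \<le> M * ?g"
  using n(2) integral_norm_bound[of lborel "\<lambda>y. f y *\<^sub>R gmix {0<..1} 0 (x - y)"] by simp
 also have "norm ?C \<le> (LBINT y. ?g * \<bar>f y\<bar>)"
  by (rule order_trans[OF integral_norm_bound integral_mono[OF integrable_norm[OF j] i le]])
 also have "\<dots> \<le> ?g * (M * vol)" using mult_left_mono[OF fi(2) less_imp_le[OF gmix_const_pos]] by simp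
 finally show "norm ?B \<le> ?g * (1 + vol) * M"
  by (simp add: algebra_simps)
qed

lemma rho_time_lipschitz:
 assumes "s \<in> {0..T}" "t \<in> {0..T}"
 shows "\<bar>\<rho> t x - \<rho> s x\<bar> \<le> B * \<bar>t - s\<bar>"
proof -
 have "norm (\<rho> t x - \<rho> s x) \<le> B * norm (t - s)"
  by (rule field_differentiable_bound[of "{0..T}" "\<lambda>t. \<rho> t x" "\<lambda>t. \<rho>' t x"])
   (use time_deriv time_bound assms in auto)
 then show ?thesis by simp
qed

text \<open>The velocity is linear in the density, and differences of densities are still supported
  in the ball of radius R. This supplies the continuity in time that Picard iteration
  requires.\<close>

lemma u_time_lipschitz:
 assumes s: "s \<in> {0..T}" and t: "t \<in> {0..T}"
 shows "norm (u t x - u s x) \<le> gmix_const TYPE('a) * (1 + vol) * B * \<bar>t - s\<bar>"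
proof -
 have [measurable]: "\<rho> t \<in> borel_measurable borel" "\<rho> s \<in> borel_measurable borel"
  using rho_measurable s t by auto
 have ab: "\<bar>\<rho> r y\<bar> \<le> B" if "r \<in> {0..T}" for r y using rho_nonneg[OF that] bound[OF that] by auto
 have i: "integrable lborel (\<lambda>y. \<rho> r y *\<^sub>R gmix {0<..} 0 (x - y))" if "r \<in> {0..T}" for r
  by (rule coulomb_field_bound(1)[OF rho_measurable[OF that] ab[OF that] supp[OF that]])
 have "u t x - u s x = - (LBINT y. (\<rho> t y - \<rho> s y) *\<^sub>R gmix {0<..} 0 (x - y))"
  unfolding velocity_eq[OF t] velocity_eq[OF s] scaleR_diff_left using i[OF s] i[OF t] by simp
 then have "norm (u t x - u s x) = norm (LBINT y. (\<rho> t y - \<rho> s y) *\<^sub>R gmix {0<..} 0 (x - y))" by simp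
 also have "\<dots> \<le> gmix_const TYPE('a) * (1 + vol) * (B * \<bar>t - s\<bar>)"
  by (rule coulomb_field_bound(2)) (use rho_time_lipschitz[OF s t] supp[OF s] supp[OF t] in auto)
 finally show ?thesis by (simp add: mult_ac)
qed

lemma flow_exists:
 "\<exists>y. y 0 = x \<and> (\<forall>t\<in>{0..T}. (y has_vector_derivative u t (y t)) (at t within {0..T}))"
proof -
 \<comment> \<open>Freezing the field after time T extends it to the half-line.\<close>
 let ?F = "\<lambda>t x. u (min t T) x"
 have mt: "min t T \<in> {0..T}" if "0 \<le> t" for t using that T by auto
 obtain y where y: "y 0 = x" "\<And>t. 0 \<le> t \<Longrightarrow> (y has_vector_derivative ?F t (y t)) (at t within {0..})"
 proof (rule picard_lindelof_global[of ?F B B x])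
  show "norm (?F t x - ?F t y) \<le> B * norm (x - y)" if "0 \<le> t" for t x y using u_lipschitz[OF mt[OF that]] .
  show "norm (?F t 0) \<le> B" if "0 \<le> t" for t using u_bound[OF mt[OF that]] .
  show "continuous_on {0..} (\<lambda>t. ?F t x)" for x
  proof (rule continuous_on_compose2[where g = "\<lambda>t. u t x" and f = "\<lambda>t. min t T" and t = "{0..T}"])
   show "continuous_on {0..T} (\<lambda>t. u t x)"
   proof (rule Lipschitz.lipschitz_on_continuous_on)
    show "(gmix_const TYPE('a) * (1 + vol) * B)-lipschitz_on {0..T} (\<lambda>t. u t x)"
     by (rule lipschitz_onI)
      (use u_time_lipschitz gmix_const_pos B in \<open>auto simp: dist_norm vol_def intro!: mult_nonneg_nonneg less_imp_le[OF gmix_const_pos]\<close>)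
   qed
  qed (use T in \<open>auto intro!: continuous_intros\<close>)
 qed (rule that)
 have "(y has_vector_derivative u t (y t)) (at t within {0..T})" if "t \<in> {0..T}" for t
  using y(2)[of t] that by (auto intro: has_vector_derivative_within_subset simp: min_absorb1)
 then show ?thesis using y(1) by blast
qed

definition flow :: "real \<Rightarrow> 'a \<Rightarrow> 'a" where
 "flow t x = (SOME y. y 0 = x \<and> (\<forall>t\<in>{0..T}. (y has_vector_derivative u t (y t)) (at t within {0..T}))) t"

lemma flow_0: "flow 0 x = x"
 and flow_has_derivative: "t \<in> {0..T} \<Longrightarrow> ((\<lambda>s. flow s x) has_vector_derivative u t (flow t x)) (at t within {0..T})"
 using someI_ex[OF flow_exists[of x]] unfolding flow_def by auto

lemma flow_bilipschitz:
 assumes t: "t \<in> {0..T}"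
 shows "(norm (flow t x - flow t y))\<^sup>2 \<le> exp (2 * B * t) * (norm (x - y))\<^sup>2"
  and "exp (- 2 * B * t) * (norm (x - y))\<^sup>2 \<le> (norm (flow t x - flow t y))\<^sup>2"
proof -
 have l: "\<bar>(flow t x - flow t y) \<bullet> (u t (flow t x) - u t (flow t y))\<bar> \<le> B * (norm (flow t x - flow t y))\<^sup>2" if "t \<in> {0..T}" for t
  using order_trans[OF Cauchy_Schwarz_ineq2 mult_left_mono[OF u_lipschitz[OF that] norm_ge_zero]]
  by (simp add: power2_eq_square mult_ac)
 note d = flow_distance_bounds[where I = "{()}" and T = T and L = B and x = "\<lambda>t _. flow t x" and y = "\<lambda>t _. flow t y"
   and vx = "\<lambda>t _. u t (flow t x)" and vy = "\<lambda>t _. u t (flow t y)", OF flow_has_derivative flow_has_derivative, simplified flow_0]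
 show "(norm (flow t x - flow t y))\<^sup>2 \<le> exp (2 * B * t) * (norm (x - y))\<^sup>2"
  and "exp (- 2 * B * t) * (norm (x - y))\<^sup>2 \<le> (norm (flow t x - flow t y))\<^sup>2"
  using d[of t] l B t by auto
qed

lemma flow_measurable: "t \<in> {0..T} \<Longrightarrow> flow t \<in> borel_measurable borel"
proof (rule borel_measurable_continuous_onI, rule Lipschitz.lipschitz_on_continuous_on)
 assume t: "t \<in> {0..T}"
 show "(exp (B * t))-lipschitz_on UNIV (flow t)"
 proof (rule lipschitz_onI)
  fix x y :: 'a
  have "(norm (flow t x - flow t y))\<^sup>2 \<le> (exp (B * t) * norm (x - y))\<^sup>2"
   using flow_bilipschitz(1)[OF t, of x y] by (simp add: power_mult_distrib mult.assoc flip: exp_double)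
  then show "dist (flow t x) (flow t y) \<le> exp (B * t) * dist x y"
   unfolding dist_norm by (rule power2_le_imp_le) simp
 qed simp
qed

text \<open>The continuity equation mentions the flux only through its divergence. The product rule
  provides the whole derivative, with the bound and the compact support that the divergence theorem
  asks for.\<close>

lemma flux_derivative:
 assumes t: "t \<in> {0..T}"
 obtains W' C where "\<And>x. ((\<lambda>y. \<rho> t y *\<^sub>R u t y) has_derivative W' x) (at x)"
  "\<And>x b. b \<in> Basis \<Longrightarrow> norm (W' x b) \<le> C" "\<And>x h. x \<notin> cball 0 R \<Longrightarrow> W' x h = 0"
  "\<And>h. (\<lambda>x. W' x h) \<in> borel_measurable borel" "\<And>x. \<rho>' t x = - (\<Sum>b\<in>Basis. W' x b \<bullet> b)"
proof -
 obtain C D where D: "\<And>x. (\<rho> t has_derivative D x) (at x)" "\<And>x h. \<bar>D x h\<bar> \<le> C * norm h"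
  using diff[OF t] by blast
 let ?W' = "\<lambda>x h. D x h *\<^sub>R u t x + \<rho> t x *\<^sub>R u' t x h"
 have W: "((\<lambda>y. \<rho> t y *\<^sub>R u t y) has_derivative ?W' x) (at x)" for x
  by (rule has_derivative_eq_rhs[OF has_derivative_scaleR[OF D(1) u_has_derivative[OF t]]]) (simp add: fun_eq_iff add.commute)
 have [measurable]: "\<rho> t \<in> borel_measurable borel" "u t \<in> borel_measurable borel"
  "(\<lambda>x. D x h) \<in> borel_measurable borel" "(\<lambda>x. u' t x h) \<in> borel_measurable borel" for h
  using rho_measurable[OF t] u_measurable[OF t] borel_measurable_has_derivative[OF D(1)] borel_measurable_has_derivative[OF u_has_derivative[OF t]] by auto
 have D0: "D x h = 0" if "x \<notin> cball 0 R" for x h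
 proof -
  have "(\<rho> t has_derivative (\<lambda>h. 0)) (at x)"
   by (rule has_derivative_transform_within_open[of "\<lambda>_. 0" _ _ _ "- cball 0 R"]) (use that supp[OF t] in auto)
  from has_derivative_unique[OF D(1) this] show ?thesis by simp
 qed
 have C: "0 \<le> C" using order_trans[OF abs_ge_zero D(2)[of 0 "SOME b. b \<in> (Basis::'a set)"]] by (simp add: SOME_Basis)
 show thesis
 proof (rule that[of ?W' "C * B + B * B"])
  show "norm (?W' x b) \<le> C * B + B * B" if "b \<in> Basis" for x b
  proof (rule order_trans[OF norm_triangle_ineq add_mono])
   show "norm (D x b *\<^sub>R u t x) \<le> C * B"
    using D(2)[of x b] u_bound[OF t, of x] that C by (auto intro!: mult_mono)
   show "norm (\<rho> t x *\<^sub>R u' t x b) \<le> B * B"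
    using rho_nonneg[OF t, of x] bound[OF t, of x] u_deriv[OF t, of x b] that B by (auto intro!: mult_mono)
  qed
  show "\<rho>' t x = - (\<Sum>b\<in>Basis. ?W' x b \<bullet> b)" for x
   unfolding continuity_eq[OF t] divergence_def frechet_derivative_at[OF W, symmetric] ..
  show "?W' x h = 0" if "x \<notin> cball 0 R" for x h using D0[OF that] supp[OF t that] by simp
 qed (use W in measurable)
qed

lemma rho'_measurable: "t \<in> {0..T} \<Longrightarrow> \<rho>' t \<in> borel_measurable borel"
 and rho'_supp: "t \<in> {0..T} \<Longrightarrow> x \<notin> cball 0 R \<Longrightarrow> \<rho>' t x = 0"
proof -
 assume t: "t \<in> {0..T}"
 obtain W' C where "\<And>x. ((\<lambda>y. \<rho> t y *\<^sub>R u t y) has_derivative W' x) (at x)"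
  "\<And>x b. b \<in> Basis \<Longrightarrow> norm (W' x b) \<le> C" and W': "\<And>x h. x \<notin> cball 0 R \<Longrightarrow> W' x h = 0"
  "\<And>h. (\<lambda>x. W' x h) \<in> borel_measurable borel" "\<And>x. \<rho>' t x = - (\<Sum>b\<in>Basis. W' x b \<bullet> b)"
  by (rule flux_derivative[OF t], rule that)
 show "\<rho>' t \<in> borel_measurable borel" unfolding W'(3)[abs_def] using W'(2) by simp
 show "\<rho>' t x = 0" if "x \<notin> cball 0 R" using W'(1)[OF that] W'(3) by simp
qed

text \<open>The divergence theorem for the compactly supported field \<phi> \<rho> u.\<close>

lemma weak_continuity_equation:
 fixes \<phi> :: "'a \<Rightarrow> real" and g :: "'a \<Rightarrow> 'a"
 assumes t: "t \<in> {0..T}" and \<phi>: "\<And>x. (\<phi> has_derivative (\<lambda>h. g x \<bullet> h)) (at x)"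
  and [measurable]: "g \<in> borel_measurable borel" and \<phi>b: "\<And>x. \<bar>\<phi> x\<bar> \<le> M" and gb: "\<And>x. norm (g x) \<le> M"
 shows "(LBINT x. \<phi> x * \<rho>' t x) = (LBINT x. \<rho> t x * (g x \<bullet> u t x))"
proof -
 obtain W' C where W: "\<And>x. ((\<lambda>y. \<rho> t y *\<^sub>R u t y) has_derivative W' x) (at x)"
  and W'b: "\<And>x b. b \<in> Basis \<Longrightarrow> norm (W' x b) \<le> C" and W'0: "\<And>x h. x \<notin> cball 0 R \<Longrightarrow> W' x h = 0"
  and [measurable]: "\<And>h. (\<lambda>x. W' x h) \<in> borel_measurable borel" and div: "\<And>x. \<rho>' t x = - (\<Sum>b\<in>Basis. W' x b \<bullet> b)"
  by (rule flux_derivative[OF t], rule that)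
 have M: "0 \<le> M" using \<phi>b[of 0] by linarith
 note [measurable] = rho_measurable[OF t] u_measurable[OF t] rho'_measurable[OF t] borel_measurable_differentiable[OF \<phi>]
 let ?V' = "\<lambda>x h. (g x \<bullet> h) *\<^sub>R (\<rho> t x *\<^sub>R u t x) + \<phi> x *\<^sub>R W' x h"
 have V: "((\<lambda>x. \<phi> x *\<^sub>R (\<rho> t x *\<^sub>R u t x)) has_derivative ?V' x) (at x)" for x
  by (rule has_derivative_eq_rhs[OF has_derivative_scaleR[OF \<phi> W]]) (simp add: fun_eq_iff add.commute)
 have ru: "norm (\<rho> t x *\<^sub>R u t x) \<le> B * B" for x
  using rho_nonneg[OF t, of x] bound[OF t, of x] u_bound[OF t, of x] B by (auto intro!: mult_mono)
 have ib: "norm (v \<bullet> b) \<le> K" if "norm v \<le> K" "b \<in> Basis" for v b :: 'a and K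
  using Cauchy_Schwarz_ineq2[of v b] that by simp
 have int: "integrable lborel (\<lambda>x. ?V' x b \<bullet> b)" if b: "b \<in> Basis" for b
 proof (rule bounded_compact_support(1)[where M = "M * (B * B) + M * C"])
  show "norm (?V' x b \<bullet> b) \<le> M * (B * B) + M * C" for x
  proof (rule ib[OF order_trans[OF norm_triangle_ineq add_mono] b])
   show "norm ((g x \<bullet> b) *\<^sub>R (\<rho> t x *\<^sub>R u t x)) \<le> M * (B * B)"
    unfolding norm_scaleR[of "g x \<bullet> b"] by (rule mult_mono[OF ib[OF gb b, unfolded real_norm_def] ru M norm_ge_zero])
   show "norm (\<phi> x *\<^sub>R W' x b) \<le> M * C"
    unfolding norm_scaleR by (rule mult_mono[OF \<phi>b W'b[OF b] M norm_ge_zero])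
  qed
  show "?V' x b \<bullet> b = 0" if "x \<notin> cball 0 R" for x using supp[OF t that] W'0[OF that] by simp
 qed measurable
 have "(LBINT x. (\<Sum>b\<in>Basis. ?V' x b \<bullet> b)) = 0"
 proof (rule integral_divergence_eq_0[OF V _ int])
  fix b :: 'a assume b: "b \<in> Basis"
  show "integrable lborel (\<lambda>x. \<phi> x *\<^sub>R (\<rho> t x *\<^sub>R u t x) \<bullet> b)"
  proof (rule bounded_compact_support(1)[where M = "M * (B * B)"])
   show "norm (\<phi> x *\<^sub>R (\<rho> t x *\<^sub>R u t x) \<bullet> b) \<le> M * (B * B)" for x
    by (rule ib[OF _ b], subst norm_scaleR, rule mult_mono[OF \<phi>b ru M norm_ge_zero])
  qed (use supp[OF t] in auto)
 qed
 moreover have "(\<Sum>b\<in>Basis. ?V' x b \<bullet> b) = \<rho> t x * (g x \<bullet> u t x) - \<phi> x * \<rho>' t x" for x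
 proof -
  have "(\<Sum>b\<in>Basis. ?V' x b \<bullet> b) = \<rho> t x * (\<Sum>b\<in>Basis. (g x \<bullet> b) * (u t x \<bullet> b)) + \<phi> x * (\<Sum>b\<in>Basis. W' x b \<bullet> b)"
   unfolding sum_distrib_left sum.distrib[symmetric] by (rule sum.cong) (simp_all add: inner_add_left algebra_simps)
  then show ?thesis by (simp only: div euclidean_inner[symmetric])
 qed
 moreover have "integrable lborel (\<lambda>x. \<rho> t x * (g x \<bullet> u t x))"
 proof (rule bounded_compact_support(1)[where M = "M * (B * B)"])
  show "norm (\<rho> t x * (g x \<bullet> u t x)) \<le> M * (B * B)" for x
   using order_trans[OF Cauchy_Schwarz_ineq2[of "g x" "\<rho> t x *\<^sub>R u t x"] mult_mono[OF gb ru M norm_ge_zero]] by simp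
 qed (use supp[OF t] in auto)
 moreover have "integrable lborel (\<lambda>x. \<phi> x * \<rho>' t x)"
 proof (rule bounded_compact_support(1)[where M = "M * B"])
  show "norm (\<phi> x * \<rho>' t x) \<le> M * B" for x
   unfolding real_norm_def abs_mult using \<phi>b[of x] time_bound[OF t, of x] M by (intro mult_mono) auto
 qed (use rho'_supp[OF t] in auto)
 ultimately show ?thesis by simp
qed

end

section \<open>Transport of the energy\<close>

lemma fubini_bounded:
 fixes f :: "'v \<Rightarrow> 'w \<Rightarrow> 'b::{banach, second_countable_topology}"
 assumes "finite_measure M1" "finite_measure M2"
  and [measurable]: "(\<lambda>(x, y). f x y) \<in> borel_measurable (M1 \<Otimes>\<^sub>M M2)" and f: "\<And>x y. norm (f x y) \<le> C"
 shows "(\<integral>x. (\<integral>y. f x y \<partial>M2) \<partial>M1) = (\<integral>y. (\<integral>x. f x y \<partial>M1) \<partial>M2)"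
  and "integrable M1 (\<lambda>x. \<integral>y. f x y \<partial>M2)"
  and "(\<integral>p. (case p of (x, y) \<Rightarrow> f x y) \<partial>(M1 \<Otimes>\<^sub>M M2)) = (\<integral>x. (\<integral>y. f x y \<partial>M2) \<partial>M1)"
proof -
 let ?A = "\<integral>x. (\<integral>y. f x y \<partial>M2) \<partial>M1"
 interpret M1: finite_measure M1 by fact
 interpret M2: finite_measure M2 by fact
 interpret pair_sigma_finite M1 M2 ..
 interpret P: finite_measure "M1 \<Otimes>\<^sub>M M2"
  by (rule finite_measure_pair_measure) (rule M1.finite_measure_axioms M2.finite_measure_axioms)+
 have i: "integrable (M1 \<Otimes>\<^sub>M M2) (\<lambda>(x, y). f x y)"
  by (rule P.integrable_const_bound[of _ C]) (use f in auto)
 show "?A = (\<integral>y. (\<integral>x. f x y \<partial>M1) \<partial>M2)"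
  and "integrable M1 (\<lambda>x. \<integral>y. f x y \<partial>M2)"
  and "(\<integral>p. (case p of (x, y) \<Rightarrow> f x y) \<partial>(M1 \<Otimes>\<^sub>M M2)) = ?A"
  using Fubini_integral[OF i] integrable_fst[OF i] integral_fst[OF i] by auto
qed

text \<open>Fubini and evenness of K: the bilinear form of the kernel is symmetric also between two
  different signed measures.\<close>

lemma sdiff_commute:
 fixes K :: "'a::euclidean_space \<Rightarrow> real"
 assumes l: "law_pair \<mu> \<nu>" "law_pair \<mu>' \<nu>'" and [measurable]: "K \<in> borel_measurable borel"
  and K: "\<And>x. \<bar>K x\<bar> \<le> C" "\<And>x. K (- x) = K x"
 shows "law_pair.sdiff \<mu> \<nu> (\<lambda>x. law_pair.sdiff \<mu>' \<nu>' (\<lambda>y. K (x - y))) = law_pair.sdiff \<mu>' \<nu>' (\<lambda>x. law_pair.sdiff \<mu> \<nu> (\<lambda>y. K (x - y)))"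
proof -
 interpret l: law_pair \<mu> \<nu> by fact
 interpret m: law_pair \<mu>' \<nu>' by fact
 have sw: "(\<integral>x. \<integral>y. K (x - y) \<partial>M2 \<partial>M1) = (\<integral>x. \<integral>y. K (x - y) \<partial>M1 \<partial>M2)" and i: "integrable M1 (\<lambda>x. \<integral>y. K (x - y) \<partial>M2)"
  if M: "prob_space M1" "prob_space M2" and [measurable_cong]: "sets M1 = sets borel" "sets M2 = sets borel" for M1 M2
 proof -
  note fin = prob_space.finite_measure[OF M(1)] prob_space.finite_measure[OF M(2)]
  have m: "(\<lambda>(x, y). K (x - y)) \<in> borel_measurable (M1 \<Otimes>\<^sub>M M2)" by measurable
  note f = fubini_bounded[OF fin m, of C]
  show "integrable M1 (\<lambda>x. \<integral>y. K (x - y) \<partial>M2)" using K(1) by (intro f) auto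
  have "(\<integral>x. \<integral>y. K (x - y) \<partial>M2 \<partial>M1) = (\<integral>y. \<integral>x. K (x - y) \<partial>M1 \<partial>M2)" using K(1) by (intro f) auto
  also have "\<dots> = (\<integral>y. \<integral>x. K (y - x) \<partial>M1 \<partial>M2)" using K(2)[of "_ - _"] by simp
  finally show "(\<integral>x. \<integral>y. K (x - y) \<partial>M2 \<partial>M1) = (\<integral>x. \<integral>y. K (x - y) \<partial>M1 \<partial>M2)" .
 qed
 note p = l.prob l.sets_eq m.prob m.sets_eq
 show ?thesis
  unfolding l.sdiff_def m.sdiff_def using p i
  by (simp add: sw[of \<mu>' \<mu>] sw[of \<mu>' \<nu>] sw[of \<nu>' \<mu>] sw[of \<nu>' \<nu>])
qed

lemma (in law_pair) hmix_potential:
 assumes ka: "0 < ka" and S: "0 < S"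
  and C: "\<And>x::'a. \<bar>hmix {S<..} ka 0 x\<bar> \<le> C" "\<And>x::'a. norm (gmix {S<..} ka x) \<le> C"
 shows "((\<lambda>x. sdiff (\<lambda>y. hmix {S<..} ka 0 (x - y))) has_derivative (\<lambda>h. sdiff (\<lambda>y. gmix {S<..} ka (x - y)) \<bullet> h)) (at x)"
  and "\<bar>sdiff (\<lambda>y. hmix {S<..} ka 0 (x - y))\<bar> \<le> 2 * C" "norm (sdiff (\<lambda>y. gmix {S<..} ka (x - y))) \<le> 2 * C"
proof -
 let ?K = "hmix {S<..} ka 0 :: 'a \<Rightarrow> real" and ?g = "gmix {S<..} ka :: 'a \<Rightarrow> 'a"
 have "((\<lambda>x. sdiff (\<lambda>y. ?K (x - y))) has_derivative (\<lambda>h. sdiff (\<lambda>y. ?g (x - y) \<bullet> h))) (at x)"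
 proof (rule sdiff_has_derivative[of _ _ C C])
  show "(?K has_derivative (\<bullet>) (?g w)) (at w)" for w
   using S by (intro hmix_has_derivative_gmix[OF _ ka] hmix_atI_cut[of _ S]) auto
  show "norm (?g w \<bullet> h) \<le> C * norm h" for w h
   using order_trans[OF Cauchy_Schwarz_ineq2 mult_right_mono[OF C(2) norm_ge_zero]] by simp
 qed (use C(1) in simp)
 moreover have "sdiff (\<lambda>y. ?g (x - y) \<bullet> h) = sdiff (\<lambda>y. ?g (x - y)) \<bullet> h" for h
  using C(2) by (intro sdiff_linear[OF bounded_linear_inner_left, of _ C]) auto
 ultimately show "((\<lambda>x. sdiff (\<lambda>y. ?K (x - y))) has_derivative (\<lambda>h. sdiff (\<lambda>y. ?g (x - y)) \<bullet> h)) (at x)" by simp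
 have c: "ssum (\<lambda>y. C) = 2 * C" using M.prob_space N.prob_space by (simp add: ssum_def)
 show "\<bar>sdiff (\<lambda>y. ?K (x - y))\<bar> \<le> 2 * C" "norm (sdiff (\<lambda>y. ?g (x - y))) \<le> 2 * C"
  using norm_sdiff_le[of "\<lambda>y. ?K (x - y)" "\<lambda>y. C" C] norm_sdiff_le[of "\<lambda>y. ?g (x - y)" "\<lambda>y. C" C] C unfolding c by auto
qed

text \<open>Used in two ways: with \<open>P\<close> the initial law and \<open>Z\<close> the Coulomb
  flow in \<open>flow_law\<close>, and with \<open>P\<close> uniform on the particle labels and
  \<open>Z\<close> the particle positions in \<open>menergy_has_derivative\<close>.\<close>

locale moving_points = density_curve \<rho> \<rho>' T R B
 for \<rho> \<rho>' :: "real \<Rightarrow> 'a::euclidean_space \<Rightarrow> real" and T R B :: real +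
 fixes P :: "'w measure" and Z V :: "real \<Rightarrow> 'w \<Rightarrow> 'a" and C :: real
 assumes P: "prob_space P"
  and Z: "t \<in> {0..T} \<Longrightarrow> ((\<lambda>s. Z s w) has_vector_derivative V t w) (at t within {0..T})"
  and V: "t \<in> {0..T} \<Longrightarrow> norm (V t w) \<le> C"
  and Zm: "t \<in> {0..T} \<Longrightarrow> Z t \<in> borel_measurable P" and Vm: "t \<in> {0..T} \<Longrightarrow> V t \<in> borel_measurable P"

lemma (in density_curve) law_pair_law: "t \<in> {0..T} \<Longrightarrow> prob_space \<mu> \<Longrightarrow> sets \<mu> = sets borel \<Longrightarrow> law_pair \<mu> (law t)"
 by (rule law_pair.intro; (rule prob_law)?; (simp only: sets_density sets_lborel)?)

context moving_points begin

abbreviation sd where "sd t \<equiv> law_pair.sdiff (distr P borel (Z t)) (law t)"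

text \<open>The time derivative of \<open>sd t f\<close> when \<open>G\<close> is the gradient of
  \<open>f\<close>: the points move with velocity \<open>V\<close> and the background with velocity
  \<open>u\<close>.\<close>

definition transport_rate :: "real \<Rightarrow> ('a \<Rightarrow> 'a) \<Rightarrow> real" where
 "transport_rate t G = (\<integral>w. V t w \<bullet> G (Z t w) \<partial>P) - (\<integral>x. u t x \<bullet> G x \<partial>law t)"

lemma lp: "t \<in> {0..T} \<Longrightarrow> law_pair (distr P borel (Z t)) (law t)"
 by (rule law_pair_law) (auto intro!: prob_space.prob_space_distr[OF P Zm])

text \<open>The points contribute by differentiation under the expectation, the background by the
  weak continuity equation.\<close>

lemma sd_has_derivative:
 assumes f: "\<And>x. (f has_derivative (\<lambda>h. G x \<bullet> h)) (at x)" and [measurable]: "G \<in> borel_measurable borel"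
  and D: "\<And>x. \<bar>f x\<bar> \<le> D" "\<And>x. norm (G x) \<le> D" and t: "t \<in> {0..T}"
 shows "((\<lambda>s. sd s f) has_real_derivative transport_rate t G) (at t within {0..T})"
  and "\<bar>transport_rate t G\<bar> \<le> (C + B) * D"
proof -
 interpret P: prob_space P by (rule P)
 interpret \<nu>: prob_space "law t" by (rule prob_law[OF t])
 have [measurable]: "f \<in> borel_measurable borel" by (rule borel_measurable_differentiable[OF f])
 note [measurable] = Zm[OF t] Vm[OF t] u_measurable[OF t] rho_measurable[OF t]
 have D0: "0 \<le> D" using D(1)[of 0] by linarith
 have VG: "\<bar>V s w \<bullet> G x\<bar> \<le> C * D" if "s \<in> {0..T}" for s w x
  using order_trans[OF norm_ge_zero V[OF that, of w]]
  by (intro order_trans[OF Cauchy_Schwarz_ineq2 mult_mono[OF V[OF that] D(2)]]) auto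
 have "((\<lambda>s. \<integral>w. f (Z s w) \<partial>P) has_derivative (\<lambda>h. \<integral>w. h * (V t w \<bullet> G (Z t w)) \<partial>P)) (at t within {0..T})"
 proof (rule has_derivative_lebesgue_integral[where B = "\<lambda>_. C * D"])
  show "integrable P (\<lambda>w. f (Z s w))" if "s \<in> {0..T}" for s
   using D(1) measurable_compose[OF Zm[OF that], of f] by (intro P.integrable_const_bound[of _ D]) auto
  show "((\<lambda>s. f (Z s w)) has_derivative (\<lambda>h. h * (V s w \<bullet> G (Z s w)))) (at s within {0..T})" if "s \<in> {0..T}" for s w
   using has_derivative_compose[OF Z[OF that, unfolded has_vector_derivative_def] f] by (simp add: inner_commute)
  show "norm (h * (V s w \<bullet> G (Z s w))) \<le> C * D * norm h" if "s \<in> {0..T}" for s w h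
   using mult_left_mono[OF VG[OF that] abs_ge_zero[of h]] by (simp add: abs_mult mult.commute)
 qed (use t in auto)
 moreover have "((\<lambda>s. LBINT x. \<rho> s x * f x) has_derivative (\<lambda>h. LBINT x. h * (f x * \<rho>' t x))) (at t within {0..T})"
 proof (rule has_derivative_lebesgue_integral[where B = "\<lambda>x. D * B * indicator (cball 0 R) x"])
  have rb: "\<bar>\<rho> s x\<bar> \<le> B" if "s \<in> {0..T}" for s x using rho_nonneg[OF that] bound[OF that] by auto
  show "integrable lborel (\<lambda>x. \<rho> s x * f x)" if "s \<in> {0..T}" for s
   using rho_measurable[OF that] supp[OF that] rb[OF that] D(1) B
   by (intro bounded_compact_support(1)[where M = "B * D"]) (auto simp: abs_mult intro!: mult_mono)
  show "integrable lborel (\<lambda>x. D * B * indicator (cball (0::'a) R) x)"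
   using emeasure_lborel_cball_finite[of "0::'a" R] by (intro integrable_mult_right integrable_real_indicator) auto
  show "((\<lambda>s. \<rho> s x * f x) has_derivative (\<lambda>h. h * (f x * \<rho>' s x))) (at s within {0..T})" if "s \<in> {0..T}" for s x
   by (rule has_derivative_eq_rhs[OF DERIV_cmult_right[OF time_deriv[OF that], unfolded has_field_derivative_def]]) (simp add: fun_eq_iff)
  show "norm (h * (f x * \<rho>' s x)) \<le> D * B * indicator (cball 0 R) x * norm h" if s: "s \<in> {0..T}" for s x h
  proof (cases "x \<in> cball 0 R")
   case True
   have "\<bar>f x * \<rho>' s x\<bar> \<le> D * B" unfolding abs_mult using D(1) time_bound[OF s] D0 by (intro mult_mono) auto
   from mult_left_mono[OF this abs_ge_zero[of h]] True show ?thesis by (simp add: abs_mult mult.commute)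
  qed (simp add: rho'_supp[OF s])
 qed (use t rho'_measurable[OF t] in auto)
 moreover have "(LBINT x. f x * \<rho>' t x) = (\<integral>x. u t x \<bullet> G x \<partial>law t)"
  using weak_continuity_equation[OF t f _ D] t by (simp add: integral_law inner_commute)
 ultimately have "((\<lambda>s. (\<integral>w. f (Z s w) \<partial>P) - (LBINT x. \<rho> s x * f x)) has_real_derivative transport_rate t G) (at t within {0..T})"
  unfolding has_field_derivative_def transport_rate_def integral_mult_right_zero
  by (auto intro: has_derivative_eq_rhs[OF has_derivative_diff] simp: fun_eq_iff algebra_simps)
 then show "((\<lambda>s. sd s f) has_real_derivative transport_rate t G) (at t within {0..T})"
  by (rule has_field_derivative_transform_within[of _ _ _ _ 1])
   (use t Zm in \<open>auto simp: law_pair.sdiff_def[OF lp] integral_distr integral_law\<close>)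
 have "\<bar>\<integral>w. V t w \<bullet> G (Z t w) \<partial>P\<bar> \<le> C * D"
  using VG[OF t] by (intro order_trans[OF integral_abs_bound P.integral_le_const]) (auto intro!: P.integrable_const_bound[of _ "C * D"])
 moreover have "\<bar>u t x \<bullet> G x\<bar> \<le> B * D" for x
  using B by (intro order_trans[OF Cauchy_Schwarz_ineq2 mult_mono[OF u_bound[OF t] D(2)]]) auto
 then have "\<bar>\<integral>x. u t x \<bullet> G x \<partial>law t\<bar> \<le> B * D"
  by (intro order_trans[OF integral_abs_bound \<nu>.integral_le_const]) (auto intro!: \<nu>.integrable_const_bound[of _ "B * D"])
 ultimately show "\<bar>transport_rate t G\<bar> \<le> (C + B) * D" unfolding transport_rate_def distrib_right by linarith
qed

lemma sd_time_lipschitz: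
 assumes f: "\<And>x. (f has_derivative (\<lambda>h. G x \<bullet> h)) (at x)" "G \<in> borel_measurable borel"
  and D: "\<And>x. \<bar>f x\<bar> \<le> D" "\<And>x. norm (G x) \<le> D" and st: "s \<in> {0..T}" "t \<in> {0..T}"
 shows "\<bar>sd s f - sd t f\<bar> \<le> (C + B) * D * \<bar>s - t\<bar>"
 using field_differentiable_bound[of "{0..T}" "\<lambda>s. sd s f" "\<lambda>s. transport_rate s G" "(C + B) * D" t s]
  sd_has_derivative[OF f D] st by (auto simp: abs_minus_commute)

text \<open>With the symmetric form \<open>B s t = sd s (sd t K)\<close> one has \<open>B s s = 2 * B s t - B t t + (sd s - sd t) (sd s - sd t) K\<close>,
 and the last term is quadratic in \<open>s - t\<close>.\<close>

lemma energy_has_derivative: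
 assumes ka: "0 < ka" and S: "0 < S" and t: "t \<in> {0..T}"
 shows "((\<lambda>s. sd s (\<lambda>x. sd s (\<lambda>y. hmix {S<..} ka 0 (x - y)))) has_real_derivative
  2 * transport_rate t (\<lambda>x. sd t (\<lambda>y. gmix {S<..} ka (x - y)))) (at t within {0..T})"
proof -
 let ?K = "hmix {S<..} ka 0 :: 'a \<Rightarrow> real" and ?g = "gmix {S<..} ka :: 'a \<Rightarrow> 'a" and ?H = "hessmix {S<..} ka :: 'a \<Rightarrow> 'a \<Rightarrow> 'a"
 obtain D where D: "\<And>x. ?K x \<le> D" "\<And>x. norm (?g x) \<le> D" "\<And>x h. norm (?H x h) \<le> D * norm h"
 proof -
  obtain K0 :: "'a \<Rightarrow> real" and D where K: "\<And>x. K0 x \<le> D" "\<And>x. ?K x \<le> K0 x" "\<And>x. norm (?g x) \<le> K0 x" "\<And>x h. norm (?H x h) \<le> K0 x * norm h"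
   using hmix_cut_dominated[OF ka S] by metis
  show thesis by (rule that[of D]) (use K in \<open>blast intro: order_trans mult_right_mono norm_ge_zero\<close>)+
 qed
 have Kn: "0 \<le> ?K x" for x using S by (intro hmix_nonneg) auto
 have K: "\<bar>?K x\<bar> \<le> D" for x using D(1) Kn by simp
 have at: "hmix_at {S<..} x" for x :: 'a using S by (intro hmix_atI_cut[of _ S]) auto
 have sh: "((\<lambda>y. x - y) has_derivative uminus) (at y)" for x y :: 'a by (auto intro!: derivative_eq_intros)
 have C0: "0 \<le> C + B" using order_trans[OF norm_ge_zero V[OF t]] B by simp
 define c where "c = (C + B) * D"
 define F G where "F s x = sd s (\<lambda>y. ?K (x - y))" and "G s x = sd s (\<lambda>y. ?g (x - y))" for s x
 have FG: "(F s has_derivative (\<lambda>h. G s x \<bullet> h)) (at x)" "\<bar>F s x\<bar> \<le> 2 * D" "norm (G s x) \<le> 2 * D" "G s \<in> borel_measurable borel" "F s \<in> borel_measurable borel"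
  if s: "s \<in> {0..T}" for s x
  using law_pair.hmix_potential[OF lp[OF s] ka S K D(2), of x] law_pair.borel_measurable_sdiff[OF lp[OF s], of "\<lambda>x y. ?g (x - y)" borel]
   law_pair.borel_measurable_sdiff[OF lp[OF s], of "\<lambda>x y. ?K (x - y)" borel]
  unfolding F_def[abs_def] G_def[abs_def] by simp_all
 have Ft: "\<bar>F s x - F t x\<bar> \<le> c * \<bar>s - t\<bar>" if s: "s \<in> {0..T}" for s x
  unfolding F_def c_def
 proof (rule sd_time_lipschitz[where G = "\<lambda>y. - ?g (x - y)", OF _ _ _ _ s t])
  show "((\<lambda>y. ?K (x - y)) has_derivative (\<bullet>) (- ?g (x - y))) (at y)" for y
   by (rule has_derivative_eq_rhs[OF has_derivative_compose[OF sh hmix_has_derivative_gmix[OF at ka]]]) (simp add: fun_eq_iff)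
 qed (use K D(2) in auto)
 have Gt: "norm (G s x - G t x) \<le> c * \<bar>s - t\<bar>" if s: "s \<in> {0..T}" for s x
 proof -
  \<comment> \<open>The norm is tested against vectors of norm at most 1; the extremal one is
    \<open>sgn\<close> of the difference.\<close>
  have e: "(G s x - G t x) \<bullet> e \<le> c * \<bar>s - t\<bar>" if n: "norm e \<le> 1" for e
  proof -
   have ge: "\<bar>?g w \<bullet> e\<bar> \<le> D" "norm (?H w e) \<le> D" for w
    using order_trans[OF Cauchy_Schwarz_ineq2 mult_left_le[OF n norm_ge_zero], of "?g w"] D(2)[of w]
     order_trans[OF D(3) mult_left_le[OF n order_trans[OF norm_ge_zero D(2)]], of w] by auto
   have "\<bar>sd s (\<lambda>y. ?g (x - y) \<bullet> e) - sd t (\<lambda>y. ?g (x - y) \<bullet> e)\<bar> \<le> c * \<bar>s - t\<bar>"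
    unfolding c_def
   proof (rule sd_time_lipschitz[where G = "\<lambda>y. - ?H (x - y) e", OF _ _ _ _ s t])
    show "((\<lambda>y. ?g (x - y) \<bullet> e) has_derivative (\<bullet>) (- ?H (x - y) e)) (at y)" for y
     by (rule has_derivative_eq_rhs[OF has_derivative_inner_left[OF has_derivative_compose[OF sh gmix_has_derivative[OF at ka]]]]) (simp add: hessmix_def fun_eq_iff inner_simps inner_commute field_simps)
    show "(\<lambda>y. - ?H (x - y) e) \<in> borel_measurable borel" unfolding hessmix_def by measurable
   qed (use ge in auto)
   moreover have "sd r (\<lambda>y. ?g (x - y) \<bullet> e) = G r x \<bullet> e" if "r \<in> {0..T}" for r
    unfolding G_def using D(2) by (intro law_pair.sdiff_linear[OF lp[OF that] bounded_linear_inner_left, of _ D]) auto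
   ultimately show ?thesis using s t by (simp add: inner_diff_left)
  qed
  show ?thesis
  proof (cases "G s x = G t x")
   case True
   then show ?thesis using order_trans[OF abs_ge_zero Ft[OF s]] by simp
  next
   case False
   then show ?thesis using e[of "sgn (G s x - G t x)"] by (simp add: sgn_div_norm dot_square_norm power2_eq_square mult.assoc[symmetric])
  qed
 qed
 define R where "R s = sd s (F s) - 2 * sd s (F t) + sd t (F t)" for s
 have R: "\<bar>R s\<bar> \<le> (C + B) * c * (s - t)\<^sup>2" if s: "s \<in> {0..T}" for s
 proof -
  have sub: "sd r (\<lambda>x. F s x - F t x) = sd r (F s) - sd r (F t)" if r: "r \<in> {0..T}" for r
   using FG[OF s] FG[OF t] by (intro law_pair.sdiff_add(2)[OF lp[OF r], of _ "2 * D" _ "2 * D"]) auto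
  have "sd s (F t) = sd t (F s)" unfolding F_def by (rule sdiff_commute[OF lp[OF s] lp[OF t] _ K]) auto
  then have "R s = sd s (\<lambda>x. F s x - F t x) - sd t (\<lambda>x. F s x - F t x)" unfolding R_def sub[OF s] sub[OF t] by simp
  moreover have "((\<lambda>x. F s x - F t x) has_derivative (\<bullet>) (G s x - G t x)) (at x)" for x
   by (rule has_derivative_eq_rhs[OF has_derivative_diff[OF FG(1)[OF s] FG(1)[OF t]]]) (simp add: fun_eq_iff inner_diff_left)
  from sd_time_lipschitz[OF this _ Ft[OF s] Gt[OF s] s t] have "\<bar>sd s (\<lambda>x. F s x - F t x) - sd t (\<lambda>x. F s x - F t x)\<bar> \<le> (C + B) * (c * \<bar>s - t\<bar>) * \<bar>s - t\<bar>"
   using FG(4)[OF s] FG(4)[OF t] by simp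
  ultimately show ?thesis by (simp add: power2_eq_square mult.assoc flip: abs_mult)
 qed
 have R0: "(R has_real_derivative 0) (at t within {0..T})"
  unfolding has_field_derivative_iff
 proof (rule Lim_null_comparison)
  have "R t = 0" by (simp add: R_def)
  then have "norm ((R s - R t) / (s - t)) \<le> (C + B) * c * \<bar>s - t\<bar>" if "s \<in> {0..T}" for s
   using R[OF that] by (cases "s = t") (simp_all add: abs_divide pos_divide_le_eq power2_eq_square mult.assoc)
  then show "\<forall>\<^sub>F s in at t within {0..T}. norm ((R s - R t) / (s - t)) \<le> (C + B) * c * \<bar>s - t\<bar>"
   by (auto simp: eventually_at_filter)
  show "((\<lambda>s. (C + B) * c * \<bar>s - t\<bar>) \<longlongrightarrow> 0) (at t within {0..T})" by (auto intro!: tendsto_eq_intros)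
 qed
 have "((\<lambda>s. 2 * sd s (F t) - sd t (F t) + R s) has_real_derivative 2 * transport_rate t (G t)) (at t within {0..T})"
  using sd_has_derivative(1)[OF FG(1)[OF t] FG(4)[OF t] FG(2,3)[OF t] t] R0 by (auto intro!: derivative_eq_intros)
 then have "((\<lambda>s. sd s (F s)) has_real_derivative 2 * transport_rate t (G t)) (at t within {0..T})" by (simp add: R_def)
 then show ?thesis unfolding F_def G_def .
qed

end

section \<open>Laws whose energy distance vanishes are equal\<close>

lemma eq_0_if_le_sqrt:
 fixes h c \<delta> :: real
 assumes "0 < \<delta>" and le: "\<And>ta. 0 < ta \<Longrightarrow> ta < \<delta> \<Longrightarrow> \<bar>h\<bar> \<le> c * sqrt ta"
 shows "h = 0"
proof -
 have "eventually (\<lambda>ta. \<bar>h\<bar> \<le> c * sqrt ta) (at_right 0)"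
  using eventually_at_right[of 0 1] assms by (auto simp: eventually_at_right intro!: exI[of _ \<delta>])
 moreover have "((\<lambda>ta. c * sqrt ta) \<longlongrightarrow> c * sqrt 0) (at_right 0)" by (intro tendsto_intros)
 ultimately have "\<bar>h\<bar> \<le> c * sqrt 0" by (intro tendsto_lowerbound[of _ _ "at_right 0"]) auto
 then show ?thesis by simp
qed

context law_pair begin

lemma sdiff_sdiff_eq:
 fixes K :: "'a \<Rightarrow> real"
 assumes [measurable]: "K \<in> borel_measurable borel" and K: "\<And>x. \<bar>K x\<bar> \<le> C" "\<And>x. K (- x) = K x"
 shows "sdiff (\<lambda>x. sdiff (\<lambda>y. K (x - y))) =
  (\<integral>x. \<integral>y. K (x - y) \<partial>\<mu> \<partial>\<mu>) - 2 * (\<integral>x. \<integral>y. K (x - y) \<partial>\<nu> \<partial>\<mu>) + (\<integral>x. \<integral>y. K (x - y) \<partial>\<nu> \<partial>\<nu>)"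
proof -
 let ?A = "\<lambda>x. \<integral>y. K (x - y) \<partial>\<mu>" and ?B = "\<lambda>x. \<integral>y. K (x - y) \<partial>\<nu>"
 note f = fubini_bounded[of _ _ "\<lambda>x y. K (x - y)" C]
 have i: "integrable \<mu> ?A" "integrable \<mu> ?B"
  "integrable \<nu> ?A" "integrable \<nu> ?B"
  using K(1) by (auto intro!: f(2) M.finite_measure_axioms N.finite_measure_axioms)
 have "(\<integral>x. \<integral>y. K (x - y) \<partial>\<mu> \<partial>\<nu>) = (\<integral>y. \<integral>x. K (x - y) \<partial>\<nu> \<partial>\<mu>)"
  using K(1) by (intro f(1) M.finite_measure_axioms N.finite_measure_axioms) auto
 also have "\<dots> = (\<integral>x. \<integral>y. K (x - y) \<partial>\<nu> \<partial>\<mu>)"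
  using K(2)[of "_ - _"] by simp
 finally show ?thesis unfolding sdiff_def using i by simp
qed

text \<open>The energy bound makes the squared L2 norm of the potential with cut \<open>ta\<close>
  of order \<open>ta\<close>. The potential with the fixed cut r is that potential convolved with a
  heat kernel of time r - ta, so it is of order sqrt ta for every small \<open>ta\<close>.\<close>

lemma hmix_sdiff_eq_0:
 assumes ka: "0 < ka" and \<delta>: "0 < \<delta>" and r: "0 < r" and C: "0 \<le> C"
  and E: "\<And>ta. 0 < ta \<Longrightarrow> ta < \<delta> \<Longrightarrow> sdiff (\<lambda>x. sdiff (\<lambda>y. hmix {2 * ta<..} ka 0 (x - y))) \<le> C * ta"
 shows "sdiff (\<lambda>y. hmix {r<..} ka 0 (x - y)) = 0"
proof (rule eq_0_if_le_sqrt)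
 let ?A = "\<lambda>y. hmix {r<..} ka 0 (x - y)"
 let ?c = "(4 * pi * r) powr (- (real DIM('a) / 2))"
 show "0 < min \<delta> (r / 2)" using \<delta> r by simp
 fix ta assume ta: "0 < ta" "ta < min \<delta> (r / 2)"
 \<comment> \<open>The smearing time stays above r / 2, so the L2 norm of its heat kernel is bounded
   in terms of r alone.\<close>
 define s where "s = r - ta"
 have s: "0 < s" "r = ta + s" "r \<le> 2 * s" using ta by (auto simp: s_def)
 define H where "H z = sdiff (\<lambda>y. hmix {ta<..} ka 0 (z - y))" for z
 have [measurable]: "H \<in> borel_measurable borel" unfolding H_def by measurable
 note ce = commutator_estimate[where u = "\<lambda>_. 0" and u' = "\<lambda>_ _. 0" and B = 0 and L = 0, OF ka ta(1), simplified]
 have "ka\<^sup>2 * (LBINT z. (H z)\<^sup>2) \<le> C * ta" and H2i: "integrable lborel (\<lambda>z. (H z)\<^sup>2)"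
  using ce(3,4) E[of ta] ta unfolding H_def by auto
 then have H2: "integrable lborel (\<lambda>z. (H z)\<^sup>2)" "(LBINT z. (H z)\<^sup>2) \<le> C * ta / ka\<^sup>2"
  using ka by (auto simp: pos_le_divide_eq mult.commute)
 obtain K0 :: "'a \<Rightarrow> real" and D where K0: "integrable lborel K0" "\<And>x. K0 x \<le> D" "\<And>x. hmix {ta<..} ka 0 x \<le> K0 x"
  using hmix_cut_dominated[OF ka ta(1)] by metis
 have hn: "0 \<le> hmix {ta<..} ka 0 w" for w :: 'a using ta by (intro hmix_nonneg) auto
 have hD: "\<bar>hmix {ta<..} ka 0 w\<bar> \<le> D" for w :: 'a using K0(2,3)[of w] hn[of w] by simp
 let ?q = "\<lambda>w::'a. exp (- ka\<^sup>2 * s) * heat s w"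
 have q1: "?q w \<le> heat s (0::'a)" for w
 proof -
  have "?q w \<le> 1 * heat s w" using s by (intro mult_right_mono) auto
  then show ?thesis using heat_le_at_0[OF s(1), of w] by simp
 qed
 have "sdiff (\<lambda>y. \<integral>z. ?q (x - z) * hmix {ta<..} ka 0 (z - y) \<partial>lborel) = (LBINT z. sdiff (\<lambda>y. ?q (x - z) * hmix {ta<..} ka 0 (z - y)))"
 proof (rule sdiff_fubini(2)[symmetric])
  show "\<bar>?q (x - z) * hmix {ta<..} ka 0 (z - y)\<bar> \<le> heat s (0::'a) * K0 (z - y)" for y z
   unfolding abs_mult by (intro mult_mono) (use q1 K0(3) hn in auto)
  show "integrable lborel (\<lambda>w. heat s (0::'a) * K0 w)" using K0 by simp
 qed measurable
 also have "\<dots> = (LBINT z. ?q (x - z) * H z)"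
  unfolding H_def using hD
  by (intro Bochner_Integration.integral_cong refl sdiff_linear[OF bounded_linear_mult_right, of _ D]) auto
 finally have eq: "sdiff ?A = (LBINT z. ?q (x - z) * H z)"
  unfolding hmix_convolution[OF ka s(1) ta(1)] s(2) .
 have h2: "integrable lborel (\<lambda>z. heat s (x - z) * heat s (x - z))" "(LBINT z. heat s (x - z) * heat s (x - z)) \<le> ?c"
 proof -
  have "heat (s + s) (x - x) \<le> (4 * pi * (s + s)) powr (- (real DIM('a) / 2))" using s by (intro heat_le) auto
  also have "\<dots> \<le> ?c" using s r by (intro powr_mono2') auto
  finally show "integrable lborel (\<lambda>z. heat s (x - z) * heat s (x - z))" "(LBINT z. heat s (x - z) * heat s (x - z)) \<le> ?c"
   using integral_heat_mult_heat(1,2)[OF s(1) s(1), of x x] by (simp_all add: heat_minus_commute[of s _ x])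
 qed
 have sq: "0 < sqrt ta" using ta by simp
 \<comment> \<open>Young's inequality with weight sqrt ta balances the bounded square of the heat
   kernel against the square of H, of order ta.\<close>
 let ?b = "\<lambda>z. sqrt ta * (heat s (x - z) * heat s (x - z)) + (1 / sqrt ta) * (H z)\<^sup>2"
 have ib: "integrable lborel ?b" using h2 H2 by simp
 have "\<bar>\<integral>z. ?q (x - z) * H z \<partial>lborel\<bar> \<le> (LBINT z. ?b z)"
 proof (rule integral_abs_bound_integral[OF Bochner_Integration.integrable_bound[OF ib _ AE_I2] ib])
  show le: "\<bar>?q (x - z) * H z\<bar> \<le> ?b z" for z
  proof -
   have "\<bar>?q (x - z) * H z\<bar> \<le> heat s (x - z) * \<bar>H z\<bar>"
    unfolding abs_mult using s by (intro mult_right_mono) (auto intro!: mult_left_le_one_le)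
   also have "\<dots> \<le> ?b z"
   proof -
    have "ta * X / sqrt ta = sqrt ta * X" for X using real_div_sqrt[of ta] ta by (simp add: mult.commute[of ta] times_divide_eq_right[symmetric] del: times_divide_eq_right)
    note div = this[of "heat s (x - z) * heat s (x - z)"]
    have "0 \<le> (sqrt ta * heat s (x - z) - \<bar>H z\<bar>)\<^sup>2 / sqrt ta" using sq by simp
    also have "\<dots> = ?b z - 2 * (heat s (x - z) * \<bar>H z\<bar>)" using sq
     by (simp add: power2_diff power_mult_distrib add_divide_distrib diff_divide_distrib) (use div ta in \<open>simp add: power2_eq_square\<close>)
    finally show ?thesis using mult_nonneg_nonneg[OF heat_nonneg abs_ge_zero, of s "x - z" "H z"] by linarith
   qed
   finally show ?thesis .
  qed
  show "norm (?q (x - z) * H z) \<le> norm (?b z)" for z using le[of z] by simp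
 qed measurable
 also have "\<dots> = sqrt ta * (LBINT z. heat s (x - z) * heat s (x - z)) + (1 / sqrt ta) * (LBINT z. (H z)\<^sup>2)"
  using h2(1) H2(1) by simp
 also have "\<dots> \<le> sqrt ta * ?c + (1 / sqrt ta) * (C * ta / ka\<^sup>2)"
  using h2(2) H2(2) sq by (intro add_mono mult_left_mono) auto
 also have "\<dots> = (?c + C / ka\<^sup>2) * sqrt ta"
 proof -
  have "(1 / sqrt ta) * (C * ta / ka\<^sup>2) = C / ka\<^sup>2 * (ta / sqrt ta)" by simp
  then have "(1 / sqrt ta) * (C * ta / ka\<^sup>2) = C / ka\<^sup>2 * sqrt ta" using real_div_sqrt[of ta] ta by simp
  then show ?thesis by (simp add: algebra_simps)
 qed
 finally show "\<bar>sdiff ?A\<bar> \<le> (?c + C / ka\<^sup>2) * sqrt ta" unfolding eq .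
qed

text \<open>Mollification by the heat kernel changes a Lipschitz function by at most a multiple of
  sqrt r, and a mollified function cannot distinguish the two laws.\<close>

lemma sdiff_lipschitz_eq_0:
 fixes \<phi> :: "'a \<Rightarrow> real"
 assumes heat: "\<And>r z. 0 < r \<Longrightarrow> sdiff (\<lambda>x. heat r (x - z)) = 0"
  and [measurable]: "\<phi> \<in> borel_measurable borel" and \<phi>: "\<And>x. \<bar>\<phi> x\<bar> \<le> M" "\<And>x y. \<bar>\<phi> x - \<phi> y\<bar> \<le> L * norm (x - y)"
 shows "sdiff \<phi> = 0"
proof (rule eq_0_if_le_sqrt[of 1])
 fix r :: real assume r: "0 < r"
 let ?p = "2 powr (real DIM('a) / 2)"
 have M: "0 \<le> M" using \<phi>(1)[of 0] by linarith
 have L: "0 \<le> L"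
 proof -
  obtain b :: 'a where "b \<in> Basis" using nonempty_Basis by blast
  then show ?thesis using order_trans[OF abs_ge_zero \<phi>(2)[of b 0]] by simp
 qed
 define \<psi> where "\<psi> x = (LBINT z. \<phi> z * heat r (x - z))" for x
 have [measurable]: "\<psi> \<in> borel_measurable borel" unfolding \<psi>_def by measurable
 have i: "integrable lborel (\<lambda>z. \<phi> z * heat r (x - z))" for x
  by (rule Bochner_Integration.integrable_bound[OF integrable_mult_right[OF integrable_heat(3)[OF r, of x], of M]])
   (use \<phi>(1) M in \<open>auto intro!: AE_I2 mult_right_mono simp: abs_mult\<close>)
 have "sdiff \<psi> = (LBINT z. sdiff (\<lambda>x. \<phi> z * heat r (x - z)))"
  unfolding \<psi>_def
 proof (rule sdiff_fubini(2)[symmetric])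
  show "\<bar>\<phi> z * heat r (x - z)\<bar> \<le> M * heat r (z - x)" for x z
   using \<phi>(1)[of z] by (auto simp: abs_mult heat_minus_commute[of r z] intro!: mult_right_mono)
 qed (use integrable_heat(1)[OF r] in auto)
 moreover have "sdiff (\<lambda>x. \<phi> z * heat r (x - z)) = \<phi> z * sdiff (\<lambda>x. heat r (x - z))" for z
  using heat_le_at_0[OF r] by (intro sdiff_linear[OF bounded_linear_mult_right, of _ "heat r (0::'a)"]) auto
 ultimately have 0: "sdiff \<psi> = 0" using heat[OF r] by simp
 have d: "\<bar>\<phi> x - \<psi> x\<bar> \<le> L * (?p * sqrt (8 * r))" for x
 proof -
  have "\<phi> x - \<psi> x = (LBINT z. (\<phi> x - \<phi> z) * heat r (x - z))"
   unfolding \<psi>_def left_diff_distrib using i integrable_heat(3)[OF r, of x] integral_heat(3)[OF r, of x]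
   by (subst Bochner_Integration.integral_diff) auto
  also have "\<bar>\<dots>\<bar> \<le> (LBINT z. L * (?p * sqrt (8 * r)) * heat (2 * r) (x - z))"
  proof (rule integral_abs_bound_integral)
   show "integrable lborel (\<lambda>z. (\<phi> x - \<phi> z) * heat r (x - z))"
    unfolding left_diff_distrib using i integrable_heat(3)[OF r, of x] by (intro Bochner_Integration.integrable_diff) auto
   show "integrable lborel (\<lambda>z. L * (?p * sqrt (8 * r)) * heat (2 * r) (x - z))"
    using r by (intro integrable_mult_right integrable_heat) auto
   fix z
   have "\<bar>(\<phi> x - \<phi> z) * heat r (x - z)\<bar> \<le> L * (norm (x - z) * heat r (x - z))"
    using mult_right_mono[OF \<phi>(2)[of x z] heat_nonneg[of r "x - z"]] by (simp add: abs_mult mult.assoc)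
   also have "\<dots> \<le> L * (?p * sqrt (8 * r) * heat (2 * r) (x - z))" using norm_heat_le[OF r, of "x - z"] L by (intro mult_left_mono)
   finally show "\<bar>(\<phi> x - \<phi> z) * heat r (x - z)\<bar> \<le> L * (?p * sqrt (8 * r)) * heat (2 * r) (x - z)" by (simp only: mult.assoc)
  qed
  also have "\<dots> = L * (?p * sqrt (8 * r))" using integral_heat(3)[of "2 * r" x] r by simp
  finally show ?thesis .
 qed
 have "\<bar>\<psi> x\<bar> \<le> M + L * (?p * sqrt (8 * r))" for x using d[of x] \<phi>(1)[of x] by linarith
 then have "sdiff \<phi> = sdiff (\<lambda>x. \<phi> x - \<psi> x)"
  using sdiff_add(2)[of \<phi> M \<psi> "M + L * (?p * sqrt (8 * r))"] \<phi>(1) 0 by simp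
 also have "\<bar>\<dots>\<bar> \<le> ssum (\<lambda>x. L * (?p * sqrt (8 * r)))"
  using d norm_sdiff_le[of "\<lambda>x. \<phi> x - \<psi> x" "\<lambda>x. L * (?p * sqrt (8 * r))" "L * (?p * sqrt (8 * r))"] by simp
 also have "\<dots> = (2 * L * ?p * sqrt 8) * sqrt r"
  unfolding ssum_def using M.prob_space N.prob_space by (simp add: real_sqrt_mult)
 finally show "\<bar>sdiff \<phi>\<bar> \<le> (2 * L * ?p * sqrt 8) * sqrt r" .
qed simp

text \<open>The indicator of a closed set is the limit of bounded Lipschitz functions of the
  distance to it, and closed sets generate the Borel sets.\<close>

lemma eq_if_sdiff_lipschitz_eq_0:
 assumes 0: "\<And>(\<phi> :: 'a \<Rightarrow> real) L. \<phi> \<in> borel_measurable borel \<Longrightarrow> (\<And>x. \<bar>\<phi> x\<bar> \<le> 1) \<Longrightarrow> (\<And>x y. \<bar>\<phi> x - \<phi> y\<bar> \<le> L * norm (x - y)) \<Longrightarrow> sdiff \<phi> = 0"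
 shows "\<mu> = \<nu>"
proof (rule measure_eqI_generator_eq[where E = "Collect closed" and \<Omega> = UNIV and A = "\<lambda>_. UNIV"])
 have "emeasure \<mu> F = emeasure \<nu> F" if F: "closed F" "F \<noteq> {}" for F
 proof -
  define \<phi> where "\<phi> n x = max 0 (1 - real n * infdist x F)" for n and x :: 'a
  have [measurable]: "F \<in> sets borel" "\<phi> n \<in> borel_measurable borel" for n
   unfolding \<phi>_def using F by (auto intro!: borel_measurable_continuous_onI continuous_intros borel_closed)
  have b: "\<bar>\<phi> n x\<bar> \<le> 1" for n x unfolding \<phi>_def using infdist_nonneg[of x F] by auto
  have "\<bar>\<phi> n x - \<phi> n y\<bar> \<le> real n * norm (x - y)" for n x y
  proof -
   have "\<bar>\<phi> n x - \<phi> n y\<bar> \<le> real n * \<bar>infdist x F - infdist y F\<bar>"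
   proof -
    have "\<bar>max 0 (1 - a) - max 0 (1 - b)\<bar> \<le> \<bar>a - b\<bar>" for a b :: real by linarith
    from this[of "real n * infdist x F" "real n * infdist y F"] show ?thesis
     unfolding \<phi>_def by (simp add: abs_mult flip: right_diff_distrib)
   qed
   also have "\<dots> \<le> real n * norm (x - y)"
    using infdist_triangle_abs[of x F y] by (intro mult_left_mono) (auto simp: dist_norm)
   finally show ?thesis .
  qed
  from 0[OF _ b this] have eq: "(\<integral>x. \<phi> n x \<partial>\<mu>) = (\<integral>x. \<phi> n x \<partial>\<nu>)" for n by (simp add: sdiff_def)
  have lim: "(\<lambda>n. \<phi> n x) \<longlonglongrightarrow> indicator F x" for x
  proof (cases "x \<in> F")
   case True
   then show ?thesis by (simp add: \<phi>_def)
  next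
   case False
   then have p: "infdist x F > 0" using F in_closed_iff_infdist_zero[of F x] infdist_nonneg[of x F] by (simp add: less_le)
   obtain m :: nat where m: "1 < real m * infdist x F" using reals_Archimedean3[OF p] by blast
   have "\<phi> n x = 0" if "m \<le> n" for n
   proof -
    have "real m * infdist x F \<le> real n * infdist x F" using that p by (intro mult_right_mono) auto
    then show ?thesis using m by (simp add: \<phi>_def)
   qed
   then have "eventually (\<lambda>n. \<phi> n x = 0) sequentially" by (auto simp: eventually_sequentially)
   then show ?thesis using False by (simp add: tendsto_eventually)
  qed
  have "(\<lambda>n. \<integral>x. \<phi> n x \<partial>\<mu>) \<longlonglongrightarrow> (\<integral>x. indicator F x \<partial>\<mu>)"
   by (rule integral_dominated_convergence[where w = "\<lambda>_. 1"]) (use b lim in auto)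
  moreover have "(\<lambda>n. \<integral>x. \<phi> n x \<partial>\<nu>) \<longlonglongrightarrow> (\<integral>x. indicator F x \<partial>\<nu>)"
   by (rule integral_dominated_convergence[where w = "\<lambda>_. 1"]) (use b lim in auto)
  ultimately have "measure \<mu> F = measure \<nu> F" unfolding eq using LIMSEQ_unique by fastforce
  then show ?thesis by (simp add: M.emeasure_eq_measure N.emeasure_eq_measure)
 qed
 then show "emeasure \<mu> X = emeasure \<nu> X" if "X \<in> Collect closed" for X using that by (cases "X = {}") auto
 show "sets \<mu> = sigma_sets UNIV (Collect closed)" "sets \<nu> = sigma_sets UNIV (Collect closed)"
  unfolding sets_eq borel_eq_closed by simp_all
qed (auto simp: Int_stable_def )

text \<open>Energies of order \<open>ta\<close> for all small cuts kill the potentials, hence their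
  sources, the heat-smeared differences, and thereby all integrals of bounded Lipschitz
  functions.\<close>

lemma eq_if_energy_le:
 assumes "0 < ka" "0 < \<delta>" "0 \<le> C"
  and "\<And>ta. 0 < ta \<Longrightarrow> ta < \<delta> \<Longrightarrow> sdiff (\<lambda>x. sdiff (\<lambda>y. hmix {2 * ta<..} ka 0 (x - y))) \<le> C * ta"
 shows "\<mu> = \<nu>"
proof (rule eq_if_sdiff_lipschitz_eq_0, rule sdiff_lipschitz_eq_0)
 fix r :: real and z :: 'a assume r: "0 < r"
 show "sdiff (\<lambda>x. heat r (x - z)) = 0"
  by (rule commutator_estimate(5)[where u = "\<lambda>_. 0" and u' = "\<lambda>_ _. 0" and B = 0 and L = 0, OF assms(1) r])
   (use hmix_sdiff_eq_0[OF assms(1,2) r assms(3,4)] in auto)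
qed

end

section \<open>The Coulomb flow transports the initial law to the solution\<close>

context density_curve begin

lemma heat_law_le:
 assumes t: "t \<in> {0..T}" and s: "0 < s"
 shows "(\<integral>y. heat s (x - y) \<partial>law t) \<le> B"
proof -
 have "(\<integral>y. heat s (x - y) \<partial>law t) = (LBINT y. \<rho> t y * heat s (x - y))" using t by (subst integral_law) auto
 also have "\<dots> \<le> (LBINT y. B * heat s (x - y))"
 proof (rule integral_mono)
  show le: "\<rho> t y * heat s (x - y) \<le> B * heat s (x - y)" for y using bound[OF t] by (intro mult_right_mono) auto
  show i: "integrable lborel (\<lambda>y. B * heat s (x - y))" by (intro integrable_mult_right integrable_heat s)
  have [measurable]: "\<rho> t \<in> borel_measurable borel" by (rule rho_measurable[OF t])
  show "integrable lborel (\<lambda>y. \<rho> t y * heat s (x - y))"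
   by (rule Bochner_Integration.integrable_bound[OF i]) (use le rho_nonneg[OF t] B in \<open>auto intro!: AE_I2 simp: abs_mult\<close>)
 qed
 finally show ?thesis using integral_heat(3)[OF s, of x] by simp
qed

text \<open>Three of the four products of the two measures contain the background, whose density is
  at most B.\<close>

lemma ssum_heat_le:
 assumes t: "t \<in> {0..T}" and s: "0 < s" and \<mu>: "prob_space \<mu>" "sets \<mu> = sets borel"
 shows "law_pair.ssum \<mu> (law t) (\<lambda>x. law_pair.ssum \<mu> (law t) (\<lambda>y. heat s (x - y))) \<le> (\<integral>x. \<integral>y. heat s (x - y) \<partial>\<mu> \<partial>\<mu>) + 3 * B"
proof -
 let ?A = "\<integral>x. \<integral>y. heat s (x - y) \<partial>law t \<partial>\<mu>" and ?B = "\<integral>x. \<integral>y. heat s (x - y) \<partial>\<mu> \<partial>law t" and ?C = "\<lambda>x. \<integral>y. heat s (x - y) \<partial>\<mu>" and ?D = "\<lambda>x. \<integral>y. heat s (x - y) \<partial>law t"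
 interpret law_pair \<mu> "law t" by (rule law_pair_law[OF t \<mu>])
 note fin = M.finite_measure_axioms N.finite_measure_axioms
 have b: "norm (heat s x) \<le> heat s (0::'a)" for x :: 'a using heat_le_at_0[OF s, of x] by simp
 have m: "(\<lambda>(x, y). heat s (x - y)) \<in> borel_measurable (M1 \<Otimes>\<^sub>M M2)" if [measurable_cong]: "sets M1 = sets borel" "sets M2 = sets borel"
  for M1 M2 :: "'a measure" by measurable
 have i: "integrable \<mu> ?C" "integrable \<mu> ?D"
  "integrable (law t) ?C" "integrable (law t) ?D"
  by (rule fubini_bounded(2)[OF fin(1) fin(1) m b] fubini_bounded(2)[OF fin(1) fin(2) m b]
   fubini_bounded(2)[OF fin(2) fin(1) m b] fubini_bounded(2)[OF fin(2) fin(2) m b], simp_all add: \<mu>)+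
 have c: "?A \<le> B" "(\<integral>x. \<integral>y. heat s (x - y) \<partial>law t \<partial>law t) \<le> B"
  using heat_law_le[OF t s] by (auto intro!: M.integral_le_const N.integral_le_const i)
 have "?B = (\<integral>y. \<integral>x. heat s (x - y) \<partial>law t \<partial>\<mu>)"
  by (rule fubini_bounded(1)[OF fin(2) fin(1) m b]) (simp_all add: \<mu>)
 then have "?B = ?A" by (simp add: heat_minus_commute)
 with c i show ?thesis unfolding ssum_def by simp
qed

text \<open>The flow shrinks squared distances at most by exp (- 2 B t), so a Gaussian of
  transported points is dominated by a Gaussian of the original points with a longer time.
  Renormalization costs exp (2 B t) to the power d / 2, at most exp (B T d).\<close>

lemma flow_heat_le:
 assumes t: "t \<in> {0..T}" and s: "0 < s"
 shows "heat s (flow t x - flow t y) \<le> exp (B * T * real DIM('a)) * heat (s * exp (2 * B * t)) (x - y)"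
proof -
 let ?e = "exp (2 * B * t)" and ?d = "real DIM('a) / 2"
 have "?e * exp (- 2 * B * t) = 1" by (simp flip: exp_add)
 then have "(norm (x - y))\<^sup>2 = ?e * (exp (- 2 * B * t) * (norm (x - y))\<^sup>2)" by (simp add: mult.assoc[symmetric])
 also have "\<dots> \<le> ?e * (norm (flow t x - flow t y))\<^sup>2" using flow_bilipschitz(2)[OF t, of x y] by (intro mult_left_mono) auto
 finally have n: "(norm (x - y))\<^sup>2 / (4 * (s * ?e)) \<le> (norm (flow t x - flow t y))\<^sup>2 / (4 * s)"
  using s by (simp add: field_simps)
 have "?e powr ?d \<le> exp (B * T * real DIM('a))"
  using t B by (simp add: powr_def mult_right_mono mult.assoc)
 moreover have "(4 * pi * s) powr (- ?d) = ?e powr ?d * (4 * pi * (s * ?e)) powr (- ?d)"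
  using s by (simp add: powr_mult powr_minus)
 ultimately have "(4 * pi * s) powr (- ?d) \<le> exp (B * T * real DIM('a)) * (4 * pi * (s * ?e)) powr (- ?d)"
  by (simp add: mult_right_mono)
 then show ?thesis unfolding heat_def mult.assoc[symmetric] using n by (intro mult_mono) auto
qed

lemma flow_pair_heat_le:
 assumes s: "s \<in> {0..T}" and ta: "0 < ta"
 shows "(\<integral>x. \<integral>y. heat ta (x - y) \<partial>distr (law 0) borel (flow s) \<partial>distr (law 0) borel (flow s)) \<le> exp (B * T * real DIM('a)) * B"
proof -
 have 0: "0 \<in> {0..T}" using T by simp
 interpret P: prob_space "law 0" by (rule prob_law[OF 0])
 note flow_measurable[OF s, measurable]
 have 4: "0 < ta * exp (2 * B * s)" using ta by auto
 have b: "norm (heat ta x) \<le> heat ta (0::'a)" for x :: 'a using heat_le_at_0[OF ta, of x] by simp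
 have "(\<integral>y. heat ta (flow s x - flow s y) \<partial>law 0) \<le> (\<integral>y. exp (B * T * real DIM('a)) * heat (ta * exp (2 * B * s)) (x - y) \<partial>law 0)" for x
 proof (rule integral_mono)
  show "integrable (law 0) (\<lambda>y. heat ta (flow s x - flow s y))"
   by (rule P.integrable_const_bound[OF AE_I2[OF b]]) measurable
  show "integrable (law 0) (\<lambda>y. exp (B * T * real DIM('a)) * heat (ta * exp (2 * B * s)) (x - y))"
   using heat_le_at_0[OF 4] by (intro integrable_mult_right P.integrable_const_bound[OF AE_I2]) auto
 qed (rule flow_heat_le[OF s ta])
 also have "\<dots> x \<le> exp (B * T * real DIM('a)) * B" for x using heat_law_le[OF 0 4, of x] by simp
 finally have "(\<integral>x. \<integral>y. heat ta (flow s x - flow s y) \<partial>law 0 \<partial>law 0) \<le> exp (B * T * real DIM('a)) * B"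
  by (intro P.integral_le_const fubini_bounded(2)[OF P.finite_measure_axioms P.finite_measure_axioms _ b]) auto
 then show ?thesis by (subst integral_distr; simp add: integral_distr)+
qed

text \<open>Both the transported law and the solution move with the velocity u, so the derivative of
  their energy is twice a commutator. The energy starts at 0, and the commutator estimate with
  Gronwall keeps it of order \<open>ta\<close> for every cut.\<close>

theorem flow_law:
 assumes t: "t \<in> {0..T}"
 shows "distr (law 0) borel (flow t) = law t"
proof -
 have 0: "0 \<in> {0..T}" using T by simp
 interpret P: prob_space "law 0" by (rule prob_law[OF 0])
 interpret m: moving_points \<rho> \<rho>' T R B "law 0" flow "\<lambda>s w. u s (flow s w)" B
  by unfold_locales (use flow_has_derivative u_bound flow_measurable measurable_compose[OF flow_measurable u_measurable] in auto)
 \<comment> \<open>The screening parameter 1 is an arbitrary choice: this energy only serves to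
   compare two laws.\<close>
 let ?E = "\<lambda>ta t. m.sd t (\<lambda>x. m.sd t (\<lambda>y. hmix {2 * ta<..} 1 0 (x - y)))"
 \<comment> \<open>Twice the constants of \<open>commutator_estimate\<close>, with its heat sum
   bounded through \<open>ssum_heat_le\<close> and \<open>flow_pair_heat_le\<close>.\<close>
 define A D where "A = 2 * ((2 + real DIM('a)) * B)" and "D = 2 * (2 powr real DIM('a) * 4 * B * (exp (B * T * real DIM('a)) * B + 3 * B))"
 have A: "0 < A" and D: "0 \<le> D" unfolding A_def D_def using B by auto
 have E: "?E ta t \<le> exp (A * t) * D / A * ta" if ta: "0 < ta" and t: "t \<in> {0..T}" for ta t
 proof -
  have 2: "0 < 2 * ta" and 4: "0 < 4 * ta" using ta by auto
  let ?J = "\<lambda>s. m.transport_rate s (\<lambda>x. m.sd s (\<lambda>y. gmix {2 * ta<..} 1 (x - y)))"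
  have le: "2 * ?J s \<le> A * ?E ta s + D * ta" if s: "s \<in> {0..T}" for s
  proof -
   interpret law_pair "distr (law 0) borel (flow s)" "law s" by (rule m.lp[OF s])
   note [measurable] = u_measurable[OF s] flow_measurable[OF s]
   obtain C where C: "\<And>x::'a. norm (gmix {2 * ta<..} 1 x) \<le> C" using hmix_cut_dominated[OF zero_less_one 2] order_trans by metis
   have "m.sd s (\<lambda>y. u s x \<bullet> gmix {2 * ta<..} 1 (x - y)) = u s x \<bullet> m.sd s (\<lambda>y. gmix {2 * ta<..} 1 (x - y))" for x
    using C by (intro sdiff_linear[OF bounded_linear_inner_right, of _ C]) auto
   moreover have "(\<lambda>x. u s x \<bullet> sdiff (\<lambda>y. gmix {2 * ta<..} 1 (x - y))) \<in> borel_measurable borel" by measurable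
   then have "?J s = m.sd s (\<lambda>x. u s x \<bullet> m.sd s (\<lambda>y. gmix {2 * ta<..} 1 (x - y)))"
    unfolding m.transport_rate_def sdiff_def[of "\<lambda>x. _ x \<bullet> _ x"] by (subst integral_distr) auto
   ultimately have J: "\<bar>?J s\<bar> \<le> (2 + real DIM('a)) * B * ?E ta s + 2 powr real DIM('a) * 4 * B * ta * ssum (\<lambda>x. ssum (\<lambda>y. heat (4 * ta) (x - y)))"
    using commutator_estimate(2)[OF zero_less_one ta u_has_derivative[OF s] u_bound[OF s] u_deriv[OF s]] B by simp
   have "ssum (\<lambda>x. ssum (\<lambda>y. heat (4 * ta) (x - y))) \<le> exp (B * T * real DIM('a)) * B + 3 * B"
    using ssum_heat_le[OF s 4 M.prob_space_axioms] flow_pair_heat_le[OF s 4] by simp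
   then have "2 powr real DIM('a) * 4 * B * ta * ssum (\<lambda>x. ssum (\<lambda>y. heat (4 * ta) (x - y))) \<le> 2 powr real DIM('a) * 4 * B * ta * (exp (B * T * real DIM('a)) * B + 3 * B)"
    using B ta by (intro mult_left_mono) auto
   with J show ?thesis unfolding A_def D_def by (simp add: algebra_simps)
  qed
  have "distr (law 0) borel (flow 0) = law 0" unfolding flow_0 by (rule distr_id2) simp
  then have "?E ta 0 = 0" using law_pair.sdiff_def[OF m.lp[OF 0]] by simp
  then have "?E ta t \<le> exp (A * t) * (0 + D * ta / A) - D * ta / A"
   using gronwall_differential[of T "?E ta" "\<lambda>s. 2 * ?J s" A "D * ta" t] m.energy_has_derivative[OF zero_less_one 2] le A t by auto
  also have "\<dots> \<le> exp (A * t) * D / A * ta"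
   using divide_nonneg_pos[OF mult_nonneg_nonneg[OF D less_imp_le[OF ta]] A] by (simp add: mult.assoc)
  finally show ?thesis .
 qed
 interpret law_pair "distr (law 0) borel (flow t)" "law t" by (rule m.lp[OF t])
 show ?thesis
  by (rule eq_if_energy_le[of 1 1 "exp (A * t) * D / A"]) (use E t A D in auto)
qed

end

section \<open>Modulated energy of the particle system\<close>

text \<open>For times up to 1 the removed weight is at most \<open>alpha_rate\<close>, so screening
  removes at most that fraction of the near force.\<close>

lemma gmix_screening_near:
 fixes z :: "'a::euclidean_space"
 assumes d: "2 \<le> DIM('a)" and ka: "0 \<le> ka" and A [measurable]: "A \<in> sets borel" and sub: "A \<subseteq> {0<..1}"
 shows "norm (gmix A 0 z - gmix A ka z) \<le> alpha_rate DIM('a) ka * norm (gmix {0<..1} 0 z)"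
proof (cases "z = 0")
 case False
 let ?\<alpha> = "alpha_rate DIM('a) ka" and ?f = "\<lambda>A ka s. indicator A s * exp (- ka\<^sup>2 * s) * (heat s z / s ^ 1)"
 have A0: "A \<subseteq> {0<..}" using sub by auto
 have i: "integrable lborel (?f A 0)" "integrable lborel (?f A ka)" "integrable lborel (?f {0<..1} 0)"
  using hmix_1_integrable[OF A A0 False, of 0] hmix_1_integrable[OF A A0 False, of ka] hmix_1_integrable[OF _ _ False, of "{0<..1}" 0] by (auto simp: subset_iff)
 have le: "0 \<le> ?f A 0 s - ?f A ka s" "?f A 0 s - ?f A ka s \<le> ?\<alpha> * ?f {0<..1} 0 s" for s
 proof -
  have "(1 - exp (- ka\<^sup>2 * s)) * (heat s z / s) \<le> ?\<alpha> * (heat s z / s)" if "s \<in> {0<..1}"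
  proof (rule mult_right_mono)
   have "?\<alpha> * (if DIM('a) = 2 then sqrt s else s) \<le> ?\<alpha> * 1"
    using that ka by (intro mult_left_mono) (auto simp: alpha_rate_def)
   then show "1 - exp (- ka\<^sup>2 * s) \<le> ?\<alpha>" using screening_weight_le[OF ka _ d, of s] that by auto
  qed (use that in auto)
  then show "?f A 0 s - ?f A ka s \<le> ?\<alpha> * ?f {0<..1} 0 s"
   using sub ka by (cases "s \<in> A"; cases "s \<in> {0<..1}") (auto simp: left_diff_distrib diff_divide_distrib alpha_rate_def)
  have "exp (- ka\<^sup>2 * s) * (heat s z / s) \<le> 1 * (heat s z / s)" if "0 < s" using that by (intro mult_right_mono) auto
  then show "0 \<le> ?f A 0 s - ?f A ka s" using A0 by (cases "s \<in> A") auto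
 qed
 have "hmix A 0 1 z - hmix A ka 1 z = (LBINT s. ?f A 0 s - ?f A ka s)" unfolding hmix_def using i by simp
 moreover have "0 \<le> \<dots>" using le(1) by (intro Bochner_Integration.integral_nonneg)
 moreover have "(LBINT s. ?f A 0 s - ?f A ka s) \<le> (LBINT s. ?\<alpha> * ?f {0<..1} 0 s)"
  using i le(2) by (intro integral_mono Bochner_Integration.integrable_diff integrable_mult_right)
 moreover have "(LBINT s. ?\<alpha> * ?f {0<..1} 0 s) = ?\<alpha> * hmix {0<..1} 0 1 z"
  unfolding hmix_def by (simp only: integral_mult_right_zero)
 ultimately have h: "\<bar>hmix A 0 1 z - hmix A ka 1 z\<bar> \<le> ?\<alpha> * hmix {0<..1} 0 1 z" by linarith
 have "gmix A 0 z - gmix A ka z = - ((hmix A 0 1 z - hmix A ka 1 z) / 2) *\<^sub>R z"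
  by (simp add: gmix_def diff_divide_distrib algebra_simps)
 then have "norm (gmix A 0 z - gmix A ka z) = norm z / 2 * \<bar>hmix A 0 1 z - hmix A ka 1 z\<bar>" by simp
 also have "\<dots> \<le> norm z / 2 * (?\<alpha> * hmix {0<..1} 0 1 z)" using h by (intro mult_left_mono) auto
 also have "\<dots> = ?\<alpha> * norm (gmix {0<..1} 0 z)" by (subst norm_gmix) auto
 finally show ?thesis .
qed simp

text \<open>A distance times the force is controlled by the energy: norm z squared times a heat
  kernel of time s is at most a multiple of s times the one of time 2 s. The factor
  \<open>exp (ka\<^sup>2 * S)\<close> compensates the stronger screening weight at the doubled
  time.\<close>

lemma norm_gmix_short_le:
 fixes z :: "'a::euclidean_space"
 assumes ka: "0 < ka" and z: "z \<noteq> 0"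
 shows "norm z * norm (gmix {0<..S} ka z) \<le> 2 * 2 powr (real DIM('a) / 2) * exp (ka\<^sup>2 * S) * hmix {0<..2 * S} ka 0 z"
proof -
 let ?c = "4 * 2 powr (real DIM('a) / 2) * exp (ka\<^sup>2 * S)" and ?p = "2 powr (real DIM('a) / 2)"
 let ?k = "\<lambda>s. indicator {0<..2 * S} s * exp (- ka\<^sup>2 * s) * (heat s z / s ^ 0)"
 have ik: "integrable lborel ?k" using z ka by (intro hmix_integrable hmix_atI) auto
 have "norm z * norm (gmix {0<..S} ka z) = (norm z)\<^sup>2 / 2 * hmix {0<..S} ka 1 z"
  by (subst norm_gmix) (auto simp: power2_eq_square)
 also have "\<dots> = (LBINT s. (norm z)\<^sup>2 / 2 * (indicator {0<..S} s * exp (- ka\<^sup>2 * s) * (heat s z / s ^ 1)))"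
  unfolding hmix_def by (simp only: integral_mult_right_zero)
 also have "\<dots> \<le> (LBINT s. ?c * ?k (0 + 2 * s))"
 proof (rule integral_mono)
  show "integrable lborel (\<lambda>s. (norm z)\<^sup>2 / 2 * (indicator {0<..S} s * exp (- ka\<^sup>2 * s) * (heat s z / s ^ 1)))"
   using z ka by (intro integrable_mult_right hmix_integrable hmix_atI) auto
  show "integrable lborel (\<lambda>s. ?c * ?k (0 + 2 * s))"
   using lborel_integrable_real_affine[OF ik, of 2 0] by (intro integrable_mult_right) auto
  fix s
  show "(norm z)\<^sup>2 / 2 * (indicator {0<..S} s * exp (- ka\<^sup>2 * s) * (heat s z / s ^ 1)) \<le> ?c * ?k (0 + 2 * s)"
  proof (cases "s \<in> {0<..S}")
   case True
   have "(norm z)\<^sup>2 * heat s z / 2 / s \<le> 2 powr (real DIM('a) / 2) * (8 * s) * heat (2 * s) z / 2 / s"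
    using norm_sq_heat_le[of s z] True by (intro divide_right_mono) auto
   moreover have "?p * (8 * s) * heat (2 * s) z / 2 / s = 4 * ?p * heat (2 * s) z" using True by (simp add: field_simps)
   moreover have "exp (- ka\<^sup>2 * s) \<le> exp (ka\<^sup>2 * S) * exp (- ka\<^sup>2 * (2 * s))"
    using True mult_left_mono[of s S "ka\<^sup>2"] by (simp add: mult.commute[of s] flip: exp_add)
   moreover have "0 \<le> (norm z)\<^sup>2 * heat s z / 2 / s" using True by simp
   ultimately have "exp (- ka\<^sup>2 * s) * ((norm z)\<^sup>2 * heat s z / 2 / s) \<le> (exp (ka\<^sup>2 * S) * exp (- ka\<^sup>2 * (2 * s))) * (4 * ?p * heat (2 * s) z)"
    by (intro mult_mono) (simp | linarith)+
   then show ?thesis using True by (simp add: mult_ac)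
  qed auto
 qed
 also have "\<dots> = ?c * (LBINT s. ?k (0 + 2 * s))" by (simp only: integral_mult_right_zero)
 also have "(LBINT s. ?k (0 + 2 * s)) = hmix {0<..2 * S} ka 0 z / 2"
  unfolding hmix_def by (subst lborel_integral_real_affine[of 2 ?k 0]) auto
 finally show ?thesis by (simp add: mult_ac)
qed

text \<open>For s between 4 ta and 8 ta, \<open>heat s z\<close> is at least 2 powr (- d / 2) times
  \<open>heat (4 * ta) z\<close>. The interval has length 4 ta, which produces the factor
  \<open>ta\<close> on the left.\<close>

lemma heat_le_hmix:
 fixes z :: "'a::euclidean_space"
 assumes ka: "0 < ka" and ta: "0 < ta"
 shows "ta * heat (4 * ta) z \<le> 2 powr (real DIM('a) / 2) / 4 * exp (8 * ka\<^sup>2 * ta) * hmix {4 * ta<..8 * ta} ka 0 z"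
proof -
 let ?p = "2 powr (real DIM('a) / 2)"
 let ?c = "exp (- (8 * ka\<^sup>2 * ta)) * (heat (4 * ta) z / ?p)"
 have "(LBINT s. indicator {4 * ta<..8 * ta} s * ?c) \<le> hmix {4 * ta<..8 * ta} ka 0 z"
  unfolding hmix_def
 proof (rule integral_mono)
  show "integrable lborel (\<lambda>s. indicator {4 * ta<..8 * ta} s * exp (- ka\<^sup>2 * s) * (heat s z / s ^ 0))"
   using ta ka by (intro hmix_integrable hmix_atI_cut[of _ "4 * ta"]) auto
  show "indicator {4 * ta<..8 * ta} s * ?c \<le> indicator {4 * ta<..8 * ta} s * exp (- ka\<^sup>2 * s) * (heat s z / s ^ 0)" for s
  proof (cases "s \<in> {4 * ta<..8 * ta}")
   case True
   have "(4 * pi * (4 * ta)) powr (- (real DIM('a) / 2)) / ?p = (4 * pi * (8 * ta)) powr (- (real DIM('a) / 2))"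
    using powr_mult[of "4 * pi * (4 * ta)" 2 "- (real DIM('a) / 2)"] by (simp add: powr_minus_divide)
   also have "\<dots> \<le> (4 * pi * s) powr (- (real DIM('a) / 2))" using True ta by (intro powr_mono2') auto
   finally have "(4 * pi * (4 * ta)) powr (- (real DIM('a) / 2)) / ?p * exp (- (norm z)\<^sup>2 / (4 * (4 * ta))) \<le>
     (4 * pi * s) powr (- (real DIM('a) / 2)) * exp (- (norm z)\<^sup>2 / (4 * s))"
    using True ta by (intro mult_mono) (auto intro!: divide_left_mono)
   then have h: "heat (4 * ta) z / ?p \<le> heat s z" by (simp add: heat_def)
   have "ka\<^sup>2 * s \<le> ka\<^sup>2 * (8 * ta)" using True by (intro mult_left_mono) auto
   with h have "?c \<le> exp (- ka\<^sup>2 * s) * heat s z" by (intro mult_mono) auto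
   then show ?thesis using True by simp
  qed simp
 qed (intro integrable_mult_left integrable_real_indicator; insert ta; simp)
 then have "4 * ta * ?c \<le> hmix {4 * ta<..8 * ta} ka 0 z" using ta by simp
 from mult_left_mono[OF this, of "?p / 4 * exp (8 * ka\<^sup>2 * ta)"]
 show ?thesis by (simp add: exp_minus divide_simps)
qed

text \<open>Every heat kernel has mass 1 and the screening weight is at most 1.\<close>

lemma integral_hmix_interval_le:
 assumes ab: "0 \<le> a" "a \<le> b" and ka: "0 < ka"
 shows "integrable lborel (\<lambda>y. hmix {a<..b} ka 0 (x - (y::'a::euclidean_space)))"
  and "(LBINT y. hmix {a<..b} ka 0 (x - (y::'a))) \<le> b - a"
proof -
 have sub: "{a<..b} \<subseteq> {0<..}" using ab by auto
 have c: "hmix {a<..b} ka 0 (x - y) = hmix {a<..b} ka 0 (y - x)" for y by (rule hmix_norm_cong) (rule norm_minus_commute)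
 show i: "integrable lborel (\<lambda>y. hmix {a<..b} ka 0 (x - y))"
  unfolding c by (rule integrable_hmix[OF _ sub ka]) simp
 have "(\<integral>\<^sup>+y. ennreal (hmix {a<..b} ka 0 (x - y)) \<partial>lborel) \<le> (\<integral>\<^sup>+s. ennreal (indicator {a<..b} s * exp (- ka\<^sup>2 * s) / s ^ 0) \<partial>lborel)"
  unfolding c by (rule nn_integral_hmix_le[OF _ sub]) simp
 also have "\<dots> \<le> (\<integral>\<^sup>+s. indicator {a<..b} s \<partial>lborel)"
  by (intro nn_integral_mono) (use ab in \<open>auto split: split_indicator simp: ennreal_le_1\<close>)
 also have "\<dots> = ennreal (b - a)" using ab by simp
 finally show "(LBINT y. hmix {a<..b} ka 0 (x - y)) \<le> b - a"
  using i sub ab by (subst (asm) nn_integral_eq_integral) (auto simp: hmix_nonneg)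
qed

section \<open>Empirical measure, modulated energy and mean field\<close>

text \<open>The empirical measure of the N particles, encoded as a push-forward of the uniform law
  on labels so that it fits \<open>moving_points\<close>.\<close>

definition emp :: "nat \<Rightarrow> (nat \<Rightarrow> 'a::euclidean_space) \<Rightarrow> 'a measure" where
 "emp N x = distr (measure_pmf (pmf_of_set {..<N})) borel x"

lemma prob_emp: "prob_space (emp N x)" and sets_emp: "sets (emp N x) = sets borel"
 unfolding emp_def by (auto intro!: measure_pmf.prob_space_distr)

lemma integral_pmf_lessThan:
 fixes f :: "nat \<Rightarrow> 'b::{banach, second_countable_topology}"
 assumes "0 < N"
 shows "(\<integral>i. f i \<partial>measure_pmf (pmf_of_set {..<N})) = (1 / real N) *\<^sub>R (\<Sum>i<N. f i)"
 using assms by (subst integral_measure_pmf[of "{..<N}"]) (auto simp: lessThan_empty_iff scaleR_sum_right set_pmf_of_set)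

lemma integral_emp:
 fixes f :: "'a::euclidean_space \<Rightarrow> 'b::{banach, second_countable_topology}"
 assumes "0 < N" "f \<in> borel_measurable borel"
 shows "(\<integral>z. f z \<partial>emp N x) = (1 / real N) *\<^sub>R (\<Sum>i<N. f (x i))"
 unfolding emp_def using assms by (subst integral_distr) (auto simp: integral_pmf_lessThan)

text \<open>Heat times up to S. The diagonal is left out because short heat times make the kernel
  singular there.\<close>

definition short_energy :: "real \<Rightarrow> real \<Rightarrow> nat \<Rightarrow> (nat \<Rightarrow> 'a::euclidean_space) \<Rightarrow> real" where
 "short_energy ka S N x = (\<Sum>i<N. \<Sum>j\<in>{..<N} - {i}. hmix {0<..S} ka 0 (x i - x j)) / (2 * (real N)\<^sup>2)"

lemma short_energy_nonneg: "0 \<le> short_energy ka S N x"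
 unfolding short_energy_def by (intro divide_nonneg_nonneg sum_nonneg hmix_nonneg) auto

lemma hmix_add_interval:
 assumes ka: "0 < ka" and at: "hmix_at ({a<..b} \<union> C) x" and C: "C = {b<..} \<or> C = {b<..c}"
 shows "hmix ({a<..b} \<union> C) ka k x = hmix {a<..b} ka k x + hmix C ka k x"
 by (rule hmix_disjoint_Un[OF _ _ ka]) (use at C in \<open>auto simp: hmix_at_def\<close>)

context density_curve begin

text \<open>Times above S carry the full energy of the empirical measure minus the background,
  diagonal included, which is what makes it nonnegative. Times up to S carry the interaction of
  distinct particles only.\<close>

definition menergy :: "real \<Rightarrow> real \<Rightarrow> nat \<Rightarrow> real \<Rightarrow> (nat \<Rightarrow> 'a) \<Rightarrow> real" where
 "menergy ka S N t x = law_pair.sdiff (emp N x) (law t) (\<lambda>z. law_pair.sdiff (emp N x) (law t) (\<lambda>y. hmix {S<..} ka 0 (z - y))) / 2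
  + short_energy ka S N x"

lemma law_pair_emp: "t \<in> {0..T} \<Longrightarrow> law_pair (emp N x) (law t)"
 by (rule law_pair_law[OF _ prob_emp sets_emp])

lemma hmix_interval_law_le:
 assumes t: "t \<in> {0..T}" and ab: "0 \<le> a" "a \<le> b" and ka: "0 < ka"
 shows "(\<integral>y. hmix {a<..b} ka 0 (x - y) \<partial>law t) \<le> B * (b - a)"
proof -
 let ?h = "\<lambda>y. hmix {a<..b} ka 0 (x - y)"
 have h0: "0 \<le> ?h y" for y using ab by (intro hmix_nonneg) auto
 have "(\<integral>y. ?h y \<partial>law t) = (LBINT y. \<rho> t y * ?h y)" using t by (subst integral_law) auto
 also have "\<dots> \<le> (LBINT y. B * ?h y)"
  using integral_hmix_interval_le(1)[OF ab ka, of x] mult_right_mono[OF bound[OF t] h0] B h0 by (intro integral_mono') auto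
 also have "\<dots> \<le> B * (b - a)" using integral_hmix_interval_le(2)[OF ab ka, of x] B by simp
 finally show ?thesis .
qed

text \<open>Moving the cutoff from \<open>S0\<close> to \<open>S1\<close> changes the energy by at most \<open>B * (S1 - S0)\<close>, because the interaction
 of the particles with the background at these scales has mass \<open>S1 - S0\<close>.\<close>

lemma short_energy_le:
 assumes t: "t \<in> {0..T}" and N: "0 < N" and ka: "0 < ka" and S: "0 < S0" "S0 \<le> S1"
  and x: "\<And>i j. i < N \<Longrightarrow> j < N \<Longrightarrow> i \<noteq> j \<Longrightarrow> x i \<noteq> x j"
 shows "short_energy ka S1 N x \<le> menergy ka S0 N t x + B * (S1 - S0)"
proof -
 interpret law_pair "emp N x" "law t" by (rule law_pair_emp[OF t])
 let ?w = "hmix {S0<..S1} ka 0 :: 'a \<Rightarrow> real"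
 have at: "hmix_at {S<..} z" "hmix_at {S0<..S1} z" if "0 < S" for S and z :: 'a
  using that S by (auto intro: hmix_atI_cut[of _ S] hmix_atI_cut[of _ S0])
 have wC: "\<bar>hmix A ka 0 z\<bar> \<le> hmix A ka 0 (0::'a)" if "hmix_at A (0::'a)" for A and z :: 'a
  using hmix_le_at_0[OF that ka, of 0 z] hmix_nonneg[of A ka 0 z] that by (auto simp: hmix_at_def)
 have w0: "0 \<le> ?w z" for z using S by (intro hmix_nonneg) auto
 have eq: "hmix {S0<..} ka 0 z = ?w z + hmix {S1<..} ka 0 z" for z :: 'a
  using hmix_add_interval[OF ka, of S0 S1 "{S1<..}" z 0] at(1)[OF S(1), of z] S by (simp add: ivl_disj_un)
 have sd: "\<bar>sdiff (\<lambda>y. hmix A ka 0 (z - y))\<bar> \<le> 2 * hmix A ka 0 (0::'a)" if A: "hmix_at A (0::'a)" for A and z :: 'a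
 proof -
  have [measurable]: "A \<in> sets borel" using A by (simp add: hmix_at_def)
  have "norm (sdiff (\<lambda>y. hmix A ka 0 (z - y))) \<le> ssum (\<lambda>y. hmix A ka 0 (0::'a))"
   by (rule norm_sdiff_le) (use wC[OF A] in auto)
  then show ?thesis using M.prob_space N.prob_space by (simp add: ssum_def)
 qed
 have S1: "0 < S1" using S by simp
 have "sdiff (\<lambda>z. sdiff (\<lambda>y. hmix {S0<..} ka 0 (z - y))) =
   sdiff (\<lambda>z. sdiff (\<lambda>y. ?w (z - y)) + sdiff (\<lambda>y. hmix {S1<..} ka 0 (z - y)))"
  unfolding eq using wC[OF at(1)[OF S1]] wC[OF at(2)[OF S1]] by (subst sdiff_add(1)) auto
 also have "\<dots> = sdiff (\<lambda>z. sdiff (\<lambda>y. ?w (z - y))) + sdiff (\<lambda>z. sdiff (\<lambda>y. hmix {S1<..} ka 0 (z - y)))"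
  using sd[OF at(1)[OF S1]] sd[OF at(2)[OF S1]] by (intro sdiff_add(1)) (auto intro!: borel_measurable_sdiff)
 \<comment> \<open>The energy of the times above \<open>S1\<close> is positive semidefinite and may
   be discarded. Positivity is read off the commutator estimate for the zero field.\<close>
 moreover have "0 \<le> sdiff (\<lambda>z. sdiff (\<lambda>y. hmix {S1<..} ka 0 (z - y)))"
  using commutator_estimate(1)[where u = "\<lambda>_. 0" and u' = "\<lambda>_ _. 0" and B = 0 and L = 0, OF ka, of "S1 / 2"] S1 by simp
 ultimately have 1: "sdiff (\<lambda>z. sdiff (\<lambda>y. ?w (z - y))) \<le> sdiff (\<lambda>z. sdiff (\<lambda>y. hmix {S0<..} ka 0 (z - y)))" by simp
 have "(\<integral>z. (\<integral>y. ?w (z - y) \<partial>law t) \<partial>emp N x) \<le> B * (S1 - S0)"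
 proof (rule M.integral_le_const)
  show "integrable (emp N x) (\<lambda>z. \<integral>y. ?w (z - y) \<partial>law t)"
   by (rule fubini_bounded(2)[OF M.finite_measure_axioms N.finite_measure_axioms, of _ "?w 0"]) (use wC[OF at(2)[OF S1]] in auto)
 qed (use hmix_interval_law_le[OF t _ S(2) ka] S in auto)
 moreover have "0 \<le> (\<integral>z. (\<integral>y. ?w (z - y) \<partial>law t) \<partial>law t)" using w0 by (intro Bochner_Integration.integral_nonneg)
 moreover have "(\<integral>z. (\<integral>y. ?w (z - y) \<partial>emp N x) \<partial>emp N x) = (\<Sum>i<N. \<Sum>j<N. ?w (x i - x j)) / (real N)\<^sup>2"
  by (simp add: integral_emp[OF N] sum_divide_distrib power2_eq_square)
 \<comment> \<open>The middle band is nonnegative, so its diagonal terms may be discarded.\<close>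
 moreover have "(\<Sum>i<N. \<Sum>j\<in>{..<N} - {i}. ?w (x i - x j)) / (real N)\<^sup>2 \<le> (\<Sum>i<N. \<Sum>j<N. ?w (x i - x j)) / (real N)\<^sup>2"
  using w0 by (intro divide_right_mono sum_mono sum_mono2) auto
 ultimately have 2: "(\<Sum>i<N. \<Sum>j\<in>{..<N} - {i}. ?w (x i - x j)) / (real N)\<^sup>2 - 2 * (B * (S1 - S0)) \<le> sdiff (\<lambda>z. sdiff (\<lambda>y. ?w (z - y)))"
  using wC[OF at(2)[OF S1]] by (subst sdiff_sdiff_eq[of ?w "?w 0"]) auto
 have "hmix {0<..S1} ka 0 (x i - x j) = hmix {0<..S0} ka 0 (x i - x j) + ?w (x i - x j)" if "i < N" "j \<in> {..<N} - {i}" for i j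
  using hmix_add_interval[OF ka, of 0 S0 "{S0<..S1}" "x i - x j" S1 0] S x[of i j] that
  by (simp add: ivl_disj_un hmix_atI subset_iff)
 then have 3: "short_energy ka S1 N x = short_energy ka S0 N x + (\<Sum>i<N. \<Sum>j\<in>{..<N} - {i}. ?w (x i - x j)) / (real N)\<^sup>2 / 2"
  unfolding short_energy_def by (simp add: sum.distrib add_divide_distrib)
 show ?thesis using 1 2 unfolding 3 menergy_def by simp
qed

lemma menergy_bounds:
 assumes t: "t \<in> {0..T}" and ka: "0 < ka" and S: "0 < S"
 shows "0 \<le> menergy ka S N t x"
  "law_pair.sdiff (emp N x) (law t) (\<lambda>z. law_pair.sdiff (emp N x) (law t) (\<lambda>y. hmix {S<..} ka 0 (z - y))) \<le> 2 * menergy ka S N t x"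
proof -
 interpret law_pair "emp N x" "law t" by (rule law_pair_emp[OF t])
 have "0 \<le> sdiff (\<lambda>z. sdiff (\<lambda>y. hmix {S<..} ka 0 (z - y)))"
  using commutator_estimate(1)[where u = "\<lambda>_. 0" and u' = "\<lambda>_ _. 0" and B = 0 and L = 0, OF ka, of "S / 2"] S by simp
 then show "0 \<le> menergy ka S N t x" "sdiff (\<lambda>z. sdiff (\<lambda>y. hmix {S<..} ka 0 (z - y))) \<le> 2 * menergy ka S N t x"
  unfolding menergy_def using short_energy_nonneg[of ka S N x] by auto
qed

text \<open>The velocity that the Coulomb density would generate through the screened kernel without
  heat times up to S; its distance from u is the only place where screening causes an error.\<close>

definition cfield :: "real \<Rightarrow> real \<Rightarrow> real \<Rightarrow> 'a \<Rightarrow> 'a" where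
 "cfield ka S t x = - (\<integral>y. gmix {S<..} ka (x - y) \<partial>law t)"

text \<open>Compare heat times in three ranges: up to S they are missing, which costs sqrt S;
  between S and 1 and beyond 1 they are only screened, which costs
  \<open>alpha_rate\<close>.\<close>

lemma cfield_error:
 assumes t: "t \<in> {0..T}" and ka: "0 < ka" and S: "0 < S" "S \<le> 1"
 shows "norm (cfield ka S t x - u t x) \<le> B * gmix_const TYPE('a) * sqrt S + (B * gmix_const TYPE('a) + 5) * alpha_rate DIM('a) ka"
proof -
 let ?\<alpha> = "alpha_rate DIM('a) ka"
 have \<alpha>: "0 \<le> ?\<alpha>" using ka by (simp add: alpha_rate_def)
 have [measurable]: "\<rho> t \<in> borel_measurable borel" by (rule rho_measurable[OF t])
 have rb: "\<bar>\<rho> t y\<bar> \<le> B" for y using rho_nonneg[OF t, of y] bound[OF t, of y] by simp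
 obtain C where C: "\<And>z::'a. norm (gmix {S<..} ka z) \<le> C" using hmix_cut_dominated[OF ka S(1)] order_trans by metis
 have i1: "integrable lborel (\<lambda>y. \<rho> t y *\<^sub>R gmix {S<..} ka (x - y))"
 proof (rule bounded_compact_support(1)[where M = "B * C"])
  show "norm (\<rho> t y *\<^sub>R gmix {S<..} ka (x - y)) \<le> B * C" for y
   unfolding norm_scaleR using rb C B by (intro mult_mono) auto
 qed (use supp[OF t] in auto)
 note i0 = coulomb_field_bound(1)[OF rho_measurable[OF t] rb supp[OF t], of x]
 let ?k = "\<lambda>y. \<bar>\<rho> t y\<bar> * norm (gmix {0<..S} 0 (x - y)) + ?\<alpha> * (\<bar>\<rho> t y\<bar> * norm (gmix {0<..1} 0 (x - y))) + 5 * ?\<alpha> * \<rho> t y"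
 note n0 = gmix_integral_near[OF rho_measurable[OF t] rb, of S 0 x] and n1 = gmix_integral_near[OF rho_measurable[OF t] rb, of 1 0 x]
 have ik: "integrable lborel (\<lambda>y. \<bar>\<rho> t y\<bar> * norm (gmix {0<..S} 0 (x - y)))" "integrable lborel (\<lambda>y. \<bar>\<rho> t y\<bar> * norm (gmix {0<..1} 0 (x - y)))"
  using integrable_norm[OF n0(1)] integrable_norm[OF n1(1)] S by auto
 have "cfield ka S t x - u t x = (LBINT y. \<rho> t y *\<^sub>R gmix {0<..} 0 (x - y) - \<rho> t y *\<^sub>R gmix {S<..} ka (x - y))"
  unfolding cfield_def velocity_eq[OF t] using i0 i1 t by (simp add: integral_law)
 then have "norm (cfield ka S t x - u t x) = norm (LBINT y. \<rho> t y *\<^sub>R gmix {0<..} 0 (x - y) - \<rho> t y *\<^sub>R gmix {S<..} ka (x - y))" by simp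
 also have "\<dots> \<le> (LBINT y. ?k y)"
 proof (rule Bochner_Integration.integral_norm_bound_integral)
  show "integrable lborel ?k" using ik rho_integral(1)[OF t] by (intro Bochner_Integration.integrable_add integrable_mult_right) auto
  fix y
  have un: "{0<..} = {0<..S} \<union> ({S<..1} \<union> {1<..})" "{S<..} = {S<..1} \<union> {1::real<..}" using S by auto
  have e: "gmix {0<..} 0 (x - y) - gmix {S<..} ka (x - y) = gmix {0<..S} 0 (x - y)
   + (gmix {S<..1} 0 (x - y) - gmix {S<..1} ka (x - y)) + (gmix {1<..} 0 (x - y) - gmix {1<..} ka (x - y))"
   unfolding un using S by (subst gmix_Un | auto)+
  have "norm (gmix {0<..} 0 (x - y) - gmix {S<..} ka (x - y)) \<le> norm (gmix {0<..S} 0 (x - y)) + ?\<alpha> * norm (gmix {0<..1} 0 (x - y)) + 5 * ?\<alpha>"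
   unfolding e by (intro order_trans[OF norm_triangle_ineq add_mono] order_refl gmix_screening_near screening_tail) (use dim ka S in auto)
  then have "\<bar>\<rho> t y\<bar> * norm (gmix {0<..} 0 (x - y) - gmix {S<..} ka (x - y)) \<le>
   \<bar>\<rho> t y\<bar> * (norm (gmix {0<..S} 0 (x - y)) + ?\<alpha> * norm (gmix {0<..1} 0 (x - y)) + 5 * ?\<alpha>)" by (intro mult_left_mono) auto
  then show "norm (\<rho> t y *\<^sub>R gmix {0<..} 0 (x - y) - \<rho> t y *\<^sub>R gmix {S<..} ka (x - y)) \<le> ?k y"
   using rho_nonneg[OF t, of y] by (simp add: algebra_simps flip: scaleR_diff_right)
 qed (use i0 i1 in auto)
 also have "\<dots> = (LBINT y. \<bar>\<rho> t y\<bar> * norm (gmix {0<..S} 0 (x - y))) + ?\<alpha> * (LBINT y. \<bar>\<rho> t y\<bar> * norm (gmix {0<..1} 0 (x - y))) + 5 * ?\<alpha>"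
  using ik rho_integral[OF t] by simp
 also have "\<dots> \<le> B * (gmix_const TYPE('a) * sqrt S) + ?\<alpha> * (B * (gmix_const TYPE('a) * sqrt 1)) + 5 * ?\<alpha>"
  using n0(2) n1(2) S \<alpha> by (intro add_mono mult_left_mono) auto
 finally show ?thesis by (simp add: algebra_simps)
qed

end

section \<open>Gronwall inequality for the modulated energy\<close>

context density_curve begin

text \<open>The gradient, at z, of the potential of empirical measure minus background for times
  above S.\<close>

definition mforce :: "real \<Rightarrow> real \<Rightarrow> nat \<Rightarrow> real \<Rightarrow> (nat \<Rightarrow> 'a) \<Rightarrow> 'a \<Rightarrow> 'a" where
 "mforce ka S N t x z = law_pair.sdiff (emp N x) (law t) (\<lambda>y. gmix {S<..} ka (z - y))"

lemma mforce_eq: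
 assumes "0 < N" "t \<in> {0..T}"
 shows "mforce ka S N t x z = (1 / real N) *\<^sub>R (\<Sum>j<N. gmix {S<..} ka (z - x j)) + cfield ka S t z"
 unfolding mforce_def cfield_def law_pair.sdiff_def[OF law_pair_emp[OF assms(2)]] using assms(1) by (simp add: integral_emp)

text \<open>The particle velocity is written as u plus V - u: the part with u combines with the
  background to the commutator, and V - u is what dissipates. The vectors \<open>w i\<close> are the
  gradients of the short-time pair energy.\<close>

lemma menergy_has_derivative:
 assumes ka: "0 < ka" and S: "0 < S" and N: "0 < N" and t: "t \<in> {0..T}"
  and x: "\<And>t i. t \<in> {0..T} \<Longrightarrow> ((\<lambda>s. x s i) has_vector_derivative V t i) (at t within {0..T})"
  and V: "\<And>t i. t \<in> {0..T} \<Longrightarrow> norm (V t i) \<le> C"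
  and distinct: "\<And>t i j. t \<in> {0..T} \<Longrightarrow> i < N \<Longrightarrow> j < N \<Longrightarrow> i \<noteq> j \<Longrightarrow> x t i \<noteq> x t j"
 defines "w \<equiv> \<lambda>i. (1 / real N) *\<^sub>R (\<Sum>j\<in>{..<N} - {i}. gmix {0<..S} ka (x t i - x t j))"
 shows "((\<lambda>s. menergy ka S N s (x s)) has_real_derivative
   law_pair.sdiff (emp N (x t)) (law t) (\<lambda>z. law_pair.sdiff (emp N (x t)) (law t) (\<lambda>y. u t z \<bullet> gmix {S<..} ka (z - y)))
   + (\<Sum>i<N. (V t i - u t (x t i)) \<bullet> mforce ka S N t (x t) (x t i) + w i \<bullet> V t i) / real N) (at t within {0..T})"
proof -
 interpret m: moving_points \<rho> \<rho>' T R B "measure_pmf (pmf_of_set {..<N})" x V C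
  by unfold_locales (use x V in \<open>auto intro: measure_pmf.emeasure_space_1\<close>)
 interpret law_pair "emp N (x t)" "law t" by (rule law_pair_emp[OF t])
 let ?F = "mforce ka S N t (x t)"
 obtain D where D: "\<And>x::'a. norm (gmix {S<..} ka x) \<le> D" using hmix_cut_dominated[OF ka S] order_trans by metis
 have E: "((\<lambda>s. law_pair.sdiff (emp N (x s)) (law s) (\<lambda>z. law_pair.sdiff (emp N (x s)) (law s) (\<lambda>y. hmix {S<..} ka 0 (z - y))))
   has_real_derivative 2 * m.transport_rate t ?F) (at t within {0..T})"
  using m.energy_has_derivative[OF ka S t] by (simp add: emp_def mforce_def[abs_def])
 have sh: "((\<lambda>s. short_energy ka S N (x s)) has_real_derivative (\<Sum>i<N. w i \<bullet> V t i) / real N) (at t within {0..T})"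
 proof -
  have "((\<lambda>s. short_energy ka S N (x s)) has_real_derivative
    2 * (\<Sum>i<N. (\<Sum>j\<in>{..<N} - {i}. gmix {0<..S} ka (x t i - x t j)) \<bullet> V t i) / (2 * (real N)\<^sup>2)) (at t within {0..T})"
   unfolding short_energy_def
   by (intro DERIV_cdivide pair_energy_has_derivative ka x t hmix_atI) (use distinct[OF t] in auto)
  then show ?thesis by (rule DERIV_cong) (simp add: w_def sum_divide_distrib power2_eq_square)
 qed
 note u_measurable[OF t, measurable]
 have [measurable]: "?F \<in> borel_measurable borel" unfolding mforce_def[abs_def] by measurable
 have "sdiff (\<lambda>z. sdiff (\<lambda>y. u t z \<bullet> gmix {S<..} ka (z - y))) = sdiff (\<lambda>z. u t z \<bullet> ?F z)"
  unfolding mforce_def using D by (subst sdiff_linear[OF bounded_linear_inner_right, of _ D]) auto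
 also have "\<dots> = (\<Sum>i<N. u t (x t i) \<bullet> ?F (x t i)) / real N - (\<integral>z. u t z \<bullet> ?F z \<partial>law t)"
  unfolding sdiff_def by (subst integral_emp[OF N]) auto
 finally have s: "sdiff (\<lambda>z. sdiff (\<lambda>y. u t z \<bullet> gmix {S<..} ka (z - y))) = \<dots>" .
 show ?thesis
  unfolding menergy_def s using DERIV_add[OF DERIV_cdivide[OF E, of 2] sh]
  by (rule DERIV_cong) (simp add: m.transport_rate_def integral_pmf_lessThan[OF N] sum.distrib sum_subtractf inner_diff_left add_divide_distrib diff_divide_distrib)
qed

definition pd :: real where "pd = 2 powr (real DIM('a) / 2)"

text \<open>After the leading 1, the coefficients come from short-time forces, from the commutator,
  from the heat sum in its remainder, and, as 2 + 2 B, from the squared distance. The exponential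
  bounds the screening compensation, because
  \<open>8 * ka\<^sup>2 * ta \<le> 4 * \<kappa>s\<^sup>2\<close>.\<close>

definition rateA :: "real \<Rightarrow> real" where
 "rateA \<kappa>s = 1 + 2 * B * pd * exp (4 * \<kappa>s\<^sup>2) + 2 * (2 + real DIM('a)) * B + 2 powr real DIM('a) * 4 * B * (pd / 2 * exp (4 * \<kappa>s\<^sup>2)) + 2 + 2 * B"

text \<open>The terms with 6 B come from moving a cutoff, pd + 3 B from diagonal and background in
  the heat sum, and the squares from \<open>cfield_error\<close>.\<close>

definition rateK :: "real \<Rightarrow> real" where
 "rateK \<kappa>s = 2 * B * pd * exp (4 * \<kappa>s\<^sup>2) * (6 * B) + 2 powr real DIM('a) * 4 * B * (pd + 3 * B + pd / 2 * exp (4 * \<kappa>s\<^sup>2) * (6 * B))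
  + 2 * (B * gmix_const TYPE('a))\<^sup>2 + (B * gmix_const TYPE('a) + 5)\<^sup>2"

text \<open>Both sums are dominated by the pair energy of times up to 8 ta, since the first needs
  times up to 4 ta and the second up to 8 ta. Moving the cutoff from 2 ta to 8 ta by
  \<open>short_energy_le\<close> costs 6 B ta.\<close>

lemma pair_sum_bounds:
 assumes t: "t \<in> {0..T}" and N: "0 < N" and ka: "0 < ka" "ka \<le> \<kappa>s" and ta: "0 < ta" "2 * ta \<le> 1"
  and x: "\<And>i j. i < N \<Longrightarrow> j < N \<Longrightarrow> i \<noteq> j \<Longrightarrow> x i \<noteq> x j"
 shows "(\<Sum>i<N. \<Sum>j\<in>{..<N} - {i}. norm (x i - x j) * norm (gmix {0<..2 * ta} ka (x i - x j))) / (real N)\<^sup>2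
   \<le> 4 * pd * exp (4 * \<kappa>s\<^sup>2) * (menergy ka (2 * ta) N t x + 6 * B * ta)"
  and "(\<Sum>i<N. \<Sum>j\<in>{..<N} - {i}. ta * heat (4 * ta) (x i - x j)) / (real N)\<^sup>2
   \<le> pd / 2 * exp (4 * \<kappa>s\<^sup>2) * (menergy ka (2 * ta) N t x + 6 * B * ta)"
proof -
 let ?e = "exp (4 * \<kappa>s\<^sup>2)"
 have k: "ka\<^sup>2 \<le> \<kappa>s\<^sup>2" using ka by (intro power_mono) auto
 have "ka\<^sup>2 * (8 * ta) \<le> \<kappa>s\<^sup>2 * 4" "ka\<^sup>2 * (2 * ta) \<le> \<kappa>s\<^sup>2 * 4" using k ta by (intro mult_mono; simp)+
 then have e: "exp (ka\<^sup>2 * (2 * ta)) \<le> ?e" "exp (8 * ka\<^sup>2 * ta) \<le> ?e" by (auto simp: mult_ac)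
 have pd: "0 \<le> pd" by (simp add: pd_def)
 let ?h = "\<lambda>i j. hmix {0<..8 * ta} ka 0 (x i - x j)"
 have h0: "0 \<le> hmix {a<..b} ka 0 z" if "0 \<le> a" for a b and z :: 'a using that by (intro hmix_nonneg) auto
 have at: "hmix_at A (x i - x j)" if "i < N" "j \<in> {..<N} - {i}" "A \<in> sets borel" "A \<subseteq> {0<..}" for A i j
  using x[of i j] that by (auto intro: hmix_atI)
 have "short_energy ka (8 * ta) N x \<le> menergy ka (2 * ta) N t x + 6 * B * ta"
  using short_energy_le[OF t N ka(1) _ _ x, of "2 * ta" "8 * ta"] ta by (simp add: algebra_simps)
 moreover have "(\<Sum>i<N. \<Sum>j\<in>{..<N} - {i}. ?h i j) / (real N)\<^sup>2 = 2 * short_energy ka (8 * ta) N x"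
  by (simp add: short_energy_def)
 ultimately have P: "(\<Sum>i<N. \<Sum>j\<in>{..<N} - {i}. ?h i j) / (real N)\<^sup>2 \<le> 2 * (menergy ka (2 * ta) N t x + 6 * B * ta)" by simp
 have main: "(\<Sum>i<N. \<Sum>j\<in>{..<N} - {i}. f i j) / (real N)\<^sup>2 \<le> 2 * c * (menergy ka (2 * ta) N t x + 6 * B * ta)"
  if f: "\<And>i j. i < N \<Longrightarrow> j \<in> {..<N} - {i} \<Longrightarrow> f i j \<le> c * ?h i j" and c: "0 \<le> c" for f c
 proof -
  have "(\<Sum>i<N. \<Sum>j\<in>{..<N} - {i}. f i j) / (real N)\<^sup>2 \<le> (\<Sum>i<N. \<Sum>j\<in>{..<N} - {i}. c * ?h i j) / (real N)\<^sup>2"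
   using f by (intro divide_right_mono sum_mono) auto
  also have "\<dots> = c * ((\<Sum>i<N. \<Sum>j\<in>{..<N} - {i}. ?h i j) / (real N)\<^sup>2)" by (simp add: sum_distrib_left)
  also have "\<dots> \<le> c * (2 * (menergy ka (2 * ta) N t x + 6 * B * ta))" by (intro mult_left_mono P c)
  finally show ?thesis by (simp only: mult_ac)
 qed
 have "norm (x i - x j) * norm (gmix {0<..2 * ta} ka (x i - x j)) \<le> 2 * pd * ?e * ?h i j" if ij: "i < N" "j \<in> {..<N} - {i}" for i j
 proof -
  have "norm (x i - x j) * norm (gmix {0<..2 * ta} ka (x i - x j)) \<le> 2 * pd * exp (ka\<^sup>2 * (2 * ta)) * hmix {0<..2 * (2 * ta)} ka 0 (x i - x j)"
   unfolding pd_def using x[of i j] ij by (intro norm_gmix_short_le ka) auto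
  also have "\<dots> \<le> 2 * pd * ?e * ?h i j"
   using e pd h0 ta by (intro mult_mono hmix_le ka at ij) auto
  finally show ?thesis .
 qed
 from main[OF this] show "(\<Sum>i<N. \<Sum>j\<in>{..<N} - {i}. norm (x i - x j) * norm (gmix {0<..2 * ta} ka (x i - x j))) / (real N)\<^sup>2
   \<le> 4 * pd * ?e * (menergy ka (2 * ta) N t x + 6 * B * ta)" using pd by simp
 have "ta * heat (4 * ta) (x i - x j) \<le> pd / 4 * ?e * ?h i j" if ij: "i < N" "j \<in> {..<N} - {i}" for i j
 proof -
  have "ta * heat (4 * ta) (x i - x j) \<le> pd / 4 * exp (8 * ka\<^sup>2 * ta) * hmix {4 * ta<..8 * ta} ka 0 (x i - x j)"
   unfolding pd_def by (rule heat_le_hmix[OF ka(1) ta(1)])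
  also have "\<dots> \<le> pd / 4 * ?e * ?h i j"
   using e pd h0 ta by (intro mult_mono hmix_le ka at ij) auto
  finally show ?thesis .
 qed
 from main[OF this] show "(\<Sum>i<N. \<Sum>j\<in>{..<N} - {i}. ta * heat (4 * ta) (x i - x j)) / (real N)\<^sup>2
   \<le> pd / 2 * ?e * (menergy ka (2 * ta) N t x + 6 * B * ta)" using pd by simp
qed

text \<open>The gradient structure yields - (norm (V - u))^2 for every particle. One half absorbs
  the field error, the other half the growth of the distance to the independent particles.\<close>

lemma energy_rate_le:
 fixes x y V :: "nat \<Rightarrow> 'a"
 assumes t: "t \<in> {0..T}" and N: "0 < N" and ka: "0 < ka" "ka \<le> \<kappa>s" and ta: "0 < ta" "2 * ta \<le> 1"
  and heat0: "heat (4 * ta) (0::'a) \<le> pd * real N"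
  and x: "\<And>i j. i < N \<Longrightarrow> j < N \<Longrightarrow> i \<noteq> j \<Longrightarrow> x i \<noteq> x j"
  and V: "\<And>i. i < N \<Longrightarrow> V i = - (1 / real N) *\<^sub>R (\<Sum>j\<in>{..<N} - {i}. gmix {0<..} ka (x i - x j))"
 defines "S \<equiv> 2 * ta"
 defines "w \<equiv> \<lambda>i. (1 / real N) *\<^sub>R (\<Sum>j\<in>{..<N} - {i}. gmix {0<..S} ka (x i - x j))"
 shows "law_pair.sdiff (emp N x) (law t) (\<lambda>z. law_pair.sdiff (emp N x) (law t) (\<lambda>y. u t z \<bullet> gmix {S<..} ka (z - y)))
   + (\<Sum>i<N. (V i - u t (x i)) \<bullet> mforce ka S N t x (x i) + w i \<bullet> V i) / real N
   + (\<Sum>i<N. 2 * ((x i - y i) \<bullet> (V i - u t (y i)))) / real N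
  \<le> rateA \<kappa>s * (menergy ka S N t x + (\<Sum>i<N. (norm (x i - y i))\<^sup>2) / real N) + rateK \<kappa>s * (ta + (alpha_rate DIM('a) ka)\<^sup>2)"
proof -
 let ?\<alpha> = "alpha_rate DIM('a) ka" and ?M = "menergy ka S N t x" and ?e = "exp (4 * \<kappa>s\<^sup>2)" and ?D = "2 powr real DIM('a) * 4 * B"
 let ?Q = "(\<Sum>i<N. (norm (x i - y i))\<^sup>2) / real N"
 interpret law_pair "emp N x" "law t" by (rule law_pair_emp[OF t])
 note ps = pair_sum_bounds[OF t N ka ta x, folded S_def]
 have S: "0 < S" "S \<le> 1" using ta by (auto simp: S_def)
 note M = menergy_bounds[OF t ka(1) S(1), of N x]
 have pd: "0 \<le> pd" by (simp add: pd_def)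
 let ?U = "\<lambda>i. cfield ka S t (x i)" and ?u = "\<lambda>i. u t (x i)"
 \<comment> \<open>The bound of \<open>cfield_error\<close>. It enters only squared, which is why
   the final rate contains the square of \<open>alpha_rate\<close>.\<close>
 define \<epsilon> where "\<epsilon> = B * gmix_const TYPE('a) * sqrt S + (B * gmix_const TYPE('a) + 5) * ?\<alpha>"
 have \<epsilon>: "\<epsilon>\<^sup>2 \<le> 2 * ((B * gmix_const TYPE('a))\<^sup>2 * S) + 2 * ((B * gmix_const TYPE('a) + 5)\<^sup>2 * ?\<alpha>\<^sup>2)"
 proof -
  have "(p + q)\<^sup>2 \<le> 2 * p\<^sup>2 + 2 * q\<^sup>2" for p q :: real
   using zero_le_power2[of "p - q"] unfolding power2_diff power2_sum by linarith
  from this[of "B * gmix_const TYPE('a) * sqrt S" "(B * gmix_const TYPE('a) + 5) * ?\<alpha>"] show ?thesis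
   unfolding \<epsilon>_def using S by (simp add: power_mult_distrib)
 qed
 \<comment> \<open>The particle velocity is minus the full pair force, so the long-time pair force
   equals - V - w. The diagonal term does no harm because \<open>gmix\<close> vanishes at 0.\<close>
 have F: "mforce ka S N t x (x i) = ?U i - V i - w i" if i: "i < N" for i
 proof -
  have "gmix {0<..} ka z = gmix {0<..S} ka z + gmix {S<..} ka z" for z :: 'a
   using gmix_Un[of "{0<..S}" "{S<..}" ka z] S by (simp add: ivl_disj_un ivl_disj_int subset_iff)
  moreover have "(\<Sum>j<N. gmix {S<..} ka (x i - x j)) = (\<Sum>j\<in>{..<N} - {i}. gmix {S<..} ka (x i - x j))"
   using i by (subst sum.remove[of _ i]) auto
  ultimately show ?thesis
   unfolding mforce_eq[OF N t] w_def V[OF i] by (simp add: sum.distrib scaleR_add_right)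
 qed
 \<comment> \<open>With p = V - u and q the field error, the left-hand side contains p \<bullet> q -
   (norm p)^2 + u \<bullet> w; two Young inequalities use up the negative square.\<close>
 have "(V i - ?u i) \<bullet> mforce ka S N t x (x i) + w i \<bullet> V i + 2 * ((x i - y i) \<bullet> (V i - u t (y i)))
   \<le> \<epsilon>\<^sup>2 / 2 + ?u i \<bullet> w i + (2 + 2 * B) * (norm (x i - y i))\<^sup>2" if i: "i < N" for i
 proof -
  define p q r where "p = V i - ?u i" and "q = ?U i - ?u i" and "r = x i - y i"
  have q: "norm q \<le> \<epsilon>" unfolding q_def \<epsilon>_def by (rule cfield_error[OF t ka(1) S])
  have "p \<bullet> q \<le> norm p * \<epsilon>" using norm_cauchy_schwarz[of p q] mult_left_mono[OF q norm_ge_zero[of p]] by linarith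
  also have "\<dots> \<le> (norm p)\<^sup>2 / 2 + \<epsilon>\<^sup>2 / 2" using zero_le_power2[of "norm p - \<epsilon>"] unfolding power2_diff by linarith
  finally have 1: "p \<bullet> q \<le> (norm p)\<^sup>2 / 2 + \<epsilon>\<^sup>2 / 2" .
  have "2 * (r \<bullet> p) \<le> 2 * (norm r * norm p)" using norm_cauchy_schwarz[of r p] by simp
  also have "\<dots> \<le> 2 * (norm r)\<^sup>2 + (norm p)\<^sup>2 / 2" using zero_le_power2[of "2 * norm r - norm p"]
   unfolding power2_diff by (simp add: power_mult_distrib)
  finally have 2: "2 * (r \<bullet> p) \<le> 2 * (norm r)\<^sup>2 + (norm p)\<^sup>2 / 2" .
  have "r \<bullet> (?u i - u t (y i)) \<le> norm r * (B * norm r)"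
   using norm_cauchy_schwarz[of r "?u i - u t (y i)"] mult_left_mono[OF u_lipschitz[OF t, of "x i" "y i"] norm_ge_zero[of r]]
   unfolding r_def by linarith
  then have 3: "r \<bullet> (?u i - u t (y i)) \<le> B * (norm r)\<^sup>2" by (simp add: power2_eq_square mult_ac)
  have "(V i - ?u i) \<bullet> mforce ka S N t x (x i) + w i \<bullet> V i = p \<bullet> q - (norm p)\<^sup>2 + ?u i \<bullet> w i"
   unfolding F[OF i] p_def q_def power2_norm_eq_inner by (simp add: inner_diff_left inner_diff_right inner_commute)
  moreover have "(x i - y i) \<bullet> (V i - u t (y i)) = r \<bullet> p + r \<bullet> (?u i - u t (y i))"
   unfolding p_def r_def by (simp flip: inner_add_right)
  ultimately show ?thesis using 1 2 3 unfolding r_def by (simp add: algebra_simps)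
 qed
 then have "(\<Sum>i<N. (V i - ?u i) \<bullet> mforce ka S N t x (x i) + w i \<bullet> V i + 2 * ((x i - y i) \<bullet> (V i - u t (y i)))) / real N
   \<le> (\<Sum>i<N. \<epsilon>\<^sup>2 / 2 + ?u i \<bullet> w i + (2 + 2 * B) * (norm (x i - y i))\<^sup>2) / real N"
  by (intro divide_right_mono sum_mono) auto
 also have "\<dots> = \<epsilon>\<^sup>2 / 2 + (\<Sum>i<N. ?u i \<bullet> w i) / real N + (2 + 2 * B) * ?Q"
  using N by (simp add: sum.distrib add_divide_distrib sum_distrib_left)
 finally have T1: "(\<Sum>i<N. (V i - ?u i) \<bullet> mforce ka S N t x (x i) + w i \<bullet> V i) / real N + (\<Sum>i<N. 2 * ((x i - y i) \<bullet> (V i - u t (y i)))) / real N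
  \<le> \<epsilon>\<^sup>2 / 2 + (\<Sum>i<N. ?u i \<bullet> w i) / real N + (2 + 2 * B) * ?Q" by (simp add: sum.distrib add_divide_distrib)
 \<comment> \<open>Antisymmetry of the force replaces u at one particle by the difference of u at
   both, so a factor norm (x i - x j) appears and tames the singular force.\<close>
 have T2: "(\<Sum>i<N. ?u i \<bullet> w i) / real N \<le> 2 * B * pd * ?e * (?M + 6 * B * ta)"
 proof -
  let ?g = "\<lambda>i j. gmix {0<..S} ka (x i - x j)"
  have "(\<Sum>i<N. \<Sum>j\<in>{..<N} - {i}. ?u i \<bullet> ?g i j) = (\<Sum>i<N. \<Sum>j\<in>{..<N} - {i}. - (?u j \<bullet> ?g i j))"
   by (subst sum_off_diagonal_swap, intro sum.cong refl) (metis gmix_minus inner_minus_right minus_diff_eq)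
  then have "2 * (\<Sum>i<N. \<Sum>j\<in>{..<N} - {i}. ?u i \<bullet> ?g i j) = (\<Sum>i<N. \<Sum>j\<in>{..<N} - {i}. (?u i - ?u j) \<bullet> ?g i j)"
   by (simp add: inner_diff_left sum_subtractf sum_negf)
  also have "\<dots> \<le> (\<Sum>i<N. \<Sum>j\<in>{..<N} - {i}. B * (norm (x i - x j) * norm (?g i j)))"
  proof (intro sum_mono)
   fix i j
   show "(?u i - ?u j) \<bullet> ?g i j \<le> B * (norm (x i - x j) * norm (?g i j))"
    using norm_cauchy_schwarz[of "?u i - ?u j" "?g i j"] mult_right_mono[OF u_lipschitz[OF t, of "x i" "x j"] norm_ge_zero[of "?g i j"]]
    by (simp add: mult.assoc)
  qed
  finally have "2 * (\<Sum>i<N. \<Sum>j\<in>{..<N} - {i}. ?u i \<bullet> ?g i j) / (real N)\<^sup>2 \<le> B * ((\<Sum>i<N. \<Sum>j\<in>{..<N} - {i}. norm (x i - x j) * norm (?g i j)) / (real N)\<^sup>2)"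
   by (simp add: divide_right_mono sum_distrib_left)
  also have "\<dots> \<le> B * (4 * pd * ?e * (?M + 6 * B * ta))" using ps(1) B by (intro mult_left_mono) auto
  also have "\<dots> = 2 * (2 * B * pd * ?e * (?M + 6 * B * ta))" by simp
  finally show ?thesis by (simp add: w_def inner_sum_right power2_eq_square flip: sum_divide_distrib)
 qed
 \<comment> \<open>The commutator estimate. In its heat sum the diagonal is heat at 0 divided by N,
   bounded by \<open>heat0\<close>; the pairs are bounded by the short-time energy.\<close>
 have T3: "sdiff (\<lambda>z. sdiff (\<lambda>y. u t z \<bullet> gmix {S<..} ka (z - y))) \<le> 2 * (2 + real DIM('a)) * B * ?M
   + ?D * ((pd + 3 * B) * ta + pd / 2 * ?e * (?M + 6 * B * ta))"
 proof -
  have 4: "0 < 4 * ta" using ta by simp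
  let ?h = "\<lambda>i j. heat (4 * ta) (x i - x j)"
  have "ta * (\<integral>z. \<integral>y. heat (4 * ta) (z - y) \<partial>emp N x \<partial>emp N x) = (\<Sum>i<N. \<Sum>j<N. ta * ?h i j) / (real N)\<^sup>2"
   by (simp add: integral_emp[OF N] sum_divide_distrib power2_eq_square sum_distrib_left)
  also have "\<dots> = ta * heat (4 * ta) (0::'a) / real N + (\<Sum>i<N. \<Sum>j\<in>{..<N} - {i}. ta * ?h i j) / (real N)\<^sup>2"
  proof -
   have "(\<Sum>j<N. ta * ?h i j) = ta * heat (4 * ta) (0::'a) + (\<Sum>j\<in>{..<N} - {i}. ta * ?h i j)" if "i < N" for i
    using that by (subst sum.remove[of _ i]) auto
   then show ?thesis using N by (simp add: sum.distrib add_divide_distrib power2_eq_square)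
  qed
  also have "\<dots> \<le> pd * ta + pd / 2 * ?e * (?M + 6 * B * ta)"
   using mult_left_mono[OF heat0, of ta] ta N by (intro add_mono ps(2)) (auto simp: pos_divide_le_eq mult_ac)
  finally have "ta * ssum (\<lambda>x. ssum (\<lambda>y. heat (4 * ta) (x - y))) \<le> (pd + 3 * B) * ta + pd / 2 * ?e * (?M + 6 * B * ta)"
   using mult_left_mono[OF ssum_heat_le[OF t 4 prob_emp sets_emp, of N x], of ta] ta by (simp add: algebra_simps)
  then have "?D * (ta * ssum (\<lambda>x. ssum (\<lambda>y. heat (4 * ta) (x - y)))) \<le> ?D * ((pd + 3 * B) * ta + pd / 2 * ?e * (?M + 6 * B * ta))"
   using B by (intro mult_left_mono) auto
  moreover have "(2 + real DIM('a)) * B * sdiff (\<lambda>z. sdiff (\<lambda>y. hmix {S<..} ka 0 (z - y))) \<le> (2 + real DIM('a)) * B * (2 * ?M)"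
   using M(2) B by (intro mult_left_mono) auto
  moreover have "\<bar>sdiff (\<lambda>z. sdiff (\<lambda>y. u t z \<bullet> gmix {S<..} ka (z - y)))\<bar> \<le> (2 + real DIM('a)) * B * sdiff (\<lambda>z. sdiff (\<lambda>y. hmix {S<..} ka 0 (z - y)))
   + ?D * (ta * ssum (\<lambda>x. ssum (\<lambda>y. heat (4 * ta) (x - y))))"
   unfolding S_def mult.assoc[symmetric, of _ ta] by (rule commutator_estimate(2)[OF ka(1) ta(1) u_has_derivative[OF t] u_bound[OF t] u_deriv[OF t]]) (use B in auto)
  moreover have "(2 + real DIM('a)) * B * (2 * ?M) = 2 * (2 + real DIM('a)) * B * ?M" by simp
  ultimately show ?thesis by linarith
 qed
 have Q0: "0 \<le> ?Q" by (intro divide_nonneg_nonneg sum_nonneg) auto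
 let ?g2 = "(B * gmix_const TYPE('a))\<^sup>2" and ?g5 = "(B * gmix_const TYPE('a) + 5)\<^sup>2"
 have c: "0 \<le> 2 * B * pd * ?e" "0 \<le> ?D * (pd / 2 * ?e)" "0 \<le> ?D * (pd + 3 * B)" "0 \<le> ?g2" "0 \<le> ?g5" using B pd by auto
 define a1 a2 where "a1 = 2 * B * pd * ?e" and "a2 = ?D * (pd / 2 * ?e)"
 have A_eq: "rateA \<kappa>s = 1 + a1 + 2 * (2 + real DIM('a)) * B + a2 + 2 + 2 * B" unfolding rateA_def a1_def a2_def by simp
 have K_eq: "rateK \<kappa>s = a1 * (6 * B) + ?D * (pd + 3 * B) + a2 * (6 * B) + 2 * ?g2 + ?g5"
  unfolding rateK_def a1_def a2_def by (simp add: algebra_simps)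
 have a: "0 \<le> a1" "0 \<le> a2" unfolding a1_def a2_def using c by auto
 have "rateA \<kappa>s * (?M + ?Q) \<ge> (a1 + 2 * (2 + real DIM('a)) * B + a2) * ?M + (2 + 2 * B) * ?Q"
 proof -
  have "0 \<le> 2 * (2 + real DIM('a)) * B" using B by simp
  then have "rateA \<kappa>s * ?M \<ge> (a1 + 2 * (2 + real DIM('a)) * B + a2) * ?M" "rateA \<kappa>s * ?Q \<ge> (2 + 2 * B) * ?Q"
   using a B by (intro mult_right_mono M(1) Q0; simp add: A_eq)+
  then show ?thesis by (simp add: distrib_left)
 qed
 moreover have "rateK \<kappa>s * (ta + ?\<alpha>\<^sup>2) \<ge> (a1 * (6 * B) + ?D * (pd + 3 * B) + a2 * (6 * B) + 2 * ?g2) * ta + ?g5 * ?\<alpha>\<^sup>2"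
 proof -
  have "rateK \<kappa>s * ta \<ge> (a1 * (6 * B) + ?D * (pd + 3 * B) + a2 * (6 * B) + 2 * ?g2) * ta"
   using ta c by (intro mult_right_mono) (auto simp: K_eq)
  moreover have "rateK \<kappa>s * ?\<alpha>\<^sup>2 \<ge> ?g5 * ?\<alpha>\<^sup>2"
  proof (intro mult_right_mono)
   have "0 \<le> a1 * (6 * B)" "0 \<le> a2 * (6 * B)" using a B by auto
   then show "?g5 \<le> rateK \<kappa>s" unfolding K_eq using c by linarith
  qed simp
  ultimately show ?thesis by (simp add: distrib_left)
 qed
 moreover have "\<epsilon>\<^sup>2 / 2 \<le> 2 * ?g2 * ta + ?g5 * ?\<alpha>\<^sup>2" using \<epsilon> by (simp add: S_def mult_ac)
 moreover have "?D * ((pd + 3 * B) * ta + pd / 2 * ?e * (?M + 6 * B * ta)) = ?D * (pd + 3 * B) * ta + a2 * ?M + a2 * (6 * B) * ta"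
  unfolding a2_def by (simp add: algebra_simps)
 moreover have "2 * B * pd * ?e * (?M + 6 * B * ta) = a1 * ?M + a1 * (6 * B) * ta"
  unfolding a1_def by (simp add: algebra_simps)
 moreover have "(a1 + 2 * (2 + real DIM('a)) * B + a2) * ?M = a1 * ?M + 2 * (2 + real DIM('a)) * B * ?M + a2 * ?M"
  "(a1 * (6 * B) + ?D * (pd + 3 * B) + a2 * (6 * B) + 2 * ?g2) * ta = a1 * (6 * B) * ta + ?D * (pd + 3 * B) * ta + a2 * (6 * B) * ta + 2 * ?g2 * ta"
  by (simp_all only: distrib_right)
 ultimately show ?thesis using T1 T2 T3 by linarith
qed

text \<open>Gronwall for the sum of modulated energy and mean squared distance. The distance starts
  at 0, because the particle and its independent partner have the same initial point.\<close>

theorem pathwise_estimate: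
 assumes N: "0 < N" and ka: "0 < ka" "ka \<le> \<kappa>s" and ta: "0 < ta" "2 * ta \<le> 1"
  and heat0: "heat (4 * ta) (0::'a) \<le> pd * real N"
  and X: "X \<in> {..<N} \<rightarrow>\<^sub>E UNIV" "X \<notin> collision_set N" and t: "t \<in> {0..T}"
 shows "(\<Sum>i<N. (norm (particle_flow N ka t X i - flow t (X i)))\<^sup>2) / real N \<le>
  exp (rateA \<kappa>s * T) * (menergy ka (2 * ta) N 0 X + rateK \<kappa>s * (ta + (alpha_rate DIM('a) ka)\<^sup>2))"
proof -
 define x where "x s = particle_flow N ka s X" for s
 have tr: "particle_trajectory N ka X x" unfolding x_def by (rule particle_flow_trajectory[OF dim ka(1) X])
 note tr' = tr[unfolded particle_trajectory_iff[OF ka(1)]]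
 have x0: "x 0 = X" and xs: "\<And>s. 0 \<le> s \<Longrightarrow> x s \<in> ({..<N} \<rightarrow>\<^sub>E UNIV) - collision_set N"
  and ps: "psolution (\<lambda>z. - gmix {0<..} ka z) N {0..} x"
  using tr' by (simp_all del: Diff_iff)
 have ps: "psolution (\<lambda>z. - gmix {0<..} ka z) N {0..T} x" by (rule psolution_subset[OF ps]) auto
 obtain \<delta> where \<delta>: "0 < \<delta>" "\<And>t i j. t \<in> {0..T} \<Longrightarrow> i < N \<Longrightarrow> j < N \<Longrightarrow> i \<noteq> j \<Longrightarrow> \<delta> \<le> norm (x t i - x t j)"
  using particle_trajectory_min_distance[OF ka(1) tr] by metis
 have xd: "x s i \<noteq> x s j" if "s \<in> {0..T}" "i < N" "j < N" "i \<noteq> j" for s i j using \<delta>(1) \<delta>(2)[OF that] by auto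
 \<comment> \<open>Labels from N on do not move, which gives the velocity 0 to the constant value
   \<open>undefined\<close>.\<close>
 define V where "V s i = (if i < N then - (1 / real N) *\<^sub>R (\<Sum>j\<in>{..<N} - {i}. gmix {0<..} ka (x s i - x s j)) else 0)" for s i
 have Vd: "((\<lambda>s. x s i) has_vector_derivative V s i) (at s within {0..T})" if s: "s \<in> {0..T}" for s i
 proof (cases "i < N")
  case True
  then show ?thesis using ps s by (simp add: psolution_def pforce_def V_def sum_negf)
 next
  case False
  have "((\<lambda>s. undefined) has_vector_derivative V s i) (at s within {0..T})" using False by (simp add: V_def)
  then show ?thesis
   by (rule has_vector_derivative_transform[rotated 2]) (use s xs False in \<open>auto simp: PiE_def extensional_def\<close>)
 qed
 \<comment> \<open>Along this trajectory the force equals a truncated, continuous one, so it is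
   bounded on the compact time interval. The bound only serves differentiability of the
   energy.\<close>
 obtain C where C: "\<And>s i. s \<in> {0..T} \<Longrightarrow> norm (V s i) \<le> C"
 proof -
  obtain L where L: "0 < L" "\<And>z w::'a. norm (trunc_force ka \<delta> z - trunc_force ka \<delta> w) \<le> L * norm (z - w)"
   using trunc_force_lipschitz[OF ka(1) \<delta>(1)] by blast
  have cont: "continuous_on UNIV (trunc_force ka \<delta> :: 'a \<Rightarrow> 'a)"
   by (rule Lipschitz.lipschitz_on_continuous_on[of L], rule lipschitz_onI) (use L in \<open>auto simp: dist_norm\<close>)
  have "\<exists>c. \<forall>s\<in>{0..T}. norm (V s i) \<le> c" if i: "i < N" for i
  proof -
   have eq: "V s i = pforce (trunc_force ka \<delta>) N (x s) i" if s: "s \<in> {0..T}" for s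
    unfolding V_def pforce_def using i trunc_force_eq[OF \<delta>(2)[OF s i]] by (simp add: sum_negf)
   have "continuous_on {0..T} (\<lambda>s. pforce (trunc_force ka \<delta>) N (x s) i)"
    unfolding pforce_def using psolution_continuous[OF ps] i
    by (intro continuous_intros continuous_on_compose2[OF cont]) auto
   then have "bounded ((\<lambda>s. pforce (trunc_force ka \<delta>) N (x s) i) ` {0..T})"
    by (intro compact_imp_bounded compact_continuous_image) auto
   then show ?thesis unfolding bounded_iff using eq by fastforce
  qed
  then obtain c where c: "\<And>i s. i < N \<Longrightarrow> s \<in> {0..T} \<Longrightarrow> norm (V s i) \<le> c i" by metis
  have "norm (V s i) \<le> (\<Sum>i<N. \<bar>c i\<bar>)" if "s \<in> {0..T}" for s i
  proof (cases "i < N")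
   case True
   then show ?thesis using c[OF True that] member_le_sum[of i "{..<N}" "\<lambda>i. \<bar>c i\<bar>"] by force
  qed (simp add: V_def sum_nonneg)
  then show ?thesis by (rule that)
 qed
 define S where "S = 2 * ta"
 have S: "0 < S" using ta by (simp add: S_def)
 let ?Q = "\<lambda>s. (\<Sum>i<N. (norm (x s i - flow s (X i)))\<^sup>2) / real N"
 let ?\<phi> = "\<lambda>s. menergy ka S N s (x s) + ?Q s"
 let ?K = "rateK \<kappa>s * (ta + (alpha_rate DIM('a) ka)\<^sup>2)"
 have pd: "0 \<le> pd" by (simp add: pd_def)
 have A: "1 \<le> rateA \<kappa>s" and K: "0 \<le> rateK \<kappa>s" unfolding rateA_def rateK_def using pd B by auto
 have "?\<phi> t \<le> exp (rateA \<kappa>s * t) * (?\<phi> 0 + ?K / rateA \<kappa>s) - ?K / rateA \<kappa>s"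
 proof (rule gronwall_differential[OF _ _ _ t])
  fix s assume s: "s \<in> {0..T}"
  show "(?\<phi> has_real_derivative
    (law_pair.sdiff (emp N (x s)) (law s) (\<lambda>z. law_pair.sdiff (emp N (x s)) (law s) (\<lambda>y. u s z \<bullet> gmix {S<..} ka (z - y)))
   + (\<Sum>i<N. (V s i - u s (x s i)) \<bullet> mforce ka S N s (x s) (x s i) + (1 / real N) *\<^sub>R (\<Sum>j\<in>{..<N} - {i}. gmix {0<..S} ka (x s i - x s j)) \<bullet> V s i) / real N)
   + (\<Sum>i<N. 2 * ((x s i - flow s (X i)) \<bullet> (V s i - u s (flow s (X i))))) / real N) (at s within {0..T})"
   by (intro DERIV_add DERIV_cdivide sum_sq_dist_has_derivative Vd flow_has_derivative s
     menergy_has_derivative[OF ka(1) S N s Vd C xd])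
  show "law_pair.sdiff (emp N (x s)) (law s) (\<lambda>z. law_pair.sdiff (emp N (x s)) (law s) (\<lambda>y. u s z \<bullet> gmix {S<..} ka (z - y)))
   + (\<Sum>i<N. (V s i - u s (x s i)) \<bullet> mforce ka S N s (x s) (x s i) + (1 / real N) *\<^sub>R (\<Sum>j\<in>{..<N} - {i}. gmix {0<..S} ka (x s i - x s j)) \<bullet> V s i) / real N
   + (\<Sum>i<N. 2 * ((x s i - flow s (X i)) \<bullet> (V s i - u s (flow s (X i))))) / real N \<le> rateA \<kappa>s * ?\<phi> s + ?K"
   unfolding S_def by (rule energy_rate_le[OF s N ka ta heat0 xd[OF s]]) (auto simp: V_def)
 qed (use A in auto)
 also have "\<dots> \<le> exp (rateA \<kappa>s * T) * (?\<phi> 0 + ?K)"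
 proof -
  have "0 \<le> ?K" using K ta by simp
  then have k: "0 \<le> ?K / rateA \<kappa>s" "?K / rateA \<kappa>s \<le> ?K" using A by (auto simp: divide_le_eq mult_le_cancel_left1)
  have "0 \<in> {0..T}" using T by simp
  then have "0 \<le> ?\<phi> 0" using menergy_bounds(1)[OF _ ka(1) S] by (auto intro!: add_nonneg_nonneg divide_nonneg_nonneg sum_nonneg)
  then have "exp (rateA \<kappa>s * t) * (?\<phi> 0 + ?K / rateA \<kappa>s) \<le> exp (rateA \<kappa>s * T) * (?\<phi> 0 + ?K)"
   using k A t by (intro mult_mono add_mono) auto
  then show ?thesis using k by linarith
 qed
 finally show ?thesis using menergy_bounds(1)[OF t ka(1) S, of N "x t"] using x0 by (simp add: flow_0 S_def x_def)
qed

end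

section \<open>Expectation over independent initial points\<close>

lemma distr_PiM_pair:
 assumes M: "prob_space M" and ij: "i \<in> I" "j \<in> I" "i \<noteq> j"
 shows "distr (PiM I (\<lambda>_. M)) (M \<Otimes>\<^sub>M M) (\<lambda>X. (X i, X j)) = M \<Otimes>\<^sub>M M"
proof -
 interpret prob_space M by fact
 let ?f = "\<lambda>b. if b then i else j"
 have c: "case_bool M M = (\<lambda>_. M)" by (auto simp: fun_eq_iff split: bool.split)
 have "PiM UNIV (\<lambda>_::bool. M) = distr (PiM I (\<lambda>_. M)) (PiM UNIV (\<lambda>_. M)) (\<lambda>X. \<lambda>b\<in>UNIV. X (?f b))"
  by (rule distr_PiM_reindex[symmetric]) (use M ij in \<open>auto simp: inj_on_def\<close>)
 then have "M \<Otimes>\<^sub>M M = distr (distr (PiM I (\<lambda>_. M)) (PiM UNIV (\<lambda>_. M)) (\<lambda>X. \<lambda>b\<in>UNIV. X (?f b))) (M \<Otimes>\<^sub>M M) (\<lambda>x. (x True, x False))"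
  using pair_measure_eq_distr_PiM[of M M] sigma_finite_measure_axioms by (simp add: c)
 also have "\<dots> = distr (PiM I (\<lambda>_. M)) (M \<Otimes>\<^sub>M M) ((\<lambda>x. (x True, x False)) \<circ> (\<lambda>X. \<lambda>b\<in>UNIV. X (?f b)))"
  by (rule distr_distr) (use ij in \<open>auto intro!: measurable_restrict measurable_component_singleton\<close>)
 finally show ?thesis by (simp add: comp_def)
qed

text \<open>A bound for the integral of s powr (- d / 2) over times from S to 1; from dimension 3
  on, 1 / (d / 2 - 1) is at most 2.\<close>

definition cutoff_gap :: "nat \<Rightarrow> real \<Rightarrow> real" where
 "cutoff_gap d S = (if d = 2 then - ln S else 2 * S powr (1 - real d / 2))"

text \<open>In dimension 2 the value at 0 alone grows like - ln ka as ka tends to 0, through the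
  large heat times. In the difference these times carry the factor 1 - exp (- y) with y of order 1 /
  s, and the bound becomes uniform in ka.\<close>

lemma hmix_cutoff_diff:
 fixes z :: "'a::euclidean_space"
 assumes d: "2 \<le> DIM('a)" and ka: "0 < ka" and S: "0 < S" "S \<le> 1" and z: "norm z \<le> 2 * R"
 shows "hmix {S<..} ka 0 (0::'a) - hmix {S<..} ka 0 z \<le> cutoff_gap DIM('a) S + 2 * R\<^sup>2"
proof -
 define e where "e = real DIM('a) / 2"
 have e: "1 \<le> e" "DIM('a) = 2 \<longleftrightarrow> e = 1" "DIM('a) \<noteq> 2 \<Longrightarrow> 3 / 2 \<le> e" using d by (auto simp: e_def)
 let ?f = "\<lambda>x s. indicator {S<..} s * exp (- ka\<^sup>2 * s) * (heat s (x::'a) / s ^ 0)"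
 have i: "integrable lborel (?f x)" for x using S ka by (intro hmix_integrable hmix_atI_cut[of _ S]) auto
 \<comment> \<open>An antiderivative of s powr (- e), with the logarithm in the case e = 1 of
   dimension 2.\<close>
 define F where "F s = (if e = 1 then ln s else s powr (1 - e) / (1 - e))" for s
 have "has_bochner_integral lborel (\<lambda>s. s powr (- e) * indicator {S..1} s) (F 1 - F S)"
 proof (rule has_bochner_integral_FTC_Icc_real)
  fix s assume s: "S \<le> s"
  show "DERIV F s :> s powr (- e)"
  proof (cases "e = 1")
   case True
   then show ?thesis unfolding F_def using s S by (auto intro!: derivative_eq_intros simp: powr_minus_divide)
  next
   case False
   have "((\<lambda>s. s powr (1 - e) / (1 - e)) has_real_derivative (1 - e) * s powr (1 - e - 1) / (1 - e)) (at s)"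
    using s S by (intro DERIV_cdivide has_real_derivative_powr) auto
   then show ?thesis unfolding F_def using False by simp
  qed
  show "isCont (\<lambda>s. s powr (- e)) s" using s S by (intro continuous_intros) auto
 qed (use S in auto)
 moreover have "F 1 - F S \<le> cutoff_gap DIM('a) S"
 proof (cases "e = 1")
  case False
  have "(S powr (1 - e) - 1) / (e - 1) \<le> S powr (1 - e) / (1 / 2)"
   using e False S by (intro frac_le) auto
  moreover have "F 1 - F S = (S powr (1 - e) - 1) / (e - 1)" using False by (simp add: F_def divide_simps) (simp add: algebra_simps)
  ultimately show ?thesis using e False by (simp add: cutoff_gap_def flip: e_def)
 qed (use e in \<open>simp add: F_def cutoff_gap_def\<close>)
 ultimately have near: "integrable lborel (\<lambda>s. s powr (- e) * indicator {S..1} s)" "(LBINT s. s powr (- e) * indicator {S..1} s) \<le> cutoff_gap DIM('a) S"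
  by (auto simp: has_bochner_integral_iff)
 \<comment> \<open>Up to time 1 the heat kernel at 0 alone is used; beyond it the factor 1 / s is
   gained, weakened to s powr (- 3 / 2), whose integral is 2.\<close>
 let ?b = "\<lambda>s. s powr (- e) * indicator {S..1} s + R\<^sup>2 * (indicator {1<..} s * s powr (- (3 / 2)))"
 have "hmix {S<..} ka 0 (0::'a) - hmix {S<..} ka 0 z = (LBINT s. ?f 0 s - ?f z s)" unfolding hmix_def using i by simp
 also have "\<dots> \<le> (LBINT s. ?b s)"
 proof (rule integral_mono)
  fix s
  show "?f 0 s - ?f z s \<le> ?b s"
  proof (cases "S < s")
   case True
   then have s: "0 < s" using S by simp
   have "(4 * pi) powr (- e) \<le> 1" using e pi_gt3 powr_mono[of "- e" 0 "4 * pi"] by simp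
   then have c: "(4 * pi * s) powr (- e) \<le> s powr (- e)" by (simp add: powr_mult mult_left_le_one_le)
   define y where "y = (norm z)\<^sup>2 / (4 * s)"
   have y: "0 \<le> y" "1 - exp (- y) \<le> y" using s exp_ge_add_one_self[of "- y"] by (auto simp: y_def)
   have "?f 0 s - ?f z s = exp (- ka\<^sup>2 * s) * ((4 * pi * s) powr (- e) * (1 - exp (- y)))"
    using True by (simp add: heat_def e_def y_def algebra_simps)
   also have "\<dots> \<le> 1 * (s powr (- e) * (1 - exp (- y)))" using c y s by (intro mult_mono mult_right_mono) auto
   finally have main: "?f 0 s - ?f z s \<le> s powr (- e) * (1 - exp (- y))" by simp
   show ?thesis
   proof (cases "s \<le> 1")
    case True
    have "s powr (- e) * (1 - exp (- y)) \<le> s powr (- e)" by (intro mult_left_le) auto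
    then show ?thesis using main True \<open>S < s\<close> by simp
   next
    case False
    have "(norm z)\<^sup>2 \<le> (2 * R)\<^sup>2" using z by (intro power_mono) auto
    then have "y \<le> R\<^sup>2 / s" using s by (simp add: y_def field_simps power_mult_distrib)
    moreover have "s powr (- e) \<le> s powr (- 1)" using False e by (intro powr_mono) auto
    ultimately have "s powr (- e) * (1 - exp (- y)) \<le> s powr (- 1) * (R\<^sup>2 / s)" using y by (intro mult_mono) auto
    also have "\<dots> = R\<^sup>2 * s powr (- 2)" using s by (simp add: powr_minus powr_numeral power2_eq_square field_simps)
    also have "\<dots> \<le> R\<^sup>2 * s powr (- (3 / 2))" using False by (intro mult_left_mono powr_mono) auto
    finally show ?thesis using main False by simp
   qed
  qed (use S in auto)
 qed (use i near integral_powr_minus_three_half in auto)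
 also have "\<dots> = (LBINT s. s powr (- e) * indicator {S..1} s) + R\<^sup>2 * (LBINT s. indicator {1<..} s * s powr (- (3 / 2)))"
  using near(1) integral_powr_minus_three_half(1) by (subst Bochner_Integration.integral_add) auto
 also have "\<dots> \<le> cutoff_gap DIM('a) S + 2 * R\<^sup>2" using near(2) unfolding integral_powr_minus_three_half(2) by simp
 finally show ?thesis .
qed

context density_curve begin

lemma zero_mem: "0 \<in> {0..T}" using T by simp

lemma tensor_law_component:
 assumes t: "t \<in> {0..T}"
 shows "sets (tensor_law N (\<rho> t)) = sets (PiM {..<N} (\<lambda>_. borel))" "prob_space (tensor_law N (\<rho> t))"
  and "i < N \<Longrightarrow> distr (tensor_law N (\<rho> t)) (law t) (\<lambda>X. X i) = law t"
  and "i < N \<Longrightarrow> j < N \<Longrightarrow> i \<noteq> j \<Longrightarrow> distr (tensor_law N (\<rho> t)) (law t \<Otimes>\<^sub>M law t) (\<lambda>X. (X i, X j)) = law t \<Otimes>\<^sub>M law t"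
 unfolding tensor_law_def using prob_law[OF t]
 by (auto intro!: sets_PiM_cong prob_space_PiM distr_PiM_component distr_PiM_pair simp: lessThan_def)

lemma AE_no_collision: "AE X in tensor_law N (\<rho> 0). X \<in> ({..<N} \<rightarrow>\<^sub>E UNIV) - collision_set N"
proof -
 interpret L: prob_space "law 0" by (rule prob_law[OF zero_mem])
 note [measurable_cong] = tensor_law_component(1)[OF zero_mem]
 note [measurable] = rho_measurable[OF zero_mem]
 have "AE X in tensor_law N (\<rho> 0). X i \<noteq> X j" if "i < N" "j < N" "i \<noteq> j" for i j
 proof -
  interpret pair_sigma_finite "law 0" "law 0" ..
  have "AE y in law 0. x \<noteq> y" for x
  proof -
   have "AE y in lborel. y \<noteq> x" by (rule AE_lborel_singleton)
   then show ?thesis by (subst AE_density) (auto elim!: eventually_mono)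
  qed
  moreover have "{p \<in> space (law 0 \<Otimes>\<^sub>M law 0). fst p \<noteq> snd p} \<in> sets (law 0 \<Otimes>\<^sub>M law 0)" by measurable
  ultimately have "AE p in law 0 \<Otimes>\<^sub>M law 0. fst p \<noteq> snd p" by (intro AE_pair_measure) auto
  then have "AE p in distr (tensor_law N (\<rho> 0)) (law 0 \<Otimes>\<^sub>M law 0) (\<lambda>X. (X i, X j)). fst p \<noteq> snd p"
   unfolding tensor_law_component(4)[OF zero_mem that] .
  from AE_distrD[OF _ this] show ?thesis using that by simp
 qed
 then have "AE X in tensor_law N (\<rho> 0). \<forall>i\<in>{..<N}. \<forall>j\<in>{..<N}. i \<noteq> j \<longrightarrow> X i \<noteq> X j"
  by (intro AE_finite_allI) auto
 moreover have "AE X in tensor_law N (\<rho> 0). X \<in> {..<N} \<rightarrow>\<^sub>E UNIV"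
  by (rule AE_I2) (simp add: tensor_law_def space_PiM)
 ultimately show ?thesis by eventually_elim (auto simp: collision_set_def)
qed

text \<open>By independence a pair has a product law with densities at most B, and the short-time
  kernel has mass at most S.\<close>

lemma expected_short_energy:
 assumes ka: "0 < ka" and S: "0 < S" and N: "0 < N"
 shows "(\<integral>\<^sup>+X. ennreal (short_energy ka S N X) \<partial>tensor_law N (\<rho> 0)) \<le> ennreal (B * S / 2)"
proof -
 interpret L: prob_space "law 0" by (rule prob_law[OF zero_mem])
 interpret P: prob_space "tensor_law N (\<rho> 0)" by (rule tensor_law_component(2)[OF zero_mem])
 note [measurable_cong] = tensor_law_component(1)[OF zero_mem]
 note [measurable] = rho_measurable[OF zero_mem]
 let ?h = "hmix {0<..S} ka 0 :: 'a \<Rightarrow> real" and ?c = "1 / (2 * (real N)\<^sup>2)"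
 have h0: "0 \<le> ?h z" for z by (intro hmix_nonneg) auto
 have 1: "(\<integral>\<^sup>+y. ennreal (?h (x - y)) \<partial>law 0) \<le> ennreal (B * S)" for x
 proof -
  have "(\<integral>\<^sup>+y. ennreal (?h (x - y)) \<partial>law 0) = (\<integral>\<^sup>+y. ennreal (\<rho> 0 y) * ennreal (?h (x - y)) \<partial>lborel)"
   by (rule nn_integral_density) auto
  also have "\<dots> \<le> (\<integral>\<^sup>+y. ennreal B * ennreal (?h (x - y)) \<partial>lborel)"
   using bound[OF zero_mem] by (intro nn_integral_mono mult_right_mono ennreal_leI) auto
  also have "\<dots> = ennreal B * ennreal (LBINT y. ?h (x - y))"
   using integral_hmix_interval_le(1)[of 0 S ka x] S ka h0 by (subst nn_integral_cmult) (auto simp: nn_integral_eq_integral)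
  also have "\<dots> \<le> ennreal (B * S)"
   using integral_hmix_interval_le(2)[of 0 S ka x] S ka B by (subst ennreal_mult'[symmetric]) (auto intro!: ennreal_leI)
  finally show ?thesis .
 qed
 have 2: "(\<integral>\<^sup>+X. ennreal (?h (X i - X j)) \<partial>tensor_law N (\<rho> 0)) \<le> ennreal (B * S)" if ij: "i < N" "j \<in> {..<N} - {i}" for i j
 proof -
  have "(\<integral>\<^sup>+X. ennreal (?h (X i - X j)) \<partial>tensor_law N (\<rho> 0)) = (\<integral>\<^sup>+p. ennreal (?h (fst p - snd p)) \<partial>distr (tensor_law N (\<rho> 0)) (law 0 \<Otimes>\<^sub>M law 0) (\<lambda>X. (X i, X j)))"
   using ij by (subst nn_integral_distr) auto
  also have "\<dots> = (\<integral>\<^sup>+x. \<integral>\<^sup>+y. ennreal (?h (x - y)) \<partial>law 0 \<partial>law 0)"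
   using ij by (subst tensor_law_component(4)[OF zero_mem]) (auto simp: L.nn_integral_fst[symmetric])
  also have "\<dots> \<le> (\<integral>\<^sup>+x. ennreal (B * S) \<partial>law 0)" by (intro nn_integral_mono 1)
  also have "\<dots> = ennreal (B * S)" using L.emeasure_space_1 by simp
  finally show ?thesis .
 qed
 have "(\<integral>\<^sup>+X. ennreal (short_energy ka S N X) \<partial>tensor_law N (\<rho> 0)) =
  (\<integral>\<^sup>+X. ennreal ?c * (\<Sum>i<N. \<Sum>j\<in>{..<N} - {i}. ennreal (?h (X i - X j))) \<partial>tensor_law N (\<rho> 0))"
  unfolding short_energy_def using h0 by (simp add: sum_nonneg ennreal_mult'[symmetric])
 also have "\<dots> = ennreal ?c * (\<Sum>i<N. \<Sum>j\<in>{..<N} - {i}. \<integral>\<^sup>+X. ennreal (?h (X i - X j)) \<partial>tensor_law N (\<rho> 0))"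
 proof -
  have hm: "(\<lambda>X. ennreal (?h (X i - X j))) \<in> borel_measurable (tensor_law N (\<rho> 0))" if "i < N" "j \<in> {..<N} - {i}" for i j using that by simp
  have sm: "(\<integral>\<^sup>+X. (\<Sum>j\<in>{..<N} - {i}. ennreal (?h (X i - X j))) \<partial>tensor_law N (\<rho> 0)) = (\<Sum>j\<in>{..<N} - {i}. \<integral>\<^sup>+X. ennreal (?h (X i - X j)) \<partial>tensor_law N (\<rho> 0))" if "i < N" for i
   by (rule nn_integral_sum) (use hm that in auto)
  have "(\<integral>\<^sup>+X. (\<Sum>i<N. \<Sum>j\<in>{..<N} - {i}. ennreal (?h (X i - X j))) \<partial>tensor_law N (\<rho> 0)) = (\<Sum>i<N. \<integral>\<^sup>+X. (\<Sum>j\<in>{..<N} - {i}. ennreal (?h (X i - X j))) \<partial>tensor_law N (\<rho> 0))"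
   by (rule nn_integral_sum) simp
  also have "\<dots> = (\<Sum>i<N. \<Sum>j\<in>{..<N} - {i}. \<integral>\<^sup>+X. ennreal (?h (X i - X j)) \<partial>tensor_law N (\<rho> 0))"
   by (intro sum.cong refl sm) simp
  finally show ?thesis by (subst nn_integral_cmult) simp_all
 qed
 also have "\<dots> \<le> ennreal ?c * (\<Sum>i<N. \<Sum>j<N. ennreal (B * S))"
  using 2 by (intro mult_left_mono sum_mono order_trans[OF sum_mono[of "{..<N} - {_}"] sum_mono2]) auto
 also have "\<dots> = ennreal (B * S / 2)"
  using N B S by (simp add: power2_eq_square ennreal_of_nat_eq_real_of_nat ennreal_mult'[symmetric])
 finally show ?thesis .
qed

text \<open>For independent points distributed like the background the off-diagonal, mixed and
  background terms cancel up to the diagonal: the expectation is (K 0 - I) / N, where I is the mean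
  interaction. Only the difference from the value at 0 remains.\<close>

lemma expected_smooth_energy:
 assumes ka: "0 < ka" and S: "0 < S" "S \<le> 1" and N: "0 < N"
 defines "E \<equiv> \<lambda>X. law_pair.sdiff (emp N X) (law 0) (\<lambda>z. law_pair.sdiff (emp N X) (law 0) (\<lambda>y. hmix {S<..} ka 0 (z - y)))"
 shows "E \<in> borel_measurable (tensor_law N (\<rho> 0))"
  and "(\<integral>\<^sup>+X. ennreal (E X) \<partial>tensor_law N (\<rho> 0)) \<le> ennreal ((cutoff_gap DIM('a) S + 2 * R\<^sup>2) / real N)"
proof -
 interpret L: prob_space "law 0" by (rule prob_law[OF zero_mem])
 interpret P: prob_space "tensor_law N (\<rho> 0)" by (rule tensor_law_component(2)[OF zero_mem])
 note [measurable_cong] = tensor_law_component(1)[OF zero_mem]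
 let ?P = "tensor_law N (\<rho> 0)" and ?K = "hmix {S<..} ka 0 :: 'a \<Rightarrow> real"
 have K: "\<bar>?K z\<bar> \<le> ?K 0" for z
  using hmix_le_at_0[OF hmix_atI_cut[of "{S<..}" S] ka, of 0 z] hmix_nonneg[of "{S<..}" ka 0 z] S by (auto simp: subset_iff)
 note fin = L.finite_measure_axioms
 define k where "k x = (\<integral>y. ?K (x - y) \<partial>law 0)" for x
 define I where "I = (\<integral>x. k x \<partial>law 0)"
 have [measurable]: "k \<in> borel_measurable borel" unfolding k_def by measurable
 have kb: "\<bar>k x\<bar> \<le> ?K 0" for x
  unfolding k_def using K by (intro order_trans[OF integral_abs_bound L.integral_le_const]) (auto intro!: L.integrable_const_bound[of _ "?K 0"])
 have Eeq: "E X = (\<Sum>i<N. \<Sum>j<N. ?K (X i - X j)) / (real N)\<^sup>2 - 2 * ((\<Sum>i<N. k (X i)) / real N) + I" for X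
  unfolding E_def using K
  by (subst law_pair.sdiff_sdiff_eq[OF law_pair_emp[OF zero_mem], of _ "?K 0"])
   (auto simp: integral_emp[OF N] k_def[symmetric] I_def power2_eq_square sum_divide_distrib)
 show "E \<in> borel_measurable ?P" unfolding Eeq[abs_def] by measurable
 have "(\<integral>X. k (X i) \<partial>?P) = I" if "i < N" for i
 proof -
  have "(\<integral>X. k (X i) \<partial>?P) = (\<integral>x. k x \<partial>distr ?P (law 0) (\<lambda>X. X i))" using that by (subst integral_distr) auto
  then show ?thesis unfolding tensor_law_component(3)[OF zero_mem that] I_def .
 qed
 moreover have "(\<integral>X. ?K (X i - X j) \<partial>?P) = (if i = j then ?K 0 else I)" if "i < N" "j < N" for i j
 proof (cases "i = j")
  case False
  have "(\<integral>X. ?K (X i - X j) \<partial>?P) = (\<integral>p. (case p of (x, y) \<Rightarrow> ?K (x - y)) \<partial>distr ?P (law 0 \<Otimes>\<^sub>M law 0) (\<lambda>X. (X i, X j)))"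
   using that by (subst integral_distr) auto
  then show ?thesis using False K unfolding tensor_law_component(4)[OF zero_mem that False] I_def k_def
   by (subst (asm) fubini_bounded(3)[OF fin fin, of _ "?K 0"]) auto
 qed (use P.prob_space in simp)
 moreover have i: "integrable ?P (\<lambda>X. k (X i))" "integrable ?P (\<lambda>X. ?K (X i - X j))" if "i < N" "j < N" for i j
  using that kb K by (auto intro!: P.integrable_const_bound[of _ "?K 0"])
 moreover have i2: "integrable ?P (\<lambda>X. (\<Sum>i<N. \<Sum>j<N. ?K (X i - X j)) / (real N)\<^sup>2)" "integrable ?P (\<lambda>X. 2 * ((\<Sum>i<N. k (X i)) / real N))"
  by (intro integrable_divide integrable_mult_right Bochner_Integration.integrable_sum i; simp)+
 moreover have "(\<integral>X. (\<Sum>i<N. \<Sum>j<N. ?K (X i - X j)) \<partial>?P) = (\<Sum>i<N. \<Sum>j<N. \<integral>X. ?K (X i - X j) \<partial>?P)"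
  by (subst Bochner_Integration.integral_sum; (intro sum.cong refl Bochner_Integration.integral_sum)?) (auto intro!: i)
 moreover have "(\<integral>X. E X \<partial>?P) = (\<integral>X. (\<Sum>i<N. \<Sum>j<N. ?K (X i - X j)) / (real N)\<^sup>2 \<partial>?P) - (\<integral>X. 2 * ((\<Sum>i<N. k (X i)) / real N) \<partial>?P) + I"
  unfolding Eeq Bochner_Integration.integral_diff[OF i2, symmetric]
  using Bochner_Integration.integrable_diff[OF i2] by (simp only: Bochner_Integration.integral_add P.integrable_const lebesgue_integral_const P.prob_space) simp
 ultimately have "(\<integral>X. E X \<partial>?P) = (\<Sum>i<N. \<Sum>j<N. if i = j then ?K 0 else I) / (real N)\<^sup>2 - 2 * ((\<Sum>i<N. I) / real N) + I"
  by simp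
 also have "(\<Sum>i<N. \<Sum>j<N. if i = j then ?K 0 else I) = (\<Sum>i<N. \<Sum>j<N. I + (if i = j then ?K 0 - I else 0))"
  by (intro sum.cong) auto
 also have "\<dots> = real N * real N * I + real N * (?K 0 - I)" by (simp add: sum.distrib distrib_left)
 also have "\<dots> / (real N)\<^sup>2 - 2 * ((\<Sum>i<N. I) / real N) + I = (?K 0 - I) / real N"
  using N by (simp add: power2_eq_square field_simps)
 finally have EI: "(\<integral>X. E X \<partial>?P) = (?K 0 - I) / real N" .
 have sup0: "AE x in law 0. norm x \<le> R"
  using rho_measurable[OF zero_mem] supp[OF zero_mem] by (subst AE_density) (auto intro!: AE_I2 simp: not_less[symmetric])
 \<comment> \<open>Two points of the support are at distance at most 2 R.\<close>
 have "?K 0 - (cutoff_gap DIM('a) S + 2 * R\<^sup>2) \<le> k x" if x: "norm x \<le> R" for x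
  unfolding k_def
 proof (rule L.integral_ge_const)
  show "integrable (law 0) (\<lambda>y. ?K (x - y))" using K by (auto intro!: L.integrable_const_bound[of _ "?K 0"])
  show "AE y in law 0. ?K 0 - (cutoff_gap DIM('a) S + 2 * R\<^sup>2) \<le> ?K (x - y)"
   using sup0
  proof eventually_elim
   case (elim y)
   then have "norm (x - y) \<le> 2 * R" using x norm_triangle_ineq4[of x y] by linarith
   from hmix_cutoff_diff[OF dim ka S this] show ?case by linarith
  qed
 qed
 then have "?K 0 - (cutoff_gap DIM('a) S + 2 * R\<^sup>2) \<le> I"
  unfolding I_def using sup0 kb by (intro L.integral_ge_const) (auto intro!: L.integrable_const_bound[of _ "?K 0"] elim!: eventually_mono)
 then have le: "(\<integral>X. E X \<partial>?P) \<le> (cutoff_gap DIM('a) S + 2 * R\<^sup>2) / real N" unfolding EI by (intro divide_right_mono) auto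
 have "0 \<le> E X" for X
  using menergy_bounds[OF zero_mem ka S(1), of N X] short_energy_nonneg law_pair.commutator_estimate(1)[OF law_pair_emp[OF zero_mem], where u = "\<lambda>_. 0" and u' = "\<lambda>_ _. 0" and B = 0 and L = 0, OF ka, of "S / 2"] S
  unfolding E_def by simp
 moreover have "integrable ?P E" unfolding Eeq[abs_def]
  by (intro Bochner_Integration.integrable_add Bochner_Integration.integrable_diff i2) auto
 ultimately show "(\<integral>\<^sup>+X. ennreal (E X) \<partial>?P) \<le> ennreal ((cutoff_gap DIM('a) S + 2 * R\<^sup>2) / real N)"
  using le by (subst nn_integral_eq_integral) (auto intro!: ennreal_leI)
qed

definition mean_const :: "real \<Rightarrow> real" where
 "mean_const \<kappa>s = exp (rateA \<kappa>s * T) * ((1 + R\<^sup>2 + B / 2) + rateK \<kappa>s)"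

theorem expected_error:
 assumes N: "0 < N" and ka: "0 < ka" "ka \<le> \<kappa>s" and t: "t \<in> {0..T}"
 shows "(\<integral>\<^sup>+X. ennreal ((\<Sum>i<N. (norm (particle_flow N ka t X i - flow t (X i)))\<^sup>2) / real N) \<partial>tensor_law N (\<rho> 0))
  \<le> ennreal (mean_const \<kappa>s * (a_rate N DIM('a) + (alpha_rate DIM('a) ka)\<^sup>2))"
proof -
 interpret P: prob_space "tensor_law N (\<rho> 0)" by (rule tensor_law_component(2)[OF zero_mem])
 note [measurable_cong] = tensor_law_component(1)[OF zero_mem]
 \<comment> \<open>At this scale S powr (- d / 2) = N. Hence the self-energy
   \<open>cutoff_gap DIM('a) S / N\<close> is 2 S from dimension 3 on and ln N / N in dimension 2,
   and the heat kernel at 0 is of order N.\<close>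
 define S where "S = real N powr (- 2 / real DIM('a))"
 define ta where "ta = S / 2"
 let ?a = "a_rate N DIM('a)" and ?\<alpha> = "alpha_rate DIM('a) ka" and ?d = "real DIM('a)"
 have N1: "1 \<le> real N" using N by simp
 have S: "0 < S" "S \<le> 1" unfolding S_def using N1 powr_mono[of "- 2 / real DIM('a)" 0 "real N"] by auto
 have ta: "0 < ta" "2 * ta \<le> 1" "S = 2 * ta" using S by (auto simp: ta_def)
 have SN: "S powr (- (?d / 2)) = real N" using N1 dim by (simp add: S_def powr_powr)
 have S2: "DIM('a) = 2 \<Longrightarrow> S = 1 / real N" using N1 by (simp add: S_def powr_minus_divide)
 have Sa: "S \<le> ?a"
 proof (cases "DIM('a) = 2")
  case True
  have "1 / real N \<le> (1 + ln (real N)) / real N" using N1 by (intro divide_right_mono) auto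
  then show ?thesis using True S2 by (simp add: a_rate_def)
 qed (simp add: a_rate_def S_def)
 have gap: "cutoff_gap DIM('a) S / real N \<le> 2 * ?a"
 proof (cases "DIM('a) = 2")
  case True
  have "ln (real N) / real N \<le> 2 * ((1 + ln (real N)) / real N)"
   unfolding times_divide_eq_right using N1 by (intro divide_right_mono) (auto simp: algebra_simps)
  then show ?thesis using True S2 N1 by (simp add: cutoff_gap_def a_rate_def ln_div)
 next
  case False
  have "S powr (1 - ?d / 2) = S * real N" using S powr_add[of S 1 "- (?d / 2)"] unfolding SN by simp
  then show ?thesis using False N1 by (simp add: cutoff_gap_def a_rate_def S_def)
 qed
 \<comment> \<open>Since 2 / d is at most 1, 1 / N is below S; this takes care of the term with
   R.\<close>
 have N_a: "1 / real N \<le> ?a"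
 proof -
  have "real N powr (- 1) \<le> S" unfolding S_def using N1 dim by (intro powr_mono) (auto simp: field_simps)
  then show ?thesis using Sa N1 by (simp add: powr_minus_divide)
 qed
 \<comment> \<open>Here the choice of S gives the admissibility condition of
   \<open>pathwise_estimate\<close>.\<close>
 have heat0: "heat (4 * ta) (0::'a) \<le> pd * real N"
 proof -
  have "heat (4 * ta) (0::'a) = (8 * pi * S) powr (- (?d / 2))" by (simp add: heat_def ta(3))
  also have "\<dots> \<le> S powr (- (?d / 2))" using S pi_gt3 by (intro powr_mono2') auto
  also have "\<dots> \<le> pd * real N" unfolding SN pd_def using dim N1 by (simp add: ge_one_powr_ge_zero)
  finally show ?thesis .
 qed
 have pd: "0 \<le> pd" by (simp add: pd_def)
 have K: "0 \<le> rateK \<kappa>s" unfolding rateK_def using pd B by auto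
 let ?e = "exp (rateA \<kappa>s * T)" and ?SS = "\<lambda>X. law_pair.sdiff (emp N X) (law 0) (\<lambda>z. law_pair.sdiff (emp N X) (law 0) (\<lambda>y. hmix {S<..} ka 0 (z - y)))"
 note es = expected_smooth_energy[OF ka(1) S N] and eh = expected_short_energy[OF ka(1) S(1) N]
 note [measurable] = es(1)
 have [measurable]: "short_energy ka S N \<in> borel_measurable (tensor_law N (\<rho> 0))" unfolding short_energy_def[abs_def] by measurable
 let ?k = "rateK \<kappa>s * (ta + ?\<alpha>\<^sup>2)"
 have k0: "0 \<le> ?k" using K ta by simp
 have "(\<integral>\<^sup>+X. ennreal ((\<Sum>i<N. (norm (particle_flow N ka t X i - flow t (X i)))\<^sup>2) / real N) \<partial>tensor_law N (\<rho> 0))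
  \<le> (\<integral>\<^sup>+X. ennreal ?e * (ennreal (1 / 2) * ennreal (?SS X) + ennreal (short_energy ka S N X) + ennreal ?k) \<partial>tensor_law N (\<rho> 0))"
 proof (rule nn_integral_mono_AE, use AE_no_collision[of N] in eventually_elim)
  case (elim X)
  have "(\<Sum>i<N. (norm (particle_flow N ka t X i - flow t (X i)))\<^sup>2) / real N \<le> ?e * (menergy ka S N 0 X + ?k)"
   using pathwise_estimate[OF N ka ta(1,2) heat0 _ _ t, of X] elim ta(3) by auto
  moreover have SS0: "0 \<le> ?SS X"
   using law_pair.commutator_estimate(1)[OF law_pair_emp[OF zero_mem], where u = "\<lambda>_. 0" and u' = "\<lambda>_ _. 0" and B = 0 and L = 0, OF ka(1) ta(1)] ta(3) by simp
  ultimately have "ennreal ((\<Sum>i<N. (norm (particle_flow N ka t X i - flow t (X i)))\<^sup>2) / real N) \<le> ennreal (?e * (1 / 2 * ?SS X + short_energy ka S N X + ?k))"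
   unfolding menergy_def by (intro ennreal_leI) simp
  also have "\<dots> = ennreal ?e * (ennreal (1 / 2) * ennreal (?SS X) + ennreal (short_energy ka S N X) + ennreal ?k)"
  proof -
   have "ennreal (e * (1 / 2 * s + h + k)) = ennreal e * (ennreal (1 / 2) * ennreal s + ennreal h + ennreal k)"
    if "0 \<le> e" "0 \<le> s" "0 \<le> h" "0 \<le> k" for e s h k :: real
    using that ennreal_mult[of e "1 / 2 * s + h + k"] ennreal_plus[of "1 / 2 * s + h" k] ennreal_plus[of "1 / 2 * s" h] ennreal_mult[of "1 / 2" s] by simp
   then show ?thesis using SS0 short_energy_nonneg[of ka S N X] k0 by simp
  qed
  finally show ?case .
 qed
 also have "\<dots> = ennreal ?e * (ennreal (1 / 2) * (\<integral>\<^sup>+X. ennreal (?SS X) \<partial>tensor_law N (\<rho> 0)) + (\<integral>\<^sup>+X. ennreal (short_energy ka S N X) \<partial>tensor_law N (\<rho> 0)) + ennreal ?k)"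
  using P.emeasure_space_1 by (simp add: nn_integral_cmult nn_integral_add del: ennreal_half)
 also have "\<dots> \<le> ennreal ?e * (ennreal (1 / 2) * ennreal ((cutoff_gap DIM('a) S + 2 * R\<^sup>2) / real N) + ennreal (B * S / 2) + ennreal ?k)"
  by (intro mult_left_mono add_mono es eh order_refl) auto
 also have "\<dots> \<le> ennreal ?e * (ennreal (?a + R\<^sup>2 * ?a) + ennreal (B / 2 * ?a) + ennreal ?k)"
 proof (intro mult_left_mono add_mono order_refl)
  have "(cutoff_gap DIM('a) S + 2 * R\<^sup>2) / real N / 2 \<le> ?a + R\<^sup>2 * ?a"
   using gap mult_left_mono[OF N_a, of "R\<^sup>2"] by (simp add: add_divide_distrib)
  then show "ennreal (1 / 2) * ennreal ((cutoff_gap DIM('a) S + 2 * R\<^sup>2) / real N) \<le> ennreal (?a + R\<^sup>2 * ?a)"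
   by (subst ennreal_mult'[symmetric]) (auto intro!: ennreal_leI)
  show "ennreal (B * S / 2) \<le> ennreal (B / 2 * ?a)" using Sa B by (auto intro!: ennreal_leI mult_left_mono)
 qed auto
 also have "\<dots> = ennreal (?e * ((?a + R\<^sup>2 * ?a) + B / 2 * ?a + ?k))"
  using k0 Sa S B by (simp add: ennreal_mult ennreal_plus)
 also have "\<dots> \<le> ennreal (mean_const \<kappa>s * (?a + ?\<alpha>\<^sup>2))"
 proof (rule ennreal_leI)
  have "0 \<le> B / 2 * ?\<alpha>\<^sup>2" "0 \<le> R\<^sup>2 * ?\<alpha>\<^sup>2" "0 \<le> ?\<alpha>\<^sup>2" using B by auto
  moreover have "?k \<le> rateK \<kappa>s * (?a + ?\<alpha>\<^sup>2)" using K Sa ta by (intro mult_left_mono) auto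
  moreover have "((1 + R\<^sup>2 + B / 2) + rateK \<kappa>s) * (?a + ?\<alpha>\<^sup>2) =
   (?a + R\<^sup>2 * ?a) + B / 2 * ?a + (?\<alpha>\<^sup>2 + R\<^sup>2 * ?\<alpha>\<^sup>2 + B / 2 * ?\<alpha>\<^sup>2) + rateK \<kappa>s * (?a + ?\<alpha>\<^sup>2)" by (simp add: algebra_simps)
  ultimately have "(?a + R\<^sup>2 * ?a) + B / 2 * ?a + ?k \<le> ((1 + R\<^sup>2 + B / 2) + rateK \<kappa>s) * (?a + ?\<alpha>\<^sup>2)"
   by linarith
  then show "?e * ((?a + R\<^sup>2 * ?a) + B / 2 * ?a + ?k) \<le> mean_const \<kappa>s * (?a + ?\<alpha>\<^sup>2)"
   unfolding mean_const_def mult.assoc by (intro mult_left_mono) auto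
 qed
 finally show ?thesis .
qed

end

section \<open>Wasserstein distances\<close>

text \<open>The joint law of \<open>F\<close> and \<open>G\<close> on the common probability space
  is an admissible coupling.\<close>

lemma W2_squared_distr_le:
 fixes F G :: "'w \<Rightarrow> nat \<Rightarrow> 'a::euclidean_space"
 assumes [measurable]: "F \<in> measurable P (PiM {..<n} (\<lambda>_. borel))" "G \<in> measurable P (PiM {..<n} (\<lambda>_. borel))"
 shows "W2_squared n (distr P (PiM {..<n} (\<lambda>_. borel)) F) (distr P (PiM {..<n} (\<lambda>_. borel)) G)
  \<le> (\<Sum>i<n. \<integral>\<^sup>+w. ennreal ((norm (F w i - G w i))\<^sup>2) \<partial>P)"
proof -
 let ?M = "PiM {..<n} (\<lambda>_. borel :: 'a measure)"
 let ?\<pi> = "distr P (?M \<Otimes>\<^sub>M ?M) (\<lambda>w. (F w, G w))"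
 have "distr ?\<pi> (distr P ?M F) fst = distr P (distr P ?M F) F" "distr ?\<pi> (distr P ?M G) snd = distr P (distr P ?M G) G"
  by (subst distr_distr; simp add: comp_def)+
 moreover have "distr P (distr P ?M H) H = distr P ?M H" for H by (rule distr_cong) auto
 ultimately have "?\<pi> \<in> couplings (distr P ?M F) (distr P ?M G)"
  by (simp add: couplings_def cong: sets_pair_measure_cong)
 then have "W2_squared n (distr P ?M F) (distr P ?M G) \<le> (\<integral>\<^sup>+p. (\<Sum>i<n. ennreal ((dist (fst p i) (snd p i))\<^sup>2)) \<partial>?\<pi>)"
  unfolding W2_squared_def by (rule INF_lower)
 also have "\<dots> = (\<Sum>i<n. \<integral>\<^sup>+p. ennreal ((dist (fst p i) (snd p i))\<^sup>2) \<partial>?\<pi>)" by (rule nn_integral_sum) simp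
 also have "\<dots> = (\<Sum>i<n. \<integral>\<^sup>+w. ennreal ((norm (F w i - G w i))\<^sup>2) \<partial>P)"
  by (intro sum.cong refl) (subst nn_integral_distr; simp add: dist_norm)
 finally show ?thesis .
qed

context density_curve begin

text \<open>Swapping two labels preserves the product law and commutes with the particle flow, while
  the Coulomb flow acts on each point separately.\<close>

lemma nn_integral_exchangeable:
 assumes ka: "0 < ka" and t: "t \<in> {0..T}" and ij: "i < N" "j < N"
 shows "(\<integral>\<^sup>+X. ennreal ((norm (particle_flow N ka t X i - flow t (X i)))\<^sup>2) \<partial>tensor_law N (\<rho> 0)) =
  (\<integral>\<^sup>+X. ennreal ((norm (particle_flow N ka t X j - flow t (X j)))\<^sup>2) \<partial>tensor_law N (\<rho> 0))"
proof -
 let ?p = "Transposition.transpose i j" and ?P = "tensor_law N (\<rho> 0)"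
 let ?f = "\<lambda>i X. ennreal ((norm (particle_flow N ka t X i - flow t (X i)))\<^sup>2)"
 have t0: "0 \<le> t" using t by simp
 note [measurable_cong] = tensor_law_component(1)[OF zero_mem]
 note [measurable] = measurable_particle_flow[OF dim ka t0] flow_measurable[OF t]
 have p: "?p permutes {..<N}" using ij by (simp add: permutes_swap_id)
 have inv: "distr ?P ?P (\<lambda>X. \<lambda>n\<in>{..<N}. X (?p n)) = ?P"
  unfolding tensor_law_def
  by (rule distr_PiM_reindex) (use prob_law[OF zero_mem] permutes_inj_on[OF p] permutes_in_image[OF p] in auto)
 have pm: "(\<lambda>X. \<lambda>n\<in>{..<N}. X (?p n)) \<in> measurable ?P ?P"
  unfolding measurable_cong_sets[OF refl tensor_law_component(1)[OF zero_mem]]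
  using permutes_in_image[OF p] by (intro measurable_restrict) auto
 have "(\<integral>\<^sup>+X. ?f i X \<partial>?P) = (\<integral>\<^sup>+X. ?f i X \<partial>distr ?P ?P (\<lambda>X. \<lambda>n\<in>{..<N}. X (?p n)))" by (simp only: inv)
 also have "\<dots> = (\<integral>\<^sup>+X. ?f i (\<lambda>n\<in>{..<N}. X (?p n)) \<partial>?P)"
  using ij by (intro nn_integral_distr pm) simp
 also have "\<dots> = (\<integral>\<^sup>+X. ?f j X \<partial>?P)"
 proof (rule nn_integral_cong_AE, use AE_no_collision[of N] in eventually_elim)
  case (elim X)
  then have "(\<lambda>n\<in>{..<N}. X (?p n)) = X \<circ> ?p"
   using permutes_not_in[OF p] by (auto simp: fun_eq_iff PiE_def extensional_def restrict_def)
  then show ?case using particle_flow_permute[OF dim ka _ _ p t0, of X] elim by simp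
 qed
 finally show ?thesis .
qed

text \<open>By exchangeability the expected error of one particle is the average over all
  particles.\<close>

lemma nn_integral_particle_error_le:
 assumes ka: "0 < ka" "ka \<le> \<kappa>s" and t: "t \<in> {0..T}" and i: "i < N"
 shows "(\<integral>\<^sup>+X. ennreal ((norm (particle_flow N ka t X i - flow t (X i)))\<^sup>2) \<partial>tensor_law N (\<rho> 0))
  \<le> ennreal (mean_const \<kappa>s * (a_rate N DIM('a) + (alpha_rate DIM('a) ka)\<^sup>2))"
proof -
 let ?P = "tensor_law N (\<rho> 0)" and ?f = "\<lambda>i X. ennreal ((norm (particle_flow N ka t X i - flow t (X i)))\<^sup>2)"
 have N: "0 < N" using i by simp
 have t0: "0 \<le> t" using t by simp
 note [measurable_cong] = tensor_law_component(1)[OF zero_mem]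
 note [measurable] = measurable_particle_flow[OF dim ka(1) t0] flow_measurable[OF t]
 have "(\<integral>\<^sup>+X. ?f i X \<partial>?P) = ennreal (1 / real N) * (\<Sum>j<N. \<integral>\<^sup>+X. ?f i X \<partial>?P)"
  using N by (simp add: ennreal_of_nat_eq_real_of_nat mult.assoc[symmetric] ennreal_mult'[symmetric])
 also have "(\<Sum>j<N. \<integral>\<^sup>+X. ?f i X \<partial>?P) = (\<Sum>j<N. \<integral>\<^sup>+X. ?f j X \<partial>?P)"
  using nn_integral_exchangeable[OF ka(1) t i] by (intro sum.cong) auto
 also have "\<dots> = (\<integral>\<^sup>+X. (\<Sum>j<N. ?f j X) \<partial>?P)" by (rule nn_integral_sum[symmetric]) simp
 also have "ennreal (1 / real N) * \<dots> = (\<integral>\<^sup>+X. ennreal (1 / real N) * (\<Sum>j<N. ?f j X) \<partial>?P)"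
  by (rule nn_integral_cmult[symmetric]) simp
 also have "\<dots> = (\<integral>\<^sup>+X. ennreal ((\<Sum>j<N. (norm (particle_flow N ka t X j - flow t (X j)))\<^sup>2) / real N) \<partial>?P)"
  by (simp add: sum_nonneg ennreal_mult'[symmetric])
 also have "\<dots> \<le> ennreal (mean_const \<kappa>s * (a_rate N DIM('a) + (alpha_rate DIM('a) ka)\<^sup>2))"
  by (rule expected_error[OF N ka t])
 finally show ?thesis .
qed

text \<open>Couple the first k particles of both systems started from the same points. By
  \<open>flow_law\<close> the independent ones have exactly the tensor law of the solution, and each
  of the k particles costs the same.\<close>

theorem W2_squared_le:
 assumes ka: "0 < ka" "ka \<le> \<kappa>s" and t: "t \<in> {0..T}" and k: "k \<le> N"
 shows "W2_squared k (marginal k (particle_law N ka (\<rho> 0) t)) (tensor_law k (\<rho> t))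
  \<le> of_nat k * ennreal (mean_const \<kappa>s * (a_rate N DIM('a) + (alpha_rate DIM('a) ka)\<^sup>2))"
proof -
 let ?P = "tensor_law N (\<rho> 0)" and ?M = "\<lambda>k. PiM {..<k} (\<lambda>_. borel :: 'a measure)"
 have t0: "0 \<le> t" using t by simp
 note [measurable_cong] = tensor_law_component(1)[OF zero_mem]
 note [measurable] = measurable_particle_flow[OF dim ka(1) t0] flow_measurable[OF t]
 have sub: "{..<k} \<subseteq> {..<N}" using k by auto
 have r [measurable]: "(\<lambda>X. restrict X {..<k}) \<in> measurable (?M N) (?M k)" by (rule measurable_restrict_subset[OF sub])
 let ?F = "\<lambda>X. restrict (particle_flow N ka t X) {..<k}" and ?G = "\<lambda>X. restrict (compose {..<N} (flow t) X) {..<k}"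
 have c [measurable]: "compose {..<N} (flow t) \<in> measurable ?P (?M N)"
  unfolding compose_def[abs_def] by (rule measurable_restrict) simp
 have "marginal k (particle_law N ka (\<rho> 0) t) = distr ?P (?M k) ?F"
  unfolding marginal_def particle_law_def by (subst distr_distr) (auto simp: comp_def)
 moreover have "tensor_law k (\<rho> t) = distr ?P (?M k) ?G"
 proof -
  have "distr ?P (tensor_law N (\<rho> t)) (compose {..<N} (flow t)) = PiM {..<N} (\<lambda>_. distr (law 0) (law t) (flow t))"
   unfolding tensor_law_def by (rule distr_PiM_finite_prob_space') (use prob_law t zero_mem in auto)
  also have "distr (law 0) (law t) (flow t) = law t" using flow_law[OF t] by (subst distr_cong[of _ "law 0" _ borel _ "flow t"]) auto
  finally have e: "distr ?P (?M N) (compose {..<N} (flow t)) = tensor_law N (\<rho> t)"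
   unfolding tensor_law_def[symmetric] using tensor_law_component(1)[OF t] by (subst distr_cong[OF refl _ refl]) auto
  have "tensor_law k (\<rho> t) = distr (tensor_law N (\<rho> t)) (PiM {..<k} (\<lambda>_. law t)) (\<lambda>X. \<lambda>n\<in>{..<k}. X n)"
   unfolding tensor_law_def by (rule distr_PiM_reindex[symmetric]) (use prob_law[OF t] sub in auto)
  also have "\<dots> = distr (distr ?P (?M N) (compose {..<N} (flow t))) (?M k) (\<lambda>X. restrict X {..<k})"
   unfolding e by (rule distr_cong) (auto intro!: sets_PiM_cong)
  also have "\<dots> = distr ?P (?M k) ?G" by (subst distr_distr) (auto simp: comp_def)
  finally show ?thesis .
 qed
 ultimately have "W2_squared k (marginal k (particle_law N ka (\<rho> 0) t)) (tensor_law k (\<rho> t)) \<le> (\<Sum>i<k. \<integral>\<^sup>+X. ennreal ((norm (?F X i - ?G X i))\<^sup>2) \<partial>?P)"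
  using W2_squared_distr_le[of ?F ?P k ?G] by simp
 also have "\<dots> \<le> (\<Sum>i<k. ennreal (mean_const \<kappa>s * (a_rate N DIM('a) + (alpha_rate DIM('a) ka)\<^sup>2)))"
  using nn_integral_particle_error_le[OF ka t] k by (intro sum_mono) (simp add: compose_def)
 finally show ?thesis by simp
qed

text \<open>Makes the bound for the full N-particle law the case k = N of
  \<open>W2_squared_le\<close>.\<close>

lemma marginal_self:
 assumes ka: "0 < ka" and t: "t \<in> {0..T}"
 shows "marginal N (particle_law N ka (\<rho> 0) t) = particle_law N ka (\<rho> 0) t"
proof -
 have t0: "0 \<le> t" using t by simp
 note [measurable_cong] = tensor_law_component(1)[OF zero_mem]
 have F [measurable]: "particle_flow N ka t \<in> measurable (tensor_law N (\<rho> 0)) (PiM {..<N} (\<lambda>_. borel))"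
  using measurable_particle_flow[OF dim ka t0] by simp
 show ?thesis
  unfolding marginal_def particle_law_def
  by (subst distr_distr, simp_all, rule distr_cong)
   (use measurable_space[OF F] in \<open>auto simp: space_PiM PiE_def extensional_restrict\<close>)
qed

end

section \<open>From classical solutions to a density curve\<close>

lemma le_sup_norm: "norm (f x) \<le> C" if "sup_norm f \<le> ennreal C" "0 \<le> C"
proof -
 have "ennreal (norm (f x)) \<le> ennreal C" using SUP_upper[of x UNIV "\<lambda>x. ennreal (norm (f x))"] that(1) unfolding sup_norm_def by simp
 then show ?thesis using that(2) by simp
qed

lemma holder_norm_finite_bound:
 assumes "holder_norm \<beta> f < \<infinity>"
 obtains C where "0 \<le> C" "\<And>x. norm (f x) \<le> C"
proof -
 have fin: "sup_norm f < \<infinity>" using assms by (simp add: holder_norm_def)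
 show thesis
 proof (rule that[of "enn2real (sup_norm f)"])
  show "norm (f x) \<le> enn2real (sup_norm f)" for x by (rule le_sup_norm) (use fin in auto)
 qed simp
qed

text \<open>Pointwise bounds on a curve in a Hoelder space are locally uniform in time, hence uniform on compact intervals.\<close>

lemma C_curve_bounded:
 assumes f: "C_curve (holder_norm \<beta>) {0..<S} f" and T: "T < S"
 obtains M where "0 \<le> M" "\<And>t x. t \<in> {0..T} \<Longrightarrow> norm (f t x) \<le> M"
proof -
 have "\<exists>d K. 0 < d \<and> (\<forall>s\<in>{0..T}. dist s t < d \<longrightarrow> (\<forall>x. norm (f s x) \<le> K))" if t: "t \<in> {0..T}" for t
 proof -
  have tI: "t \<in> {0..<S}" using t T by auto
  obtain C where C: "\<And>x. norm (f t x) \<le> C" using f tI holder_norm_finite_bound unfolding C_curve_def by metis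
  have "((\<lambda>s. holder_norm \<beta> (\<lambda>x. f s x - f t x)) \<longlongrightarrow> 0) (at t within {0..<S})" using f tI by (simp add: C_curve_def)
  then have "eventually (\<lambda>s. holder_norm \<beta> (\<lambda>x. f s x - f t x) < 1) (at t within {0..<S})" by (rule order_tendstoD) simp
  then obtain d where d: "0 < d" "\<And>s. s \<in> {0..<S} \<Longrightarrow> s \<noteq> t \<Longrightarrow> dist s t < d \<Longrightarrow> holder_norm \<beta> (\<lambda>x. f s x - f t x) < 1"
   unfolding eventually_at by auto
  have "norm (f s x) \<le> C + 1" if s: "s \<in> {0..T}" "dist s t < d" for s x
  proof (cases "s = t")
   case True
   then show ?thesis using C[of x] by simp
  next
   case False
   have "sup_norm (\<lambda>x. f s x - f t x) \<le> holder_norm \<beta> (\<lambda>x. f s x - f t x)" by (simp add: holder_norm_def)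
   also have "\<dots> \<le> ennreal 1" using d(2)[OF _ False s(2)] s(1) T by auto
   finally have "norm (f s x - f t x) \<le> 1" by (rule le_sup_norm) simp
   then show ?thesis using C[of x] norm_triangle_sub[of "f s x" "f t x"] by linarith
  qed
  then show ?thesis using d(1) by blast
 qed
 then obtain d K where d: "\<And>t. t \<in> {0..T} \<Longrightarrow> 0 < d t" "\<And>t s x. t \<in> {0..T} \<Longrightarrow> s \<in> {0..T} \<Longrightarrow> dist s t < d t \<Longrightarrow> norm (f s x) \<le> K t"
  by metis
 obtain D where D: "D \<subseteq> {0..T}" "finite D" "{0..T} \<subseteq> (\<Union>t\<in>D. ball t (d t))"
  by (rule compactE_image[of "{0..T}" "{0..T}" "\<lambda>t. ball t (d t)"]) (use d(1) in auto)
 show thesis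
 proof (rule that[of "\<Sum>t\<in>D. \<bar>K t\<bar>"])
  fix s x assume s: "s \<in> {0..T}"
  then obtain t where t: "t \<in> D" "s \<in> ball t (d t)" using D(3) by blast
  have "norm (f s x) \<le> \<bar>K t\<bar>" using d(2)[of t s x] t s D(1) by (auto simp: dist_commute)
  also have "\<dots> \<le> (\<Sum>t\<in>D. \<bar>K t\<bar>)" by (rule member_le_sum[OF t(1) _ D(2)]) simp
  finally show "norm (f s x) \<le> (\<Sum>t\<in>D. \<bar>K t\<bar>)" .
 qed (simp add: sum_nonneg)
qed

text \<open>Convergence of difference quotients in a Hoelder norm is pointwise convergence, so the
  derivative of the curve is the pointwise time derivative. The equation identifies it with minus
  the divergence, and the curve bound applies.\<close>

lemma classical_solution_time_bound:
 fixes \<rho> :: "real \<Rightarrow> 'a::euclidean_space \<Rightarrow> real"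
 assumes sol: "classical_solution \<beta> ka S \<rho>0 \<rho>" and \<beta>: "0 < \<beta>" and T: "0 < T" "T < S"
 obtains M where "0 \<le> M" "\<And>t x. t \<in> {0..T} \<Longrightarrow> \<bar>divergence (\<lambda>y. \<rho> t y *\<^sub>R velocity ka (\<rho> t) y) x\<bar> \<le> M"
proof -
 have "C1_curve (holder_norm (\<beta> / 2)) {0..<S} \<rho>" using sol \<beta> unfolding classical_solution_def by simp
 then obtain f where f: "C_curve (holder_norm (\<beta> / 2)) {0..<S} f"
  "\<And>t. t \<in> {0..<S} \<Longrightarrow> ((\<lambda>s. holder_norm (\<beta> / 2) (\<lambda>x. (\<rho> s x - \<rho> t x) / (s - t) - f t x)) \<longlongrightarrow> 0) (at t within {0..<S})"
  unfolding C1_curve_def by blast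
 obtain M where M: "0 \<le> M" "\<And>t x. t \<in> {0..T} \<Longrightarrow> norm (f t x) \<le> M" using C_curve_bounded[OF f(1) T(2)] by blast
 have "- divergence (\<lambda>y. \<rho> t y *\<^sub>R velocity ka (\<rho> t) y) x = f t x" if t: "t \<in> {0..T}" for t x
 proof -
  have tI: "t \<in> {0..<S}" using t T by auto
  have "((\<lambda>s. ennreal (norm ((\<rho> s x - \<rho> t x) / (s - t) - f t x))) \<longlongrightarrow> 0) (at t within {0..<S})"
  proof (rule tendsto_sandwich[OF _ _ tendsto_const f(2)[OF tI]])
   have "ennreal (norm (g x)) \<le> holder_norm (\<beta> / 2) g" for g :: "'a \<Rightarrow> real"
   proof -
    have "ennreal (norm (g x)) \<le> sup_norm g" unfolding sup_norm_def by (rule SUP_upper) simp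
    then show ?thesis by (simp add: holder_norm_def add_increasing2)
   qed
   then show "\<forall>\<^sub>F s in at t within {0..<S}. ennreal (norm ((\<rho> s x - \<rho> t x) / (s - t) - f t x))
     \<le> holder_norm (\<beta> / 2) (\<lambda>x. (\<rho> s x - \<rho> t x) / (s - t) - f t x)" by (intro always_eventually allI)
  qed simp
  then have "((\<lambda>s. norm ((\<rho> s x - \<rho> t x) / (s - t) - f t x)) \<longlongrightarrow> 0) (at t within {0..<S})"
   by (subst (asm) ennreal_0[symmetric], subst (asm) tendsto_ennreal_iff) simp_all
  then have "((\<lambda>s. \<rho> s x) has_real_derivative f t x) (at t within {0..<S})"
   unfolding has_field_derivative_iff by - (rule LIM_zero_cancel, rule tendsto_norm_zero_cancel)
  moreover have "((\<lambda>s. \<rho> s x) has_real_derivative - divergence (\<lambda>y. \<rho> t y *\<^sub>R velocity ka (\<rho> t) y) x) (at t within {0..<S})"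
   using sol tI unfolding classical_solution_def by blast
  \<comment> \<open>Uniqueness of the one-sided derivative needs t to be a limit point of the
    interval.\<close>
  moreover have "at t within {0..<S} \<noteq> bot"
  proof -
   have "t islimpt {t<..<S}" using tI by (simp add: islimpt_greaterThanLessThan1)
   then have "t islimpt {0..<S}" by (rule islimpt_subset) (use tI in auto)
   then show ?thesis by (simp add: trivial_limit_within)
  qed
  ultimately show ?thesis by (intro has_field_derivative_unique[of "\<lambda>s. \<rho> s x" _ t "{0..<S}"]) auto
 qed
 then show thesis using M that by (metis abs_minus_cancel real_norm_def)
qed

lemma gradient_inner:
 assumes "f differentiable (at x)"
 shows "(f has_derivative (\<lambda>h. gradient f x \<bullet> h)) (at x)"
proof -
 have d: "(f has_derivative frechet_derivative f (at x)) (at x)" using assms by (simp add: frechet_derivative_works)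
 interpret bounded_linear "frechet_derivative f (at x)" using d by (rule has_derivative_bounded_linear)
 have "frechet_derivative f (at x) h = gradient f x \<bullet> h" for h
 proof -
  have "frechet_derivative f (at x) h = frechet_derivative f (at x) (\<Sum>b\<in>Basis. (h \<bullet> b) *\<^sub>R b)" by (simp add: euclidean_representation)
  also have "\<dots> = (\<Sum>b\<in>Basis. (h \<bullet> b) * frechet_derivative f (at x) b)" by (simp add: sum scaleR)
  also have "\<dots> = gradient f x \<bullet> h" unfolding gradient_def inner_sum_left by (simp add: inner_commute[of h] mult.commute)
  finally show ?thesis .
 qed
 then show ?thesis by (intro has_derivative_eq_rhs[OF d]) (simp add: fun_eq_iff)
qed

text \<open>The uniqueness clause for \<kappa> = 0 identifies the given solution with the member of
  the common family, so the uniform bounds of that family apply to it.\<close>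

lemma density_curve_exists:
 fixes \<rho>0 :: "'a::euclidean_space \<Rightarrow> real"
 assumes d: "2 \<le> DIM('a)" and \<beta>: "0 < \<beta>" and \<kappa>star: "0 < \<kappa>star" and ex: "common_existence_time \<beta> \<kappa>star \<rho>0 Tstar"
  and sol: "classical_solution \<beta> 0 Tstar \<rho>0 \<rho>" and T: "0 < T" "T < Tstar"
 shows "\<exists>\<rho>' R B. density_curve \<rho> \<rho>' T R B"
proof -
 have z: "0 \<in> {0..\<kappa>star}" using \<kappa>star by simp
 obtain r where r: "\<And>t. t \<in> {0..<Tstar} \<Longrightarrow> \<rho> t = r 0 t"
  and bnd: "\<exists>R. \<forall>ka\<in>{0..\<kappa>star}. \<forall>t\<in>{0..T}. {x. r ka t x \<noteq> 0} \<subseteq> cball 0 R"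
   "(SUP ka\<in>{0..\<kappa>star}. SUP t\<in>{0..T}. sup_norm (r ka t) + holder_seminorm \<beta> (r ka t)
     + (\<integral>\<^sup>+x. ennreal ((norm x)\<^sup>2 * r ka t x) \<partial>lborel) + W1_infty_norm (velocity ka (r ka t))) < \<infinity>"
 proof -
  obtain r where r: "\<forall>ka\<in>{0..\<kappa>star}. classical_solution \<beta> ka Tstar \<rho>0 (r ka) \<and>
     (\<forall>\<sigma>. classical_solution \<beta> ka Tstar \<rho>0 \<sigma> \<longrightarrow> (\<forall>t\<in>{0..<Tstar}. \<sigma> t = r ka t))"
   and b: "\<forall>T. 0 \<le> T \<and> T < Tstar \<longrightarrow> (\<exists>R. \<forall>ka\<in>{0..\<kappa>star}. \<forall>t\<in>{0..T}. {x. r ka t x \<noteq> 0} \<subseteq> cball 0 R) \<and>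
     (SUP ka\<in>{0..\<kappa>star}. SUP t\<in>{0..T}. sup_norm (r ka t) + holder_seminorm \<beta> (r ka t)
     + (\<integral>\<^sup>+x. ennreal ((norm x)\<^sup>2 * r ka t x) \<partial>lborel) + W1_infty_norm (velocity ka (r ka t))) < \<infinity>"
   using ex unfolding common_existence_time_def by blast
  have "0 \<le> T \<and> T < Tstar" using T by simp
  note b' = b[rule_format, OF this]
  show thesis by (rule that[of r, OF _ conjunct1[OF b'] conjunct2[OF b']]) (rule r[rule_format, OF z, THEN conjunct2, rule_format, OF sol])
 qed
 have tI: "t \<in> {0..<Tstar}" if "t \<in> {0..T}" for t using that T by auto
 obtain R0 where R0: "\<And>t. t \<in> {0..T} \<Longrightarrow> {x. \<rho> t x \<noteq> 0} \<subseteq> cball 0 R0" using bnd(1) z r tI by metis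
 define s where "s = (SUP ka\<in>{0..\<kappa>star}. SUP t\<in>{0..T}. sup_norm (r ka t) + holder_seminorm \<beta> (r ka t)
     + (\<integral>\<^sup>+x. ennreal ((norm x)\<^sup>2 * r ka t x) \<partial>lborel) + W1_infty_norm (velocity ka (r ka t)))"
 define M1 where "M1 = enn2real s"
 have M1: "0 \<le> M1" "s = ennreal M1" using bnd(2) unfolding M1_def s_def[symmetric] by auto
 have sW: "sup_norm (\<rho> t) + W1_infty_norm (velocity 0 (\<rho> t)) \<le> ennreal M1" if t: "t \<in> {0..T}" for t
  unfolding M1(2)[symmetric] s_def r[OF tI[OF t]]
  by (intro order_trans[OF _ SUP_upper[OF z]] order_trans[OF _ SUP_upper[OF t]] add_right_mono) (simp add: add.assoc)
 have sn: "sup_norm (\<rho> t) \<le> ennreal M1" and W: "W1_infty_norm (velocity 0 (\<rho> t)) \<le> ennreal M1" if t: "t \<in> {0..T}" for t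
  by (rule order_trans[OF _ sW[OF t]]; simp)+
 have ud: "velocity 0 (\<rho> t) differentiable (at x)" and ub: "norm (velocity 0 (\<rho> t) x) \<le> M1"
  and ud': "norm (frechet_derivative (velocity 0 (\<rho> t)) (at x) h) \<le> M1 * norm h" if t: "t \<in> {0..T}" for t x h
 proof -
  let ?u = "velocity 0 (\<rho> t)"
  have all: "\<forall>x. ?u differentiable (at x)" using W[OF t] by (auto simp: W1_infty_norm_def top_unique split: if_splits)
  then show "?u differentiable (at x)" by simp
  have w: "sup_norm ?u + (SUP x. ennreal (onorm (frechet_derivative ?u (at x)))) \<le> ennreal M1" using W[OF t] all by (simp add: W1_infty_norm_def)
  have "sup_norm ?u \<le> ennreal M1" by (rule order_trans[OF _ w]) simp
  then show "norm (?u x) \<le> M1" by (rule le_sup_norm[OF _ M1(1)])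
  have "ennreal (onorm (frechet_derivative ?u (at x))) \<le> ennreal M1"
   by (rule order_trans[OF SUP_upper[of x UNIV] order_trans[OF _ w]]) auto
  then have on: "onorm (frechet_derivative ?u (at x)) \<le> M1" using M1(1) by simp
  have bl: "bounded_linear (frechet_derivative ?u (at x))" using all frechet_derivative_works has_derivative_bounded_linear by blast
  show "norm (frechet_derivative ?u (at x) h) \<le> M1 * norm h"
   by (intro order_trans[OF onorm[OF bl]] mult_right_mono on) simp
 qed
 obtain M2 where M2: "0 \<le> M2" "\<And>t x. t \<in> {0..T} \<Longrightarrow> \<bar>divergence (\<lambda>y. \<rho> t y *\<^sub>R velocity 0 (\<rho> t) y) x\<bar> \<le> M2"
  using classical_solution_time_bound[OF sol \<beta> T] by blast
 define B where "B = 1 + M1 + M2"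
 have B: "1 \<le> B" "M1 \<le> B" "M2 \<le> B" using M1 M2 by (auto simp: B_def)
 have "density_curve \<rho> (\<lambda>t x. - divergence (\<lambda>y. \<rho> t y *\<^sub>R velocity 0 (\<rho> t) y) x) T (max R0 0) B"
 proof
  fix t assume t: "t \<in> {0..T}"
  show "probability_density (\<rho> t)" using sol tI[OF t] by (simp add: classical_solution_def)
  show "\<rho> t x = 0" if "x \<notin> cball 0 (max R0 0)" for x using R0[OF t] that by force
  show "\<rho> t x \<le> B" for x using le_sup_norm[OF sn[OF t] M1(1), of x] B by simp
  show "\<exists>C D. \<forall>x. (\<rho> t has_derivative D x) (at x) \<and> (\<forall>h. \<bar>D x h\<bar> \<le> C * norm h)"
  proof -
   have "C1_holder_norm (\<beta> / 2) (\<rho> t) < \<infinity>"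
    using sol tI[OF t] \<beta> unfolding classical_solution_def C_curve_def by simp
   then have dd: "\<And>x. \<rho> t differentiable (at x)" and g: "holder_norm (\<beta> / 2) (gradient (\<rho> t)) < \<infinity>"
    by (auto simp: C1_holder_norm_def split: if_splits)
   obtain C where C: "\<And>x. norm (gradient (\<rho> t) x) \<le> C" using holder_norm_finite_bound[OF g] by blast
   have "\<bar>gradient (\<rho> t) x \<bullet> h\<bar> \<le> C * norm h" for x h
    using order_trans[OF Cauchy_Schwarz_ineq2 mult_right_mono[OF C norm_ge_zero]] .
   then show ?thesis using gradient_inner[OF dd] by (intro exI[of _ C] exI[of _ "\<lambda>x h. gradient (\<rho> t) x \<bullet> h"]) simp
  qed
  show "velocity 0 (\<rho> t) differentiable (at x)" for x by (rule ud[OF t])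
  show "norm (velocity 0 (\<rho> t) x) \<le> B" for x using ub[OF t, of x] B by linarith
  show "norm (frechet_derivative (velocity 0 (\<rho> t)) (at x) h) \<le> B * norm h" for x h
   using ud'[OF t, of x h] mult_right_mono[OF B(2) norm_ge_zero[of h]] by linarith
  show "((\<lambda>s. \<rho> s x) has_real_derivative - divergence (\<lambda>y. \<rho> t y *\<^sub>R velocity 0 (\<rho> t) y) x) (at t within {0..T})" for x
  proof (rule DERIV_subset)
   show "((\<lambda>s. \<rho> s x) has_real_derivative - divergence (\<lambda>y. \<rho> t y *\<^sub>R velocity 0 (\<rho> t) y) x) (at t within {0..<Tstar})"
    using sol tI[OF t] unfolding classical_solution_def by blast
  qed (use T in auto)
  show "\<bar>- divergence (\<lambda>y. \<rho> t y *\<^sub>R velocity 0 (\<rho> t) y) x\<bar> \<le> B" for x using M2(2)[OF t, of x] B by simp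
 qed (use d T B in auto)
 then show ?thesis by blast
qed

section \<open>Limits of the rates and conclusion\<close>

lemma rates_tendsto_0:
 assumes "2 \<le> d"
 shows "(\<lambda>N. a_rate N d) \<longlonglongrightarrow> 0" and "\<kappa>s \<longlonglongrightarrow> 0 \<Longrightarrow> (\<lambda>N. alpha_rate d (\<kappa>s N)) \<longlonglongrightarrow> 0"
proof -
 show "(\<lambda>N. a_rate N d) \<longlonglongrightarrow> 0"
 proof (cases "d = 2")
  case True
  have "(\<lambda>N. 1 / real N + ln (real N) / real N) \<longlonglongrightarrow> 0 + 0" by (intro tendsto_add lim_1_over_n lim_ln_over_n)
  then show ?thesis using True by (simp add: a_rate_def add_divide_distrib)
 next
  case False
  have "(\<lambda>N. real N powr (- 2 / real d)) \<longlonglongrightarrow> 0"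
   using assms by (intro tendsto_neg_powr filterlim_real_sequentially) auto
  then show ?thesis using False by (simp add: a_rate_def)
 qed
 assume "\<kappa>s \<longlonglongrightarrow> 0"
 then show "(\<lambda>N. alpha_rate d (\<kappa>s N)) \<longlonglongrightarrow> 0"
  using tendsto_power[of \<kappa>s 0 sequentially 2] by (cases "d = 2") (auto simp: alpha_rate_def)
qed

theorem corollary6p4:
  fixes \<beta> \<kappa>star Tstar T :: real
    and \<rho>0 :: "'a::euclidean_space \<Rightarrow> real"
    and \<rho>C :: "real \<Rightarrow> 'a \<Rightarrow> real"
  assumes "2 \<le> DIM('a)"
    and "0 < \<beta>" and "\<beta> < 1"
    and "0 < \<kappa>star"
    and "probability_density \<rho>0" and "C1_holder_compact \<beta> \<rho>0"
    and "common_existence_time \<beta> \<kappa>star \<rho>0 Tstar"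
    and "classical_solution \<beta> 0 Tstar \<rho>0 \<rho>C"
    and "0 < T" and "T < Tstar"
  shows
    "(\<exists>C::real. \<forall>N\<ge>2. \<forall>\<kappa>. 0 < \<kappa> \<and> \<kappa> \<le> \<kappa>star \<longrightarrow>
        (SUP t\<in>{0..T}. W2_squared N (particle_law N \<kappa> \<rho>0 t) (tensor_law N (\<rho>C t)) / of_nat N)
          \<le> ennreal (C * (a_rate N DIM('a) + (alpha_rate DIM('a) \<kappa>)\<^sup>2)) \<and>
        (\<forall>k. 1 \<le> k \<and> k \<le> N \<longrightarrow>
          (SUP t\<in>{0..T}. W2_squared k (marginal k (particle_law N \<kappa> \<rho>0 t)) (tensor_law k (\<rho>C t)))
            \<le> ennreal (C * real k * (a_rate N DIM('a) + (alpha_rate DIM('a) \<kappa>)\<^sup>2))))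
     \<and> (\<forall>N\<ge>2. \<forall>\<kappa>. 0 < \<kappa> \<and> \<kappa> \<le> \<kappa>star \<longrightarrow>
        (3 \<le> DIM('a) \<longrightarrow>
          a_rate N DIM('a) + (alpha_rate DIM('a) \<kappa>)\<^sup>2 = real N powr (- 2 / real DIM('a)) + \<kappa> ^ 4) \<and>
        (DIM('a) = 2 \<longrightarrow>
          a_rate N DIM('a) + (alpha_rate DIM('a) \<kappa>)\<^sup>2 = (1 + ln (real N)) / real N + \<kappa>\<^sup>2))
     \<and> (\<forall>\<kappa>s :: nat \<Rightarrow> real.
        (\<forall>N\<ge>2. 0 < \<kappa>s N \<and> \<kappa>s N \<le> \<kappa>star) \<and> \<kappa>s \<longlonglongrightarrow> 0 \<longrightarrow>
          (\<lambda>N. SUP t\<in>{0..T}.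
             W2_squared N (particle_law N (\<kappa>s N) \<rho>0 t) (tensor_law N (\<rho>C t)) / of_nat N)
            \<longlonglongrightarrow> 0 \<and>
          (\<forall>k\<ge>1. (\<lambda>N. SUP t\<in>{0..T}.
             W2_squared k (marginal k (particle_law N (\<kappa>s N) \<rho>0 t)) (tensor_law k (\<rho>C t)))
            \<longlonglongrightarrow> 0))"
proof -
 obtain \<rho>' R B where "density_curve \<rho>C \<rho>' T R B"
  using density_curve_exists[OF assms(1,2,4,7-10)] by blast
 then interpret density_curve \<rho>C \<rho>' T R B .
 have init: "\<rho>C 0 = \<rho>0" using assms(8) by (simp add: classical_solution_def)
 define C where "C = mean_const \<kappa>star"
 let ?r = "\<lambda>N ka. a_rate N DIM('a) + (alpha_rate DIM('a) ka)\<^sup>2"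
 have C: "0 \<le> C" unfolding C_def mean_const_def rateK_def pd_def using B by (intro mult_nonneg_nonneg) auto
 have k: "(SUP t\<in>{0..T}. W2_squared k (marginal k (particle_law N ka \<rho>0 t)) (tensor_law k (\<rho>C t))) \<le> ennreal (C * real k * ?r N ka)"
  if "0 < ka" "ka \<le> \<kappa>star" "k \<le> N" for N k ka
 proof (rule SUP_least)
  fix t assume "t \<in> {0..T}"
  from W2_squared_le[OF that(1,2) this that(3)]
  show "W2_squared k (marginal k (particle_law N ka \<rho>0 t)) (tensor_law k (\<rho>C t)) \<le> ennreal (C * real k * ?r N ka)"
   by (simp add: init C_def ennreal_of_nat_eq_real_of_nat ennreal_mult'[symmetric] mult_ac)
 qed
 \<comment> \<open>The case k = N, with the factor N of the coupling cost cancelled by the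
   normalization.\<close>
 have N: "(SUP t\<in>{0..T}. W2_squared N (particle_law N ka \<rho>0 t) (tensor_law N (\<rho>C t)) / of_nat N) \<le> ennreal (C * ?r N ka)"
  if "0 < ka" "ka \<le> \<kappa>star" "2 \<le> N" for N ka
 proof (rule SUP_least)
  fix t assume t: "t \<in> {0..T}"
  have "W2_squared N (particle_law N ka \<rho>0 t) (tensor_law N (\<rho>C t)) / of_nat N \<le> of_nat N * ennreal (C * ?r N ka) / of_nat N"
   using W2_squared_le[OF that(1,2) t order_refl, of N] unfolding init marginal_self[OF that(1) t, unfolded init] C_def by (rule divide_right_mono_ennreal)
  also have "\<dots> = ennreal (C * ?r N ka)"
   using that(3) by (subst mult.commute, intro mult_divide_eq_ennreal) auto
  finally show "W2_squared N (particle_law N ka \<rho>0 t) (tensor_law N (\<rho>C t)) / of_nat N \<le> ennreal (C * ?r N ka)" .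
 qed
 have lim: "(\<lambda>N. ennreal (c * ?r N (\<kappa>s N))) \<longlonglongrightarrow> 0" if "\<kappa>s \<longlonglongrightarrow> 0" for \<kappa>s :: "nat \<Rightarrow> real" and c
 proof -
  have "(\<lambda>N. c * ?r N (\<kappa>s N)) \<longlonglongrightarrow> c * (0 + 0\<^sup>2)"
   by (intro tendsto_intros rates_tendsto_0 assms(1) that)
  then show ?thesis using tendsto_ennrealI by fastforce
 qed
 have sq: "f \<longlonglongrightarrow> 0" if "\<And>N. n0 \<le> N \<Longrightarrow> f N \<le> g N" "g \<longlonglongrightarrow> 0" for f g :: "nat \<Rightarrow> ennreal" and n0
  by (rule tendsto_sandwich[OF _ _ tendsto_const that(2)]) (use that(1) in \<open>auto simp: eventually_at_top_linorder\<close>)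
 show ?thesis
 proof (intro conjI allI impI exI[of _ C])
  fix \<kappa>s :: "nat \<Rightarrow> real" assume ks: "(\<forall>N\<ge>2. 0 < \<kappa>s N \<and> \<kappa>s N \<le> \<kappa>star) \<and> \<kappa>s \<longlonglongrightarrow> 0"
  show "(\<lambda>N. SUP t\<in>{0..T}. W2_squared N (particle_law N (\<kappa>s N) \<rho>0 t) (tensor_law N (\<rho>C t)) / of_nat N) \<longlonglongrightarrow> 0"
   by (rule sq[of 2, OF N lim]) (use ks in auto)
  \<comment> \<open>For fixed k the bound is available from N = max 2 k on, which is enough for the
    limit.\<close>
  show "(\<lambda>N. SUP t\<in>{0..T}. W2_squared k (marginal k (particle_law N (\<kappa>s N) \<rho>0 t)) (tensor_law k (\<rho>C t))) \<longlonglongrightarrow> 0" for k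
   by (rule sq[of "max 2 k", OF k lim]) (use ks in auto)
 qed (use k N in \<open>auto simp: a_rate_def alpha_rate_def power_mult[symmetric]\<close>)
qed

end
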